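(* Assume $a$ is (WD) or (SD) with degeneracy constant $K$, let $\beta,\gamma>0$, let $0<\varepsilon_0\le 2-K$, and let $y$ be a mild solution of $$\begin{cases} y_{tt}(t,x)+(ay_{xx})_{xx}(t,x)=0, & t>0,\ x\in(0,1),\\ y(t,0)=0, & t>0,\\ y_x(t,0)=0 \text{ if } a\text{ is (WD)},\quad (ay_{xx})(t,0)=0\text{ if } a\text{ is (SD)}, & t>0,\\ \beta y(t,1)-(ay_{xx})_x(t,1)+y_t(t,1)=0, & t>0,\\ \gamma y_x(t,1)+(ay_{xx})(t,1)+y_{tx}(t,1)=0, & t>0,\\ y(0,x)=y_0(x),\ y_t(0,x)=y_1(x), & x\in(0,1).\end{cases}$$ Let $C_1:=2\max\{1,\frac1{a(1)(2-K)}\}$, $C_2:=\max\{1,\frac1\gamma\}$, $\nu:=\frac{\beta\gamma}{2C_2\max\{1,C_1\}(\beta+\gamma)}$ and, for $\delta\in(0,\nu)$, $$C_\delta:=1-2C_2\max\{1,C_1\}\,\delta\left(\frac1\beta+\frac1\gamma\right),$$ $$C_3:=\left(\frac K4+\frac{K\beta}2+\beta+\varepsilon_0\frac\beta2\right)\frac2{C_\delta}+\left(\beta+1+\frac{2\gamma^2}{a(1)}+\varepsilon_0\frac\gamma2\right)\frac2{C_\delta},$$ $$C_4:=\vartheta+\varrho+\varsigma+\left(2-\frac K2\right)\frac1\gamma+C_5,$$ $$C_5:=\frac1{C_\delta}\left(2+4\frac{C_1^2C_2^2}{\beta}+4\frac{C_1C_2^2}{\gamma}+\frac1\delta+\frac{2C_1C_2^2\max\{1,C_1\}}{\delta}\right)\left(\frac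 K4+\frac{K\beta}2+2\beta+\varepsilon_0\frac\beta2+1+\frac{2\gamma^2}{a(1)}+\varepsilon_0\frac\gamma2\right),$$ where $$\vartheta:=K\max\left\{1,\frac2{a(1)(2-K)},\frac2\gamma\right\},\quad \varrho:=4\max\left\{\frac2\gamma,\frac2{a(1)(2-K)},1\right\},\quad \varsigma:=\max\left\{\frac K4+2,\frac2{a(1)}\right\}.$$ Then for all $t>0$ and for all $\delta\in\left(0,\min\left\{\nu,\frac{\varepsilon_0}{C_3}\right\}\right)$ (i.e. $\delta\in(0,\nu)$ with $\delta\, C_3<\varepsilon_0$, where $C_3=C_3(\delta)$), one has $$E_y(t)\le E_y(0)\,e^{1-\frac tM},\qquad M:=\frac{C_4}{\varepsilon_0-\delta C_3}.$$
   Context: Degeneracy. $a$ is weakly degenerate (WD) if $a\in C[0,1]\cap C^1(0,1]$, $a(0)=0$, $a>0$ on $(0,1]$ and $K:=\sup_{x\in(0,1]}\frac{x|a'(x)|}{a(x)}\in(0,1)$; $a$ is strongly degenerate (SD) if $a\in C^1[0,1]$, $a(0)=0$, $a>0$ on $(0,1]$ and $K\in[1,2)$. Spaces. $K^2_{a,0}(0,1)$: if $a$ is (WD), the set of $u\in H^1(0,1)$ with $u'$ absolutely continuous on $[0,1]$, $u(0)=u'(0)=0$, $\sqrt a u''\in L^2(0,1)$; if $a$ is (SD), the set of $u\in H^1(0,1)$ with $u'$ locally absolutely continuous on $(0,1]$, $u(0)=0$, $\sqrt au''\in L^2(0,1)$. $D(B)$ is the set of $u\in K^2_{a,0}(0,1)$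 with $au''\in H^2(0,1)$ and, if $a$ is (SD), $(au'')(0)=0$; $Bu:=(au'')''$. $\mathcal K_0:=K^2_{a,0}(0,1)\times L^2(0,1)$ with norm $\|(u,v)\|^2_{\mathcal K_0}=\int_0^1a(u'')^2dx+\int_0^1v^2dx+\beta u^2(1)+\gamma(u'(1))^2$. $\mathcal B(u,v):=(v,-Bu)$ on $D(\mathcal B):=\{(u,v)\in D(B)\times K^2_{a,0}(0,1):\ \beta u(1)-(au'')'(1)+v(1)=0,\ \gamma u'(1)+(au'')(1)+v'(1)=0\}$; $\mathcal B$ generates a contraction semigroup $(R(t))_{t\ge0}$ on $\mathcal K_0$. The mild solution with data $(y_0,y_1)\in\mathcal K_0$ is the first component of $(y(t),y_t(t))=R(t)(y_0,y_1)$. Energy: $E_y(t):=\frac12\int_0^1\left(y_t^2(t,x)+a(x)y_{xx}^2(t,x)\right)dx+\frac\beta2y^2(t,1)+\frac\gamma2y_x^2(t,1)$. *)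

theory Defs
  imports "HOL-Analysis.Analysis"
begin

section \<open>Function spaces on the unit interval\<close>

text \<open>
  Functions on \<open>[0,1]\<close> are total functions \<^typ>\<open>real \<Rightarrow> real\<close> whose values
  outside \<open>[0,1]\<close> are never inspected.  The one-sided derivatives at the endpoints are those
  relative to \<open>[0,1]\<close>.
\<close>

abbreviation I01 :: "real measure" where
  "I01 \<equiv> lebesgue_on {0<..<1}"

definition D01 :: "(real \<Rightarrow> real) \<Rightarrow> real \<Rightarrow> real" where
  "D01 f x = vector_derivative f (at x within {0..1})"

text \<open>\<open>S\<close> is meant to be \<open>[0,1]\<close> or \<open>(0,1]\<close>.\<close>

definition C1_on :: "real set \<Rightarrow> (real \<Rightarrow> real) \<Rightarrow> bool" where
  "C1_on S f \<longleftrightarrow>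
     (\<forall>x\<in>S. f differentiable (at x within {0..1})) \<and> continuous_on S (D01 f)"

text \<open>The finitely many non-overlapping intervals \<open>[s i, t i]\<close> are listed from left to right.\<close>

definition abs_cont_on :: "real \<Rightarrow> real \<Rightarrow> (real \<Rightarrow> real) \<Rightarrow> bool" where
  "abs_cont_on c d f \<longleftrightarrow>
     (\<forall>\<epsilon>>0. \<exists>\<delta>>0. \<forall>(n::nat) s t.
        (\<forall>i<n. c \<le> s i \<and> s i \<le> t i \<and> t i \<le> d) \<and>
        (\<forall>i. Suc i < n \<longrightarrow> t i \<le> s (Suc i)) \<and>
        (\<Sum>i<n. t i - s i) < \<delta>
        \<longrightarrow> (\<Sum>i<n. \<bar>f (t i) - f (s i)\<bar>) < \<epsilon>)"

definition L2 :: "(real \<Rightarrow> real) \<Rightarrow> bool" where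
  "L2 f \<longleftrightarrow> f \<in> borel_measurable I01 \<and> integrable I01 (\<lambda>x. (f x)\<^sup>2)"

definition L1_loc :: "(real \<Rightarrow> real) \<Rightarrow> bool" where
  "L1_loc f \<longleftrightarrow> (\<forall>c d. 0 < c \<and> d < 1 \<longrightarrow> f absolutely_integrable_on {c..d})"

definition test_function :: "(real \<Rightarrow> real) \<Rightarrow> bool" where
  "test_function \<phi> \<longleftrightarrow>
     (\<forall>n. (deriv ^^ n) \<phi> differentiable_on UNIV) \<and>
     (\<exists>c d. 0 < c \<and> c < d \<and> d < 1 \<and> (\<forall>x. x \<notin> {c..d} \<longrightarrow> \<phi> x = 0))"

definition is_weak_deriv :: "(real \<Rightarrow> real) \<Rightarrow> (real \<Rightarrow> real) \<Rightarrow> bool" where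
  "is_weak_deriv f g \<longleftrightarrow> L1_loc f \<and> L1_loc g \<and>
     (\<forall>\<phi>. test_function \<phi> \<longrightarrow>
        (LINT x|I01. f x * deriv \<phi> x) = - (LINT x|I01. g x * \<phi> x))"

text \<open>Some representative of the weak derivative, which is determined up to null sets.\<close>

definition wderiv :: "(real \<Rightarrow> real) \<Rightarrow> real \<Rightarrow> real" where
  "wderiv f = (SOME g. is_weak_deriv f g)"

definition H1 :: "(real \<Rightarrow> real) \<Rightarrow> bool" where
  "H1 f \<longleftrightarrow> L2 f \<and> (\<exists>g. is_weak_deriv f g \<and> L2 g)"

definition H2 :: "(real \<Rightarrow> real) \<Rightarrow> bool" where
  "H2 f \<longleftrightarrow> L2 f \<and> (\<exists>g. is_weak_deriv f g \<and> H1 g)"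

text \<open>The continuous representative on \<open>[0,1]\<close>; point values of \<open>H1\<close> and
  \<open>H2\<close> functions, and of their derivatives, refer to it.\<close>

definition cont_rep :: "(real \<Rightarrow> real) \<Rightarrow> real \<Rightarrow> real" where
  "cont_rep f = (SOME h. continuous_on {0..1} h \<and> (AE x in I01. f x = h x))"

section \<open>Degeneracy\<close>

definition degen_ratio :: "(real \<Rightarrow> real) \<Rightarrow> real \<Rightarrow> real" where
  "degen_ratio a x = x * \<bar>D01 a x\<bar> / a x"

definition degen_const :: "(real \<Rightarrow> real) \<Rightarrow> real" where
  "degen_const a = (SUP x\<in>{0<..1}. degen_ratio a x)"

text \<open>Boundedness is stated separately: \<^const>\<open>Sup\<close> on the reals is meaningless
  for unbounded sets.\<close>

definition weakly_degenerate :: "(real \<Rightarrow> real) \<Rightarrow> bool" where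
  "weakly_degenerate a \<longleftrightarrow>
     continuous_on {0..1} a \<and> C1_on {0<..1} a \<and> a 0 = 0 \<and> (\<forall>x\<in>{0<..1}. 0 < a x) \<and>
     bdd_above (degen_ratio a ` {0<..1}) \<and> 0 < degen_const a \<and> degen_const a < 1"

definition strongly_degenerate :: "(real \<Rightarrow> real) \<Rightarrow> bool" where
  "strongly_degenerate a \<longleftrightarrow>
     C1_on {0..1} a \<and> a 0 = 0 \<and> (\<forall>x\<in>{0<..1}. 0 < a x) \<and>
     bdd_above (degen_ratio a ` {0<..1}) \<and> 1 \<le> degen_const a \<and> degen_const a < 2"

section \<open>The operators\<close>

text \<open>\<open>u'\<close> is (locally) absolutely continuous for all \<open>u\<close> considered below, so that
  its weak derivative is its almost everywhere derivative.\<close>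

definition D2 :: "(real \<Rightarrow> real) \<Rightarrow> real \<Rightarrow> real" where
  "D2 u = wderiv (D01 u)"

text \<open>Elements of \<open>H1\<close> are represented by their continuous representative.  The two
  alternatives are exclusive, since the degeneracy constants are.\<close>

definition K2a0 :: "(real \<Rightarrow> real) \<Rightarrow> (real \<Rightarrow> real) set" where
  "K2a0 a = {u. H1 u \<and> continuous_on {0..1} u \<and>
     (weakly_degenerate a \<longrightarrow>
        (\<forall>x\<in>{0..1}. u differentiable (at x within {0..1})) \<and> abs_cont_on 0 1 (D01 u) \<and>
        u 0 = 0 \<and> D01 u 0 = 0) \<and>
     (strongly_degenerate a \<longrightarrow>
        (\<forall>x\<in>{0<..1}. u differentiable (at x within {0..1})) \<and>
        (\<forall>c\<in>{0<..<1}. abs_cont_on c 1 (D01 u)) \<and> u 0 = 0) \<and>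
     L2 (\<lambda>x. sqrt (a x) * D2 u x)}"

text \<open>\<open>a u''\<close>, in its continuous representative\<close>

definition aD2 :: "(real \<Rightarrow> real) \<Rightarrow> (real \<Rightarrow> real) \<Rightarrow> real \<Rightarrow> real" where
  "aD2 a u = cont_rep (\<lambda>x. a x * D2 u x)"

definition dom_B :: "(real \<Rightarrow> real) \<Rightarrow> (real \<Rightarrow> real) set" where
  "dom_B a = {u \<in> K2a0 a. H2 (\<lambda>x. a x * D2 u x) \<and> (strongly_degenerate a \<longrightarrow> aD2 a u 0 = 0)}"

definition op_B :: "(real \<Rightarrow> real) \<Rightarrow> (real \<Rightarrow> real) \<Rightarrow> real \<Rightarrow> real" where
  "op_B a u = wderiv (wderiv (aD2 a u))"

type_synonym state = "(real \<Rightarrow> real) \<times> (real \<Rightarrow> real)"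

definition space_K0 :: "(real \<Rightarrow> real) \<Rightarrow> state set" where
  "space_K0 a = K2a0 a \<times> {v. L2 v}"

definition norm_K0 :: "(real \<Rightarrow> real) \<Rightarrow> real \<Rightarrow> real \<Rightarrow> state \<Rightarrow> real" where
  "norm_K0 a \<beta> \<gamma> x = (case x of (u, v) \<Rightarrow>
     sqrt ((LINT x|I01. a x * (D2 u x)\<^sup>2) + (LINT x|I01. (v x)\<^sup>2)
           + \<beta> * (u 1)\<^sup>2 + \<gamma> * (D01 u 1)\<^sup>2))"

definition dom_calB :: "(real \<Rightarrow> real) \<Rightarrow> real \<Rightarrow> real \<Rightarrow> state set" where
  "dom_calB a \<beta> \<gamma> = {(u, v). u \<in> dom_B a \<and> v \<in> K2a0 a \<and>
     \<beta> * u 1 - D01 (aD2 a u) 1 + v 1 = 0 \<and>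
     \<gamma> * D01 u 1 + aD2 a u 1 + D01 v 1 = 0}"

definition calB :: "(real \<Rightarrow> real) \<Rightarrow> state \<Rightarrow> state" where
  "calB a x = (case x of (u, v) \<Rightarrow> (v, \<lambda>s. - op_B a u s))"

section \<open>Semigroups and mild solutions\<close>

definition lin :: "real \<Rightarrow> state \<Rightarrow> real \<Rightarrow> state \<Rightarrow> state" where
  "lin c x d y = (\<lambda>s. c * fst x s + d * fst y s, \<lambda>s. c * snd x s + d * snd y s)"

text \<open>
  The elements of \<open>X\<close> are representatives of the elements of a normed space; two of them
  represent the same element iff the norm \<open>N\<close> of their difference is \<open>0\<close>.  Hence
  equations between elements of the space are expressed by vanishing distance.
\<close>

definition dist_of :: "(state \<Rightarrow> real) \<Rightarrow> state \<Rightarrow> state \<Rightarrow> real" where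
  "dist_of N x y = N (lin 1 x (-1) y)"

definition contraction_semigroup ::
  "state set \<Rightarrow> (state \<Rightarrow> real) \<Rightarrow> (real \<Rightarrow> state \<Rightarrow> state) \<Rightarrow> bool" where
  "contraction_semigroup X N R \<longleftrightarrow>
     (\<forall>t\<ge>0. \<forall>x\<in>X. R t x \<in> X \<and> N (R t x) \<le> N x) \<and>
     (\<forall>t\<ge>0. \<forall>x\<in>X. \<forall>y\<in>X. \<forall>c d.
        dist_of N (R t (lin c x d y)) (lin c (R t x) d (R t y)) = 0) \<and>
     (\<forall>x\<in>X. dist_of N (R 0 x) x = 0) \<and>
     (\<forall>s\<ge>0. \<forall>t\<ge>0. \<forall>x\<in>X. dist_of N (R (s + t) x) (R s (R t x)) = 0) \<and>
     (\<forall>x\<in>X. ((\<lambda>t. dist_of N (R t x) x) \<longlongrightarrow> 0) (at_right 0))"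

definition has_generator_value ::
  "(state \<Rightarrow> real) \<Rightarrow> (real \<Rightarrow> state \<Rightarrow> state) \<Rightarrow> state \<Rightarrow> state \<Rightarrow> bool" where
  "has_generator_value N R x z \<longleftrightarrow>
     ((\<lambda>h. dist_of N (lin (1 / h) (R h x) (- 1 / h) x) z) \<longlongrightarrow> 0) (at_right 0)"

text \<open>The operator \<open>A\<close> with domain \<open>D\<close>, given on representatives, is the generator:
  equality of the graphs, including the domains.\<close>

definition generates ::
  "state set \<Rightarrow> (state \<Rightarrow> real) \<Rightarrow> state set \<Rightarrow> (state \<Rightarrow> state) \<Rightarrow> (real \<Rightarrow> state \<Rightarrow> state) \<Rightarrow> bool"
where
  "generates X N D A R \<longleftrightarrow> contraction_semigroup X N R \<and>
     (\<forall>x\<in>X. \<forall>z\<in>X. has_generator_value N R x z \<longleftrightarrow>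
        (\<exists>x'\<in>D. dist_of N x x' = 0 \<and> dist_of N z (A x') = 0))"

text \<open>\<open>y t\<close> and \<open>y\<^sub>t t\<close> are the two components of the semigroup orbit.\<close>

definition mild_solution :: "(real \<Rightarrow> real) \<Rightarrow> real \<Rightarrow> real \<Rightarrow> (real \<Rightarrow> real) \<Rightarrow> (real \<Rightarrow> real) \<Rightarrow>
    (real \<Rightarrow> real \<Rightarrow> real) \<Rightarrow> (real \<Rightarrow> real \<Rightarrow> real) \<Rightarrow> bool" where
  "mild_solution a \<beta> \<gamma> y\<^sub>0 y\<^sub>1 y y\<^sub>t \<longleftrightarrow> (y\<^sub>0, y\<^sub>1) \<in> space_K0 a \<and>
     (\<exists>R. generates (space_K0 a) (norm_K0 a \<beta> \<gamma>) (dom_calB a \<beta> \<gamma>) (calB a) R \<and>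
          (\<forall>t\<ge>0. (y t, y\<^sub>t t) = R t (y\<^sub>0, y\<^sub>1)))"

definition energy :: "(real \<Rightarrow> real) \<Rightarrow> real \<Rightarrow> real \<Rightarrow>
    (real \<Rightarrow> real \<Rightarrow> real) \<Rightarrow> (real \<Rightarrow> real \<Rightarrow> real) \<Rightarrow> real \<Rightarrow> real" where
  "energy a \<beta> \<gamma> y y\<^sub>t t =
     1/2 * (LINT x|I01. (y\<^sub>t t x)\<^sup>2 + a x * (D2 (y t) x)\<^sup>2)
     + \<beta>/2 * (y t 1)\<^sup>2 + \<gamma>/2 * (D01 (y t) 1)\<^sup>2"

section \<open>Constants of the decay estimate\<close>

text \<open>Here \<open>a1\<close> stands for \<open>a(1)\<close> and \<open>e\<close> for the parameter \<open>\<epsilon>\<^sub>0\<close>.\<close>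

definition C1c :: "real \<Rightarrow> real \<Rightarrow> real" where
  "C1c a1 K = 2 * max 1 (1 / (a1 * (2 - K)))"

definition C2c :: "real \<Rightarrow> real" where
  "C2c \<gamma> = max 1 (1 / \<gamma>)"

definition nu :: "real \<Rightarrow> real \<Rightarrow> real \<Rightarrow> real \<Rightarrow> real" where
  "nu a1 K \<beta> \<gamma> = \<beta> * \<gamma> / (2 * C2c \<gamma> * max 1 (C1c a1 K) * (\<beta> + \<gamma>))"

definition Cdelta :: "real \<Rightarrow> real \<Rightarrow> real \<Rightarrow> real \<Rightarrow> real \<Rightarrow> real" where
  "Cdelta a1 K \<beta> \<gamma> \<delta> = 1 - 2 * C2c \<gamma> * max 1 (C1c a1 K) * \<delta> * (1/\<beta> + 1/\<gamma>)"

definition C3c :: "real \<Rightarrow> real \<Rightarrow> real \<Rightarrow> real \<Rightarrow> real \<Rightarrow> real \<Rightarrow> real" where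
  "C3c a1 K \<beta> \<gamma> e \<delta> =
     (K/4 + K * \<beta> / 2 + \<beta> + e * (\<beta>/2)) * (2 / Cdelta a1 K \<beta> \<gamma> \<delta>)
     + (\<beta> + 1 + 2 * \<gamma>\<^sup>2 / a1 + e * (\<gamma>/2)) * (2 / Cdelta a1 K \<beta> \<gamma> \<delta>)"

definition C5c :: "real \<Rightarrow> real \<Rightarrow> real \<Rightarrow> real \<Rightarrow> real \<Rightarrow> real \<Rightarrow> real" where
  "C5c a1 K \<beta> \<gamma> e \<delta> =
     1 / Cdelta a1 K \<beta> \<gamma> \<delta>
     * (2 + 4 * ((C1c a1 K)\<^sup>2 * (C2c \<gamma>)\<^sup>2 / \<beta>) + 4 * (C1c a1 K * (C2c \<gamma>)\<^sup>2 / \<gamma>)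
        + 1 / \<delta> + 2 * C1c a1 K * (C2c \<gamma>)\<^sup>2 * max 1 (C1c a1 K) / \<delta>)
     * (K/4 + K * \<beta> / 2 + 2 * \<beta> + e * (\<beta>/2) + 1 + 2 * \<gamma>\<^sup>2 / a1 + e * (\<gamma>/2))"

definition vartheta :: "real \<Rightarrow> real \<Rightarrow> real \<Rightarrow> real" where
  "vartheta a1 K \<gamma> = K * Max {1, 2 / (a1 * (2 - K)), 2 / \<gamma>}"

definition varrho :: "real \<Rightarrow> real \<Rightarrow> real \<Rightarrow> real" where
  "varrho a1 K \<gamma> = 4 * Max {2 / \<gamma>, 2 / (a1 * (2 - K)), 1}"

definition varsigma :: "real \<Rightarrow> real \<Rightarrow> real" where
  "varsigma a1 K = max (K/4 + 2) (2 / a1)"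

definition C4c :: "real \<Rightarrow> real \<Rightarrow> real \<Rightarrow> real \<Rightarrow> real \<Rightarrow> real \<Rightarrow> real" where
  "C4c a1 K \<beta> \<gamma> e \<delta> =
     vartheta a1 K \<gamma> + varrho a1 K \<gamma> + varsigma a1 K + (2 - K/2) * (1/\<gamma>) + C5c a1 K \<beta> \<gamma> e \<delta>"

definition Mc :: "real \<Rightarrow> real \<Rightarrow> real \<Rightarrow> real \<Rightarrow> real \<Rightarrow> real \<Rightarrow> real" where
  "Mc a1 K \<beta> \<gamma> e \<delta> = C4c a1 K \<beta> \<gamma> e \<delta> / (e - \<delta> * C3c a1 K \<beta> \<gamma> e \<delta>)"

end

theory Submission
  imports Defs "HOL-Computational_Algebra.Polynomial" "HOL-Real_Asymp.Real_Asymp"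
begin


text \<open>An element \<open>u\<close> of the energy space is recovered from its slope \<open>q\<close> at \<open>1\<close> and its second
  derivative \<open>w\<close>, with \<open>\<integral> a w\<^sup>2 < \<infinity>\<close>, by \<open>u(x) = x q - \<integral> min(x, s) w(s) ds\<close>, which turns every
  estimate into Cauchy-Schwarz for the kernel \<open>min(x, s)\<close> against the weight, using
  \<open>a(x) \<ge> a(1) x\<^sup>K\<close>.

  Let \<open>L(t) = \<kappa> E(t) + \<integral> y\<^sub>t (2 x y\<^sub>x + 2 \<Lambda> z)\<close>: the multiplier \<open>2 x y\<^sub>x\<close> yields the interior energy
  up to boundary terms at \<open>1\<close>; the stationary solution \<open>z\<close> with the boundary data of \<open>y\<close> absorbs the
  terms in \<open>y(1)\<close> and \<open>y\<^sub>x(1)\<close>, and \<open>\<kappa> E\<close> absorbs the velocities at \<open>1\<close> through the damping.  Hence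
  \<open>L' \<le> - \<mu> E\<close> along orbits starting in the domain of the generator, while \<open>L\<close> is bounded by
  multiples of \<open>E\<close>.  Integration gives \<open>\<mu> \<integral>\<^sub>S\<^sup>t E \<le> (\<kappa> + 2 \<rho>) E(S)\<close>, and Komornik's lemma turns this
  into exponential decay.  All functionals are quadratic forms continuous in the energy norm, so the
  density of the domain extends the estimate to mild solutions.\<close>

section \<open>Smooth functions and test functions\<close>

text \<open>In the strongly degenerate case the slope of an element may be unbounded at 0, and of
  its second derivative \<open>w\<close> only \<open>s * w s\<close> is known to be integrable.
  Integration by parts up to 0 is therefore mostly replaced by Fubini with kernels of size at most
  \<open>s\<close>, which pair with \<open>w\<close> because \<open>s / sqrt (a s)\<close> is square
  integrable; boundary terms at 0 then cancel. The conditions at 0 enter as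
  \<open>q = \<integral> w\<close> in the weakly and as a vanishing flux in the strongly degenerate
  case, and both lead to the same formulas.

  Weak derivatives and continuous representatives are choices, and the semigroup acts on
  representatives of a seminormed space, so identities hold almost everywhere or up to distance 0.

  The constants of the theorem are multiples of one quantity \<Lambda>, the last factor of
  \<open>C5c\<close>: \<open>C3c\<close> is 2 \<Lambda> / \<open>Cdelta\<close>, and
  \<open>C5c\<close> is \<Lambda> / \<open>Cdelta\<close> times a factor free of the multiplier. As
  \<open>Cdelta\<close> lies in (0, 1), the rate \<mu> = \<epsilon> - 2 \<Lambda> \<delta> obtained
  here is at least the denominator of M.\<close>

definition smooth :: "(real \<Rightarrow> real) \<Rightarrow> bool" where
  "smooth f \<longleftrightarrow> (\<forall>n. (deriv ^^ n) f differentiable_on UNIV)"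

text \<open>A class in which every function has a derivative again in the class contains all
  iterated derivatives. Smoothness proofs thus exhibit a single derivative, never an n-th
  one.\<close>

lemma smooth_coinduct:
  assumes "P f" and step: "\<And>f. P f \<Longrightarrow> \<exists>f'. P f' \<and> (\<forall>x. (f has_real_derivative f' x) (at x))"
  shows "smooth f"
proof -
  have "P ((deriv ^^ n) f)" for n
  proof (induction n)
    case 0 then show ?case using assms by simp
  next
    case (Suc n)
    then obtain f' where f': "P f'" "\<forall>x. ((deriv ^^ n) f has_real_derivative f' x) (at x)"
      using step by blast
    then have "deriv ((deriv ^^ n) f) = f'" by (auto intro: DERIV_imp_deriv)
    then show ?case using f' by simp
  qed
  then show ?thesis
    unfolding smooth_def
    by (metis step differentiable_on_def real_differentiable_def differentiable_at_withinI)
qed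

lemma smooth_deriv: "smooth f \<Longrightarrow> smooth (deriv f)"
  unfolding smooth_def by (metis funpow_Suc_right o_apply)

lemma smooth_DERIV:
  assumes "smooth f" shows "(f has_real_derivative deriv f x) (at x)"
proof -
  have "(deriv ^^ 0) f differentiable_on UNIV" using assms unfolding smooth_def by blast
  then show ?thesis by (simp add: differentiable_on_def DERIV_deriv_iff_real_differentiable)
qed

lemma smooth_continuous: "smooth f \<Longrightarrow> continuous_on S f"
  using smooth_DERIV DERIV_isCont continuous_at_imp_continuous_on by blast

lemma smooth_primitive:
  assumes "smooth f" "\<And>x. (F has_real_derivative f x) (at x)"
  shows "smooth F"
proof (rule smooth_coinduct[of "\<lambda>g. g = F \<or> smooth g"])
  fix g assume "g = F \<or> smooth g"
  then show "\<exists>g'. (g' = F \<or> smooth g') \<and> (\<forall>x. (g has_real_derivative g' x) (at x))"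
  proof
    assume "g = F" then show ?thesis using assms by blast
  next
    assume "smooth g" then show ?thesis using smooth_DERIV smooth_deriv by blast
  qed
qed simp

lemma smooth_const: "smooth (\<lambda>x. c)"
proof (rule smooth_coinduct[of "\<lambda>f. \<exists>c. f = (\<lambda>x. c)"])
  fix f :: "real \<Rightarrow> real" assume "\<exists>c. f = (\<lambda>x. c)"
  then show "\<exists>f'. (\<exists>c. f' = (\<lambda>x. c)) \<and> (\<forall>x. (f has_real_derivative f' x) (at x))"
    by (intro exI[of _ "\<lambda>x. 0"]) auto
qed auto

text \<open>By the product rule this class is closed under differentiation as soon as the
  derivatives of the generators lie in it; this is the invariant that \<open>smooth_coinduct\<close>
  needs for products and exponentials.\<close>

inductive in_algebra :: "(real \<Rightarrow> real) set \<Rightarrow> (real \<Rightarrow> real) \<Rightarrow> bool" for G where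
  base: "f \<in> G \<Longrightarrow> in_algebra G f"
| add: "in_algebra G f \<Longrightarrow> in_algebra G g \<Longrightarrow> in_algebra G (\<lambda>x. f x + g x)"
| mult: "in_algebra G f \<Longrightarrow> in_algebra G g \<Longrightarrow> in_algebra G (\<lambda>x. f x * g x)"

lemma smooth_in_algebra:
  assumes G: "\<And>f. f \<in> G \<Longrightarrow> \<exists>f'. in_algebra G f' \<and> (\<forall>x. (f has_real_derivative f' x) (at x))"
    and f: "in_algebra G f"
  shows "smooth f"
proof (rule smooth_coinduct[of "in_algebra G", OF f])
  fix f assume "in_algebra G f"
  then show "\<exists>f'. in_algebra G f' \<and> (\<forall>x. (f has_real_derivative f' x) (at x))"
  proof induction
    case (base f) then show ?case using G by blast
  next
    case (add f g)
    then obtain f' g' where "in_algebra G f'" "\<forall>x. (f has_real_derivative f' x) (at x)"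
      "in_algebra G g'" "\<forall>x. (g has_real_derivative g' x) (at x)" by blast
    then show ?case
      by (intro exI[of _ "\<lambda>x. f' x + g' x"]) (auto intro: in_algebra.intros DERIV_add)
  next
    case (mult f g)
    then obtain f' g' where "in_algebra G f'" "\<forall>x. (f has_real_derivative f' x) (at x)"
      "in_algebra G g'" "\<forall>x. (g has_real_derivative g' x) (at x)" by blast
    then show ?case using mult.hyps
      by (intro exI[of _ "\<lambda>x. f' x * g x + g' x * f x"]) (auto intro: in_algebra.intros DERIV_mult)
  qed
qed

lemma smooth_in_smooth_algebra: "in_algebra (Collect smooth) f \<Longrightarrow> smooth f"
proof (erule smooth_in_algebra[rotated])
  fix f assume "f \<in> Collect smooth"
  then show "\<exists>f'. in_algebra (Collect smooth) f' \<and> (\<forall>x. (f has_real_derivative f' x) (at x))"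
    by (intro exI[of _ "deriv f"]) (auto intro: in_algebra.base smooth_deriv smooth_DERIV)
qed

lemma smooth_add: "smooth f \<Longrightarrow> smooth g \<Longrightarrow> smooth (\<lambda>x. f x + g x)"
  by (intro smooth_in_smooth_algebra in_algebra.add in_algebra.base) auto

lemma smooth_mult: "smooth f \<Longrightarrow> smooth g \<Longrightarrow> smooth (\<lambda>x. f x * g x)"
  by (intro smooth_in_smooth_algebra in_algebra.mult in_algebra.base) auto

text \<open>The derivative contains the factor \<open>exp (f x)\<close> again, so this function is
  adjoined as a generator to the smooth functions.\<close>

lemma smooth_exp: assumes f: "smooth f" shows "smooth (\<lambda>x. exp (f x))"
proof (rule smooth_in_algebra[of "insert (\<lambda>x. exp (f x)) (Collect smooth)"])
  fix g assume "g \<in> insert (\<lambda>x. exp (f x)) (Collect smooth)"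
  then consider "g = (\<lambda>x. exp (f x))" | "smooth g" by auto
  then show "\<exists>g'. in_algebra (insert (\<lambda>x. exp (f x)) (Collect smooth)) g' \<and>
      (\<forall>x. (g has_real_derivative g' x) (at x))"
  proof cases
    case 1
    then show ?thesis using f
      by (intro exI[of _ "\<lambda>x. exp (f x) * deriv f x"] conjI in_algebra.mult in_algebra.base)
         (auto intro!: smooth_deriv derivative_eq_intros smooth_DERIV)
  next
    case 2
    then show ?thesis by (auto intro!: exI[of _ "deriv g"] in_algebra.intros smooth_deriv smooth_DERIV)
  qed
qed (auto intro: in_algebra.intros)

section \<open>Flat functions at the origin and cut-off functions\<close>

definition poly_exp_inv :: "real poly \<Rightarrow> real \<Rightarrow> real" where
  "poly_exp_inv p x = (if x > 0 then poly p (1/x) * exp (- (1/x)) else 0)"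

lemma poly_exp_tendsto_0: "((\<lambda>y. poly p y * exp (- y)) \<longlongrightarrow> (0::real)) at_top"
proof -
  have "((\<lambda>y::real. \<Sum>i\<le>degree p. coeff p i * (y ^ i / exp y)) \<longlongrightarrow> (\<Sum>i\<le>degree p. coeff p i * 0)) at_top"
    by (intro tendsto_intros tendsto_power_div_exp_0)
  moreover have "(\<lambda>y::real. \<Sum>i\<le>degree p. coeff p i * (y ^ i / exp y)) = (\<lambda>y. poly p y * exp (- y))"
    by (simp add: poly_altdef sum_distrib_right exp_minus divide_inverse mult.assoc)
  ultimately show ?thesis by simp
qed

text \<open>The polynomial factor makes the family closed under differentiation: p(1/x) exp(-1/x)
  has the derivative (1/x)^2 (p - p')(1/x) exp(-1/x), and \<open>[:0,0,1:]\<close> is the square of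
  the variable.\<close>

lemma poly_exp_inv_deriv:
  "(poly_exp_inv p has_real_derivative poly_exp_inv ([:0,0,1:] * (p - pderiv p)) x) (at x)"
proof -
  consider "x > 0" | "x < 0" | "x = 0" by linarith
  then show ?thesis
  proof cases
    case 1
    have "((\<lambda>x. poly p (1/x) * exp (- (1/x))) has_real_derivative
        poly_exp_inv ([:0,0,1:] * (p - pderiv p)) x) (at x)"
      unfolding poly_exp_inv_def using 1
      by (auto intro!: derivative_eq_intros DERIV_chain2[OF poly_DERIV]
          simp: power2_eq_square) (simp add: field_simps)
    then show ?thesis
      by (rule has_field_derivative_transform_within_open[of _ _ _ "{0<..}"])
        (use 1 in \<open>auto simp: poly_exp_inv_def\<close>)
  next
    case 2
    have "((\<lambda>x. 0) has_real_derivative poly_exp_inv ([:0,0,1:] * (p - pderiv p)) x) (at x)"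
      using 2 by (auto simp: poly_exp_inv_def)
    then show ?thesis
      by (rule has_field_derivative_transform_within_open[of _ _ _ "{..<0}"])
        (use 2 in \<open>auto simp: poly_exp_inv_def\<close>)
  next
    case 3
    \<comment> \<open>From the right, the difference quotient at 0 is again a polynomial in 1/h
      times exp(-1/h), with \<open>p\<close> multiplied by the variable; from the left it is
      0.\<close>
    have "((\<lambda>h. poly_exp_inv p h / h) \<longlongrightarrow> 0) (at_right 0)"
    proof (rule Lim_transform_eventually)
      show "((\<lambda>h. poly ([:0,1:] * p) (inverse h) * exp (- inverse h)) \<longlongrightarrow> 0) (at_right 0)"
        by (rule filterlim_compose[OF poly_exp_tendsto_0 filterlim_inverse_at_top_right])
      show "\<forall>\<^sub>F h in at_right 0. poly ([:0,1:] * p) (inverse h) * exp (- inverse h)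
          = poly_exp_inv p h / h"
        by (auto simp: eventually_at_right_field poly_exp_inv_def field_simps intro!: exI[of _ 1])
    qed
    moreover have "((\<lambda>h. poly_exp_inv p h / h) \<longlongrightarrow> 0) (at_left 0)"
      by (rule tendsto_eventually)
        (auto simp: eventually_at_left_field poly_exp_inv_def intro!: exI[of _ "-1"])
    ultimately have "((\<lambda>h. poly_exp_inv p h / h) \<longlongrightarrow> 0) (at 0)"
      by (rule filterlim_split_at_real[rotated])
    then show ?thesis using 3 by (simp add: DERIV_def poly_exp_inv_def)
  qed
qed

lemma smooth_poly_exp_inv: "smooth (\<lambda>x. poly_exp_inv p (\<sigma> * x + c))"
proof (rule smooth_coinduct[of "\<lambda>f. \<exists>p. f = (\<lambda>x. poly_exp_inv p (\<sigma> * x + c))"])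
  fix f assume "\<exists>p. f = (\<lambda>x. poly_exp_inv p (\<sigma> * x + c))"
  then obtain p where f: "f = (\<lambda>x. poly_exp_inv p (\<sigma> * x + c))" by blast
  define q where "q = smult \<sigma> ([:0,0,1:] * (p - pderiv p))"
  have "(f has_real_derivative poly_exp_inv q (\<sigma> * x + c)) (at x)" for x
  proof -
    have "(f has_real_derivative poly_exp_inv ([:0,0,1:] * (p - pderiv p)) (\<sigma> * x + c) * \<sigma>) (at x)"
      unfolding f by (rule DERIV_chain2[OF poly_exp_inv_deriv]) (auto intro!: derivative_eq_intros)
    then show ?thesis
      by (rule DERIV_cong) (auto simp: q_def poly_exp_inv_def)
  qed
  then show "\<exists>f'. (\<exists>p. f' = (\<lambda>x. poly_exp_inv p (\<sigma> * x + c))) \<and> (\<forall>x. (f has_real_derivative f' x) (at x))"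
    by blast
qed blast

lemma test_function_iff: "test_function \<phi> \<longleftrightarrow>
    smooth \<phi> \<and> (\<exists>c d. 0 < c \<and> c < d \<and> d < 1 \<and> (\<forall>x. x \<notin> {c..d} \<longrightarrow> \<phi> x = 0))"
  by (simp add: test_function_def smooth_def)

text \<open>1 - exp(-n b) for a bump b that is positive exactly on (c, d). As n grows it tends to
  the indicator of (c, d), which replaces mollification. The forms \<open>1 + - 1 * ...\<close> and
  \<open>1 * x + - c\<close> fit the closure lemmas for smooth functions.\<close>

definition plateau :: "real \<Rightarrow> real \<Rightarrow> nat \<Rightarrow> real \<Rightarrow> real" where
  "plateau c d n x = 1 + - 1 * exp (- real n * (poly_exp_inv 1 (1 * x + - c) * poly_exp_inv 1 (- 1 * x + d)))"

lemma test_function_plateau: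
  assumes "0 < c" "c < d" "d < 1" shows "test_function (plateau c d n)"
  unfolding test_function_iff
proof (intro conjI exI allI impI)
  show "smooth (plateau c d n)"
    unfolding plateau_def
    by (intro smooth_add smooth_mult smooth_exp smooth_const smooth_poly_exp_inv)
  fix x assume "x \<notin> {c..d}"
  then have "poly_exp_inv 1 (1 * x + - c) = 0 \<or> poly_exp_inv 1 (- 1 * x + d) = 0"
    by (auto simp: poly_exp_inv_def)
  then show "plateau c d n x = 0" by (auto simp: plateau_def)
qed (use assms in auto)

lemma plateau_bounds: "0 \<le> plateau c d n x" "plateau c d n x \<le> 1"
  by (auto simp: plateau_def poly_exp_inv_def)

lemma plateau_tendsto: "(\<lambda>n. plateau c d n x) \<longlonglongrightarrow> indicator {c<..<d} x"
proof (cases "x \<in> {c<..<d}")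
  case True
  define b where "b = poly_exp_inv 1 (1 * x + - c) * poly_exp_inv 1 (- 1 * x + d)"
  have b: "b > 0" using True by (auto simp: b_def poly_exp_inv_def)
  have "(\<lambda>n. 1 + - 1 * exp (- b) ^ n) \<longlonglongrightarrow> 1 + - 1 * 0"
    by (intro tendsto_intros LIMSEQ_realpow_zero) (use b in auto)
  then show ?thesis using True
    by (simp only: plateau_def b_def[symmetric]) (simp add: exp_of_nat_mult[symmetric])
next
  case False
  then have "poly_exp_inv 1 (1 * x + - c) = 0 \<or> poly_exp_inv 1 (- 1 * x + d) = 0"
    by (auto simp: poly_exp_inv_def)
  then have "plateau c d n x = 0" for n by (auto simp: plateau_def)
  then show ?thesis using False by simp
qed

section \<open>Weak derivatives\<close>

lemma AE_I01_iff: "(AE x in I01. P x) \<longleftrightarrow> (AE x in lebesgue. 0 < x \<and> x < 1 \<longrightarrow> P x)"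
  by (subst AE_restrict_space_iff) auto

text \<open>The passage between the two integrals in use: the Lebesgue integral over the open
  interval, in which norms and pairings are stated, and the gauge integral over closed intervals, to
  which the fundamental theorem of calculus applies. They agree because endpoints are null.\<close>

lemma I01_interval_integral:
  fixes g :: "real \<Rightarrow> real"
  assumes g: "g absolutely_integrable_on {x..y}" and "0 \<le> x" "y \<le> 1"
  shows "integrable I01 (\<lambda>s. indicator {x..y} s * g s)"
    and "(LINT s|I01. indicator {x..y} s * g s) = integral {x..y} g"
proof -
  have i: "integrable lebesgue (\<lambda>s. indicator {x..y} s * g s)"
    using g by (simp add: set_integrable_def)
  have "AE s in lebesgue. s \<notin> {0,1::real}"
    by (rule AE_not_in) (simp add: negligible_iff_null_sets[symmetric])
  then have ae: "AE s in lebesgue. indicator {x..y} s * g s =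
      indicator {0<..<1} s *\<^sub>R (indicator {x..y} s * g s)"
    by eventually_elim (use assms in \<open>auto simp: indicator_def\<close>)
  have m: "(\<lambda>s. indicator {0<..<1} s *\<^sub>R (indicator {x..y} s * g s)) \<in> borel_measurable lebesgue"
    using i by (intro borel_measurable_scaleR borel_measurable_indicator) auto
  have "integrable lebesgue (\<lambda>s. indicator {0<..<1} s *\<^sub>R (indicator {x..y} s * g s))"
    using integrable_cong_AE_imp[OF i m] ae by auto
  then show "integrable I01 (\<lambda>s. indicator {x..y} s * g s)"
    by (simp add: integrable_restrict_space)
  have "(LINT s|I01. indicator {x..y} s * g s)
      = (LINT s|lebesgue. indicator {0<..<1} s *\<^sub>R (indicator {x..y} s * g s))"
    by (simp add: integral_restrict_space)
  also have "\<dots> = (LINT s|lebesgue. indicator {x..y} s * g s)"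
    by (rule integral_cong_AE) (use m i ae in auto)
  also have "\<dots> = integral {x..y} g"
    using set_lebesgue_integral_eq_integral(2)[OF g] by (simp add: set_lebesgue_integral_def)
  finally show "(LINT s|I01. indicator {x..y} s * g s) = integral {x..y} g" .
qed

text \<open>The intervals exhaust (0, 1), so \<open>g\<close> is a pointwise limit of its
  truncations.\<close>

lemma absolutely_integrable_borel_measurable:
  fixes g :: "real \<Rightarrow> real"
  assumes "\<And>n::nat. g absolutely_integrable_on {1 / (real n + 2)..1 - 1 / (real n + 2)}"
  shows "g \<in> borel_measurable I01"
proof (rule borel_measurable_LIMSEQ_metric)
  let ?S = "\<lambda>n::nat. {1 / (real n + 2)..1 - 1 / (real n + 2)}"
  show "(\<lambda>s. indicator (?S n) s * g s) \<in> borel_measurable I01" for n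
    by (rule borel_measurable_integrable[OF I01_interval_integral(1)[OF assms]]) auto
  fix s assume "s \<in> space I01"
  then have s: "0 < s" "s < 1" by auto
  have "(\<lambda>n. 1 / (real n + 2)) \<longlonglongrightarrow> 0" by real_asymp
  then have "\<forall>\<^sub>F n in sequentially. 1 / (real n + 2) < min s (1 - s)"
    by (rule order_tendstoD) (use s in auto)
  then have "\<forall>\<^sub>F n in sequentially. indicator (?S n) s * g s = g s"
    by eventually_elim auto
  then show "(\<lambda>n. indicator (?S n) s * g s) \<longlonglongrightarrow> g s"
    by (rule tendsto_eventually)
qed

lemma L1_loc_measurable: "L1_loc g \<Longrightarrow> g \<in> borel_measurable I01"
  by (rule absolutely_integrable_borel_measurable) (auto simp: L1_loc_def)

section \<open>The fundamental lemma of the calculus of variations\<close>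

lemma test_function_integrable:
  assumes g: "L1_loc g" and \<phi>: "continuous_on UNIV \<phi>" "0 < c" "d < 1" "\<And>x. x \<notin> {c..d} \<Longrightarrow> \<phi> x = 0"
  shows "integrable I01 (\<lambda>x. g x * \<phi> x)"
proof -
  have "bounded (\<phi> ` {c..d})"
    by (intro compact_imp_bounded compact_continuous_image continuous_on_subset[OF \<phi>(1)]) auto
  then obtain B where "\<forall>y\<in>\<phi> ` {c..d}. norm y \<le> B" unfolding bounded_iff by blast
  then have B: "\<And>x. x \<in> {c..d} \<Longrightarrow> \<bar>\<phi> x\<bar> \<le> B" by auto
  have i: "integrable I01 (\<lambda>s. indicator {c..d} s * g s)"
    using g \<phi> by (intro I01_interval_integral) (auto simp: L1_loc_def)
  have [measurable]: "\<phi> \<in> borel_measurable borel" "g \<in> borel_measurable I01"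
    using \<phi>(1) g by (auto intro: borel_measurable_continuous_onI L1_loc_measurable)
  have [measurable]: "\<phi> \<in> borel_measurable I01"
    by (intro measurable_restrict_space1 measurable_completion) simp
  show ?thesis
  proof (rule Bochner_Integration.integrable_bound[OF integrable_mult_right[OF i, of B]])
    show "AE x in I01. norm (g x * \<phi> x) \<le> norm (B * (indicator {c..d} x * g x))"
    proof (rule AE_I2)
      fix x
      show "norm (g x * \<phi> x) \<le> norm (B * (indicator {c..d} x * g x))"
      proof (cases "x \<in> {c..d}")
        case True
        then have "\<bar>\<phi> x\<bar> * \<bar>g x\<bar> \<le> \<bar>B\<bar> * \<bar>g x\<bar>" using B[OF True] by (intro mult_right_mono) auto
        then show ?thesis using True by (simp add: abs_mult mult.commute)
      qed (use \<phi>(4) in auto)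
    qed
  qed measurable
qed

text \<open>Test with \<open>plateau c d n\<close> and let n tend to infinity; the restriction of
  |g| to {c..d} dominates.\<close>

lemma integral_eq_0_if_test_functions_0:
  assumes g: "L1_loc g" and 0: "\<And>\<phi>. test_function \<phi> \<Longrightarrow> (LINT x|I01. g x * \<phi> x) = 0"
    and cd: "0 < c" "c < d" "d < 1"
  shows "integral {c..d} g = 0"
proof -
  have i: "integrable I01 (\<lambda>s. indicator {c..d} s * g s)"
    "(LINT s|I01. indicator {c..d} s * g s) = integral {c..d} g"
    using g cd by (auto intro!: I01_interval_integral simp: L1_loc_def)
  have gm: "g \<in> borel_measurable I01" using g by (rule L1_loc_measurable)
  have im: "indicat_real {c<..<d} \<in> borel_measurable I01" "indicat_real {c..d} \<in> borel_measurable I01"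
    by (intro measurable_restrict_space1 measurable_completion; simp)+
  have pm: "plateau c d n \<in> borel_measurable I01" for n
    using test_function_plateau[OF cd, of n]
    by (intro measurable_restrict_space1 measurable_completion)
      (auto simp: test_function_iff intro: borel_measurable_continuous_onI smooth_continuous)
  have "(\<lambda>n. LINT x|I01. g x * plateau c d n x) \<longlonglongrightarrow> (LINT x|I01. g x * indicator {c<..<d} x)"
  proof (rule integral_dominated_convergence[where w = "\<lambda>x. norm (indicator {c..d} x * g x)"])
    show "AE x in I01. (\<lambda>n. g x * plateau c d n x) \<longlonglongrightarrow> g x * indicator {c<..<d} x"
      by (intro AE_I2 tendsto_intros plateau_tendsto)
    show "AE x in I01. norm (g x * plateau c d n x) \<le> norm (indicator {c..d} x * g x)" for n
    proof (rule AE_I2)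
      fix x
      show "norm (g x * plateau c d n x) \<le> norm (indicator {c..d} x * g x)"
      proof (cases "x \<in> {c..d}")
        case True then show ?thesis
          using mult_left_mono[OF plateau_bounds(2)[of c d n x], of "\<bar>g x\<bar>"] plateau_bounds(1)[of c d n x]
          by (simp add: abs_mult)
      next
        case False
        then have "poly_exp_inv 1 (1 * x + - c) = 0 \<or> poly_exp_inv 1 (- 1 * x + d) = 0"
          by (auto simp: poly_exp_inv_def)
        then show ?thesis by (auto simp: plateau_def)
      qed
    qed
    show "integrable I01 (\<lambda>x. norm (indicator {c..d} x * g x))" using i(1) by auto
    show "(\<lambda>x. g x * indicator {c<..<d} x) \<in> borel_measurable I01" by (intro borel_measurable_times gm im)
    show "(\<lambda>x. g x * plateau c d n x) \<in> borel_measurable I01" for n by (intro borel_measurable_times gm pm)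
  qed
  moreover have "(LINT x|I01. g x * plateau c d n x) = 0" for n
    by (rule 0[OF test_function_plateau[OF cd]])
  ultimately have "(LINT x|I01. g x * indicator {c<..<d} x) = 0"
    by (simp add: LIMSEQ_const_iff)
  moreover have "(LINT x|I01. g x * indicator {c<..<d} x) = (LINT x|I01. indicator {c..d} x * g x)"
  proof (rule integral_cong_AE)
    have "AE s in lebesgue. s \<notin> {c,d}"
      by (rule AE_not_in) (simp add: negligible_iff_null_sets[symmetric])
    then show "AE x in I01. g x * indicator {c<..<d} x = indicator {c..d} x * g x"
      unfolding AE_I01_iff by eventually_elim (auto simp: indicator_def)
  qed (intro borel_measurable_times gm im)+
  ultimately show ?thesis using i(2) by simp
qed

text \<open>Lebesgue differentiation: at almost every x, g(x) is the limit of the mean values of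
  \<open>g\<close> over [x, x + h], and these vanish. As \<open>g\<close> is only locally
  integrable, this is done on intervals exhausting (0, 1).\<close>

lemma AE_0_if_interval_integrals_0:
  fixes g :: "real \<Rightarrow> real"
  assumes g: "L1_loc g" and 0: "\<And>c d. 0 < c \<Longrightarrow> c < d \<Longrightarrow> d < 1 \<Longrightarrow> integral {c..d} g = 0"
  shows "AE x in I01. g x = 0"
proof -
  define c where "c n = 1 / (real n + 2)" for n :: nat
  have "AE x in lebesgue. x \<in> {c n<..<1 - c n} \<longrightarrow> g x = 0" for n
  proof -
    define f where "f x = (if x \<in> {c n..1 - c n} then g x else 0)" for x
    have c: "0 < c n" "c n < 1" by (auto simp: c_def)
    have "g integrable_on {c n..1 - c n}"
      using g c by (auto simp: L1_loc_def intro: set_lebesgue_integral_eq_integral)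
    then have "f integrable_on UNIV"
      unfolding f_def by (simp only: integrable_restrict_UNIV)
    then have "f integrable_on cbox x y" for x y by (rule integrable_on_subcbox) auto
    then obtain N where N: "negligible N"
      "\<And>x e. \<lbrakk>x \<notin> N; 0 < e\<rbrakk> \<Longrightarrow> \<exists>d>0. \<forall>h. 0 < h \<and> h < d \<longrightarrow>
           norm(integral (cbox x (x + h *\<^sub>R One)) f /\<^sub>R h ^ DIM(real) - f x) < e"
      using integrable_ccontinuous_explicit[of f] by metis
    have "g x = 0" if x: "x \<notin> N" "x \<in> {c n<..<1 - c n}" for x
    proof (rule ccontr)
      assume "g x \<noteq> 0"
      then obtain d where d: "d > 0" "\<And>h. 0 < h \<Longrightarrow> h < d \<Longrightarrow>
          norm (integral {x..x + h} f / h - g x) < \<bar>g x\<bar>"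
        using N(2)[OF x(1), of "\<bar>g x\<bar>"] x(2) by (auto simp: f_def field_simps)
      define h where "h = min (d/2) (1 - c n - x)"
      have h: "0 < h" "h < d" "x + h \<le> 1 - c n" using d x by (auto simp: h_def)
      have "integral {x..x + h} f = integral {x..x + h} g"
        by (rule integral_cong) (use x h in \<open>auto simp: f_def\<close>)
      also have "\<dots> = 0" using 0[of x "x + h"] x h c by auto
      finally show False using d(2)[OF h(1,2)] by simp
    qed
    then show ?thesis
      using AE_not_in[of N lebesgue] N(1) by (auto simp: negligible_iff_null_sets elim!: eventually_mono)
  qed
  then have "AE x in lebesgue. \<forall>n. x \<in> {c n<..<1 - c n} \<longrightarrow> g x = 0"
    by (subst AE_all_countable) blast
  then show ?thesis
    unfolding AE_I01_iff
  proof eventually_elim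
    case (elim x)
    show ?case
    proof
      assume x: "0 < x \<and> x < 1"
      have "c \<longlonglongrightarrow> 0" unfolding c_def by real_asymp
      then have "\<forall>\<^sub>F n in sequentially. c n < min x (1 - x)"
        by (rule order_tendstoD) (use x in auto)
      then obtain n where "c n < min x (1 - x)" by (auto simp: eventually_sequentially)
      then show "g x = 0" using elim by auto
    qed
  qed
qed

theorem fundamental_lemma_variations:
  assumes "L1_loc g" and "\<And>\<phi>. test_function \<phi> \<Longrightarrow> (LINT x|I01. g x * \<phi> x) = 0"
  shows "AE x in I01. g x = 0"
  using assms by (intro AE_0_if_interval_integrals_0 integral_eq_0_if_test_functions_0)

lemma test_function_bounds:
  assumes "test_function \<phi>"
  obtains c d where "0 < c" "c < d" "d < 1" "\<And>x. x \<notin> {c..d} \<Longrightarrow> \<phi> x = 0" "\<And>x. x \<notin> {c..d} \<Longrightarrow> deriv \<phi> x = 0"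
proof -
  obtain c d where cd: "0 < c" "c < d" "d < 1" "\<And>x. x \<notin> {c..d} \<Longrightarrow> \<phi> x = 0"
    using assms by (auto simp: test_function_iff)
  have "deriv \<phi> x = 0" if "x \<notin> {c..d}" for x
  proof -
    have "((\<lambda>x. 0) has_real_derivative 0) (at x)" by simp
    then have "(\<phi> has_real_derivative 0) (at x)"
      by (rule has_field_derivative_transform_within_open[of _ _ _ "- {c..d}"])
        (use that cd in \<open>auto intro: open_Compl\<close>)
    then show ?thesis by (rule DERIV_imp_deriv)
  qed
  then show ?thesis using that cd by blast
qed

lemma test_function_integrable1: "L1_loc g \<Longrightarrow> test_function \<phi> \<Longrightarrow> integrable I01 (\<lambda>x. g x * \<phi> x)"
  by (rule test_function_bounds, assumption)
    (auto intro!: test_function_integrable smooth_continuous simp: test_function_iff)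

lemma test_function_integrable2:
  assumes "L1_loc g" "test_function \<phi>" shows "integrable I01 (\<lambda>x. g x * deriv \<phi> x)"
proof -
  obtain c d where "0 < c" "c < d" "d < 1" "\<And>x. x \<notin> {c..d} \<Longrightarrow> deriv \<phi> x = 0"
    using test_function_bounds[OF assms(2)] by metis
  then show ?thesis using assms
    by (auto intro!: test_function_integrable smooth_continuous smooth_deriv simp: test_function_iff)
qed

lemma L1_loc_lin:
  assumes "L1_loc f" "L1_loc g" shows "L1_loc (\<lambda>x. c * f x + d * g x)"
  unfolding L1_loc_def
proof (intro allI impI)
  fix x y :: real assume "0 < x \<and> y < 1"
  then show "(\<lambda>x. c * f x + d * g x) absolutely_integrable_on {x..y}"
    using assms unfolding L1_loc_def
    by (intro set_integral_add(1) set_integrable_mult_right) blast+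
qed

lemma L1_loc_diff: "L1_loc f \<Longrightarrow> L1_loc g \<Longrightarrow> L1_loc (\<lambda>x. f x - g x)"
  using L1_loc_lin[of f g 1 "-1"] by simp

text \<open>This makes \<open>wderiv\<close> usable although it is a choice: any weak derivative at
  hand agrees with it almost everywhere.\<close>

lemma weak_deriv_unique:
  assumes "is_weak_deriv f g1" "is_weak_deriv f g2"
  shows "AE x in I01. g1 x = g2 x"
proof -
  have l: "L1_loc g1" "L1_loc g2" using assms by (auto simp: is_weak_deriv_def)
  have "AE x in I01. g1 x - g2 x = 0"
  proof (rule fundamental_lemma_variations)
    show "L1_loc (\<lambda>x. g1 x - g2 x)" using l by (rule L1_loc_diff)
    fix \<phi> assume p: "test_function \<phi>"
    have "(LINT x|I01. f x * deriv \<phi> x) = - (LINT x|I01. g1 x * \<phi> x)"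
      "(LINT x|I01. f x * deriv \<phi> x) = - (LINT x|I01. g2 x * \<phi> x)"
      using assms p unfolding is_weak_deriv_def by blast+
    then show "(LINT x|I01. (g1 x - g2 x) * \<phi> x) = 0"
      using test_function_integrable1[OF l(1) p] test_function_integrable1[OF l(2) p]
      by (simp add: left_diff_distrib)
  qed
  then show ?thesis by auto
qed

text \<open>The primitive from 0 is constant to the right of the support, and that constant is the
  integral of \<open>\<psi>\<close>.\<close>

lemma test_function_primitive:
  assumes \<psi>: "test_function \<psi>" and 0: "(LINT x|I01. \<psi> x) = 0"
  obtains \<Phi> where "test_function \<Phi>" "deriv \<Phi> = \<psi>"
proof -
  obtain c d where cd: "0 < c" "c < d" "d < 1" "\<And>x. x \<notin> {c..d} \<Longrightarrow> \<psi> x = 0"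
    using test_function_bounds[OF \<psi>] by metis
  have s: "smooth \<psi>" and co: "continuous_on S \<psi>" for S
    using \<psi> by (auto simp: test_function_iff intro: smooth_continuous)
  define \<Phi> where "\<Phi> x = integral {0..x} \<psi>" for x
  have \<Phi>0: "\<Phi> x = 0" if "x < c" for x
    unfolding \<Phi>_def by (rule integral_unique[OF has_integral_is_0]) (use that cd in auto)
  have D: "(\<Phi> has_real_derivative \<psi> x) (at x)" for x
  proof (cases "x < c")
    case True
    have "((\<lambda>x. 0) has_real_derivative 0) (at x)" by simp
    then have "(\<Phi> has_real_derivative 0) (at x)"
      by (rule has_field_derivative_transform_within_open[of _ _ _ "{..<c}"]) (use True \<Phi>0 in auto)
    then show ?thesis using True cd by simp
  next
    case False
    have "(\<Phi> has_real_derivative \<psi> x) (at x within {0..x+1})"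
      unfolding \<Phi>_def by (rule integral_has_real_derivative) (use co False cd in auto)
    moreover have "at x within {0..x+1} = at x" by (rule at_within_interior) (use False cd in auto)
    ultimately show ?thesis by simp
  qed
  have ai: "\<psi> absolutely_integrable_on {0..1}"
    using co by (simp add: absolutely_integrable_continuous_real)
  have "(LINT s|I01. indicator {0..1} s * \<psi> s) = (LINT s|I01. \<psi> s)"
    by (rule Bochner_Integration.integral_cong) (auto simp: indicator_def)
  then have "integral {0..1} \<psi> = 0" using I01_interval_integral(2)[OF ai] 0 by simp
  \<comment> \<open>At \<open>d\<close> itself the support condition says nothing about
    \<open>\<psi>\<close>; a point strictly between \<open>d\<close> and 1 avoids it.\<close>
  define d' where "d' = (d + 1) / 2"
  have d': "d < d'" "d' < 1" using cd by (auto simp: d'_def)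
  have \<Phi>1: "\<Phi> x = 0" if "x > d'" for x
  proof -
    have *: "integral {0..y} \<psi> = integral {0..d'} \<psi>" if "y \<ge> d'" for y
    proof -
      have "integral {0..d'} \<psi> + integral {d'..y} \<psi> = integral {0..y} \<psi>"
        by (rule Henstock_Kurzweil_Integration.integral_combine)
          (use that cd d' co in \<open>auto intro: integrable_continuous_real\<close>)
      moreover have "integral {d'..y} \<psi> = 0"
        by (rule integral_unique[OF has_integral_is_0]) (use cd d' in auto)
      ultimately show ?thesis by simp
    qed
    show ?thesis using *[of x] *[of 1] that d' \<open>integral {0..1} \<psi> = 0\<close> by (simp add: \<Phi>_def)
  qed
  have "test_function \<Phi>"
    unfolding test_function_iff
  proof (intro conjI exI allI impI)
    show "smooth \<Phi>" by (rule smooth_primitive[OF s D])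
    show "\<Phi> x = 0" if "x \<notin> {c..d'}" for x
      using that \<Phi>0[of x] \<Phi>1[of x] by force
  qed (use cd d' in auto)
  moreover have "deriv \<Phi> = \<psi>" using D by (auto intro: DERIV_imp_deriv)
  ultimately show ?thesis by (rule that)
qed

text \<open>Du Bois-Reymond: every test function is a multiple of a fixed \<open>\<phi>0\<close>
  with nonzero integral plus the derivative of a test function, and \<open>h\<close> annihilates the
  latter. So \<open>h\<close> acts on test functions like the constant \<open>k\<close>.\<close>

lemma weak_deriv_0_const:
  assumes h: "L1_loc h" and 0: "\<And>\<phi>. test_function \<phi> \<Longrightarrow> (LINT x|I01. h x * deriv \<phi> x) = 0"
  obtains k where "AE x in I01. h x = k"
proof -
  have one: "L1_loc (\<lambda>x. 1)" and kl: "L1_loc (\<lambda>x. k)" for k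
    by (auto simp: L1_loc_def absolutely_integrable_on_const)
  have tfi: "integrable I01 \<phi>" if "test_function \<phi>" for \<phi>
    using test_function_integrable1[OF one that] by simp
  \<comment> \<open>If all test functions had integral 0, the fundamental lemma would give 1 = 0
    almost everywhere.\<close>
  have "\<exists>\<phi>. test_function \<phi> \<and> (LINT x|I01. \<phi> x) \<noteq> 0"
  proof (rule ccontr)
    assume "\<not> ?thesis"
    then have "AE x in I01. (1::real) = 0"
      using fundamental_lemma_variations[OF one] by auto
    then have "AE x in lebesgue. x \<notin> {0<..<1::real}" by (simp add: AE_I01_iff)
    then have "{0<..<1::real} \<in> null_sets lebesgue" by (subst AE_iff_null_sets) auto
    then show False by (auto simp: null_sets_def)
  qed
  then obtain \<phi>0 where \<phi>0: "test_function \<phi>0" "(LINT x|I01. \<phi>0 x) \<noteq> 0" by blast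
  define m where "m = (LINT x|I01. \<phi>0 x)"
  define k where "k = (LINT x|I01. h x * \<phi>0 x) / m"
  have "AE x in I01. h x - k = 0"
  proof (rule fundamental_lemma_variations)
    show "L1_loc (\<lambda>x. h x - k)" using h kl by (rule L1_loc_diff)
    fix \<phi> assume p: "test_function \<phi>"
    define j where "j = (LINT x|I01. \<phi> x) / m"
    define \<psi> where "\<psi> x = \<phi> x + - j * \<phi>0 x" for x
    obtain c d where cd: "0 < c" "c < d" "d < 1" "\<And>x. x \<notin> {c..d} \<Longrightarrow> \<phi> x = 0"
      using test_function_bounds[OF p] by metis
    obtain c' d' where cd': "0 < c'" "c' < d'" "d' < 1" "\<And>x. x \<notin> {c'..d'} \<Longrightarrow> \<phi>0 x = 0"
      using test_function_bounds[OF \<phi>0(1)] by metis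
    have "test_function \<psi>" unfolding test_function_iff
    proof (intro conjI exI allI impI)
      show "smooth \<psi>" unfolding \<psi>_def using p \<phi>0
        by (intro smooth_add smooth_mult smooth_const) (auto simp: test_function_iff)
      show "\<psi> x = 0" if "x \<notin> {min c c'..max d d'}" for x
      proof -
        have "x \<notin> {c..d}" "x \<notin> {c'..d'}" using that by auto
        then show ?thesis using cd(4) cd'(4) by (simp add: \<psi>_def)
      qed
    qed (use cd cd' in auto)
    moreover have "(LINT x|I01. \<psi> x) = 0"
      using tfi[OF p] tfi[OF \<phi>0(1)] \<phi>0(2) by (simp add: \<psi>_def j_def m_def)
    ultimately obtain \<Phi> where "test_function \<Phi>" "deriv \<Phi> = \<psi>"
      by (rule test_function_primitive)
    then have "(LINT x|I01. h x * \<psi> x) = 0" using 0 by blast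
    moreover have "(LINT x|I01. h x * \<psi> x) = (LINT x|I01. h x * \<phi> x) - j * (LINT x|I01. h x * \<phi>0 x)"
    proof -
      have "(LINT x|I01. h x * \<psi> x) = (LINT x|I01. h x * \<phi> x - j * (h x * \<phi>0 x))"
        by (simp add: \<psi>_def algebra_simps)
      also have "\<dots> = (LINT x|I01. h x * \<phi> x) - (LINT x|I01. j * (h x * \<phi>0 x))"
        by (intro Bochner_Integration.integral_diff integrable_mult_right
            test_function_integrable1 h p \<phi>0)
      finally show ?thesis by simp
    qed
    ultimately have "(LINT x|I01. h x * \<phi> x) = k * (LINT x|I01. \<phi> x)"
      using \<phi>0(2) by (simp add: k_def j_def m_def)
    then show "(LINT x|I01. (h x - k) * \<phi> x) = 0"
      using test_function_integrable1[OF h p] tfi[OF p] by (simp add: left_diff_distrib)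
  qed
  then have "AE x in I01. h x = k" by auto
  then show ?thesis by (rule that)
qed

section \<open>Absolutely continuous functions are indefinite integrals\<close>

text \<open>The inner clause of \<open>abs_cont_on\<close> with both quantities explicit, so that
  one \<delta> can be handed from lemma to lemma.\<close>

definition abs_cont_modulus :: "real \<Rightarrow> real \<Rightarrow> (real \<Rightarrow> real) \<Rightarrow> real \<Rightarrow> real \<Rightarrow> bool" where
  "abs_cont_modulus c d f e \<delta> \<longleftrightarrow> (\<forall>(n::nat) s t.
        (\<forall>i<n. c \<le> s i \<and> s i \<le> t i \<and> t i \<le> d) \<and>
        (\<forall>i. Suc i < n \<longrightarrow> t i \<le> s (Suc i)) \<and>
        (\<Sum>i<n. t i - s i) < \<delta>
        \<longrightarrow> (\<Sum>i<n. \<bar>f (t i) - f (s i)\<bar>) < e)"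

lemma abs_cont_onE:
  assumes "abs_cont_on c d f" "e > 0"
  obtains \<delta> where "\<delta> > 0" "abs_cont_modulus c d f e \<delta>"
  using assms unfolding abs_cont_on_def abs_cont_modulus_def by blast

lemma abs_cont_modulusD:
  assumes "abs_cont_modulus c d f e \<delta>"
    and "\<And>i. i < n \<Longrightarrow> c \<le> s i \<and> s i \<le> t i \<and> t i \<le> d"
    and "\<And>i. Suc i < n \<Longrightarrow> t i \<le> s (Suc i)" and "(\<Sum>i<n. t i - s i) < \<delta>"
  shows "(\<Sum>i<n. \<bar>f (t i) - f (s i)\<bar>) < e"
  using assms(1) unfolding abs_cont_modulus_def
  by (elim allE[of _ n] allE[of _ s] allE[of _ t] mp) (use assms in auto)

lemma abs_cont_on_subinterval:
  assumes "abs_cont_on c d f" "c \<le> c'" "d' \<le> d" shows "abs_cont_on c' d' f"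
  unfolding abs_cont_on_def
proof (intro allI impI)
  fix e :: real assume "e > 0"
  from abs_cont_onE[OF assms(1) \<open>e > 0\<close>]
  obtain \<delta> where \<delta>: "\<delta> > 0" "abs_cont_modulus c d f e \<delta>" .
  show "\<exists>\<delta>>0. \<forall>(n::nat) s t.
        (\<forall>i<n. c' \<le> s i \<and> s i \<le> t i \<and> t i \<le> d') \<and> (\<forall>i. Suc i < n \<longrightarrow> t i \<le> s (Suc i)) \<and>
        (\<Sum>i<n. t i - s i) < \<delta> \<longrightarrow> (\<Sum>i<n. \<bar>f (t i) - f (s i)\<bar>) < e"
  proof (intro exI conjI allI impI)
    fix n :: nat and s t
    assume a: "(\<forall>i<n. c' \<le> s i \<and> s i \<le> t i \<and> t i \<le> d') \<and> (\<forall>i. Suc i < n \<longrightarrow> t i \<le> s (Suc i)) \<and>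
        (\<Sum>i<n. t i - s i) < \<delta>"
    show "(\<Sum>i<n. \<bar>f (t i) - f (s i)\<bar>) < e"
    proof (rule abs_cont_modulusD[OF \<delta>(2)])
      show "c \<le> s i \<and> s i \<le> t i \<and> t i \<le> d" if "i < n" for i
        using a that assms(2,3) by (meson order_trans)
    qed (use a in auto)
  qed (rule \<delta>(1))
qed

lemma abs_cont_on_diff:
  assumes "abs_cont_on c d f" "abs_cont_on c d g" shows "abs_cont_on c d (\<lambda>x. f x - g x)"
  unfolding abs_cont_on_def
proof (intro allI impI)
  fix e :: real assume e: "e > 0"
  then have e2: "e / 2 > 0" by simp
  from abs_cont_onE[OF assms(1) e2]
  obtain \<delta> where \<delta>: "\<delta> > 0" "abs_cont_modulus c d f (e/2) \<delta>" .
  from abs_cont_onE[OF assms(2) e2]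
  obtain \<delta>' where \<delta>': "\<delta>' > 0" "abs_cont_modulus c d g (e/2) \<delta>'" .
  show "\<exists>\<delta>>0. \<forall>(n::nat) s t.
        (\<forall>i<n. c \<le> s i \<and> s i \<le> t i \<and> t i \<le> d) \<and> (\<forall>i. Suc i < n \<longrightarrow> t i \<le> s (Suc i)) \<and>
        (\<Sum>i<n. t i - s i) < \<delta> \<longrightarrow> (\<Sum>i<n. \<bar>f (t i) - g (t i) - (f (s i) - g (s i))\<bar>) < e"
  proof (intro exI[of _ "min \<delta> \<delta>'"] conjI allI impI)
    fix n :: nat and s t
    assume a: "(\<forall>i<n. c \<le> s i \<and> s i \<le> t i \<and> t i \<le> d) \<and> (\<forall>i. Suc i < n \<longrightarrow> t i \<le> s (Suc i)) \<and>
        (\<Sum>i<n. t i - s i) < min \<delta> \<delta>'"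
    have "(\<Sum>i<n. \<bar>f (t i) - g (t i) - (f (s i) - g (s i))\<bar>)
        \<le> (\<Sum>i<n. \<bar>f (t i) - f (s i)\<bar> + \<bar>g (t i) - g (s i)\<bar>)"
      by (intro sum_mono) linarith
    also have "\<dots> = (\<Sum>i<n. \<bar>f (t i) - f (s i)\<bar>) + (\<Sum>i<n. \<bar>g (t i) - g (s i)\<bar>)"
      by (rule sum.distrib)
    also have "(\<Sum>i<n. \<bar>f (t i) - f (s i)\<bar>) < e/2" by (rule abs_cont_modulusD[OF \<delta>(2)]) (use a in auto)
    also have "(\<Sum>i<n. \<bar>g (t i) - g (s i)\<bar>) < e/2" by (rule abs_cont_modulusD[OF \<delta>'(2)]) (use a in auto)
    finally show "(\<Sum>i<n. \<bar>f (t i) - g (t i) - (f (s i) - g (s i))\<bar>) < e" by simp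
  qed (use \<delta> \<delta>' in auto)
qed

lemma abs_cont_on_cmult:
  assumes "abs_cont_on c d f" shows "abs_cont_on c d (\<lambda>x. k * f x)"
  unfolding abs_cont_on_def
proof (intro allI impI)
  fix e :: real assume e: "e > 0"
  then have ek: "e / (\<bar>k\<bar> + 1) > 0" by simp
  from abs_cont_onE[OF assms(1) ek]
  obtain \<delta> where \<delta>: "\<delta> > 0" "abs_cont_modulus c d f (e / (\<bar>k\<bar> + 1)) \<delta>" .
  show "\<exists>\<delta>>0. \<forall>(n::nat) s t.
        (\<forall>i<n. c \<le> s i \<and> s i \<le> t i \<and> t i \<le> d) \<and> (\<forall>i. Suc i < n \<longrightarrow> t i \<le> s (Suc i)) \<and>
        (\<Sum>i<n. t i - s i) < \<delta> \<longrightarrow> (\<Sum>i<n. \<bar>k * f (t i) - k * f (s i)\<bar>) < e"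
  proof (intro exI conjI allI impI)
    fix n :: nat and s t
    assume a: "(\<forall>i<n. c \<le> s i \<and> s i \<le> t i \<and> t i \<le> d) \<and> (\<forall>i. Suc i < n \<longrightarrow> t i \<le> s (Suc i)) \<and>
        (\<Sum>i<n. t i - s i) < \<delta>"
    have "(\<Sum>i<n. \<bar>f (t i) - f (s i)\<bar>) < e / (\<bar>k\<bar> + 1)" by (rule abs_cont_modulusD[OF \<delta>(2)]) (use a in auto)
    then have "(\<bar>k\<bar> + 1) * (\<Sum>i<n. \<bar>f (t i) - f (s i)\<bar>) < e" by (simp add: field_simps)
    moreover have "(\<Sum>i<n. \<bar>k * f (t i) - k * f (s i)\<bar>) = \<bar>k\<bar> * (\<Sum>i<n. \<bar>f (t i) - f (s i)\<bar>)"
      by (simp add: sum_distrib_left abs_mult[symmetric] right_diff_distrib)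
    moreover have "\<dots> \<le> (\<bar>k\<bar> + 1) * (\<Sum>i<n. \<bar>f (t i) - f (s i)\<bar>)"
      by (intro mult_right_mono sum_nonneg) auto
    ultimately show "(\<Sum>i<n. \<bar>k * f (t i) - k * f (s i)\<bar>) < e" by linarith
  qed (rule \<delta>(1))
qed

lemma abs_cont_on_lin:
  assumes "abs_cont_on c d f" "abs_cont_on c d g" shows "abs_cont_on c d (\<lambda>x. k * f x + l * g x)"
  using abs_cont_on_diff[OF abs_cont_on_cmult[OF assms(1), of k] abs_cont_on_cmult[OF assms(2), of "- l"]]
  by simp

text \<open>Used for slopes: \<open>D01\<close> of a linear combination is known to be the
  combination of the slopes only at points of the interval.\<close>

lemma abs_cont_on_cong:
  assumes "\<And>x. x \<in> {c..d} \<Longrightarrow> f x = g x" "abs_cont_on c d f" shows "abs_cont_on c d g"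
  unfolding abs_cont_on_def
proof (intro allI impI)
  fix e :: real assume "e > 0"
  from abs_cont_onE[OF assms(2) \<open>e > 0\<close>]
  obtain \<delta> where \<delta>: "\<delta> > 0" "abs_cont_modulus c d f e \<delta>" .
  show "\<exists>\<delta>>0. \<forall>(n::nat) s t.
        (\<forall>i<n. c \<le> s i \<and> s i \<le> t i \<and> t i \<le> d) \<and> (\<forall>i. Suc i < n \<longrightarrow> t i \<le> s (Suc i)) \<and>
        (\<Sum>i<n. t i - s i) < \<delta> \<longrightarrow> (\<Sum>i<n. \<bar>g (t i) - g (s i)\<bar>) < e"
  proof (intro exI conjI allI impI)
    fix n :: nat and s t
    assume a: "(\<forall>i<n. c \<le> s i \<and> s i \<le> t i \<and> t i \<le> d) \<and> (\<forall>i. Suc i < n \<longrightarrow> t i \<le> s (Suc i)) \<and>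
        (\<Sum>i<n. t i - s i) < \<delta>"
    have "(\<Sum>i<n. \<bar>f (t i) - f (s i)\<bar>) < e" by (rule abs_cont_modulusD[OF \<delta>(2)]) (use a in auto)
    moreover have "(\<Sum>i<n. \<bar>f (t i) - f (s i)\<bar>) = (\<Sum>i<n. \<bar>g (t i) - g (s i)\<bar>)"
    proof (rule sum.cong)
      fix i assume "i \<in> {..<n}"
      then have "s i \<in> {c..d}" "t i \<in> {c..d}" using a by (auto intro: order_trans)
      then show "\<bar>f (t i) - f (s i)\<bar> = \<bar>g (t i) - g (s i)\<bar>" using assms(1) by simp
    qed simp
    ultimately show "(\<Sum>i<n. \<bar>g (t i) - g (s i)\<bar>) < e" by simp
  qed (rule \<delta>(1))
qed

lemma Lipschitz_imp_abs_cont_on: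
  assumes L: "\<And>x y. x \<in> {c..d} \<Longrightarrow> y \<in> {c..d} \<Longrightarrow> \<bar>f x - f y\<bar> \<le> L * \<bar>x - y\<bar>"
  shows "abs_cont_on c d f"
  unfolding abs_cont_on_def
proof (intro allI impI)
  fix e :: real assume e: "e > 0"
  show "\<exists>\<delta>>0. \<forall>(n::nat) s t.
        (\<forall>i<n. c \<le> s i \<and> s i \<le> t i \<and> t i \<le> d) \<and> (\<forall>i. Suc i < n \<longrightarrow> t i \<le> s (Suc i)) \<and>
        (\<Sum>i<n. t i - s i) < \<delta> \<longrightarrow> (\<Sum>i<n. \<bar>f (t i) - f (s i)\<bar>) < e"
  proof (intro exI[of _ "e / (\<bar>L\<bar> + 1)"] conjI allI impI)
    fix n :: nat and s t
    assume a: "(\<forall>i<n. c \<le> s i \<and> s i \<le> t i \<and> t i \<le> d) \<and> (\<forall>i. Suc i < n \<longrightarrow> t i \<le> s (Suc i)) \<and>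
        (\<Sum>i<n. t i - s i) < e / (\<bar>L\<bar> + 1)"
    have "(\<Sum>i<n. \<bar>f (t i) - f (s i)\<bar>) \<le> (\<Sum>i<n. (\<bar>L\<bar> + 1) * (t i - s i))"
    proof (rule sum_mono)
      fix i assume "i \<in> {..<n}"
      then have *: "s i \<in> {c..d}" "t i \<in> {c..d}" "s i \<le> t i" using a by (auto intro: order_trans)
      have "\<bar>f (t i) - f (s i)\<bar> \<le> L * \<bar>t i - s i\<bar>" using L * by blast
      also have "\<dots> \<le> (\<bar>L\<bar> + 1) * \<bar>t i - s i\<bar>" by (intro mult_right_mono) auto
      finally show "\<bar>f (t i) - f (s i)\<bar> \<le> (\<bar>L\<bar> + 1) * (t i - s i)" using * by simp
    qed
    also have "\<dots> = (\<bar>L\<bar> + 1) * (\<Sum>i<n. t i - s i)" by (simp add: sum_distrib_left)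
    also have "\<dots> < e" using a by (auto simp: field_simps)
    finally show "(\<Sum>i<n. \<bar>f (t i) - f (s i)\<bar>) < e" .
  qed (use e in auto)
qed

lemma abs_cont_on_imp_continuous_on:
  assumes "abs_cont_on c d f" shows "continuous_on {c..d} f"
  unfolding continuous_on_iff
proof (intro ballI allI impI)
  fix x e :: real assume x: "x \<in> {c..d}" and "e > 0"
  from abs_cont_onE[OF assms(1) \<open>e > 0\<close>]
  obtain \<delta> where \<delta>: "\<delta> > 0" "abs_cont_modulus c d f e \<delta>" .
  have *: "\<bar>f v - f u\<bar> < e" if "c \<le> u" "u \<le> v" "v \<le> d" "v - u < \<delta>" for u v
    using abs_cont_modulusD[OF \<delta>(2), of 1 "\<lambda>_. u" "\<lambda>_. v"] that by simp
  have "dist (f y) (f x) < e" if "y \<in> {c..d}" "dist y x < \<delta>" for y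
    using *[of x y] *[of y x] that x by (cases "x \<le> y") (auto simp: dist_real_def)
  then show "\<exists>\<delta>>0. \<forall>y\<in>{c..d}. dist y x < \<delta> \<longrightarrow> dist (f y) (f x) < e" using \<delta>(1) by blast
qed

text \<open>Absolute continuity of \<open>G\<close> makes its Stieltjes measure absolutely
  continuous with respect to Lebesgue measure; \<open>g\<close> is the Radon-Nikodym
  density.\<close>

lemma abs_cont_mono_density:
  assumes pq: "p \<le> q" and mono: "mono_on {p..q} G" and ac: "abs_cont_on p q G"
  obtains g where "g absolutely_integrable_on {p..q}" "\<And>x. x \<in> {p..q} \<Longrightarrow> G x - G p = integral {p..x} g"
proof -
  \<comment> \<open>Stieltjes measures are built from functions that are monotone and right
    continuous on the whole line, hence the constant extension.\<close>
  define H where "H x = G (max p (min q x))" for x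
  have mH: "H x \<le> H y" if "x \<le> y" for x y
    unfolding H_def using pq that by (intro mono_onD[OF mono]) (auto simp: max_def min_def)
  have HG: "H x = G x" if "x \<in> {p..q}" for x using that by (auto simp: H_def)
  have "continuous_on UNIV H"
    unfolding H_def
    by (rule continuous_on_compose2[OF abs_cont_on_imp_continuous_on[OF ac]])
      (use pq in \<open>auto intro!: continuous_intros\<close>)
  then have cH: "continuous (at_right x) H" for x
    by (simp add: continuous_on_eq_continuous_at continuous_at_imp_continuous_within)
  define M where "M = interval_measure H"
  have sM[measurable_cong, simp]: "sets M = sets borel" by (simp add: M_def)
  have eM: "emeasure M {x<..y} = ennreal (H y - H x)" if "x \<le> y" for x y
    unfolding M_def by (rule emeasure_interval_measure_Ioc[OF that mH cH])
  define M' where "M' = density M (indicator {p<..q})"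
  have sM'[measurable_cong, simp]: "sets M' = sets borel" by (simp add: M'_def)
  have eM': "emeasure M' A = emeasure M (A \<inter> {p<..q})" if "A \<in> sets borel" for A
    using that by (simp add: M'_def emeasure_restricted Int_commute)
  have ac': "absolutely_continuous lborel M'"
    unfolding absolutely_continuous_def
  proof
    fix N :: "real set" assume N: "N \<in> null_sets lborel"
    then have Nb[measurable]: "N \<in> sets borel" by auto
    have small: "emeasure M' N \<le> ennreal e" if e: "e > 0" for e
    proof -
      from abs_cont_onE[OF ac e]
  obtain \<delta> where \<delta>: "\<delta> > 0" "abs_cont_modulus p q G e \<delta>" .
      obtain U where U: "open U" "N \<subseteq> U" "emeasure lborel (U - N) < ennreal \<delta>"
        using outer_regular_lborel[OF Nb \<delta>(1)] .
      have [measurable]: "U \<in> sets borel" using U by simp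
      have U\<delta>: "emeasure lborel U < ennreal \<delta>"
      proof -
        have "emeasure lborel U \<le> emeasure lborel (U - N) + emeasure lborel N"
          by (rule order_trans[OF emeasure_mono emeasure_subadditive]) auto
        then show ?thesis using U(3) N by (auto simp: null_sets_def)
      qed
      \<comment> \<open>\<open>abs_cont_on\<close> speaks of finitely many intervals listed from
        left to right, so \<open>U\<close> is exhausted by those cells of a uniform grid that lie in
        it. A cell not contained in \<open>U\<close> is kept as an empty interval by t = s, which
        preserves the numbering.\<close>
      define h where "h m = (q - p) / (real m + 1)" for m :: nat
      define s where "s m k = p + real k * h m" for m k :: nat
      define ok where "ok m k \<longleftrightarrow> {s m k<..s m (Suc k)} \<subseteq> U" for m k
      define t where "t m k = (if ok m k then s m (Suc k) else s m k)" for m k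
      define W where "W m = (\<Union>k<Suc m. {s m k<..t m k})" for m
      have h0: "h m \<ge> 0" for m using pq by (simp add: h_def)
      have ss: "s m (Suc k) = s m k + h m" for m k by (simp add: s_def algebra_simps)
      have smono: "s m k \<le> s m l" if "k \<le> l" for m k l
        using that h0 by (simp add: s_def mult_right_mono)
      have send: "s m 0 = p" "s m (Suc m) = q" for m
        by (simp_all add: s_def h_def) (simp add: field_simps)
      have st: "s m k \<le> t m k" "t m k \<le> s m (Suc k)" for m k
        using h0[of m] by (auto simp: t_def ss)
      have [measurable]: "W m \<in> sets borel" for m unfolding W_def by measurable
      have WM: "emeasure M (W m) \<le> ennreal e" for m
      proof -
        have rng: "p \<le> s m k \<and> s m k \<le> t m k \<and> t m k \<le> q" if "k < Suc m" for k
          using smono[of 0 k m] smono[of "Suc k" "Suc m" m] st[of m k] send that by force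
        have disj: "disjoint_family_on (\<lambda>k. {s m k<..t m k}) {..<Suc m}"
        proof -
          have *: "{s m k<..t m k} \<inter> {s m l<..t m l} = {}" if "k < l" for k l
          proof -
            have "t m k \<le> s m l" using st(2)[of m k] smono[of "Suc k" l m] that by linarith
            then show ?thesis by auto
          qed
          show ?thesis unfolding disjoint_family_on_def
            by (metis * Int_commute nat_neq_iff)
        qed
        have "ennreal (\<Sum>k<Suc m. t m k - s m k) = (\<Sum>k<Suc m. emeasure lborel {s m k<..t m k})"
          using st by (subst sum_ennreal[symmetric]) (auto simp del: sum.lessThan_Suc)
        also have "\<dots> = emeasure lborel (W m)"
          unfolding W_def by (rule sum_emeasure[OF _ disj]) auto
        also have "\<dots> \<le> emeasure lborel U"
          by (rule emeasure_mono) (auto simp: W_def t_def ok_def subset_iff split: if_splits)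
        finally have "ennreal (\<Sum>k<Suc m. t m k - s m k) < ennreal \<delta>" using U\<delta> by simp
        then have "(\<Sum>k<Suc m. t m k - s m k) < \<delta>"
          using st by (subst (asm) ennreal_less_iff) (auto intro!: sum_nonneg simp del: sum.lessThan_Suc)
        then have "(\<Sum>k<Suc m. \<bar>G (t m k) - G (s m k)\<bar>) < e"
          using rng st smono by (intro abs_cont_modulusD[OF \<delta>(2)]) auto
        moreover have "emeasure M (W m) \<le> (\<Sum>k<Suc m. emeasure M {s m k<..t m k})"
          unfolding W_def by (rule emeasure_subadditive_finite) auto
        moreover have "(\<Sum>k<Suc m. emeasure M {s m k<..t m k}) = ennreal (\<Sum>k<Suc m. \<bar>G (t m k) - G (s m k)\<bar>)"
        proof -
          have "(\<Sum>k<Suc m. emeasure M {s m k<..t m k}) = (\<Sum>k<Suc m. ennreal \<bar>G (t m k) - G (s m k)\<bar>)"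
          proof (rule sum.cong)
            fix k assume "k \<in> {..<Suc m}"
            then have r: "p \<le> s m k" "s m k \<le> t m k" "t m k \<le> q" using rng by auto
            then show "emeasure M {s m k<..t m k} = ennreal \<bar>G (t m k) - G (s m k)\<bar>"
              using eM[OF r(2)] mH[OF r(2)] by (simp add: HG)
          qed simp
          then show ?thesis by (simp add: sum_ennreal)
        qed
        ultimately have "emeasure M (W m) \<le> ennreal (\<Sum>k<Suc m. \<bar>G (t m k) - G (s m k)\<bar>)"
          and "ennreal (\<Sum>k<Suc m. \<bar>G (t m k) - G (s m k)\<bar>) \<le> ennreal e"
          by (simp_all del: sum.lessThan_Suc add: ennreal_leI)
        then show ?thesis by (rule order_trans)
      qed
      \<comment> \<open>The grids are not nested, so the sets \<open>W m\<close> need not increase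
        with m. Their tail intersections do, and every point of \<open>U\<close> in (p, q] lies in
        all late \<open>W m\<close>.\<close>
      define V where "V n = (\<Inter>m\<in>{n..}. W m)" for n
      have [measurable]: "V n \<in> sets borel" for n unfolding V_def by measurable
      have cover: "U \<inter> {p<..q} \<subseteq> (\<Union>n. V n)"
      proof
        fix x assume x: "x \<in> U \<inter> {p<..q}"
        then obtain r where r: "r > 0" "ball x r \<subseteq> U" using U(1) by (auto simp: open_contains_ball)
        have "h \<longlonglongrightarrow> 0" unfolding h_def by real_asymp
        then have "\<forall>\<^sub>F m in sequentially. h m < r" by (rule order_tendstoD) (use r in auto)
        then obtain n where n: "\<And>m. m \<ge> n \<Longrightarrow> h m < r" by (auto simp: eventually_sequentially)
        have "x \<in> W m" if "m \<ge> n" for m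
        proof -
          have hp: "h m > 0" using x by (auto simp: h_def)
          \<comment> \<open>The index of the cell containing x; cells are open on the left, hence
            the ceiling minus one.\<close>
          define k where "k = nat (\<lceil>(x - p) / h m\<rceil> - 1)"
          have c: "\<lceil>(x - p) / h m\<rceil> \<ge> 1" using x hp by (simp add: le_ceiling_iff)
          then have k: "real k < (x - p) / h m" "(x - p) / h m \<le> real k + 1"
            unfolding k_def by linarith+
          have k1: "s m k < x" "x \<le> s m (Suc k)" using k hp by (simp_all add: s_def field_simps)
          have "(x - p) / h m \<le> (q - p) / h m" using x hp by (intro divide_right_mono) auto
          also have "\<dots> = real m + 1" using x by (simp add: h_def)
          finally have "k < Suc m" using k(1) by linarith
          moreover have "ok m k" unfolding ok_def
          proof
            fix z assume "z \<in> {s m k<..s m (Suc k)}"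
            then have "\<bar>z - x\<bar> < r" using k1 n[OF that] ss[of m k] by (auto simp: abs_if)
            then show "z \<in> U" using r by (auto simp: dist_real_def abs_minus_commute)
          qed
          ultimately show ?thesis using k1 by (auto simp: W_def t_def)
        qed
        then show "x \<in> (\<Union>n. V n)" by (auto simp: V_def)
      qed
      have "emeasure M' N \<le> emeasure M (\<Union>n. V n)"
        using cover U(2) by (subst eM') (auto intro!: emeasure_mono)
      also have "\<dots> = (SUP n. emeasure M (V n))"
        by (rule SUP_emeasure_incseq[symmetric]) (auto simp: incseq_def V_def)
      also have "\<dots> \<le> ennreal e"
      proof (rule SUP_least)
        fix n
        have "emeasure M (V n) \<le> emeasure M (W n)" by (rule emeasure_mono) (auto simp: V_def)
        then show "emeasure M (V n) \<le> ennreal e" using WM[of n] by simp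
      qed
      finally show ?thesis .
    qed
    have "emeasure M' N \<le> 0"
    proof (rule ennreal_le_epsilon)
      fix e :: real assume "0 < e"
      then show "emeasure M' N \<le> 0 + ennreal e" using small[of e] by simp
    qed
    then have "emeasure M' N = 0" by simp
    then show "N \<in> null_sets M'" by (auto simp: null_sets_def)
  qed
  obtain f where f[measurable]: "f \<in> borel_measurable lborel" and df: "density lborel f = M'"
    using sigma_finite_measure.Radon_Nikodym[OF sigma_finite_lborel ac'] by auto
  have fi: "(\<integral>\<^sup>+s. f s * indicator {p<..x} s \<partial>lborel) = ennreal (G x - G p)" if x: "x \<in> {p..q}" for x
  proof -
    have "(\<integral>\<^sup>+s. f s * indicator {p<..x} s \<partial>lborel) = emeasure M' {p<..x}"
      by (subst df[symmetric], subst emeasure_density) auto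
    also have "\<dots> = emeasure M {p<..x}"
      using x by (subst eM') (auto intro!: arg_cong[of _ _ "emeasure M"])
    finally show ?thesis using eM[of p x] x pq by (simp add: HG)
  qed
  \<comment> \<open>The density is finite almost everywhere on (p, q], so \<open>enn2real\<close>
    loses nothing there.\<close>
  have fin: "AE s in lborel. s \<in> {p<..q} \<longrightarrow> f s \<noteq> \<infinity>"
  proof -
    have "(\<integral>\<^sup>+s. f s * indicator {p<..q} s \<partial>lborel) \<noteq> \<infinity>" using fi[of q] pq by simp
    then have "AE s in lborel. f s * indicator {p<..q} s \<noteq> \<infinity>"
      by (intro nn_integral_noteq_infinite) auto
    then show ?thesis by eventually_elim (auto simp: indicator_def split: if_splits)
  qed
  define g where "g s = enn2real (f s)" for s
  have hg: "(g has_integral (G x - G p)) {p..x}" if x: "x \<in> {p..q}" for x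
  proof -
    have "has_bochner_integral lborel (\<lambda>s. indicator {p<..x} s * g s) (G x - G p)"
    proof (rule has_bochner_integral_nn_integral)
      have "(\<integral>\<^sup>+s. ennreal (indicator {p<..x} s * g s) \<partial>lborel) = (\<integral>\<^sup>+s. f s * indicator {p<..x} s \<partial>lborel)"
      proof (rule nn_integral_cong_AE)
        show "AE s in lborel. ennreal (indicator {p<..x} s * g s) = f s * indicator {p<..x} s"
          using fin
        proof eventually_elim
          case (elim s)
          then show ?case using x by (auto simp: indicator_def g_def less_top)
        qed
      qed
      then show "(\<integral>\<^sup>+s. ennreal (indicator {p<..x} s * g s) \<partial>lborel) = ennreal (G x - G p)"
        using fi[OF x] by simp
      show "0 \<le> G x - G p" using mono_onD[OF mono, of p x] x pq by auto
    qed (auto simp: g_def)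
    then have "((\<lambda>s. indicator {p<..x} s * g s) has_integral (G x - G p)) UNIV"
      using has_integral_integral_lborel[of "\<lambda>s. indicator {p<..x} s * g s"]
      by (auto simp: has_bochner_integral_iff)
    also have "(\<lambda>s. indicator {p<..x} s * g s) = (\<lambda>s. if s \<in> {p<..x} then g s else 0)"
      by (auto simp: indicator_def)
    finally have "(g has_integral (G x - G p)) {p<..x}" by (simp only: has_integral_restrict_UNIV)
    then show ?thesis
      by (subst has_integral_spike_set_eq[of _ "{p<..x}"]) (auto intro: negligible_subset[of "{p}"])
  qed
  show ?thesis
  proof
    show "g absolutely_integrable_on {p..q}"
      by (rule nonnegative_absolutely_integrable_1) (use hg[of q] pq in \<open>auto simp: g_def\<close>)
    show "G x - G p = integral {p..x} g" if "x \<in> {p..q}" for x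
      using hg[OF that] by (simp add: integral_unique)
  qed
qed

section \<open>Variation and Jordan decomposition\<close>

definition partition :: "real \<Rightarrow> real \<Rightarrow> (nat \<Rightarrow> real) \<Rightarrow> nat \<Rightarrow> bool" where
  "partition x y c n \<longleftrightarrow> incseq c \<and> c 0 = x \<and> (\<forall>k\<ge>n. c k = y)"

definition vsum :: "(real \<Rightarrow> real) \<Rightarrow> (nat \<Rightarrow> real) \<Rightarrow> nat \<Rightarrow> real" where
  "vsum F c n = (\<Sum>k<n. \<bar>F (c (Suc k)) - F (c k)\<bar>)"

definition variation :: "(real \<Rightarrow> real) \<Rightarrow> real \<Rightarrow> real \<Rightarrow> real" where
  "variation F x y = Sup {vsum F c n | c n. partition x y c n}"

lemma partition_bounds:
  assumes "partition x y c n" shows "x \<le> c k" "c k \<le> y" "c k \<le> c (Suc k)"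
proof -
  have i: "incseq c" and 0: "c 0 = x" and n: "\<forall>k\<ge>n. c k = y" using assms by (auto simp: partition_def)
  show "x \<le> c k" using incseqD[OF i, of 0 k] 0 by simp
  show "c k \<le> y" using incseqD[OF i, of k "max k n"] n by simp
  show "c k \<le> c (Suc k)" using incseqD[OF i, of k "Suc k"] by simp
qed

lemma ex_partition: "x \<le> y \<Longrightarrow> partition x y (\<lambda>k. if k = 0 then x else y) 1"
  by (auto simp: partition_def incseq_def)

text \<open>A partition is an eventually constant sequence, so further steps cost nothing; this
  brings the partitions of several intervals to a common length.\<close>

lemma vsum_extend:
  assumes "partition x y c n" "n \<le> m" shows "vsum F c m = vsum F c n"
  unfolding vsum_def
  by (rule sum.mono_neutral_right) (use assms in \<open>auto simp: partition_def\<close>)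

lemma partition_sum_lengths: "partition x y c n \<Longrightarrow> (\<Sum>k<n. c (Suc k) - c k) = y - x"
  by (simp add: sum_lessThan_telescope partition_def)

text \<open>The steps of all partitions, concatenated from left to right, form one admissible family
  of the same total length. Hence sums of variations obey the same modulus as sums of
  increments.\<close>

lemma abs_cont_variation:
  assumes ac: "abs_cont_modulus p q F e \<delta>"
    and xy: "\<And>i. i < n \<Longrightarrow> p \<le> x i \<and> x i \<le> y i \<and> y i \<le> q"
    and ord: "\<And>i. Suc i < n \<Longrightarrow> y i \<le> x (Suc i)" and len: "(\<Sum>i<n. y i - x i) < \<delta>"
    and part: "\<And>i. i < n \<Longrightarrow> partition (x i) (y i) (c i) m"
  shows "(\<Sum>i<n. vsum F (c i) m) < e"
proof (cases "m = 0")
  case True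
  have "(\<Sum>i<n. \<bar>F (y i) - F (x i)\<bar>) < e"
    by (rule abs_cont_modulusD[OF ac]) (use xy ord len in auto)
  \<comment> \<open>For m = 0 all variation sums are empty and only the positivity of
    \<open>e\<close> is at stake.\<close>
  then have "0 < e" by (smt (verit) sum_nonneg)
  then show ?thesis using True by (simp add: vsum_def)
next
  case False
  then have m: "m > 0" by simp
  \<comment> \<open>Position j of the concatenation is step \<open>j mod m\<close> of partition
    \<open>j div m\<close>; this is the reason for a common length m.\<close>
  define s where "s j = c (j div m) (j mod m)" for j
  define t where "t j = c (j div m) (Suc (j mod m))" for j
  have grp: "(\<Sum>i<n. \<Sum>k<m. f (c i k) (c i (Suc k))) = (\<Sum>j<n * m. f (s j) (t j))" for f :: "real \<Rightarrow> real \<Rightarrow> real"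
  proof -
    have "(\<Sum>j<n * m. f (s j) (t j)) = (\<Sum>i<n. \<Sum>j\<in>{i * m..<i * m + m}. f (s j) (t j))"
      by (rule sum.nat_group[symmetric])
    also have "\<dots> = (\<Sum>i<n. \<Sum>k<m. f (c i k) (c i (Suc k)))"
    proof (rule sum.cong)
      fix i
      have "(\<Sum>j\<in>{i * m..<i * m + m}. f (s j) (t j)) = (\<Sum>k<m. f (s (k + i * m)) (t (k + i * m)))"
        using sum.shift_bounds_nat_ivl[of "\<lambda>j. f (s j) (t j)" 0 "i * m" m] by (simp add: lessThan_atLeast0 add.commute)
      also have "\<dots> = (\<Sum>k<m. f (c i k) (c i (Suc k)))"
        by (rule sum.cong) (auto simp: s_def t_def)
      finally show "(\<Sum>j\<in>{i * m..<i * m + m}. f (s j) (t j)) = (\<Sum>k<m. f (c i k) (c i (Suc k)))" .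
    qed simp
    finally show ?thesis by simp
  qed
  have idx: "j div m < n" "j mod m < m" if "j < n * m" for j
    using that m by (auto simp: less_mult_imp_div_less)
  have "(\<Sum>j<n * m. \<bar>F (t j) - F (s j)\<bar>) < e"
  proof (rule abs_cont_modulusD[OF ac])
    fix j assume j: "j < n * m"
    note part[OF idx(1)[OF j]] xy[OF idx(1)[OF j]]
    then show "p \<le> s j \<and> s j \<le> t j \<and> t j \<le> q"
      using partition_bounds[of "x (j div m)" "y (j div m)"] unfolding s_def t_def by (meson order_trans)
  next
    fix j assume j: "Suc j < n * m"
    then have j': "j < n * m" by simp
    show "t j \<le> s (Suc j)"
    proof (cases "Suc (j mod m) = m")
      case True
      then have d: "Suc j div m = Suc (j div m)" "Suc j mod m = 0" by (auto simp: div_Suc mod_Suc)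
      have "t j = y (j div m)" using part[OF idx(1)[OF j']] True by (simp add: t_def partition_def)
      moreover have "s (Suc j) = x (Suc (j div m))"
        using part[OF idx(1)[OF j]] d by (simp add: s_def partition_def)
      moreover have "y (j div m) \<le> x (Suc (j div m))" using ord idx(1)[OF j] d by simp
      ultimately show ?thesis by simp
    next
      case False
      then show ?thesis by (simp add: s_def t_def div_Suc mod_Suc)
    qed
  next
    have "(\<Sum>j<n * m. t j - s j) = (\<Sum>i<n. \<Sum>k<m. c i (Suc k) - c i k)"
      using grp[of "\<lambda>u v. v - u"] by simp
    also have "\<dots> = (\<Sum>i<n. y i - x i)"
      by (rule sum.cong) (auto intro: partition_sum_lengths[OF part])
    finally show "(\<Sum>j<n * m. t j - s j) < \<delta>" using len by simp
  qed
  then show ?thesis using grp[of "\<lambda>u v. \<bar>F v - F u\<bar>"] by (simp add: vsum_def)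
qed

text \<open>Jordan decomposition F = V - (V - F) with V the variation from \<open>p\<close>; both
  parts are nondecreasing and absolutely continuous. The interval is shorter than
  \<open>\<delta>1\<close>, so all variation sums stay below 1 and the suprema are finite.\<close>

lemma abs_cont_density_local:
  assumes pq: "p \<le> q" and ac: "abs_cont_on p q F"
    and small: "abs_cont_modulus p q F 1 \<delta>1" "q - p < \<delta>1"
  obtains g where "g absolutely_integrable_on {p..q}" "\<And>x. x \<in> {p..q} \<Longrightarrow> F x - F p = integral {p..x} g"
proof -
  have vbound: "vsum F c n < 1" if "partition x y c n" "p \<le> x" "x \<le> y" "y \<le> q" for x y c n
    using abs_cont_variation[OF small(1), of 1 "\<lambda>_. x" "\<lambda>_. y" "\<lambda>_. c" n] that small(2) by simp
  have bdd: "bdd_above {vsum F c n | c n. partition x y c n}" if "p \<le> x" "x \<le> y" "y \<le> q" for x y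
    using vbound[OF _ that] by (auto intro!: bdd_aboveI[of _ 1] less_imp_le)
  have le_var: "vsum F c n \<le> variation F x y" if "partition x y c n" "p \<le> x" "x \<le> y" "y \<le> q" for x y c n
    unfolding variation_def using that by (intro cSup_upper bdd) auto
  define V where "V = variation F p"
  have V_step: "V x + \<bar>F y - F x\<bar> \<le> V y" if xy: "p \<le> x" "x \<le> y" "y \<le> q" for x y
  proof -
    have "V x \<le> V y - \<bar>F y - F x\<bar>"
      unfolding V_def variation_def[of F p x]
    proof (rule cSup_least)
      show "{vsum F c n |c n. partition p x c n} \<noteq> {}" using ex_partition[OF xy(1)] by blast
      fix v assume "v \<in> {vsum F c n |c n. partition p x c n}"
      then obtain c n where v: "v = vsum F c n" "partition p x c n" by blast
      define c' where "c' k = (if k \<le> n then c k else y)" for k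
      have pc: "partition p y c' (Suc n)"
        unfolding partition_def
      proof (intro conjI)
        show "incseq c'"
        proof (rule incseq_SucI)
          fix k show "c' k \<le> c' (Suc k)"
            using partition_bounds[OF v(2), of k] xy by (auto simp: c'_def intro: order_trans)
        qed
      qed (use v in \<open>auto simp: c'_def partition_def\<close>)
      have "vsum F c' (Suc n) = vsum F c n + \<bar>F y - F x\<bar>"
        using v(2) by (simp add: vsum_def c'_def partition_def)
      then show "v \<le> variation F p y - \<bar>F y - F x\<bar>"
        using le_var[OF pc] xy v by simp
    qed
    then show ?thesis by simp
  qed
  have V_diff: "V y - V x \<le> variation F x y" if xy: "p \<le> x" "x \<le> y" "y \<le> q" for x y
  proof -
    have "V y \<le> V x + variation F x y"
      unfolding V_def variation_def[of F p y]
    proof (rule cSup_least)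
      show "{vsum F c n |c n. partition p y c n} \<noteq> {}" using ex_partition[of p y] xy by force
      fix v assume "v \<in> {vsum F c n |c n. partition p y c n}"
      then obtain c n where v: "v = vsum F c n" "partition p y c n" by blast
      \<comment> \<open>Cutting the partition at x: on a step that does not straddle x one of the
        clamped sequences is stationary, and on a straddling step the triangle inequality
        applies.\<close>
      define c1 where "c1 k = min (c k) x" for k
      define c2 where "c2 k = max (c k) x" for k
      have i: "incseq c" using v by (simp add: partition_def)
      have c1: "partition p x c1 n" and c2: "partition x y c2 n"
        using v(2) xy incseqD[OF i] unfolding partition_def c1_def c2_def incseq_def
        by (auto intro: min.coboundedI1 max.coboundedI1)
      have "vsum F c n \<le> vsum F c1 n + vsum F c2 n"
        unfolding vsum_def sum.distrib[symmetric]
      proof (rule sum_mono)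
        fix k
        have "c k \<le> c (Suc k)" using i by (simp add: incseq_SucD)
        then show "\<bar>F (c (Suc k)) - F (c k)\<bar> \<le> \<bar>F (c1 (Suc k)) - F (c1 k)\<bar> + \<bar>F (c2 (Suc k)) - F (c2 k)\<bar>"
          by (auto simp: c1_def c2_def min_def max_def)
      qed
      also have "\<dots> \<le> variation F p x + variation F x y"
        by (intro add_mono le_var c1 c2) (use xy in auto)
      finally show "v \<le> variation F p x + variation F x y" using v by simp
    qed
    then show ?thesis by simp
  qed
  have monoV: "mono_on {p..q} V" by (rule mono_onI) (use V_step in force)
  have monoVF: "mono_on {p..q} (\<lambda>x. V x - F x)"
    by (rule mono_onI) (use V_step in force)
  have acV: "abs_cont_on p q V"
    unfolding abs_cont_on_def
  proof (intro allI impI)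
    fix e :: real assume "e > 0"
    then have e2: "e / 2 > 0" by simp
    from abs_cont_onE[OF ac e2]
    obtain \<delta> where \<delta>: "\<delta> > 0" "abs_cont_modulus p q F (e/2) \<delta>" .
    show "\<exists>\<delta>>0. \<forall>(n::nat) s t.
        (\<forall>i<n. p \<le> s i \<and> s i \<le> t i \<and> t i \<le> q) \<and> (\<forall>i. Suc i < n \<longrightarrow> t i \<le> s (Suc i)) \<and>
        (\<Sum>i<n. t i - s i) < \<delta> \<longrightarrow> (\<Sum>i<n. \<bar>V (t i) - V (s i)\<bar>) < e"
    proof (intro exI conjI allI impI)
      fix n :: nat and s t
      assume a: "(\<forall>i<n. p \<le> s i \<and> s i \<le> t i \<and> t i \<le> q) \<and> (\<forall>i. Suc i < n \<longrightarrow> t i \<le> s (Suc i)) \<and>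
          (\<Sum>i<n. t i - s i) < \<delta>"
      \<comment> \<open>Each of the n variations is approximated up to \<open>\<eta>\<close>, with
        total error at most e/2; the other half of e goes to the variation sums.\<close>
      define \<eta> where "\<eta> = e / (2 * (real n + 1))"
      have \<eta>: "\<eta> > 0" using \<open>e > 0\<close> by (simp add: \<eta>_def)
      have "\<exists>c m. partition (s i) (t i) c m \<and> variation F (s i) (t i) - \<eta> < vsum F c m" if "i < n" for i
      proof -
        have r: "p \<le> s i" "s i \<le> t i" "t i \<le> q" using a that by auto
        have "{vsum F c n |c n. partition (s i) (t i) c n} \<noteq> {}" using ex_partition[OF r(2)] by blast
        then obtain v where "v \<in> {vsum F c n |c n. partition (s i) (t i) c n}" "variation F (s i) (t i) - \<eta> < v"
          using less_cSup_iff[OF _ bdd[OF r], of "variation F (s i) (t i) - \<eta>"] \<eta>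
          unfolding variation_def by auto
        then show ?thesis by blast
      qed
      then obtain c m where cm: "\<And>i. i < n \<Longrightarrow> partition (s i) (t i) (c i) (m i)"
        "\<And>i. i < n \<Longrightarrow> variation F (s i) (t i) - \<eta> < vsum F (c i) (m i)" by metis
      define m' where "m' = (\<Sum>i<n. m i)"
      have mm: "m i \<le> m'" if "i < n" for i unfolding m'_def using that by (intro member_le_sum) auto
      have "(\<Sum>i<n. vsum F (c i) m') < e / 2"
      proof (rule abs_cont_variation[OF \<delta>(2)])
        show "partition (s i) (t i) (c i) m'" if "i < n" for i
          using cm(1)[OF that] mm[OF that] by (auto simp: partition_def)
      qed (use a in auto)
      moreover have "(\<Sum>i<n. \<bar>V (t i) - V (s i)\<bar>) \<le> (\<Sum>i<n. vsum F (c i) m' + \<eta>)"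
      proof (rule sum_mono)
        fix i assume "i \<in> {..<n}"
        then have i: "i < n" by simp
        then have r: "p \<le> s i" "s i \<le> t i" "t i \<le> q" using a by auto
        have "vsum F (c i) m' = vsum F (c i) (m i)" by (rule vsum_extend[OF cm(1)[OF i] mm[OF i]])
        then show "\<bar>V (t i) - V (s i)\<bar> \<le> vsum F (c i) m' + \<eta>"
          using cm(2)[OF i] V_diff[OF r] V_step[OF r] by simp
      qed
      moreover have "(\<Sum>i<n. vsum F (c i) m' + \<eta>) = (\<Sum>i<n. vsum F (c i) m') + real n * \<eta>"
        by (simp add: sum.distrib)
      moreover have "real n * \<eta> \<le> e / 2"
        using \<open>e > 0\<close> by (simp add: \<eta>_def field_simps)
      ultimately show "(\<Sum>i<n. \<bar>V (t i) - V (s i)\<bar>) < e" by linarith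
    qed (rule \<delta>(1))
  qed
  obtain g1 where g1: "g1 absolutely_integrable_on {p..q}" "\<And>x. x \<in> {p..q} \<Longrightarrow> V x - V p = integral {p..x} g1"
    using abs_cont_mono_density[OF pq monoV acV] by metis
  obtain g2 where g2: "g2 absolutely_integrable_on {p..q}"
    "\<And>x. x \<in> {p..q} \<Longrightarrow> (V x - F x) - (V p - F p) = integral {p..x} g2"
    using abs_cont_mono_density[OF pq monoVF abs_cont_on_diff[OF acV ac]] by metis
  show ?thesis
  proof
    show "(\<lambda>x. g1 x - g2 x) absolutely_integrable_on {p..q}" using g1 g2 by (intro set_integral_diff(1))
    fix x assume x: "x \<in> {p..q}"
    have "g1 integrable_on {p..x}" "g2 integrable_on {p..x}"
      using g1(1) g2(1) x by (auto intro: integrable_on_subinterval set_lebesgue_integral_eq_integral(1))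
    then have "integral {p..x} (\<lambda>x. g1 x - g2 x) = integral {p..x} g1 - integral {p..x} g2"
      by (rule Henstock_Kurzweil_Integration.integral_diff)
    then show "F x - F p = integral {p..x} (\<lambda>x. g1 x - g2 x)"
      using g1(2)[OF x] g2(2)[OF x] by simp
  qed
qed

text \<open>Bolzano's principle: a property of intervals that holds for all short intervals around
  each point and passes to adjacent unions holds for {c..d}. Short intervals are those below the
  modulus for 1.\<close>

theorem abs_cont_density:
  assumes cd: "c \<le> d" and ac: "abs_cont_on c d F"
  obtains g where "g absolutely_integrable_on {c..d}" "\<And>x. x \<in> {c..d} \<Longrightarrow> F x - F c = integral {c..x} g"
proof -
  from abs_cont_onE[OF ac zero_less_one]
  obtain \<delta> where \<delta>: "\<delta> > 0" "abs_cont_modulus c d F 1 \<delta>" .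
  define P where "P p q \<longleftrightarrow> (c \<le> p \<longrightarrow> q \<le> d \<longrightarrow>
    (\<exists>g. g absolutely_integrable_on {p..q} \<and> (\<forall>x\<in>{p..q}. F x - F p = integral {p..x} g)))" for p q
  have "P c d" using cd
  proof (induction rule: Bolzano)
    case (trans a b e)
    show ?case
      unfolding P_def
    proof (intro impI)
      assume "c \<le> a" "e \<le> d"
      then obtain g h where g: "g absolutely_integrable_on {a..b}" "\<forall>x\<in>{a..b}. F x - F a = integral {a..x} g"
        and h: "h absolutely_integrable_on {b..e}" "\<forall>x\<in>{b..e}. F x - F b = integral {b..x} h"
        using trans unfolding P_def by (meson order_trans)
      define k where "k x = (if x < b then g x else h x)" for x
      have k1: "integral {a..x} k = integral {a..x} g" if "x \<le> b" for x
        by (rule integral_spike[of "{b}"]) (use that in \<open>auto simp: k_def\<close>)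
      have k2: "integral {b..x} k = integral {b..x} h" for x
        by (rule integral_cong) (auto simp: k_def)
      have ka: "k absolutely_integrable_on {a..b}"
        by (rule absolutely_integrable_spike[OF g(1), of "{b}"]) (auto simp: k_def)
      have kb: "k absolutely_integrable_on {b..e}"
        by (rule absolutely_integrable_spike[OF h(1), of "{}"]) (auto simp: k_def)
      have "k absolutely_integrable_on {a..b} \<union> {b..e}"
        by (rule absolutely_integrable_Un[OF ka kb])
      moreover have "{a..b} \<union> {b..e} = {a..e}" using trans by auto
      ultimately have ke: "k absolutely_integrable_on {a..e}" by simp
      have "F x - F a = integral {a..x} k" if x: "x \<in> {a..e}" for x
      proof (cases "x \<le> b")
        case True
        then show ?thesis using g(2) k1[OF True] x by simp
      next
        case False
        then have "integral {a..b} k + integral {b..x} k = integral {a..x} k"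
          using ke x trans
          by (intro Henstock_Kurzweil_Integration.integral_combine)
            (auto intro: integrable_on_subinterval set_lebesgue_integral_eq_integral(1))
        then show ?thesis using k1[of b] k2[of x] g(2)[rule_format, of b] h(2)[rule_format, of x] x False trans by simp
      qed
      then show "\<exists>g. g absolutely_integrable_on {a..e} \<and> (\<forall>x\<in>{a..e}. F x - F a = integral {a..x} g)"
        using ke by blast
    qed
  next
    case (local x)
    show ?case
    proof (intro exI[of _ \<delta>] conjI allI impI)
      fix a b assume ab: "a \<le> x \<and> x \<le> b \<and> b - a < \<delta>"
      show "P a b"
        unfolding P_def
      proof (intro impI)
        assume cd: "c \<le> a" "b \<le> d"
        have "abs_cont_modulus a b F 1 \<delta>"
          unfolding abs_cont_modulus_def
        proof (intro allI impI)
          fix n :: nat and s t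
          assume a: "(\<forall>i<n. a \<le> s i \<and> s i \<le> t i \<and> t i \<le> b) \<and> (\<forall>i. Suc i < n \<longrightarrow> t i \<le> s (Suc i)) \<and>
              (\<Sum>i<n. t i - s i) < \<delta>"
          show "(\<Sum>i<n. \<bar>F (t i) - F (s i)\<bar>) < 1"
          proof (rule abs_cont_modulusD[OF \<delta>(2)])
            show "c \<le> s i \<and> s i \<le> t i \<and> t i \<le> d" if "i < n" for i
              using a that cd by (meson order_trans)
          qed (use a in auto)
        qed
        moreover have "a \<le> b" "b - a < \<delta>" using ab by auto
        ultimately obtain g where "g absolutely_integrable_on {a..b}"
            "\<And>x. x \<in> {a..b} \<Longrightarrow> F x - F a = integral {a..x} g"
          using abs_cont_density_local abs_cont_on_subinterval[OF ac cd] by blast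
        then show "\<exists>g. g absolutely_integrable_on {a..b} \<and> (\<forall>x\<in>{a..b}. F x - F a = integral {a..x} g)"
          by blast
      qed
    qed (rule \<delta>(1))
  qed
  then show ?thesis using that unfolding P_def by blast
qed

section \<open>Weak derivatives and indefinite integrals\<close>

lemma finite_measure_I01: "finite_measure I01"
  by (rule finite_measure_lebesgue_on) auto

lemma measurable_id_I01: "(\<lambda>x. x) \<in> borel_measurable I01"
  by (intro measurable_restrict_space1 measurable_completion) simp

lemma borel_measurable_I01: "f \<in> borel_measurable borel \<Longrightarrow> f \<in> borel_measurable I01"
  by (intro measurable_restrict_space1 measurable_completion) simp

text \<open>Most integrations by parts below take this form: a function is written as the integral
  of its derivative against a kernel, and the order of integration is exchanged.\<close>

lemma fubini_I01:
  fixes f h :: "real \<Rightarrow> real" and k :: "real \<Rightarrow> real \<Rightarrow> real"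
  assumes f: "integrable I01 f" and h: "integrable I01 h"
    and k: "(\<lambda>(x, s). k x s) \<in> borel_measurable (borel \<Otimes>\<^sub>M borel)"
    and bd: "\<And>x s. 0 < x \<Longrightarrow> x < 1 \<Longrightarrow> 0 < s \<Longrightarrow> s < 1 \<Longrightarrow> \<bar>k x s\<bar> \<le> 1"
  shows "(LINT x|I01. f x * (LINT s|I01. k x s * h s)) = (LINT s|I01. h s * (LINT x|I01. k x s * f x))"
    and "integrable I01 (\<lambda>x. f x * (LINT s|I01. k x s * h s))"
proof -
  interpret finite_measure I01 by (rule finite_measure_I01)
  interpret pair_sigma_finite I01 I01 ..
  have [measurable]: "(\<lambda>x. x) \<in> borel_measurable I01" by (rule measurable_id_I01)
  have [measurable]: "f \<in> borel_measurable I01" "h \<in> borel_measurable I01" using f h by auto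
  have [measurable]: "(\<lambda>z. k (fst z) (snd z)) \<in> borel_measurable (I01 \<Otimes>\<^sub>M I01)"
  proof -
    have "(\<lambda>z. (fst z, snd z)) \<in> (I01 \<Otimes>\<^sub>M I01) \<rightarrow>\<^sub>M (borel \<Otimes>\<^sub>M borel)"
      by measurable
    from measurable_compose[OF this k] show ?thesis by simp
  qed
  have int0: "integrable (I01 \<Otimes>\<^sub>M I01) (\<lambda>(x, s). f x * h s)"
  proof (rule Fubini_integrable)
    show "integrable I01 (\<lambda>x. LINT y|I01. norm (case (x, y) of (x, s) \<Rightarrow> f x * h s))"
      using f by (simp add: abs_mult)
    show "AE x in I01. integrable I01 (\<lambda>y. case (x, y) of (x, s) \<Rightarrow> f x * h s)"
      using h by simp
  qed measurable
  have int: "integrable (I01 \<Otimes>\<^sub>M I01) (\<lambda>(x, s). f x * (k x s * h s))"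
  proof (rule Bochner_Integration.integrable_bound[OF int0])
    show "AE z in I01 \<Otimes>\<^sub>M I01. norm (case z of (x, s) \<Rightarrow> f x * (k x s * h s)) \<le> norm (case z of (x, s) \<Rightarrow> f x * h s)"
    proof (rule AE_I2)
      fix z assume "z \<in> space (I01 \<Otimes>\<^sub>M I01)"
      then have z: "0 < fst z" "fst z < 1" "0 < snd z" "snd z < 1" by (auto simp: space_pair_measure)
      have "\<bar>k (fst z) (snd z)\<bar> * \<bar>f (fst z) * h (snd z)\<bar> \<le> 1 * \<bar>f (fst z) * h (snd z)\<bar>"
        by (intro mult_right_mono bd z) auto
      then show "norm (case z of (x, s) \<Rightarrow> f x * (k x s * h s)) \<le> norm (case z of (x, s) \<Rightarrow> f x * h s)"
        by (simp add: case_prod_beta abs_mult mult_ac)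
    qed
  qed (simp add: case_prod_beta)
  have "(LINT s|I01. LINT x|I01. f x * (k x s * h s)) = (LINT x|I01. LINT s|I01. f x * (k x s * h s))"
    by (rule Fubini_integral[OF int])
  moreover have "(LINT x|I01. f x * (k x s * h s)) = h s * (LINT x|I01. k x s * f x)" for s
    by (subst integral_mult_right_zero[symmetric]) (simp add: mult_ac)
  ultimately show "(LINT x|I01. f x * (LINT s|I01. k x s * h s)) = (LINT s|I01. h s * (LINT x|I01. k x s * f x))"
    by simp
  show "integrable I01 (\<lambda>x. f x * (LINT s|I01. k x s * h s))"
    using integrable_fst'[OF int] by simp
qed

definition indefinite_integral :: "(real \<Rightarrow> real) \<Rightarrow> (real \<Rightarrow> real) \<Rightarrow> bool" where
  "indefinite_integral f g \<longleftrightarrow> L1_loc g \<and>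
     (\<forall>x y. 0 < x \<longrightarrow> x \<le> y \<longrightarrow> y < 1 \<longrightarrow> f y - f x = integral {x..y} g)"

lemma indefinite_integralD:
  "indefinite_integral f g \<Longrightarrow> 0 < x \<Longrightarrow> x \<le> y \<Longrightarrow> y < 1 \<Longrightarrow> f y - f x = integral {x..y} g"
  by (simp add: indefinite_integral_def)

lemma L1_loc_absolutely: "L1_loc g \<Longrightarrow> 0 < c \<Longrightarrow> d < 1 \<Longrightarrow> g absolutely_integrable_on {c..d}"
  by (simp add: L1_loc_def)

lemma L1_loc_integrable_on: "L1_loc g \<Longrightarrow> 0 < c \<Longrightarrow> d < 1 \<Longrightarrow> g integrable_on {c..d}"
  by (rule set_lebesgue_integral_eq_integral(1)) (rule L1_loc_absolutely)

lemma continuous_on_L1_loc: 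
  assumes "continuous_on {0<..<1} f" shows "L1_loc f"
  unfolding L1_loc_def
proof (intro allI impI)
  fix c d :: real assume "0 < c \<and> d < 1"
  then have "continuous_on {c..d} f" by (intro continuous_on_subset[OF assms]) auto
  then show "f absolutely_integrable_on {c..d}" by (rule absolutely_integrable_continuous_real)
qed

lemma indefinite_integral_continuous:
  assumes "indefinite_integral f g" shows "continuous_on {0<..<1} f"
proof (rule continuous_at_imp_continuous_on, intro ballI)
  fix x :: real assume x: "x \<in> {0<..<1}"
  define c where "c = x / 2"
  define d where "d = (x + 1) / 2"
  have cd: "0 < c" "c < x" "x < d" "d < 1" using x by (auto simp: c_def d_def)
  have g: "g integrable_on {c..d}" using assms cd by (auto simp: indefinite_integral_def L1_loc_integrable_on)
  have "continuous_on {c..d} (\<lambda>y. f c + integral {c..y} g)"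
    by (intro continuous_on_add continuous_on_const indefinite_integral_continuous_1 g)
  moreover have "f c + integral {c..y} g = f y" if "y \<in> {c..d}" for y
    using indefinite_integralD[OF assms, of c y] that cd by simp
  ultimately have "continuous_on {c..d} f" by (rule continuous_on_eq)
  then show "isCont f x" using cd by (auto intro: continuous_on_interior simp: interior_atLeastAtMost_real)
qed

text \<open>Fubini with the kernel that is 1 for s \<le> x: integrating deriv \<phi> over [s, 1]
  gives - \<phi>(s).\<close>

lemma indefinite_integral_weak_deriv:
  assumes fg: "indefinite_integral f g" shows "is_weak_deriv f g"
proof -
  have g: "L1_loc g" using fg by (simp add: indefinite_integral_def)
  have f: "L1_loc f" by (rule continuous_on_L1_loc[OF indefinite_integral_continuous[OF fg]])
  have "(LINT x|I01. f x * deriv \<phi> x) = - (LINT x|I01. g x * \<phi> x)" if \<phi>: "test_function \<phi>" for \<phi>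
  proof -
    obtain c d where cd: "0 < c" "c < d" "d < 1" "\<And>x. x \<notin> {c..d} \<Longrightarrow> \<phi> x = 0" "\<And>x. x \<notin> {c..d} \<Longrightarrow> deriv \<phi> x = 0"
      using test_function_bounds[OF \<phi>] by metis
    have one: "L1_loc (\<lambda>x. 1)" by (intro continuous_on_L1_loc continuous_intros)
    have D: "(\<phi> has_real_derivative deriv \<phi> x) (at x)" for x
      using \<phi> by (auto simp: test_function_iff intro: smooth_DERIV)
    have i\<phi>': "integrable I01 (deriv \<phi>)" using test_function_integrable2[OF one \<phi>] by simp
    have gc: "integrable I01 (\<lambda>s. indicator {c..d} s * g s)"
      using g cd by (intro I01_interval_integral) (auto simp: L1_loc_def)
    have FTC: "(LINT x|I01. indicator {u..} x * deriv \<phi> x) = - \<phi> u" if "0 \<le> u" "u \<le> 1" for u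
    proof -
      have "(deriv \<phi> has_integral (\<phi> 1 - \<phi> u)) {u..1}"
        by (rule fundamental_theorem_of_calculus)
          (use that D in \<open>auto simp: has_real_derivative_iff_has_vector_derivative[symmetric] intro: has_field_derivative_at_within\<close>)
      then have "integral {u..1} (deriv \<phi>) = - \<phi> u" using cd by (simp add: integral_unique)
      moreover have "(LINT x|I01. indicator {u..} x * deriv \<phi> x) = (LINT x|I01. indicator {u..1} x * deriv \<phi> x)"
        by (rule Bochner_Integration.integral_cong) (auto simp: indicator_def)
      moreover have "deriv \<phi> absolutely_integrable_on {u..1}"
        using \<phi> by (auto intro!: absolutely_integrable_continuous_real smooth_continuous smooth_deriv simp: test_function_iff)
      ultimately show ?thesis using I01_interval_integral(2)[where g = "deriv \<phi>" and x = u and y = 1] that by simp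
    qed
    define k where "k x s = indicat_real {s..} x" for x s :: real
    have k: "(\<lambda>(x, s). k x s) \<in> borel_measurable (borel \<Otimes>\<^sub>M borel)"
    proof -
      have "(\<lambda>(x, s). k x s) = (\<lambda>z. indicator {z. snd z \<le> fst z} z)"
        by (auto simp: k_def indicator_def)
      also have "\<dots> \<in> borel_measurable (borel \<Otimes>\<^sub>M borel)" by measurable
      finally show ?thesis .
    qed
    \<comment> \<open>Outside {c..d} both sides vanish with deriv \<phi>; inside, f(x) is f(c) plus
      the integral of g over [c, x].\<close>
    have fk: "f x * deriv \<phi> x = f c * deriv \<phi> x + deriv \<phi> x * (LINT s|I01. k x s * (indicator {c..d} s * g s))" for x
    proof (cases "x \<in> {c..d}")
      case True
      have "(LINT s|I01. k x s * (indicator {c..d} s * g s)) = (LINT s|I01. indicator {c..x} s * g s)"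
        using True by (intro Bochner_Integration.integral_cong) (auto simp: k_def indicator_def)
      also have "\<dots> = integral {c..x} g"
        using g True cd by (intro I01_interval_integral) (auto simp: L1_loc_def)
      also have "\<dots> = f x - f c" using indefinite_integralD[OF fg, of c x] True cd by simp
      finally have e: "(LINT s|I01. k x s * (indicator {c..d} s * g s)) = f x - f c" .
      show ?thesis unfolding e by (simp add: algebra_simps)
    qed (use cd in auto)
    have "(LINT x|I01. f x * deriv \<phi> x)
        = (LINT x|I01. f c * deriv \<phi> x) + (LINT x|I01. deriv \<phi> x * (LINT s|I01. k x s * (indicator {c..d} s * g s)))"
      unfolding fk
      by (rule Bochner_Integration.integral_add)
        (use i\<phi>' fubini_I01(2)[OF i\<phi>' gc k] in \<open>auto simp: k_def\<close>)
    also have "(LINT x|I01. f c * deriv \<phi> x) = f c * (LINT x|I01. indicator {0..} x * deriv \<phi> x)"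
      by (subst integral_mult_right_zero[symmetric], rule Bochner_Integration.integral_cong) auto
    also have "\<dots> = 0" using FTC[of 0] cd by simp
    also have "(LINT x|I01. deriv \<phi> x * (LINT s|I01. k x s * (indicator {c..d} s * g s)))
        = (LINT s|I01. indicator {c..d} s * g s * (LINT x|I01. k x s * deriv \<phi> x))"
      by (rule fubini_I01(1)[OF i\<phi>' gc k]) (auto simp: k_def)
    also have "\<dots> = (LINT s|I01. - (g s * \<phi> s))"
    proof (rule Bochner_Integration.integral_cong)
      fix s assume "s \<in> space I01"
      then have "(LINT x|I01. k x s * deriv \<phi> x) = - \<phi> s" using FTC[of s] by (simp add: k_def)
      then show "indicator {c..d} s * g s * (LINT x|I01. k x s * deriv \<phi> x) = - (g s * \<phi> s)"
        using cd(4)[of s] by (auto simp: indicator_def)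
    qed simp
    finally show ?thesis by simp
  qed
  then show ?thesis using f g by (simp add: is_weak_deriv_def)
qed

lemma negligible_AE_I01:
  assumes "AE x in I01. P x"
  obtains N where "negligible N" "\<And>x. 0 < x \<Longrightarrow> x < 1 \<Longrightarrow> x \<notin> N \<Longrightarrow> P x"
proof -
  have "AE x in lebesgue. 0 < x \<and> x < 1 \<longrightarrow> P x" using assms by (simp add: AE_I01_iff)
  then obtain N where "N \<in> null_sets lebesgue" "{x \<in> space lebesgue. \<not> (0 < x \<and> x < 1 \<longrightarrow> P x)} \<subseteq> N"
    unfolding eventually_ae_filter by blast
  then show ?thesis by (intro that[of N]) (auto simp: negligible_iff_null_sets)
qed

lemma L1_loc_AE:
  assumes f: "L1_loc f" and ae: "AE x in I01. f x = f' x" shows "L1_loc f'"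
  unfolding L1_loc_def
proof (intro allI impI)
  fix c d :: real assume cd: "0 < c \<and> d < 1"
  obtain N where N: "negligible N" "\<And>x. 0 < x \<Longrightarrow> x < 1 \<Longrightarrow> x \<notin> N \<Longrightarrow> f x = f' x"
    using negligible_AE_I01[OF ae] by metis
  show "f' absolutely_integrable_on {c..d}"
    by (rule absolutely_integrable_spike[OF L1_loc_absolutely[OF f] N(1)]) (use N(2) cd in auto)
qed

lemma is_weak_deriv_cong_AE:
  assumes w: "is_weak_deriv f g" and f: "AE x in I01. f x = f' x" and g: "AE x in I01. g x = g' x"
  shows "is_weak_deriv f' g'"
proof -
  have l: "L1_loc f" "L1_loc g" using w by (auto simp: is_weak_deriv_def)
  have l': "L1_loc f'" "L1_loc g'" using L1_loc_AE l f g by blast+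
  have "(LINT x|I01. f' x * deriv \<phi> x) = - (LINT x|I01. g' x * \<phi> x)" if \<phi>: "test_function \<phi>" for \<phi>
  proof -
    have "(LINT x|I01. f x * deriv \<phi> x) = (LINT x|I01. f' x * deriv \<phi> x)"
    proof (rule integral_cong_AE)
      show "AE x in I01. f x * deriv \<phi> x = f' x * deriv \<phi> x" using f by eventually_elim simp
    qed (auto intro: borel_measurable_integrable test_function_integrable2 l l' \<phi>)
    moreover have "(LINT x|I01. g x * \<phi> x) = (LINT x|I01. g' x * \<phi> x)"
    proof (rule integral_cong_AE)
      show "AE x in I01. g x * \<phi> x = g' x * \<phi> x" using g by eventually_elim simp
    qed (auto intro: borel_measurable_integrable test_function_integrable1 l l' \<phi>)
    moreover have "(LINT x|I01. f x * deriv \<phi> x) = - (LINT x|I01. g x * \<phi> x)"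
      using w \<phi> unfolding is_weak_deriv_def by blast
    ultimately show ?thesis by simp
  qed
  then show ?thesis using l' by (simp add: is_weak_deriv_def)
qed

lemma is_weak_deriv_lin:
  assumes w: "is_weak_deriv f g" and w': "is_weak_deriv f' g'"
  shows "is_weak_deriv (\<lambda>x. c * f x + d * f' x) (\<lambda>x. c * g x + d * g' x)"
proof -
  have l: "L1_loc f" "L1_loc g" "L1_loc f'" "L1_loc g'" using w w' by (auto simp: is_weak_deriv_def)
  have "(LINT x|I01. (c * f x + d * f' x) * deriv \<phi> x) = - (LINT x|I01. (c * g x + d * g' x) * \<phi> x)"
    if \<phi>: "test_function \<phi>" for \<phi>
  proof -
    have "(LINT x|I01. (c * f x + d * f' x) * deriv \<phi> x)
        = (LINT x|I01. c * (f x * deriv \<phi> x) + d * (f' x * deriv \<phi> x))"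
      by (simp add: algebra_simps)
    also have "\<dots> = c * (LINT x|I01. f x * deriv \<phi> x) + d * (LINT x|I01. f' x * deriv \<phi> x)"
      by (subst Bochner_Integration.integral_add) (auto intro!: integrable_mult_right test_function_integrable2 l \<phi>)
    also have "(LINT x|I01. f x * deriv \<phi> x) = - (LINT x|I01. g x * \<phi> x)"
      using w \<phi> unfolding is_weak_deriv_def by blast
    also have "(LINT x|I01. f' x * deriv \<phi> x) = - (LINT x|I01. g' x * \<phi> x)"
      using w' \<phi> unfolding is_weak_deriv_def by blast
    also have "c * - (LINT x|I01. g x * \<phi> x) + d * - (LINT x|I01. g' x * \<phi> x)
        = - (LINT x|I01. c * (g x * \<phi> x) + d * (g' x * \<phi> x))"
      by (subst Bochner_Integration.integral_add) (auto intro!: integrable_mult_right test_function_integrable1 l \<phi>)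
    also have "\<dots> = - (LINT x|I01. (c * g x + d * g' x) * \<phi> x)" by (simp add: algebra_simps)
    finally show ?thesis .
  qed
  then show ?thesis using l by (simp add: is_weak_deriv_def L1_loc_lin)
qed

lemma weak_deriv_wderiv:
  assumes "is_weak_deriv f g"
  shows "is_weak_deriv f (wderiv f)" "AE x in I01. wderiv f x = g x"
proof -
  show 1: "is_weak_deriv f (wderiv f)" unfolding wderiv_def using someI[of "is_weak_deriv f" g] assms by simp
  show "AE x in I01. wderiv f x = g x" by (rule weak_deriv_unique[OF 1 assms])
qed

text \<open>A primitive of \<open>g\<close> has \<open>g\<close> as weak derivative as well, so its
  difference from \<open>f\<close> is constant almost everywhere.\<close>

lemma weak_deriv_indefinite_integral:
  assumes w: "is_weak_deriv f g"
  obtains h where "indefinite_integral h g" "AE x in I01. f x = h x"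
proof -
  have g: "L1_loc g" and f: "L1_loc f" using w by (auto simp: is_weak_deriv_def)
  \<comment> \<open>Normalised at 1/2, since \<open>g\<close> need not be integrable up to 0 or 1.
    For each x one of the two intervals is empty or a point.\<close>
  define h where "h x = integral {1/2..x} g - integral {x..1/2} g" for x
  have "h y - h x = integral {x..y} g" if "0 < x" "x \<le> y" "y < 1" for x y
  proof -
    have cmb: "integral {u..v} g + integral {v..z} g = integral {u..z} g"
      if "0 < u" "u \<le> v" "v \<le> z" "z < 1" for u v z
      using that by (intro Henstock_Kurzweil_Integration.integral_combine L1_loc_integrable_on g) auto
    have e: "integral {u..v} g = 0" if "v \<le> u" for u v
      using that by (cases "u = v") auto
    consider "y \<le> 1/2" | "x \<le> 1/2" "1/2 \<le> y" | "1/2 \<le> x" by linarith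
    then show ?thesis
    proof cases
      case 1 then show ?thesis using cmb[of x y "1/2"] e[of x "1/2"] e[of y "1/2"] that by (simp add: h_def)
    next
      case 2 then show ?thesis using cmb[of x "1/2" y] e[of x "1/2"] e[of "1/2" y] that by (simp add: h_def)
    next
      case 3 then show ?thesis using cmb[of "1/2" x y] e[of "1/2" x] e[of "1/2" y] that by (simp add: h_def)
    qed
  qed
  then have h: "indefinite_integral h g" using g by (auto simp: indefinite_integral_def)
  have "is_weak_deriv h g" by (rule indefinite_integral_weak_deriv[OF h])
  then have w0: "is_weak_deriv (\<lambda>x. 1 * f x + - 1 * h x) (\<lambda>x. 1 * g x + - 1 * g x)"
    by (rule is_weak_deriv_lin[OF w])
  then have "L1_loc (\<lambda>x. 1 * f x + - 1 * h x)" by (simp add: is_weak_deriv_def)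
  then obtain k where k: "AE x in I01. 1 * f x + - 1 * h x = k"
  proof (rule weak_deriv_0_const)
    fix \<phi> assume "test_function \<phi>"
    then have "(LINT x|I01. (1 * f x + - 1 * h x) * deriv \<phi> x) = - (LINT x|I01. (1 * g x + - 1 * g x) * \<phi> x)"
      using w0 unfolding is_weak_deriv_def by blast
    then show "(LINT x|I01. (1 * f x + - 1 * h x) * deriv \<phi> x) = 0" by simp
  qed
  show ?thesis
  proof (rule that)
    show "indefinite_integral (\<lambda>x. h x + k) g" using h by (simp add: indefinite_integral_def)
    show "AE x in I01. f x = h x + k" using k by eventually_elim simp
  qed
qed

lemma integrable_I01_absolutely_integrable:
  fixes g :: "real \<Rightarrow> real"
  assumes "integrable I01 g" "0 \<le> c" "d \<le> 1" shows "g absolutely_integrable_on {c..d}"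
proof -
  have "integrable lebesgue (\<lambda>x. indicator {0<..<1} x *\<^sub>R g x)"
    using assms(1) by (simp add: integrable_restrict_space)
  then have "g absolutely_integrable_on {0<..<1}" by (simp add: set_integrable_def)
  then have "g absolutely_integrable_on {0..1}"
    by (subst absolutely_integrable_spike_set_eq[of _ "{0<..<1}"]) (auto intro: negligible_subset[of "{0,1}"])
  then show ?thesis by (rule set_integrable_subset) (use assms in auto)
qed

lemma weak_deriv_integrable:
  assumes w: "is_weak_deriv f g" and g: "integrable I01 g"
  obtains C where "AE x in I01. f x = C + integral {0..x} g"
proof -
  obtain h where h: "indefinite_integral h g" "AE x in I01. f x = h x"
    using weak_deriv_indefinite_integral[OF w] by metis
  have rep: "h x = (h (1/2) - integral {0..1/2} g) + integral {0..x} g" if "0 < x" "x < 1" for x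
  proof -
    have cmb: "integral {0..v} g + integral {v..z} g = integral {0..z} g"
      if "0 \<le> v" "v \<le> z" "z \<le> 1" for v z
      using that
      by (intro Henstock_Kurzweil_Integration.integral_combine set_lebesgue_integral_eq_integral(1)
          integrable_I01_absolutely_integrable g) auto
    show ?thesis
    proof (cases "x \<le> 1/2")
      case True
      then have "h (1/2) - h x = integral {x..1/2} g"
        using indefinite_integralD[OF h(1), of x "1/2"] that by simp
      then show ?thesis using cmb[of x "1/2"] that True by simp
    next
      case False
      then have "h x - h (1/2) = integral {1/2..x} g"
        using indefinite_integralD[OF h(1), of "1/2" x] that by simp
      then show ?thesis using cmb[of "1/2" x] that False by simp
    qed
  qed
  have "AE x in I01. f x = (h (1/2) - integral {0..1/2} g) + integral {0..x} g"
    using h(2) unfolding AE_I01_iff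
  proof eventually_elim
    case (elim x)
    then show ?case using rep[of x] by simp
  qed
  then show ?thesis by (rule that)
qed

lemma L2_integrable: assumes "L2 f" shows "integrable I01 f"
proof -
  interpret finite_measure I01 by (rule finite_measure_I01)
  have "integrable I01 (\<lambda>x. 1 + (f x)\<^sup>2)" using assms by (auto simp: L2_def)
  then show ?thesis
  proof (rule Bochner_Integration.integrable_bound)
    show "AE x in I01. norm (f x) \<le> norm (1 + (f x)\<^sup>2)"
    proof (rule AE_I2)
      fix x
      have "0 \<le> (\<bar>f x\<bar> - 1/2)\<^sup>2" by simp
      then have "\<bar>f x\<bar> \<le> 1 + (f x)\<^sup>2" by (simp add: power2_eq_square algebra_simps)
      then show "norm (f x) \<le> norm (1 + (f x)\<^sup>2)" by simp
    qed
  qed (use assms in \<open>auto simp: L2_def\<close>)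
qed

text \<open>The primitive of the difference vanishes identically, and its derivative within {0..1}
  is the difference; this includes the endpoints.\<close>

lemma AE_eq_continuous_imp_eq:
  assumes f: "continuous_on {0..1} f" and g: "continuous_on {0..1} g"
    and ae: "AE x in I01. f x = g x" and x: "x \<in> {0..1::real}"
  shows "f x = (g x :: real)"
proof -
  obtain N where N: "negligible N" "\<And>x. 0 < x \<Longrightarrow> x < 1 \<Longrightarrow> x \<notin> N \<Longrightarrow> f x = g x"
    using negligible_AE_I01[OF ae] by metis
  define d where "d x = f x - g x" for x
  have d: "continuous_on {0..1} d" unfolding d_def using f g by (intro continuous_intros)
  have "integral {0..y} d = 0" if "y \<in> {0..1}" for y
  proof -
    have "integral {0..y} d = integral {0..y} (\<lambda>_. 0)"
    proof (rule integral_spike)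
      show "negligible (N \<union> {0,1})" using N(1) by (simp add: negligible_insert)
    qed (use N(2) that in \<open>auto simp: d_def\<close>)
    then show ?thesis by simp
  qed
  moreover have "((\<lambda>y. integral {0..y} d) has_vector_derivative d x) (at x within {0..1})"
    by (rule integral_has_vector_derivative[OF d x])
  ultimately have "((\<lambda>y. 0) has_vector_derivative d x) (at x within {0..1})"
    using has_vector_derivative_transform[OF x, of "\<lambda>y. 0" "\<lambda>y. integral {0..y} d" "d x"] by simp
  moreover have "((\<lambda>y. 0) has_vector_derivative 0) (at x within {0..1})" by simp
  moreover have "at x within {0..1} \<noteq> bot" using x by (simp add: trivial_limit_within islimpt_Icc)
  ultimately have "d x = 0" using vector_derivative_unique_within by blast
  then show ?thesis by (simp add: d_def)
qed

text \<open>Determines the chosen representative on all of {0..1}, so that traces at the endpoints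
  are meaningful.\<close>

lemma cont_rep:
  assumes h: "continuous_on {0..1} h" and ae: "AE x in I01. f x = h x"
  shows "continuous_on {0..1} (cont_rep f)" "AE x in I01. f x = cont_rep f x"
    "\<And>x. x \<in> {0..1} \<Longrightarrow> cont_rep f x = h x"
proof -
  have "continuous_on {0..1} (cont_rep f) \<and> (AE x in I01. f x = cont_rep f x)"
    unfolding cont_rep_def by (rule someI[of _ h]) (use assms in auto)
  then show 1: "continuous_on {0..1} (cont_rep f)" "AE x in I01. f x = cont_rep f x" by auto
  have "AE x in I01. cont_rep f x = h x" using 1(2) ae by eventually_elim simp
  then show "cont_rep f x = h x" if "x \<in> {0..1}" for x
    by (rule AE_eq_continuous_imp_eq[OF 1(1) h _ that])
qed

section \<open>One-sided derivatives and primitives on the closed interval\<close>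

lemma D01_eqI:
  fixes f :: "real \<Rightarrow> real"
  assumes "(f has_real_derivative f') (at x within {0..1})" "x \<in> {0..1}" shows "D01 f x = f'"
proof -
  have "at x within {0..1} \<noteq> bot" using assms(2) by (simp add: trivial_limit_within islimpt_Icc)
  then show ?thesis
    using assms by (simp add: D01_def vector_derivative_within has_real_derivative_iff_has_vector_derivative)
qed

lemma D01_DERIV:
  assumes "f differentiable (at x within {0..1})" "x \<in> {0..1}"
  shows "(f has_real_derivative D01 f x) (at x within {0..1})"
  using assms D01_eqI by (metis real_differentiable_def)

lemma primitive_DERIV:
  fixes h :: "real \<Rightarrow> real"
  assumes h: "continuous_on {0..1} h" and f: "\<And>x. x \<in> {0..1} \<Longrightarrow> f x = C + integral {0..x} h" and x: "x \<in> {0..1}"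
  shows "(f has_real_derivative h x) (at x within {0..1})"
proof -
  have "((\<lambda>x. C + integral {0..x} h) has_real_derivative 0 + h x) (at x within {0..1})"
    by (intro DERIV_add DERIV_const integral_has_real_derivative h x)
  then show ?thesis
    using has_vector_derivative_transform[OF x, of f "\<lambda>x. C + integral {0..x} h" "h x"] f
    by (simp add: has_real_derivative_iff_has_vector_derivative)
qed

lemma continuous_primitive:
  fixes h :: "real \<Rightarrow> real"
  assumes h: "integrable I01 h" shows "continuous_on {0..1} (\<lambda>x. C + integral {0..x} h)"
proof -
  have "h integrable_on {0..1}"
    by (intro set_lebesgue_integral_eq_integral(1) integrable_I01_absolutely_integrable h) auto
  then show ?thesis
    by (intro continuous_on_add continuous_on_const indefinite_integral_continuous_1)
qed

lemma primitive_weak_deriv: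
  assumes g: "integrable I01 g" and f: "\<And>x. x \<in> {0<..<1} \<Longrightarrow> f x = C + integral {0..x} g"
  shows "is_weak_deriv f g"
proof (rule indefinite_integral_weak_deriv)
  have "f y - f x = integral {x..y} g" if "0 < x" "x \<le> y" "y < 1" for x y
  proof -
    have "integral {0..x} g + integral {x..y} g = integral {0..y} g"
      using that
      by (intro Henstock_Kurzweil_Integration.integral_combine set_lebesgue_integral_eq_integral(1)
          integrable_I01_absolutely_integrable g) auto
    then show ?thesis using f[of x] f[of y] that by simp
  qed
  then show "indefinite_integral f g"
    by (auto simp: indefinite_integral_def L1_loc_def intro!: integrable_I01_absolutely_integrable g)
qed

text \<open>Traces of \<open>aD2\<close> are defined through \<open>cont_rep\<close>,
  \<open>D01\<close> and \<open>wderiv\<close>; here these choices are identified with actual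
  primitives. \<open>h1\<close> is the slope of the representative and itself a primitive of the
  second weak derivative.\<close>

lemma H2_representation:
  assumes "H2 f"
  obtains h1 where "AE x in I01. f x = cont_rep f x" "L2 (wderiv (wderiv (cont_rep f)))"
    "continuous_on {0..1} h1" "\<And>x. x \<in> {0..1} \<Longrightarrow> cont_rep f x = cont_rep f 0 + integral {0..x} h1"
    "\<And>x. x \<in> {0..1} \<Longrightarrow> h1 x = h1 0 + integral {0..x} (wderiv (wderiv (cont_rep f)))"
    "\<And>x. x \<in> {0..1} \<Longrightarrow> D01 (cont_rep f) x = h1 x"
    "\<And>x. x \<in> {0..1} \<Longrightarrow> (cont_rep f has_real_derivative h1 x) (at x within {0..1})"
proof -
  obtain g b where fg: "is_weak_deriv f g" "L2 g" and gb: "is_weak_deriv g b" "L2 b"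
    using assms by (auto simp: H2_def H1_def)
  obtain C1 where C1: "AE x in I01. g x = C1 + integral {0..x} b"
    using weak_deriv_integrable[OF gb(1) L2_integrable[OF gb(2)]] by metis
  define h1 where "h1 x = C1 + integral {0..x} b" for x
  have ch1: "continuous_on {0..1} h1" unfolding h1_def by (intro continuous_primitive L2_integrable gb)
  have gh1: "AE x in I01. g x = h1 x" using C1 by (simp add: h1_def)
  have fh1: "is_weak_deriv f h1" by (rule is_weak_deriv_cong_AE[OF fg(1) _ gh1]) simp
  have ih1: "integrable I01 h1"
    using integrable_cong_AE_imp[OF L2_integrable[OF fg(2)] _ gh1] fh1
    by (auto simp: is_weak_deriv_def L1_loc_measurable)
  obtain C where C: "AE x in I01. f x = C + integral {0..x} h1"
    using weak_deriv_integrable[OF fh1 ih1] by metis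
  note cr = cont_rep[OF continuous_primitive[OF ih1] C]
  have C0: "C = cont_rep f 0" using cr(3)[of 0] by simp
  have D: "(cont_rep f has_real_derivative h1 x) (at x within {0..1})" if "x \<in> {0..1}" for x
    by (rule primitive_DERIV[OF ch1 cr(3) that])
  have "is_weak_deriv (cont_rep f) h1" by (rule is_weak_deriv_cong_AE[OF fh1 cr(2)]) simp
  note w1 = weak_deriv_wderiv[OF this]
  have "is_weak_deriv h1 b" by (rule is_weak_deriv_cong_AE[OF gb(1) gh1]) simp
  then have "is_weak_deriv (wderiv (cont_rep f)) b"
    by (rule is_weak_deriv_cong_AE[OF _ AE_symmetric[OF w1(2)]]) simp
  note w2 = weak_deriv_wderiv[OF this]
  define b' where "b' = wderiv (wderiv (cont_rep f))"
  have b'm: "b' \<in> borel_measurable I01" and bb: "AE x in I01. b' x = b x"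
    using w2 by (auto simp: is_weak_deriv_def b'_def intro: L1_loc_measurable)
  have "L2 b'"
    unfolding L2_def
  proof
    show "integrable I01 (\<lambda>x. (b' x)\<^sup>2)"
    proof (rule integrable_cong_AE_imp)
      show "integrable I01 (\<lambda>x. (b x)\<^sup>2)" using gb by (simp add: L2_def)
      show "AE x in I01. (b x)\<^sup>2 = (b' x)\<^sup>2" using bb by eventually_elim simp
    qed (use b'm in simp)
  qed (rule b'm)
  obtain N where N: "negligible N" "\<And>x. 0 < x \<Longrightarrow> x < 1 \<Longrightarrow> x \<notin> N \<Longrightarrow> b' x = b x"
    using negligible_AE_I01[OF bb] by metis
  have ib: "integral {0..x} b' = integral {0..x} b" if "x \<in> {0..1}" for x
  proof (rule integral_spike)
    show "negligible (N \<union> {0,1})" using N(1) by (simp add: negligible_insert)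
  qed (use N(2) that in auto)
  show ?thesis
  proof (rule that[of h1])
    show "cont_rep f x = cont_rep f 0 + integral {0..x} h1" if "x \<in> {0..1}" for x
      using cr(3)[OF that] C0 by simp
    show "h1 x = h1 0 + integral {0..x} (wderiv (wderiv (cont_rep f)))" if "x \<in> {0..1}" for x
      using ib[OF that] by (simp add: h1_def b'_def)
    show "D01 (cont_rep f) x = h1 x" if "x \<in> {0..1}" for x by (rule D01_eqI[OF D that]) (rule that)
  qed (use cr(2) ch1 D \<open>L2 b'\<close> in \<open>auto simp: b'_def\<close>)
qed

section \<open>Square integrable functions\<close>

lemma L2_measurable: "L2 f \<Longrightarrow> f \<in> borel_measurable I01" and L2_square: "L2 f \<Longrightarrow> integrable I01 (\<lambda>x. (f x)\<^sup>2)"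
  by (auto simp: L2_def)

lemma L2_mult_integrable: assumes "L2 f" "L2 g" shows "integrable I01 (\<lambda>x. f x * g x)"
proof (rule Bochner_Integration.integrable_bound)
  show "integrable I01 (\<lambda>x. (f x)\<^sup>2 + (g x)\<^sup>2)" using assms by (auto simp: L2_def)
  show "AE x in I01. norm (f x * g x) \<le> norm ((f x)\<^sup>2 + (g x)\<^sup>2)"
  proof (rule AE_I2)
    fix x
    have "0 \<le> (\<bar>f x\<bar> - \<bar>g x\<bar>)\<^sup>2" "0 \<le> (f x)\<^sup>2 + (g x)\<^sup>2" by auto
    then have "2 * (\<bar>f x\<bar> * \<bar>g x\<bar>) \<le> (f x)\<^sup>2 + (g x)\<^sup>2" by (simp add: power2_eq_square algebra_simps)
    moreover have "\<bar>f x * g x\<bar> \<le> 2 * (\<bar>f x\<bar> * \<bar>g x\<bar>)" by (simp add: abs_mult)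
    ultimately have "\<bar>f x * g x\<bar> \<le> (f x)\<^sup>2 + (g x)\<^sup>2" by linarith
    then show "norm (f x * g x) \<le> norm ((f x)\<^sup>2 + (g x)\<^sup>2)" by simp
  qed
qed (use assms in \<open>auto simp: L2_def\<close>)

lemma L2_lin: assumes "L2 f" "L2 g" shows "L2 (\<lambda>x. c * f x + d * g x)"
  unfolding L2_def
proof
  show "(\<lambda>x. c * f x + d * g x) \<in> borel_measurable I01" using assms by (auto simp: L2_def)
  have "integrable I01 (\<lambda>x. c\<^sup>2 * (f x)\<^sup>2 + 2 * c * d * (f x * g x) + d\<^sup>2 * (g x)\<^sup>2)"
    by (intro Bochner_Integration.integrable_add integrable_mult_right L2_square L2_mult_integrable assms)
  also have "(\<lambda>x. c\<^sup>2 * (f x)\<^sup>2 + 2 * c * d * (f x * g x) + d\<^sup>2 * (g x)\<^sup>2) = (\<lambda>x. (c * f x + d * g x)\<^sup>2)"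
    by (auto simp: power2_eq_square algebra_simps)
  finally show "integrable I01 (\<lambda>x. (c * f x + d * g x)\<^sup>2)" .
qed

lemma L2_cong_AE:
  assumes "L2 f" "AE x in I01. f x = g x" "g \<in> borel_measurable I01" shows "L2 g"
  unfolding L2_def
proof
  show "integrable I01 (\<lambda>x. (g x)\<^sup>2)"
  proof (rule integrable_cong_AE_imp[OF L2_square[OF assms(1)]])
    show "AE x in I01. (f x)\<^sup>2 = (g x)\<^sup>2" using assms(2) by eventually_elim simp
  qed (use assms in simp)
qed (rule assms)

lemma L2_bounded_mult:
  assumes f: "L2 f" and h: "h \<in> borel_measurable I01" and bd: "\<And>x. 0 < x \<Longrightarrow> x < 1 \<Longrightarrow> \<bar>h x\<bar> \<le> B"
  shows "L2 (\<lambda>x. h x * f x)" "(LINT x|I01. (h x * f x)\<^sup>2) \<le> B\<^sup>2 * (LINT x|I01. (f x)\<^sup>2)"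
proof -
  have p: "(h x * f x)\<^sup>2 \<le> B\<^sup>2 * (f x)\<^sup>2" if "x \<in> space I01" for x
  proof -
    have "\<bar>h x\<bar>\<^sup>2 \<le> B\<^sup>2" by (rule power_mono[OF bd]) (use that in auto)
    then show ?thesis by (simp add: power_mult_distrib mult_right_mono)
  qed
  have i: "integrable I01 (\<lambda>x. (h x * f x)\<^sup>2)"
  proof (rule Bochner_Integration.integrable_bound)
    show "integrable I01 (\<lambda>x. B\<^sup>2 * (f x)\<^sup>2)" using f by (auto simp: L2_def)
    show "AE x in I01. norm ((h x * f x)\<^sup>2) \<le> norm (B\<^sup>2 * (f x)\<^sup>2)" using p by (intro AE_I2) auto
  qed (use f h in \<open>auto simp: L2_def\<close>)
  then show "L2 (\<lambda>x. h x * f x)" using f h by (auto simp: L2_def)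
  have "(LINT x|I01. (h x * f x)\<^sup>2) \<le> (LINT x|I01. B\<^sup>2 * (f x)\<^sup>2)"
    by (rule integral_mono[OF i]) (use f p in \<open>auto simp: L2_def\<close>)
  then show "(LINT x|I01. (h x * f x)\<^sup>2) \<le> B\<^sup>2 * (LINT x|I01. (f x)\<^sup>2)" by simp
qed

text \<open>Young's inequality with a free weight t, which is chosen anew in each later
  estimate.\<close>

lemma L2_AM_GM:
  assumes f: "L2 f" and g: "L2 g" and t: "t > 0"
  shows "2 * \<bar>LINT x|I01. f x * g x\<bar> \<le> t * (LINT x|I01. (f x)\<^sup>2) + (LINT x|I01. (g x)\<^sup>2) / t"
proof -
  \<comment> \<open>The values s = 1 and s = -1 give the two signs of the absolute value.\<close>
  have *: "2 * (LINT x|I01. f x * (s * g x)) \<le> t * (LINT x|I01. (f x)\<^sup>2) + (LINT x|I01. (g x)\<^sup>2) / t" if "s\<^sup>2 = 1" for s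
  proof -
    have i: "integrable I01 (\<lambda>x. f x * (s * g x))"
      using L2_mult_integrable[OF f g] by (simp add: mult.left_commute)
    have "(LINT x|I01. 2 * (f x * (s * g x))) \<le> (LINT x|I01. t * (f x)\<^sup>2 + (g x)\<^sup>2 / t)"
    proof (rule integral_mono)
      show "2 * (f x * (s * g x)) \<le> t * (f x)\<^sup>2 + (g x)\<^sup>2 / t" for x
      proof -
        have "0 \<le> (t * f x - s * g x)\<^sup>2 / t" using t by simp
        also have "\<dots> = t * (f x)\<^sup>2 + s\<^sup>2 * (g x)\<^sup>2 / t - 2 * (f x * (s * g x))"
          using t by (simp add: field_simps power2_eq_square)
        finally show ?thesis using that by simp
      qed
    qed (use i f g in \<open>auto simp: L2_def\<close>)
    then show ?thesis using f g by (simp add: L2_def)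
  qed
  show ?thesis using *[of 1] *[of "-1"] by (simp add: abs_if)
qed

text \<open>Young's inequality at the optimal weight t = sqrt (C / A). If A or C vanishes, a large
  or small t forces B = 0.\<close>

lemma L2_Cauchy_Schwarz:
  assumes f: "L2 f" and g: "L2 g"
  shows "(LINT x|I01. f x * g x)\<^sup>2 \<le> (LINT x|I01. (f x)\<^sup>2) * (LINT x|I01. (g x)\<^sup>2)"
proof -
  define A B C where "A = (LINT x|I01. (f x)\<^sup>2)" "B = (LINT x|I01. f x * g x)" "C = (LINT x|I01. (g x)\<^sup>2)"
  have A: "A \<ge> 0" and C: "C \<ge> 0" by (simp_all add: A_B_C_def)
  have t: "2 * \<bar>B\<bar> \<le> t * A + C / t" if "t > 0" for t
    using L2_AM_GM[OF f g that] by (simp add: A_B_C_def)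
  show ?thesis
  proof (cases "A = 0 \<or> C = 0")
    case True
    have "B = 0"
    proof (rule ccontr)
      assume "B \<noteq> 0"
      then have b: "\<bar>B\<bar> > 0" by simp
      from True show False
      proof
        assume "A = 0"
        then show False using t[of "(C + 1) / \<bar>B\<bar>"] b C by (simp add: field_simps) (smt (verit) mult_nonneg_nonneg)
      next
        assume "C = 0"
        then show False using t[of "\<bar>B\<bar> / (A + 1)"] b A by (simp add: field_simps) (smt (verit) mult_nonneg_nonneg)
      qed
    qed
    then show ?thesis using A C by (simp add: A_B_C_def)
  next
    case False
    then have AC: "A > 0" "C > 0" using A C by auto
    have "2 * \<bar>B\<bar> \<le> sqrt (C / A) * A + C / sqrt (C / A)" using AC by (intro t) simp
    also have "sqrt (C / A) * A = sqrt C * sqrt A" using AC by (simp add: real_sqrt_divide field_simps)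
    also have "C / sqrt (C / A) = sqrt C * sqrt A" using AC by (simp add: real_sqrt_divide field_simps)
    finally have "\<bar>B\<bar> \<le> sqrt (C * A)" by (simp add: real_sqrt_mult mult.commute)
    then have "\<bar>B\<bar>\<^sup>2 \<le> (sqrt (C * A))\<^sup>2" by (rule power_mono) simp
    then show ?thesis using AC by (simp add: A_B_C_def mult.commute)
  qed
qed

lemma L2_continuous: assumes "continuous_on {0..1} f" shows "L2 f"
proof -
  have "f \<in> borel_measurable I01"
    by (rule L1_loc_measurable[OF continuous_on_L1_loc[OF continuous_on_subset[OF assms]]]) auto
  moreover have "integrable I01 (\<lambda>x. (f x)\<^sup>2)"
  proof -
    have "(\<lambda>x. (f x)\<^sup>2) absolutely_integrable_on {0..1}"
      by (intro absolutely_integrable_continuous_real continuous_intros assms)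
    from I01_interval_integral(1)[OF this]
    have "integrable I01 (\<lambda>s. indicator {0..1} s * (f s)\<^sup>2)" by simp
    then show ?thesis by (rule Bochner_Integration.integrable_cong[THEN iffD1, rotated 2]) (auto simp: indicator_def)
  qed
  ultimately show ?thesis by (simp add: L2_def)
qed

section \<open>Locally absolutely continuous functions on the half-open unit interval\<close>

text \<open>There is a density on each [1/(n+2), 1], but two of them agree only almost everywhere.
  One function is patched from them, and the formula is carried towards 0 by induction on n.\<close>

lemma locally_abs_cont_density:
  assumes ac: "\<And>c. 0 < c \<Longrightarrow> c < 1 \<Longrightarrow> abs_cont_on c 1 F"
  obtains g where "\<And>c. 0 < c \<Longrightarrow> c \<le> 1 \<Longrightarrow> g absolutely_integrable_on {c..1}"
    "\<And>x. 0 < x \<Longrightarrow> x \<le> 1 \<Longrightarrow> F 1 - F x = integral {x..1} g"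
proof -
  have "\<exists>g. g absolutely_integrable_on {1 / (real n + 2)..1} \<and>
      (\<forall>x\<in>{1 / (real n + 2)..1}. F x - F (1 / (real n + 2)) = integral {1 / (real n + 2)..x} g)" for n :: nat
  proof -
    have "1 / (real n + 2) \<le> 1" by simp
    from abs_cont_density[OF this ac[of "1 / (real n + 2)"]]
    show ?thesis by (smt (verit) divide_less_eq_1 of_nat_0_le_iff zero_less_divide_iff)
  qed
  then obtain G where G: "\<And>n. G n absolutely_integrable_on {1 / (real n + 2)..1}"
    "\<And>n x. x \<in> {1 / (real n + 2)..1} \<Longrightarrow> F x - F (1 / (real n + 2)) = integral {1 / (real n + 2)..x} (G n)"
    by metis
  text \<open>For \<open>1/(n+2) \<le> s < 1/(n+1)\<close> the index chosen is \<open>n\<close>.\<close>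
  define g where "g s = G (nat \<lceil>1 / s\<rceil> - 2) s" for s
  have gG: "g s = G n s" if "1 / (real n + 2) \<le> s" "s < 1 / (real n + 1)" for s n
  proof -
    have s: "s > 0" using that(1) by (smt (verit) divide_pos_pos of_nat_0_le_iff)
    then have "1 / s \<le> real n + 2" "real n + 1 < 1 / s" using that by (simp_all add: field_simps)
    then have "\<lceil>1 / s\<rceil> = int n + 2" by (intro ceiling_unique) auto
    then show ?thesis by (simp add: g_def nat_add_distrib)
  qed
  have main: "g absolutely_integrable_on {1 / (real n + 1)..1} \<and>
      (\<forall>x\<in>{1 / (real n + 1)..1}. F 1 - F x = integral {x..1} g)" for n
  proof (induction n)
    case 0
    show ?case by (auto intro: absolutely_integrable_negligible)
  next
    case (Suc n)
    let ?c = "1 / (real n + 2)" let ?d = "1 / (real n + 1)"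
    have cd: "0 < ?c" "?c \<le> ?d" "?d \<le> 1" by (auto simp: field_simps)
    have Gcd: "G n absolutely_integrable_on {?c..?d}"
      by (rule set_integrable_subset[OF G(1)]) simp_all
    have ai: "g absolutely_integrable_on {?c..?d}"
      by (rule absolutely_integrable_spike[OF Gcd, of "{?d}"]) (use gG[of n] in auto)
    have "{c..d} \<union> {d..1} = {c..1}" if "c \<le> d" "d \<le> 1" for c d :: real using that by auto
    then have eq: "{?c..?d} \<union> {?d..1} = {?c..1}" using cd(2,3) by blast
    have aig: "g absolutely_integrable_on {?c..1}"
      using absolutely_integrable_Un[OF ai conjunct1[OF Suc]] eq by simp
    have "F 1 - F x = integral {x..1} g" if x: "x \<in> {?c..1}" for x
    proof (cases "x \<ge> ?d")
      case True then show ?thesis using Suc x by simp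
    next
      case False
      have "integral {x..?d} g + integral {?d..1} g = integral {x..1} g"
        by (rule Henstock_Kurzweil_Integration.integral_combine)
          (use False x cd aig in \<open>auto intro: integrable_on_subinterval set_lebesgue_integral_eq_integral(1)\<close>)
      moreover have "integral {x..?d} g = integral {x..?d} (G n)"
        by (rule integral_spike[of "{?d}"]) (use gG[of n] x in auto)
      moreover have "integral {?c..x} (G n) + integral {x..?d} (G n) = integral {?c..?d} (G n)"
        by (rule Henstock_Kurzweil_Integration.integral_combine)
          (use False x Gcd in \<open>auto intro: set_lebesgue_integral_eq_integral(1)\<close>)
      moreover have "F 1 - F ?d = integral {?d..1} g" using Suc cd by simp
      moreover have "F x - F ?c = integral {?c..x} (G n)" "F ?d - F ?c = integral {?c..?d} (G n)"
        using G(2) x cd by auto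
      ultimately show ?thesis by linarith
    qed
    then show ?case using aig by (simp add: add.commute)
  qed
  have ex: "\<exists>n. 1 / (real n + 1) \<le> x" if "0 < x" for x :: real
  proof -
    obtain n where "1 / x < real n" using reals_Archimedean2 by blast
    then show ?thesis using that by (intro exI[of _ n]) (simp add: field_simps)
  qed
  show ?thesis
  proof (rule that)
    fix c :: real assume c: "0 < c" "c \<le> 1"
    then obtain n where n: "1 / (real n + 1) \<le> c" using ex by blast
    show "g absolutely_integrable_on {c..1}"
      by (rule set_integrable_subset[OF conjunct1[OF main[of n]]]) (use n in auto)
    show "F 1 - F c = integral {c..1} g" using main[of n] n c by auto
  qed
qed

text \<open>\<open>wderiv F\<close> differs from the density on a null set only and so inherits
  integrability up to 1 and the formula; nothing is claimed about integrability up to 0.\<close>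

lemma locally_abs_cont_wderiv:
  assumes ac: "\<And>c. 0 < c \<Longrightarrow> c < 1 \<Longrightarrow> abs_cont_on c 1 F"
  shows "is_weak_deriv F (wderiv F)"
    and "\<And>x. 0 < x \<Longrightarrow> x \<le> 1 \<Longrightarrow> wderiv F absolutely_integrable_on {x..1}"
    and "\<And>x. 0 < x \<Longrightarrow> x \<le> 1 \<Longrightarrow> F x = F 1 - (LINT s|I01. indicator {x..1} s * wderiv F s)"
proof -
  obtain g where g: "\<And>c. 0 < c \<Longrightarrow> c \<le> 1 \<Longrightarrow> g absolutely_integrable_on {c..1}"
    "\<And>x. 0 < x \<Longrightarrow> x \<le> 1 \<Longrightarrow> F 1 - F x = integral {x..1} g"
    using locally_abs_cont_density[OF ac] by blast
  have "indefinite_integral F g"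
    unfolding indefinite_integral_def
  proof (intro conjI allI impI)
    show "L1_loc g" unfolding L1_loc_def
    proof (intro allI impI)
      fix c d :: real assume "0 < c \<and> d < 1"
      then show "g absolutely_integrable_on {c..d}"
        using set_integrable_subset[OF g(1)[of "min c 1"], of "{c..d}"] by auto
    qed
    fix x y :: real assume xy: "0 < x" "x \<le> y" "y < 1"
    have "integral {x..y} g + integral {y..1} g = integral {x..1} g"
      by (rule Henstock_Kurzweil_Integration.integral_combine)
        (use xy g(1)[of x] in \<open>auto intro: set_lebesgue_integral_eq_integral(1)\<close>)
    then show "F y - F x = integral {x..y} g" using g(2)[of x] g(2)[of y] xy by simp
  qed
  note w = weak_deriv_wderiv[OF indefinite_integral_weak_deriv[OF this]]
  show "is_weak_deriv F (wderiv F)" by (rule w)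
  obtain N where N: "negligible N" "\<And>x. 0 < x \<Longrightarrow> x < 1 \<Longrightarrow> x \<notin> N \<Longrightarrow> wderiv F x = g x"
    using negligible_AE_I01[OF w(2)] by metis
  have N': "negligible (insert 1 N)" using N(1) by (simp add: negligible_insert)
  show ai: "wderiv F absolutely_integrable_on {x..1}" if "0 < x" "x \<le> 1" for x
    by (rule absolutely_integrable_spike[OF g(1)[OF that] N']) (use N(2) that in auto)
  show "F x = F 1 - (LINT s|I01. indicator {x..1} s * wderiv F s)" if "0 < x" "x \<le> 1" for x
  proof -
    have "integral {x..1} (wderiv F) = integral {x..1} g"
      by (rule integral_spike[OF N']) (use N(2) that in auto)
    then show ?thesis using g(2)[OF that] I01_interval_integral(2)[OF ai[OF that]] that by simp
  qed
qed

section \<open>The degenerate weight\<close>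

lemma I01_integrable_cong:
  fixes f g :: "real \<Rightarrow> real"
  assumes "integrable I01 f" "\<And>s. s \<in> space I01 \<Longrightarrow> f s = g s" shows "integrable I01 g"
  using assms(1) Bochner_Integration.integrable_cong[of I01 I01 f g, OF refl assms(2)] by metis

locale degenerate =
  fixes a :: "real \<Rightarrow> real" and K :: real
  assumes deg: "weakly_degenerate a \<or> strongly_degenerate a" and K: "K = degen_const a"
begin

lemma K_bounds: "0 < K" "K < 2"
  using deg K by (auto simp: weakly_degenerate_def strongly_degenerate_def)

lemma WD_K: "weakly_degenerate a \<Longrightarrow> K < 1" and SD_K: "strongly_degenerate a \<Longrightarrow> 1 \<le> K"
  using K by (auto simp: weakly_degenerate_def strongly_degenerate_def)

lemma a_pos: "0 < x \<Longrightarrow> x \<le> 1 \<Longrightarrow> 0 < a x"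
  using deg by (auto simp: weakly_degenerate_def strongly_degenerate_def)

lemma a1_pos: "0 < a 1" by (rule a_pos) auto

lemma a_C1: "C1_on {0<..1} a"
  using deg unfolding weakly_degenerate_def strongly_degenerate_def C1_on_def
  by (auto intro: continuous_on_subset)

lemma a_DERIV: "0 < x \<Longrightarrow> x \<le> 1 \<Longrightarrow> (a has_real_derivative D01 a x) (at x within {0..1})"
  using a_C1 by (intro D01_DERIV) (auto simp: C1_on_def)

lemma a_DERIV_interior: "0 < x \<Longrightarrow> x < 1 \<Longrightarrow> (a has_real_derivative D01 a x) (at x)"
  using a_DERIV[of x] at_within_interior[of x "{0..1}"] by simp

lemma a_D01_continuous: "continuous_on {0<..1} (D01 a)"
  using a_C1 by (simp add: C1_on_def)

lemma a_continuous: "continuous_on {0<..1} a"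
  by (rule continuous_on_subset[of "{0..1}"])
    (use deg in \<open>auto simp: weakly_degenerate_def strongly_degenerate_def C1_on_def
      intro: differentiable_imp_continuous_within simp: continuous_on_eq_continuous_within\<close>)

lemma a_deriv_bound:
  assumes "0 < x" "x \<le> 1" shows "x * \<bar>D01 a x\<bar> \<le> K * a x"
proof -
  have "degen_ratio a x \<le> K"
    unfolding K degen_const_def using assms deg
    by (intro cSup_upper) (auto simp: weakly_degenerate_def strongly_degenerate_def)
  then show ?thesis using a_pos[OF assms] by (simp add: degen_ratio_def field_simps)
qed

text \<open>x |a'| \<le> K a makes a(x) x^(-K) nonincreasing.\<close>

lemma a_lower: assumes x: "0 < x" "x \<le> 1" shows "a 1 * x powr K \<le> a x"
proof -
  define f where "f x = a x * x powr (- K)" for x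
  have "f 1 \<le> f x"
  proof (rule DERIV_nonpos_imp_decreasing_open[OF x(2)])
    fix t :: real assume t: "x < t" "t < 1"
    have "(f has_real_derivative (D01 a t * t powr (- K) + (- K * t powr (- K - 1)) * a t)) (at t)"
      unfolding f_def
      by (rule DERIV_mult[OF a_DERIV_interior has_real_derivative_powr]) (use t x in auto)
    moreover have "D01 a t * t powr (- K) + (- K * t powr (- K - 1)) * a t
        = t powr (- K - 1) * (t * D01 a t - K * a t)"
      using t x by (simp add: powr_diff field_simps)
    moreover have "t * D01 a t \<le> t * \<bar>D01 a t\<bar>" using t x by (intro mult_left_mono) auto
    then have "t * D01 a t - K * a t \<le> 0" using a_deriv_bound[of t] t x by linarith
    then have "t powr (- K - 1) * (t * D01 a t - K * a t) \<le> 0" by (intro mult_nonneg_nonpos) auto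
    ultimately show "\<exists>y. (f has_real_derivative y) (at t) \<and> y \<le> 0" by metis
  next
    show "continuous_on {x..1} f"
      unfolding f_def using x
      by (auto intro!: continuous_intros continuous_on_subset[OF a_continuous])
  qed
  then show ?thesis using x by (simp add: f_def powr_minus field_simps)
qed

lemma inverse_a_bound: assumes "0 < x" "x \<le> 1" shows "1 / a x \<le> x powr (- K) / a 1"
proof -
  have "1 / a x \<le> 1 / (a 1 * x powr K)"
    using a_lower[OF assms] a1_pos assms by (intro divide_left_mono) (auto intro!: mult_pos_pos a_pos)
  then show ?thesis using assms by (simp add: powr_minus field_simps)
qed

lemma square_over_a_bound: assumes "0 < x" "x \<le> 1" shows "x\<^sup>2 / a x \<le> x powr (2 - K) / a 1"
proof -
  have "x\<^sup>2 * (1 / a x) \<le> x\<^sup>2 * (x powr (- K) / a 1)"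
    by (intro mult_left_mono inverse_a_bound assms) auto
  then show ?thesis using assms by (simp add: powr_diff powr_minus powr_numeral field_simps)
qed

lemma square_over_a_bound1: assumes "0 < x" "x \<le> 1" shows "x\<^sup>2 / a x \<le> 1 / a 1"
proof -
  have "x powr (2 - K) \<le> 1 powr (2 - K)" using K_bounds assms by (intro powr_mono2) auto
  then have "x powr (2 - K) / a 1 \<le> 1 / a 1" using a1_pos by (intro divide_right_mono) auto
  then show ?thesis using square_over_a_bound[OF assms] by linarith
qed

lemma a_measurable: "a \<in> borel_measurable I01"
  by (rule L1_loc_measurable[OF continuous_on_L1_loc[OF continuous_on_subset[OF a_continuous]]]) auto

lemma powr_I01:
  assumes "r > -1"
  shows "integrable I01 (\<lambda>s. s powr r)" "(LINT s|I01. s powr r) = 1 / (r + 1)"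
proof -
  have hi: "((\<lambda>x. x powr r) has_integral (1 / (r + 1))) {0..1}"
    using has_integral_powr_from_0[OF assms, of 1] by simp
  then have ai: "(\<lambda>x. x powr r) absolutely_integrable_on {0..1}"
    by (intro nonnegative_absolutely_integrable_1) auto
  have c: "(\<lambda>s. indicator {0..1} s * s powr r) s = s powr r" if "s \<in> space I01" for s
    using that by auto
  show "integrable I01 (\<lambda>s. s powr r)"
    using I01_integrable_cong[OF I01_interval_integral(1)[OF ai] c] by simp
  show "(LINT s|I01. s powr r) = 1 / (r + 1)"
    using I01_interval_integral(2)[OF ai] hi
    by (subst Bochner_Integration.integral_cong[OF refl c, symmetric]) (auto simp: integral_unique)
qed

text \<open>The square is at most s^(2-K) / a(1), whose integral is 1 / ((3-K) a(1)); it is rounded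
  up to the expression with 2 - K that occurs in the constants of the theorem.\<close>

lemma kernel_L2:
  assumes k: "k \<in> borel_measurable I01" and bd: "\<And>s. 0 < s \<Longrightarrow> s < 1 \<Longrightarrow> \<bar>k s\<bar> \<le> s"
  shows "L2 (\<lambda>s. k s / sqrt (a s))" "(LINT s|I01. (k s / sqrt (a s))\<^sup>2) \<le> 1 / (a 1 * (2 - K))"
proof -
  have p: "(k s / sqrt (a s))\<^sup>2 \<le> s powr (2 - K) / a 1" if "s \<in> space I01" for s
  proof -
    have s: "0 < s" "s < 1" using that by auto
    have "\<bar>k s\<bar>\<^sup>2 \<le> s\<^sup>2" by (rule power_mono[OF bd]) (use s in auto)
    then have "(k s / sqrt (a s))\<^sup>2 \<le> s\<^sup>2 / a s"
      using a_pos[of s] s by (simp add: power_divide divide_right_mono)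
    then show ?thesis using square_over_a_bound[of s] s by simp
  qed
  have i: "integrable I01 (\<lambda>s. s powr (2 - K) / a 1)"
    using powr_I01(1)[of "2 - K"] K_bounds by simp
  have m: "(\<lambda>s. k s / sqrt (a s)) \<in> borel_measurable I01" using k a_measurable by measurable
  have i2: "integrable I01 (\<lambda>s. (k s / sqrt (a s))\<^sup>2)"
  proof (rule Bochner_Integration.integrable_bound[OF i])
    show "AE s in I01. norm ((k s / sqrt (a s))\<^sup>2) \<le> norm (s powr (2 - K) / a 1)"
      using p by (intro AE_I2) (smt (verit) real_norm_def zero_le_power2)
  qed (use m in simp)
  then show "L2 (\<lambda>s. k s / sqrt (a s))" using m by (simp add: L2_def)
  have "(LINT s|I01. (k s / sqrt (a s))\<^sup>2) \<le> (LINT s|I01. s powr (2 - K) / a 1)"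
    by (rule integral_mono[OF i2 i p])
  also have "\<dots> = 1 / ((3 - K) * a 1)" using powr_I01(2)[of "2 - K"] K_bounds by simp
  also have "\<dots> \<le> 1 / (a 1 * (2 - K))"
    using K_bounds a1_pos by (intro divide_left_mono mult_pos_pos) (auto simp: mult.commute intro!: mult_left_mono)
  finally show "(LINT s|I01. (k s / sqrt (a s))\<^sup>2) \<le> 1 / (a 1 * (2 - K))" .
qed

text \<open>1/a is bounded by x^(-K) / a(1), which is integrable because K < 1. Consequently second
  derivatives are integrable up to 0 in this case.\<close>

lemma WD_inverse_L2:
  assumes "weakly_degenerate a" shows "L2 (\<lambda>s. 1 / sqrt (a s))"
  unfolding L2_def
proof
  show m: "(\<lambda>s. 1 / sqrt (a s)) \<in> borel_measurable I01" using a_measurable by measurable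
  show "integrable I01 (\<lambda>s. (1 / sqrt (a s))\<^sup>2)"
  proof (rule Bochner_Integration.integrable_bound)
    show "integrable I01 (\<lambda>s. s powr (- K) / a 1)" using powr_I01(1)[of "- K"] WD_K[OF assms] by simp
    show "AE s in I01. norm ((1 / sqrt (a s))\<^sup>2) \<le> norm (s powr (- K) / a 1)"
    proof (rule AE_I2)
      fix s assume "s \<in> space I01"
      then have s: "0 < s" "s < 1" by auto
      have "(1 / sqrt (a s))\<^sup>2 = 1 / a s" using a_pos[of s] s by (simp add: power_divide)
      also have "\<dots> \<le> s powr (- K) / a 1" by (rule inverse_a_bound) (use s in auto)
      finally show "norm ((1 / sqrt (a s))\<^sup>2) \<le> norm (s powr (- K) / a 1)" using a1_pos by simp
    qed
  qed (use m in simp)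
qed

text \<open>The class of second derivatives of finite energy. In the strongly degenerate case its
  elements need not be integrable near 0.\<close>

definition wsq :: "(real \<Rightarrow> real) \<Rightarrow> bool" where
  "wsq w \<longleftrightarrow> w \<in> borel_measurable I01 \<and> L2 (\<lambda>s. sqrt (a s) * w s)"

lemma wsqD: "wsq w \<Longrightarrow> w \<in> borel_measurable I01" "wsq w \<Longrightarrow> L2 (\<lambda>s. sqrt (a s) * w s)"
  by (auto simp: wsq_def)

lemma sqrt_a_mult: "s \<in> space I01 \<Longrightarrow> sqrt (a s) * sqrt (a s) = a s" "s \<in> space I01 \<Longrightarrow> sqrt (a s) > 0"
  using a_pos[of s] by auto

lemma wsq_mult:
  assumes w: "wsq w" and w': "wsq w'"
  shows "integrable I01 (\<lambda>s. a s * (w s * w' s))"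
    "(LINT s|I01. a s * (w s * w' s)) = (LINT s|I01. (sqrt (a s) * w s) * (sqrt (a s) * w' s))"
proof -
  have c: "(sqrt (a s) * w s) * (sqrt (a s) * w' s) = a s * (w s * w' s)" if "s \<in> space I01" for s
    using sqrt_a_mult(1)[OF that] by (metis mult.assoc mult.left_commute)
  show "integrable I01 (\<lambda>s. a s * (w s * w' s))"
    by (rule I01_integrable_cong[OF L2_mult_integrable[OF wsqD(2)[OF w] wsqD(2)[OF w']] c])
  show "(LINT s|I01. a s * (w s * w' s)) = (LINT s|I01. (sqrt (a s) * w s) * (sqrt (a s) * w' s))"
    by (rule Bochner_Integration.integral_cong[OF refl c, symmetric])
qed

lemma wsq_square:
  assumes w: "wsq w"
  shows "integrable I01 (\<lambda>s. a s * (w s)\<^sup>2)" "(LINT s|I01. a s * (w s)\<^sup>2) = (LINT s|I01. (sqrt (a s) * w s)\<^sup>2)"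
    "(LINT s|I01. a s * (w s)\<^sup>2) \<ge> 0"
  using wsq_mult[OF w w] by (simp_all add: power2_eq_square)

lemma wsq_lin:
  assumes "wsq w" "wsq w'" shows "wsq (\<lambda>s. c * w s + d * w' s)"
proof -
  have "L2 (\<lambda>s. c * (sqrt (a s) * w s) + d * (sqrt (a s) * w' s))"
    by (intro L2_lin wsqD assms)
  moreover have "(\<lambda>s. c * w s + d * w' s) \<in> borel_measurable I01" using assms[THEN wsqD(1)] by measurable
  ultimately show ?thesis by (simp add: wsq_def algebra_simps)
qed

text \<open>Cauchy-Schwarz for the splitting k w = (k / sqrt a) (sqrt a w).\<close>

lemma kernel_integrable:
  assumes w: "wsq w" and k: "k \<in> borel_measurable I01" and bd: "\<And>s. 0 < s \<Longrightarrow> s < 1 \<Longrightarrow> \<bar>k s\<bar> \<le> s"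
  shows "integrable I01 (\<lambda>s. k s * w s)"
    "(LINT s|I01. k s * w s)\<^sup>2 \<le> 1 / (a 1 * (2 - K)) * (LINT s|I01. a s * (w s)\<^sup>2)"
proof -
  have c: "(k s / sqrt (a s)) * (sqrt (a s) * w s) = k s * w s" if "s \<in> space I01" for s
    using sqrt_a_mult(2)[OF that] by simp
  note kl = kernel_L2[OF k bd]
  show "integrable I01 (\<lambda>s. k s * w s)"
    by (rule I01_integrable_cong[OF L2_mult_integrable[OF kl(1) wsqD(2)[OF w]] c])
  have "(LINT s|I01. k s * w s)\<^sup>2 = (LINT s|I01. (k s / sqrt (a s)) * (sqrt (a s) * w s))\<^sup>2"
    by (subst Bochner_Integration.integral_cong[OF refl c]) auto
  also have "\<dots> \<le> (LINT s|I01. (k s / sqrt (a s))\<^sup>2) * (LINT s|I01. (sqrt (a s) * w s)\<^sup>2)"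
    by (rule L2_Cauchy_Schwarz[OF kl(1) wsqD(2)[OF w]])
  also have "\<dots> \<le> 1 / (a 1 * (2 - K)) * (LINT s|I01. (sqrt (a s) * w s)\<^sup>2)"
    by (intro mult_right_mono kl(2)) auto
  finally show "(LINT s|I01. k s * w s)\<^sup>2 \<le> 1 / (a 1 * (2 - K)) * (LINT s|I01. a s * (w s)\<^sup>2)"
    using wsq_square(2)[OF w] by simp
qed

lemma WD_integrable: assumes "weakly_degenerate a" and w: "wsq w" shows "integrable I01 w"
proof -
  have c: "(1 / sqrt (a s)) * (sqrt (a s) * w s) = w s" if "s \<in> space I01" for s
    using sqrt_a_mult(2)[OF that] by simp
  show ?thesis
    by (rule I01_integrable_cong[OF L2_mult_integrable[OF WD_inverse_L2[OF assms(1)] wsqD(2)[OF w]] c])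
qed

lemma wsq_integrable_id: "wsq w \<Longrightarrow> integrable I01 (\<lambda>s. s * w s)"
  by (rule kernel_integrable) (auto simp: measurable_id_I01)

lemma kernel_value_bound:
  assumes w: "wsq w" and k: "k \<in> borel_measurable I01" and bd: "\<And>s. 0 < s \<Longrightarrow> s < 1 \<Longrightarrow> \<bar>k s\<bar> \<le> s" and x: "\<bar>x\<bar> \<le> 1"
  shows "(x * q - (LINT s|I01. k s * w s))\<^sup>2 \<le> 2 * q\<^sup>2 + 2 / (a 1 * (2 - K)) * (LINT s|I01. a s * (w s)\<^sup>2)"
proof -
  define J where "J = (LINT s|I01. k s * w s)"
  have "0 \<le> (x * q + J)\<^sup>2" by simp
  then have "(x * q - J)\<^sup>2 \<le> 2 * (x * q)\<^sup>2 + 2 * J\<^sup>2" by (simp add: power2_eq_square algebra_simps)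
  moreover have "(x * q)\<^sup>2 \<le> q\<^sup>2"
  proof -
    have "x\<^sup>2 \<le> 1" using x by (simp add: abs_square_le_1)
    then show ?thesis by (simp add: power_mult_distrib mult_left_le_one_le)
  qed
  moreover have "J\<^sup>2 \<le> 1 / (a 1 * (2 - K)) * (LINT s|I01. a s * (w s)\<^sup>2)"
    unfolding J_def by (rule kernel_integrable(2)[OF w k bd])
  ultimately show ?thesis by (simp add: J_def)
qed

section \<open>Representation of the energy space\<close>

text \<open>\<open>q\<close> is the slope at \<open>1\<close> and \<open>w\<close> the second derivative; in the weakly degenerate
  case the condition \<open>q = \<integral> w\<close> says that the slope at \<open>0\<close> vanishes.\<close>

definition repr :: "(real \<Rightarrow> real) \<Rightarrow> real \<Rightarrow> (real \<Rightarrow> real) \<Rightarrow> bool" where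
  "repr f q w \<longleftrightarrow> wsq w \<and> (\<forall>x\<in>{0..1}. f x = x * q - (LINT s|I01. min x s * w s)) \<and>
     (weakly_degenerate a \<longrightarrow> q = (LINT s|I01. w s))"

lemma min_measurable: "(\<lambda>s. min x s) \<in> borel_measurable I01" and
  tail_measurable: "(\<lambda>s. x * indicat_real {x..} s) \<in> borel_measurable I01"
  by (intro borel_measurable_I01; measurable)+

lemma repr_eq: "repr f q w \<Longrightarrow> 0 \<le> x \<Longrightarrow> x \<le> 1 \<Longrightarrow> f x = x * q - (LINT s|I01. min x s * w s)"
  and repr_wsq: "repr f q w \<Longrightarrow> wsq w"
  and repr_WD: "repr f q w \<Longrightarrow> weakly_degenerate a \<Longrightarrow> q = (LINT s|I01. w s)"
  by (auto simp: repr_def)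

lemma repr_1: assumes "repr f q w" shows "(LINT s|I01. s * w s) = q - f 1"
proof -
  have "f 1 = q - (LINT s|I01. min 1 s * w s)" using repr_eq[OF assms, of 1] by simp
  also have "(LINT s|I01. min 1 s * w s) = (LINT s|I01. s * w s)"
    by (rule Bochner_Integration.integral_cong) auto
  finally show ?thesis by simp
qed

lemma repr_bound:
  assumes f: "repr f q w" and x: "0 \<le> x" "x \<le> 1"
  shows "(f x)\<^sup>2 \<le> 2 * q\<^sup>2 + 2 / (a 1 * (2 - K)) * (LINT s|I01. a s * (w s)\<^sup>2)"
  unfolding repr_eq[OF f x]
  by (rule kernel_value_bound[OF repr_wsq[OF f] min_measurable]) (use x in auto)

lemma K2a0_continuous: "u \<in> K2a0 a \<Longrightarrow> continuous_on {0..1} u"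
  by (simp add: K2a0_def)

lemma K2a0_0: "u \<in> K2a0 a \<Longrightarrow> u 0 = 0"
  using deg by (auto simp: K2a0_def)

lemma K2a0_DERIV:
  assumes "u \<in> K2a0 a" "0 < x" "x \<le> 1"
  shows "(u has_real_derivative D01 u x) (at x within {0..1})"
  using assms deg by (intro D01_DERIV) (auto simp: K2a0_def)

lemma K2a0_abs_cont:
  assumes "u \<in> K2a0 a" "0 < c" "c < 1" shows "abs_cont_on c 1 (D01 u)"
  using assms deg by (auto simp: K2a0_def intro: abs_cont_on_subinterval)

lemma K2a0_D2:
  assumes u: "u \<in> K2a0 a"
  shows "is_weak_deriv (D01 u) (D2 u)" "wsq (D2 u)"
    "0 < x \<Longrightarrow> x \<le> 1 \<Longrightarrow> integrable I01 (\<lambda>s. indicator {x..1} s * D2 u s)"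
    "0 < x \<Longrightarrow> x \<le> 1 \<Longrightarrow> D01 u x = D01 u 1 - (LINT s|I01. indicator {x..1} s * D2 u s)"
proof -
  have ac: "\<And>c. 0 < c \<Longrightarrow> c < 1 \<Longrightarrow> abs_cont_on c 1 (D01 u)" by (rule K2a0_abs_cont[OF u])
  show wd: "is_weak_deriv (D01 u) (D2 u)" unfolding D2_def by (rule locally_abs_cont_wderiv(1)) (rule ac)
  show "wsq (D2 u)"
    using u wd by (auto simp: wsq_def K2a0_def is_weak_deriv_def intro: L1_loc_measurable)
  show "integrable I01 (\<lambda>s. indicator {x..1} s * D2 u s)" if x: "0 < x" "x \<le> 1"
    unfolding D2_def
  proof (rule I01_interval_integral(1))
    show "wderiv (D01 u) absolutely_integrable_on {x..1}"
      by (rule locally_abs_cont_wderiv(2)) (use ac x in auto)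
  qed (use x in auto)
  show "D01 u x = D01 u 1 - (LINT s|I01. indicator {x..1} s * D2 u s)" if x: "0 < x" "x \<le> 1"
    unfolding D2_def by (rule locally_abs_cont_wderiv(3)) (use ac x in auto)
qed

lemma lborel_I01_Icc: assumes "0 \<le> c" "d \<le> 1" shows "(LINT t|I01. indicat_real {c..d} t) = max 0 (d - c)"
proof -
  have "(LINT t|I01. indicat_real {c..d} t * 1) = integral {c..d} (\<lambda>_. 1)"
    by (rule I01_interval_integral(2)) (use assms in \<open>auto intro: absolutely_integrable_continuous_real\<close>)
  then show ?thesis by (simp add: max_def)
qed

text \<open>Integrating u'(t) = u'(1) - \<integral> u'' over [t, 1] once more and exchanging the
  order of integration gives the kernel min(x, s) - c. The lower limit c > 0 keeps u''
  integrable.\<close>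

lemma K2a0_difference:
  assumes u: "u \<in> K2a0 a" and c: "0 < c" "c \<le> x" "x \<le> 1"
  shows "u x - u c = (x - c) * D01 u 1 - (LINT s|I01. (indicator {c..1} s * (min x s - c)) * D2 u s)"
proof -
  let ?w = "\<lambda>s. indicator {c..1} s * D2 u s"
  have D: "(u has_vector_derivative D01 u t) (at t within {c..x})" if "t \<in> {c..x}" for t
    using has_field_derivative_subset[OF K2a0_DERIV[OF u, of t], of "{c..x}"] that c
    by (auto simp: has_real_derivative_iff_has_vector_derivative)
  have hi: "(D01 u has_integral (u x - u c)) {c..x}"
    by (rule fundamental_theorem_of_calculus[OF c(2) D])
  have cont: "continuous_on {c..x} (D01 u)"
  proof (cases "c < 1")
    case True
    then show ?thesis using c
      by (intro continuous_on_subset[OF abs_cont_on_imp_continuous_on[OF K2a0_abs_cont[OF u, of c]]]) auto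
  next
    case False
    then have "{c..x} = {1}" using c by auto
    then show ?thesis by simp
  qed
  have iw: "integrable I01 ?w" using K2a0_D2(3)[OF u, of c] c by auto
  have i1: "integrable I01 (indicat_real {c..x})"
    using I01_interval_integral(1)[where g = "\<lambda>_. 1" and x = c and y = x] c
    by (auto intro: absolutely_integrable_continuous_real)
  define k where "k t s = indicat_real {t..} s" for t s :: real
  have k: "(\<lambda>(t, s). k t s) \<in> borel_measurable (borel \<Otimes>\<^sub>M borel)"
  proof -
    have "(\<lambda>(t, s). k t s) = (\<lambda>z. indicator {z. fst z \<le> snd z} z)"
      by (auto simp: k_def indicator_def)
    also have "\<dots> \<in> borel_measurable (borel \<Otimes>\<^sub>M borel)" by measurable
    finally show ?thesis .
  qed
  have kb: "\<bar>k t s\<bar> \<le> 1" for t s by (simp add: k_def)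
  have pt: "indicator {c..x} t * D01 u t = indicator {c..x} t * D01 u 1 - indicator {c..x} t * (LINT s|I01. k t s * ?w s)" for t
  proof (cases "t \<in> {c..x}")
    case True
    then have "D01 u t = D01 u 1 - (LINT s|I01. indicator {t..1} s * D2 u s)"
      using K2a0_D2(4)[OF u, of t] c by auto
    also have "(LINT s|I01. indicator {t..1} s * D2 u s) = (LINT s|I01. k t s * ?w s)"
      by (rule Bochner_Integration.integral_cong) (use True in \<open>auto simp: k_def indicator_def\<close>)
    finally show ?thesis using True by simp
  qed simp
  have "u x - u c = (LINT t|I01. indicator {c..x} t * D01 u t)"
    using I01_interval_integral(2)[OF absolutely_integrable_continuous_real[OF cont]] hi c
    by (simp add: integral_unique)
  also have "\<dots> = (LINT t|I01. indicator {c..x} t * D01 u 1) - (LINT t|I01. indicator {c..x} t * (LINT s|I01. k t s * ?w s))"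
    unfolding pt using i1 fubini_I01(2)[OF i1 iw k kb] by (intro Bochner_Integration.integral_diff) auto
  also have "(LINT t|I01. indicator {c..x} t * D01 u 1) = (x - c) * D01 u 1"
    using lborel_I01_Icc[of c x] c by simp
  also have "(LINT t|I01. indicator {c..x} t * (LINT s|I01. k t s * ?w s)) = (LINT s|I01. ?w s * (LINT t|I01. k t s * indicator {c..x} t))"
    by (rule fubini_I01(1)[OF i1 iw k kb])
  also have "\<dots> = (LINT s|I01. (indicator {c..1} s * (min x s - c)) * D2 u s)"
  proof (rule Bochner_Integration.integral_cong[OF refl])
    fix s assume "s \<in> space I01"
    then have s: "0 < s" "s < 1" by auto
    have "(LINT t|I01. k t s * indicator {c..x} t) = (LINT t|I01. indicat_real {c..min x s} t)"
      by (rule Bochner_Integration.integral_cong) (auto simp: k_def indicator_def)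
    also have "\<dots> = max 0 (min x s - c)" using c by (intro lborel_I01_Icc) auto
    finally have e: "(LINT t|I01. k t s * indicator {c..x} t) = max 0 (min x s - c)" .
    show "?w s * (LINT t|I01. k t s * indicator {c..x} t) = (indicator {c..1} s * (min x s - c)) * D2 u s"
      unfolding e using c by (cases "s \<in> {c..1}") auto
  qed
  finally show ?thesis .
qed

text \<open>The limit c \<rightarrow> 0 of \<open>K2a0_difference\<close>: the kernels are bounded
  by s, and s u'' is integrable. In the weakly degenerate case u'(c) tends both to u'(0) = 0 and to
  u'(1) - \<integral> u''.\<close>

lemma K2a0_repr: assumes u: "u \<in> K2a0 a" shows "repr u (D01 u 1) (D2 u)"
  unfolding repr_def
proof (intro conjI ballI impI)
  show w: "wsq (D2 u)" by (rule K2a0_D2[OF u])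
  have iw: "integrable I01 (\<lambda>s. s * D2 u s)" by (rule wsq_integrable_id[OF w])
  have D2m: "D2 u \<in> borel_measurable I01" using w by (rule wsqD)
  define c where "c n = 1 / (real n + 2)" for n :: nat
  have c: "0 < c n" "c n < 1" for n by (auto simp: c_def)
  have c0: "c \<longlonglongrightarrow> 0" unfolding c_def by real_asymp
  have ev: "\<forall>\<^sub>F n in sequentially. c n \<le> s" if "0 < s" for s
    using order_tendstoD(2)[OF c0 that] by eventually_elim simp
  fix x :: real assume x: "x \<in> {0..1}"
  show "u x = x * D01 u 1 - (LINT s|I01. min x s * D2 u s)"
  proof (cases "x = 0")
    case True
    have "(LINT s|I01. min 0 s * D2 u s) = (LINT s|I01. 0)" by (rule Bochner_Integration.integral_cong) auto
    then show ?thesis using True K2a0_0[OF u] by simp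
  next
    case False
    then have x: "0 < x" "x \<le> 1" using x by auto
    have "(\<lambda>n. (LINT s|I01. (indicator {c n..1} s * (min x s - c n)) * D2 u s)) \<longlonglongrightarrow> (LINT s|I01. min x s * D2 u s)"
    proof (rule integral_dominated_convergence[where w = "\<lambda>s. norm (s * D2 u s)"])
      show "integrable I01 (\<lambda>s. norm (s * D2 u s))" using iw by simp
      show "AE s in I01. (\<lambda>n. indicator {c n..1} s * (min x s - c n) * D2 u s) \<longlonglongrightarrow> min x s * D2 u s"
      proof (rule AE_I2)
        fix s assume "s \<in> space I01"
        then have s: "0 < s" "s < 1" by auto
        have "(\<lambda>n. (min x s - c n) * D2 u s) \<longlonglongrightarrow> (min x s - 0) * D2 u s"
          by (intro tendsto_intros c0)
        moreover have "\<forall>\<^sub>F n in sequentially. (min x s - c n) * D2 u s = indicator {c n..1} s * (min x s - c n) * D2 u s"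
          using ev[OF s(1)] by eventually_elim (use s in auto)
        ultimately show "(\<lambda>n. indicator {c n..1} s * (min x s - c n) * D2 u s) \<longlonglongrightarrow> min x s * D2 u s"
          using Lim_transform_eventually by fastforce
      qed
      show "AE s in I01. norm (indicator {c n..1} s * (min x s - c n) * D2 u s) \<le> norm (s * D2 u s)" for n
      proof (rule AE_I2)
        fix s assume "s \<in> space I01"
        then have s: "0 < s" "s < 1" by auto
        have "\<bar>indicator {c n..1} s * (min x s - c n)\<bar> \<le> \<bar>s\<bar>"
          using s x c[of n] by (cases "s \<in> {c n..1}") (auto simp: min_def abs_if)
        then show "norm (indicator {c n..1} s * (min x s - c n) * D2 u s) \<le> norm (s * D2 u s)"
          by (simp add: abs_mult mult_right_mono del: indicator_abs_le_1)
      qed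
      show "(\<lambda>s. indicator {c n..1} s * (min x s - c n) * D2 u s) \<in> borel_measurable I01" for n
        by (intro borel_measurable_times borel_measurable_I01 D2m) measurable
      show "(\<lambda>s. min x s * D2 u s) \<in> borel_measurable I01"
        by (intro borel_measurable_times borel_measurable_I01 D2m) measurable
    qed
    then have L: "(\<lambda>n. (x - c n) * D01 u 1 - (LINT s|I01. (indicator {c n..1} s * (min x s - c n)) * D2 u s))
        \<longlonglongrightarrow> (x - 0) * D01 u 1 - (LINT s|I01. min x s * D2 u s)"
      by (intro tendsto_intros c0)
    have "(\<lambda>n. u x - u (c n)) \<longlonglongrightarrow> u x - u 0"
      by (intro tendsto_intros continuous_on_tendsto_compose[OF K2a0_continuous[OF u] c0])
        (auto intro!: always_eventually less_imp_le c)
    moreover have "\<forall>\<^sub>F n in sequentially. u x - u (c n)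
        = (x - c n) * D01 u 1 - (LINT s|I01. (indicator {c n..1} s * (min x s - c n)) * D2 u s)"
      using ev[OF x(1)] by eventually_elim (rule K2a0_difference[OF u c(1) _ x(2)])
    ultimately have "(\<lambda>n. (x - c n) * D01 u 1 - (LINT s|I01. (indicator {c n..1} s * (min x s - c n)) * D2 u s)) \<longlonglongrightarrow> u x - u 0"
      by (rule Lim_transform_eventually)
    then show ?thesis using LIMSEQ_unique[OF L] K2a0_0[OF u] by simp
  qed
next
  assume WD: "weakly_degenerate a"
  have w: "wsq (D2 u)" by (rule K2a0_D2[OF u])
  have iw: "integrable I01 (D2 u)" by (rule WD_integrable[OF WD w])
  have D2m: "D2 u \<in> borel_measurable I01" using w by (rule wsqD)
  define c where "c n = 1 / (real n + 2)" for n :: nat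
  have c: "0 < c n" "c n < 1" for n by (auto simp: c_def)
  have c0: "c \<longlonglongrightarrow> 0" unfolding c_def by real_asymp
  have "(\<lambda>n. LINT s|I01. indicator {c n..1} s * D2 u s) \<longlonglongrightarrow> (LINT s|I01. D2 u s)"
  proof (rule integral_dominated_convergence[where w = "\<lambda>s. norm (D2 u s)"])
    show "AE s in I01. (\<lambda>n. indicator {c n..1} s * D2 u s) \<longlonglongrightarrow> D2 u s"
    proof (rule AE_I2)
      fix s assume "s \<in> space I01"
      then have s: "0 < s" "s < 1" by auto
      have "\<forall>\<^sub>F n in sequentially. c n < s" by (rule order_tendstoD(2)[OF c0 s(1)])
      then have "\<forall>\<^sub>F n in sequentially. indicator {c n..1} s * D2 u s = D2 u s"
        by eventually_elim (use s in auto)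
      then show "(\<lambda>n. indicator {c n..1} s * D2 u s) \<longlonglongrightarrow> D2 u s" by (rule tendsto_eventually)
    qed
    show "AE s in I01. norm (indicator {c n..1} s * D2 u s) \<le> norm (D2 u s)" for n
      by (intro AE_I2) (auto simp: indicator_def)
    show "(\<lambda>s. indicator {c n..1} s * D2 u s) \<in> borel_measurable I01" for n
      by (rule borel_measurable_integrable[OF K2a0_D2(3)[OF u c(1)]]) (use c[of n] in simp)
  qed (use iw in auto)
  moreover have "D01 u (c n) = D01 u 1 - (LINT s|I01. indicator {c n..1} s * D2 u s)" for n
    using K2a0_D2(4)[OF u c(1)[of n]] c[of n] by simp
  ultimately have "(\<lambda>n. D01 u (c n)) \<longlonglongrightarrow> D01 u 1 - (LINT s|I01. D2 u s)"
    by (auto intro!: tendsto_intros)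
  moreover have "(\<lambda>n. D01 u (c n)) \<longlonglongrightarrow> D01 u 0"
  proof (rule continuous_on_tendsto_compose[OF abs_cont_on_imp_continuous_on c0])
    show "abs_cont_on 0 1 (D01 u)" using u WD by (simp add: K2a0_def)
  qed (auto intro!: always_eventually less_imp_le c)
  moreover have "D01 u 0 = 0" using u WD by (simp add: K2a0_def)
  ultimately show "D01 u 1 = (LINT s|I01. D2 u s)" using LIMSEQ_unique by fastforce
qed

end

section \<open>Integral identities on the domain\<close>

lemma bounded_AE_square_integral:
  assumes f: "f \<in> borel_measurable I01" and bd: "\<And>x. 0 < x \<Longrightarrow> x < 1 \<Longrightarrow> (f x)\<^sup>2 \<le> B"
  shows "L2 f" "(LINT x|I01. (f x)\<^sup>2) \<le> B"
proof -
  interpret finite_measure I01 by (rule finite_measure_I01)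
  have B: "0 \<le> B" using bd[of "1/2"] zero_le_power2[of "f (1/2)"] by linarith
  have c: "integrable I01 (\<lambda>_. B)" by simp
  have i: "integrable I01 (\<lambda>x. (f x)\<^sup>2)"
    by (rule Bochner_Integration.integrable_bound[OF c]) (use f bd B in auto)
  then show "L2 f" using f by (simp add: L2_def)
  have "(LINT x|I01. (f x)\<^sup>2) \<le> (LINT x|I01. B)"
    by (rule integral_mono[OF i c]) (use bd in auto)
  also have "\<dots> = B" by (simp add: measure_restrict_space)
  finally show "(LINT x|I01. (f x)\<^sup>2) \<le> B" .
qed

lemma continuous_bounded_I01:
  assumes "continuous_on {0..1} (h :: real \<Rightarrow> real)"
  obtains C where "C > 0" "\<And>x. x \<in> {0..1} \<Longrightarrow> \<bar>h x\<bar> \<le> C"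
proof -
  have "bounded (h ` {0..1})"
    by (intro compact_imp_bounded compact_continuous_image assms) auto
  then obtain C where "C > 0" "\<forall>y\<in>h ` {0..1}. norm y \<le> C" unfolding bounded_pos by blast
  then show ?thesis by (intro that[of C]) auto
qed

context degenerate
begin

text \<open>Abstracts g = a u'', h = g', b = g'' for \<open>u\<close> in the domain of the operator,
  together with the boundary condition that the flux carries at 0.\<close>

definition flux_data :: "(real \<Rightarrow> real) \<Rightarrow> (real \<Rightarrow> real) \<Rightarrow> (real \<Rightarrow> real) \<Rightarrow> bool" where
  "flux_data g h b \<longleftrightarrow> L2 b \<and> continuous_on {0..1} h \<and>
     (\<forall>x\<in>{0..1}. g x = g 0 + integral {0..x} h) \<and> (\<forall>x\<in>{0..1}. h x = h 0 + integral {0..x} b) \<and>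
     (\<forall>x\<in>{0..1}. (g has_real_derivative h x) (at x within {0..1})) \<and>
     (strongly_degenerate a \<longrightarrow> g 0 = 0)"

lemma dom_B_flux_data:
  assumes "u \<in> dom_B a"
  obtains h where "flux_data (aD2 a u) h (op_B a u)" "AE x in I01. a x * D2 u x = aD2 a u x"
    "h 1 = D01 (aD2 a u) 1"
proof -
  have H2: "H2 (\<lambda>x. a x * D2 u x)" using assms unfolding dom_B_def by blast
  show ?thesis
  proof (rule H2_representation[OF H2, folded aD2_def op_B_def])
    fix h
    assume h: "AE x in I01. a x * D2 u x = aD2 a u x" "L2 (op_B a u)" "continuous_on {0..1} h"
      "\<And>x. x \<in> {0..1} \<Longrightarrow> aD2 a u x = aD2 a u 0 + integral {0..x} h"
      "\<And>x. x \<in> {0..1} \<Longrightarrow> h x = h 0 + integral {0..x} (op_B a u)"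
      "\<And>x. x \<in> {0..1} \<Longrightarrow> D01 (aD2 a u) x = h x"
      "\<And>x. x \<in> {0..1} \<Longrightarrow> (aD2 a u has_real_derivative h x) (at x within {0..1})"
    have "strongly_degenerate a \<longrightarrow> aD2 a u 0 = 0" using assms unfolding dom_B_def by blast
    then have "flux_data (aD2 a u) h (op_B a u)"
      using h unfolding flux_data_def by (intro conjI ballI) assumption+
    then show ?thesis using h(1) h(6)[of 1] by (intro that[of h]) auto
  qed
qed

lemma flux_dataD:
  assumes "flux_data g h b"
  shows "L2 b" "integrable I01 b" "continuous_on {0..1} h" "\<And>x. 0 \<le> x \<Longrightarrow> x \<le> 1 \<Longrightarrow> g x = g 0 + integral {0..x} h"
    "\<And>x. 0 \<le> x \<Longrightarrow> x \<le> 1 \<Longrightarrow> h x = h 0 + integral {0..x} b"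
    "\<And>x. 0 \<le> x \<Longrightarrow> x \<le> 1 \<Longrightarrow> (g has_real_derivative h x) (at x within {0..1})"
    "strongly_degenerate a \<Longrightarrow> g 0 = 0"
proof -
  have d: "L2 b" "continuous_on {0..1} h" "\<forall>x\<in>{0..1}. g x = g 0 + integral {0..x} h"
    "\<forall>x\<in>{0..1}. h x = h 0 + integral {0..x} b"
    "\<forall>x\<in>{0..1}. (g has_real_derivative h x) (at x within {0..1})" "strongly_degenerate a \<longrightarrow> g 0 = 0"
    using assms unfolding flux_data_def by blast+
  have m: "x \<in> {0..1}" if "0 \<le> x" "x \<le> 1" for x :: real using that by simp
  show "L2 b" "continuous_on {0..1} h" "strongly_degenerate a \<Longrightarrow> g 0 = 0" using d by blast+
  show "integrable I01 b" by (rule L2_integrable[OF d(1)])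
  show "g x = g 0 + integral {0..x} h" if "0 \<le> x" "x \<le> 1" for x by (rule bspec[OF d(3) m[OF that]])
  show "h x = h 0 + integral {0..x} b" if "0 \<le> x" "x \<le> 1" for x by (rule bspec[OF d(4) m[OF that]])
  show "(g has_real_derivative h x) (at x within {0..1})" if "0 \<le> x" "x \<le> 1" for x by (rule bspec[OF d(5) m[OF that]])
qed

section \<open>Moments of the flux and pairings with second derivatives\<close>

lemma flux_continuous: assumes "flux_data g h b" shows "continuous_on {0..1} g"
  using flux_dataD(6)[OF assms] by (auto intro!: DERIV_continuous simp: continuous_on_eq_continuous_within)

text \<open>This lemma, \<open>flux_min\<close> and \<open>flux_head\<close> evaluate the inner
  integrals left over after Fubini, one for each kernel that occurs.\<close>

lemma flux_tail:
  assumes fd: "flux_data g h b" and s: "0 \<le> s" "s \<le> 1"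
  shows "(LINT x|I01. indicator {s..} x * b x) = h 1 - h s"
proof -
  note b = flux_dataD(2)[OF fd]
  have "(LINT x|I01. indicator {s..} x * b x) = (LINT x|I01. indicator {s..1} x * b x)"
    by (rule Bochner_Integration.integral_cong) (auto simp: indicator_def)
  also have "\<dots> = integral {s..1} b"
    using s by (intro I01_interval_integral integrable_I01_absolutely_integrable b) auto
  also have "integral {0..s} b + integral {s..1} b = integral {0..1} b"
    by (intro Henstock_Kurzweil_Integration.integral_combine s set_lebesgue_integral_eq_integral(1)
        integrable_I01_absolutely_integrable b) auto
  then have "integral {s..1} b = h 1 - h s"
    using flux_dataD(5)[OF fd, of 1] flux_dataD(5)[OF fd s] by simp
  finally show ?thesis .
qed

text \<open>min(s, x) is the length of the set of t in [0, s] with t \<le> x, so Fubini reduces the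
  moment to \<open>flux_tail\<close>.\<close>

lemma flux_min:
  assumes fd: "flux_data g h b" and s: "0 \<le> s" "s \<le> 1"
  shows "(LINT x|I01. min s x * b x) = s * h 1 - g s + g 0"
proof -
  note b = flux_dataD(2)[OF fd] and ch = flux_dataD(3)[OF fd]
  define k where "k x t = indicat_real {t..} x" for x t :: real
  have k: "(\<lambda>(x, t). k x t) \<in> borel_measurable (borel \<Otimes>\<^sub>M borel)"
  proof -
    have "(\<lambda>(x, t). k x t) = (\<lambda>z. indicator {z. snd z \<le> fst z} z)"
      by (auto simp: k_def indicator_def)
    also have "\<dots> \<in> borel_measurable (borel \<Otimes>\<^sub>M borel)" by measurable
    finally show ?thesis .
  qed
  have i: "integrable I01 (indicat_real {0..s})"
    using I01_interval_integral(1)[where g = "\<lambda>_. 1" and x = 0 and y = s] s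
    by (auto intro: absolutely_integrable_continuous_real)
  have ih: "h absolutely_integrable_on {0..s}"
    by (intro absolutely_integrable_continuous_real continuous_on_subset[OF ch]) (use s in auto)
  have "(LINT x|I01. min s x * b x) = (LINT x|I01. b x * (LINT t|I01. k x t * indicator {0..s} t))"
  proof (rule Bochner_Integration.integral_cong[OF refl])
    fix x assume "x \<in> space I01"
    then have x: "0 < x" "x < 1" by auto
    have "(LINT t|I01. k x t * indicator {0..s} t) = (LINT t|I01. indicat_real {0..min s x} t)"
      by (rule Bochner_Integration.integral_cong) (auto simp: k_def indicator_def)
    also have "\<dots> = min s x" using lborel_I01_Icc[of 0 "min s x"] s x by simp
    finally show "min s x * b x = b x * (LINT t|I01. k x t * indicator {0..s} t)" by simp
  qed
  also have "\<dots> = (LINT t|I01. indicator {0..s} t * (LINT x|I01. k x t * b x))"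
    by (rule fubini_I01(1)[OF b i k]) (simp add: k_def)
  also have "\<dots> = (LINT t|I01. indicator {0..s} t * h 1 - indicator {0..s} t * h t)"
  proof (rule Bochner_Integration.integral_cong[OF refl])
    fix t assume "t \<in> space I01"
    then have "(LINT x|I01. k x t * b x) = h 1 - h t" unfolding k_def by (intro flux_tail[OF fd]) auto
    then show "indicator {0..s} t * (LINT x|I01. k x t * b x) = indicator {0..s} t * h 1 - indicator {0..s} t * h t"
      by (simp add: right_diff_distrib)
  qed
  also have "\<dots> = (LINT t|I01. indicator {0..s} t * h 1) - (LINT t|I01. indicator {0..s} t * h t)"
    using i I01_interval_integral(1)[OF ih] s by (intro Bochner_Integration.integral_diff) auto
  also have "(LINT t|I01. indicator {0..s} t * h 1) = s * h 1"
    using lborel_I01_Icc[of 0 s] s by simp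
  also have "(LINT t|I01. indicator {0..s} t * h t) = integral {0..s} h"
    using I01_interval_integral(2)[OF ih] s by simp
  finally show ?thesis using flux_dataD(4)[OF fd s] by simp
qed

lemma flux_moment: assumes fd: "flux_data g h b" shows "(LINT x|I01. x * b x) = h 1 - g 1 + g 0"
proof -
  have "(LINT x|I01. x * b x) = (LINT x|I01. min 1 x * b x)"
    by (rule Bochner_Integration.integral_cong) auto
  then show ?thesis using flux_min[OF fd, of 1] by simp
qed

text \<open>The kernel x on {..<s} is min(s, x) minus s times the indicator of {s..}.\<close>

lemma flux_head:
  assumes fd: "flux_data g h b" and s: "0 \<le> s" "s \<le> 1"
  shows "(LINT x|I01. x * indicator {..<s} x * b x) = s * h s - g s + g 0"
proof -
  note b = flux_dataD(2)[OF fd]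
  have i: "integrable I01 (\<lambda>x. indicator {s..} x * b x)"
  proof (rule I01_integrable_cong)
    show "integrable I01 (\<lambda>x. indicator {s..1} x * b x)"
      by (intro I01_interval_integral integrable_I01_absolutely_integrable b s) auto
  qed (auto simp: indicator_def)
  have ib: "integrable I01 (\<lambda>x. min s x * b x)"
  proof (rule Bochner_Integration.integrable_bound[OF b])
    show "AE x in I01. norm (min s x * b x) \<le> norm (b x)"
      using s by (intro AE_I2) (auto simp: abs_mult min_def intro!: mult_left_le_one_le)
    show "(\<lambda>x. min s x * b x) \<in> borel_measurable I01"
      by (intro borel_measurable_times borel_measurable_integrable[OF b] borel_measurable_I01) measurable
  qed
  have "(LINT x|I01. x * indicator {..<s} x * b x) = (LINT x|I01. min s x * b x - s * (indicator {s..} x * b x))"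
    by (rule Bochner_Integration.integral_cong) (auto simp: indicator_def)
  also have "\<dots> = (s * h 1 - g s + g 0) - s * (h 1 - h s)"
    using i ib flux_min[OF fd s] flux_tail[OF fd s] by simp
  finally show ?thesis by (simp add: algebra_simps)
qed

text \<open>g - g(0) vanishes linearly at 0 and therefore pairs with every \<open>w\<close> of
  finite energy.\<close>

lemma flux_bounds:
  assumes fd: "flux_data g h b"
  obtains C where "C > 0" "\<And>x. 0 \<le> x \<Longrightarrow> x \<le> 1 \<Longrightarrow> \<bar>h x\<bar> \<le> C" "\<And>x. 0 \<le> x \<Longrightarrow> x \<le> 1 \<Longrightarrow> \<bar>g x - g 0\<bar> \<le> C * x"
proof -
  note ch = flux_dataD(3)[OF fd]
  obtain C where C: "C > 0" "\<And>x. x \<in> {0..1} \<Longrightarrow> \<bar>h x\<bar> \<le> C" using continuous_bounded_I01[OF ch] by metis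
  have "\<bar>g x - g 0\<bar> \<le> C * x" if "0 \<le> x" "x \<le> 1" for x
  proof -
    have "norm (integral {0..x} h) \<le> C * (x - 0)"
      by (rule integral_bound) (use that C continuous_on_subset[OF ch] in auto)
    then show ?thesis using flux_dataD(4)[OF fd that] by simp
  qed
  then show ?thesis using C by (intro that[of C]) auto
qed

lemma kernel_integrable_scaled:
  assumes w: "wsq w" and k: "k \<in> borel_measurable I01" and bd: "\<And>s. 0 < s \<Longrightarrow> s < 1 \<Longrightarrow> \<bar>k s\<bar> \<le> C * s" and C: "C > 0"
  shows "integrable I01 (\<lambda>s. k s * w s)"
proof -
  have "integrable I01 (\<lambda>s. (k s / C) * w s)"
    by (rule kernel_integrable(1)[OF w]) (use k bd C in \<open>auto simp: field_simps\<close>)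
  then have "integrable I01 (\<lambda>s. C * ((k s / C) * w s))" by (rule integrable_mult_right)
  then show ?thesis using C by simp
qed

lemma continuous_measurable_I01: "continuous_on {0..1} f \<Longrightarrow> (f :: real \<Rightarrow> real) \<in> borel_measurable I01"
  by (rule L2_measurable[OF L2_continuous])

text \<open>The two boundary conditions at 0 meet here: under weak degeneracy \<open>w\<close> is
  integrable with integral q, under strong degeneracy g(0) = 0. The same formula results, so the
  identities built on it need no case distinction.\<close>

lemma flux_pairing:
  assumes fd: "flux_data g h b" and f: "repr f q w"
  shows "integrable I01 (\<lambda>s. (g s - g 0) * w s)" "integrable I01 (\<lambda>s. g s * w s)"
    "(LINT s|I01. (g s - g 0) * w s) = (LINT s|I01. g s * w s) - g 0 * q"
proof -
  obtain C where C: "C > 0" "\<And>x. 0 \<le> x \<Longrightarrow> x \<le> 1 \<Longrightarrow> \<bar>g x - g 0\<bar> \<le> C * x"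
    using flux_bounds[OF fd] by metis
  have w: "wsq w" by (rule repr_wsq[OF f])
  have gm: "g \<in> borel_measurable I01" by (rule continuous_measurable_I01[OF flux_continuous[OF fd]])
  show i: "integrable I01 (\<lambda>s. (g s - g 0) * w s)"
    by (rule kernel_integrable_scaled[OF w _ _ C(1)]) (use gm C in auto)
  have "integrable I01 (\<lambda>s. g s * w s) \<and> (LINT s|I01. (g s - g 0) * w s) = (LINT s|I01. g s * w s) - g 0 * q"
    using deg
  proof
    assume WD: "weakly_degenerate a"
    have iw: "integrable I01 (\<lambda>s. g 0 * w s)" using WD_integrable[OF WD w] by simp
    have "integrable I01 (\<lambda>s. (g s - g 0) * w s + g 0 * w s)" using i iw by (rule Bochner_Integration.integrable_add)
    then have "integrable I01 (\<lambda>s. g s * w s)" by (simp add: algebra_simps)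
    moreover have "(LINT s|I01. (g s - g 0) * w s) = (LINT s|I01. g s * w s) - (LINT s|I01. g 0 * w s)"
      using Bochner_Integration.integral_diff[OF calculation iw] by (simp add: algebra_simps)
    ultimately show ?thesis using repr_WD[OF f WD] by simp
  next
    assume "strongly_degenerate a"
    then have "g 0 = 0" by (rule flux_dataD(7)[OF fd])
    then show ?thesis using i by simp
  qed
  then show "integrable I01 (\<lambda>s. g s * w s)" "(LINT s|I01. (g s - g 0) * w s) = (LINT s|I01. g s * w s) - g 0 * q"
    by auto
qed

text \<open>\<open>w\<close> may fail to be integrable, so the integrand is regrouped as (k / s) (s
  w) to fit the version with bounded kernels.\<close>

lemma fubini_kernel:
  assumes b: "integrable I01 b" and w: "wsq w"
    and k: "(\<lambda>(x, s). k x s) \<in> borel_measurable (borel \<Otimes>\<^sub>M borel)"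
    and bd: "\<And>x s. 0 < x \<Longrightarrow> x < 1 \<Longrightarrow> 0 < s \<Longrightarrow> s < 1 \<Longrightarrow> \<bar>k x s\<bar> \<le> s"
  shows "(LINT x|I01. b x * (LINT s|I01. k x s * w s)) = (LINT s|I01. w s * (LINT x|I01. k x s * b x))"
    and "integrable I01 (\<lambda>x. b x * (LINT s|I01. k x s * w s))"
proof -
  have k': "(\<lambda>(x, s). k x s / s) \<in> borel_measurable (borel \<Otimes>\<^sub>M borel)"
  proof -
    have [measurable]: "(\<lambda>z. k (fst z) (snd z)) \<in> borel_measurable (borel \<Otimes>\<^sub>M borel)"
      using k by (simp add: case_prod_beta)
    have "(\<lambda>z. k (fst z) (snd z) / snd z) \<in> borel_measurable (borel \<Otimes>\<^sub>M borel)" by measurable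
    then show ?thesis by (simp add: case_prod_beta)
  qed
  have bd': "\<bar>k x s / s\<bar> \<le> 1" if "0 < x" "x < 1" "0 < s" "s < 1" for x s
    using bd[OF that] that by simp
  have e: "(LINT s|I01. k x s / s * (s * w s)) = (LINT s|I01. k x s * w s)" for x
    by (rule Bochner_Integration.integral_cong) auto
  note F = fubini_I01[OF b wsq_integrable_id[OF w] k' bd', unfolded e]
  have "(LINT s|I01. s * w s * (LINT x|I01. k x s / s * b x)) = (LINT s|I01. w s * (LINT x|I01. k x s * b x))"
  proof (rule Bochner_Integration.integral_cong[OF refl])
    fix s assume "s \<in> space I01"
    then have "s \<noteq> 0" by auto
    then have "(LINT x|I01. k x s * b x) = s * (LINT x|I01. k x s / s * b x)"
      by (subst integral_mult_right_zero[symmetric]) simp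
    then show "s * w s * (LINT x|I01. k x s / s * b x) = w s * (LINT x|I01. k x s * b x)"
      by (simp only: mult_ac)
  qed
  then show "(LINT x|I01. b x * (LINT s|I01. k x s * w s)) = (LINT s|I01. w s * (LINT x|I01. k x s * b x))"
    using F(1) by simp
  show "integrable I01 (\<lambda>x. b x * (LINT s|I01. k x s * w s))" using F(2) by simp
qed

lemma repr_integrable: assumes f: "repr f q w" shows "integrable I01 f" "L2 f"
  "(LINT x|I01. (f x)\<^sup>2) \<le> 2 * q\<^sup>2 + 2 / (a 1 * (2 - K)) * (LINT s|I01. a s * (w s)\<^sup>2)"
proof -
  interpret finite_measure I01 by (rule finite_measure_I01)
  have k: "(\<lambda>(x, s). min x s) \<in> borel_measurable (borel \<Otimes>\<^sub>M (borel :: real measure))"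
    by (simp add: case_prod_beta)
  have "integrable I01 (\<lambda>x. 1 * (LINT s|I01. min x s * w s))"
    by (rule fubini_kernel(2)[OF _ repr_wsq[OF f] k]) auto
  moreover have "integrable I01 (\<lambda>x. x * q)"
    using powr_I01(1)[of 1] by (intro integrable_mult_left) (auto intro: I01_integrable_cong)
  ultimately have "integrable I01 (\<lambda>x. x * q - 1 * (LINT s|I01. min x s * w s))"
    by (rule Bochner_Integration.integrable_diff[rotated])
  then show i: "integrable I01 f"
    by (rule I01_integrable_cong) (use repr_eq[OF f] in auto)
  show "L2 f" "(LINT x|I01. (f x)\<^sup>2) \<le> 2 * q\<^sup>2 + 2 / (a 1 * (2 - K)) * (LINT s|I01. a s * (w s)\<^sup>2)"
    by (rule bounded_AE_square_integral[OF borel_measurable_integrable[OF i] repr_bound[OF f]]; simp)+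
qed

text \<open>Insert the kernel representation of \<open>f\<close>, exchange the integrals and
  evaluate by \<open>flux_min\<close>; the terms in g(0) from \<open>flux_moment\<close> and
  \<open>flux_pairing\<close> cancel.\<close>

lemma Green:
  assumes fd: "flux_data g h b" and f: "repr f q w"
  shows "(LINT x|I01. b x * f x) = h 1 * f 1 - g 1 * q + (LINT s|I01. g s * w s)"
proof -
  note b = flux_dataD(2)[OF fd] and w = repr_wsq[OF f]
  have k: "(\<lambda>(x, s). min x s) \<in> borel_measurable (borel \<Otimes>\<^sub>M (borel :: real measure))"
    by (simp add: case_prod_beta)
  have kb: "\<bar>min x s\<bar> \<le> s" if "0 < x" "x < 1" "0 < s" "s < 1" for x s :: real using that by auto
  have F: "(LINT x|I01. b x * (LINT s|I01. min x s * w s)) = (LINT s|I01. w s * (LINT x|I01. min x s * b x))"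
    "integrable I01 (\<lambda>x. b x * (LINT s|I01. min x s * w s))"
    by (rule fubini_kernel[OF b w k]; rule kb; assumption)+
  have ib: "integrable I01 (\<lambda>x. x * b x)"
    by (rule I01_integrable_cong[OF L2_mult_integrable[OF L2_continuous[of "\<lambda>x. x"] flux_dataD(1)[OF fd]]]) auto
  have "(LINT x|I01. b x * f x) = (LINT x|I01. q * (x * b x) - b x * (LINT s|I01. min x s * w s))"
  proof (rule Bochner_Integration.integral_cong[OF refl])
    fix x assume "x \<in> space I01"
    then have fx: "f x = x * q - (LINT s|I01. min x s * w s)" using repr_eq[OF f, of x] by simp
    show "b x * f x = q * (x * b x) - b x * (LINT s|I01. min x s * w s)"
      unfolding fx by (simp add: algebra_simps)
  qed
  also have "\<dots> = q * (LINT x|I01. x * b x) - (LINT x|I01. b x * (LINT s|I01. min x s * w s))"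
    using ib F(2) by simp
  also have "(LINT x|I01. b x * (LINT s|I01. min x s * w s)) = (LINT s|I01. h 1 * (s * w s) - (g s - g 0) * w s)"
    unfolding F(1)
  proof (rule Bochner_Integration.integral_cong[OF refl])
    fix s assume "s \<in> space I01"
    then have e: "(LINT x|I01. min s x * b x) = s * h 1 - g s + g 0" by (intro flux_min[OF fd]) auto
    show "w s * (LINT x|I01. min x s * b x) = h 1 * (s * w s) - (g s - g 0) * w s"
      unfolding min.commute[of _ s] e by (simp add: algebra_simps)
  qed
  also have "\<dots> = h 1 * (LINT s|I01. s * w s) - (LINT s|I01. (g s - g 0) * w s)"
    using wsq_integrable_id[OF w] flux_pairing(1)[OF fd f] by simp
  finally show ?thesis
    unfolding flux_pairing(3)[OF fd f] flux_moment[OF fd] repr_1[OF f] by (simp add: algebra_simps)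
qed

text \<open>u' may blow up at 0, but x u' is represented by the kernel x on s \<ge> x, which is at
  most s, and stays bounded.\<close>

lemma K2a0_multiplier:
  assumes u: "u \<in> K2a0 a"
  shows "x \<in> space I01 \<Longrightarrow> x * D01 u x = x * D01 u 1 - (LINT s|I01. x * indicator {x..} s * D2 u s)"
    and "L2 (\<lambda>x. x * D01 u x)"
    and "(LINT x|I01. (x * D01 u x)\<^sup>2) \<le> 2 * (D01 u 1)\<^sup>2 + 2 / (a 1 * (2 - K)) * (LINT s|I01. a s * (D2 u s)\<^sup>2)"
proof -
  show e: "x * D01 u x = x * D01 u 1 - (LINT s|I01. x * indicator {x..} s * D2 u s)" if "x \<in> space I01" for x
  proof -
    have "(LINT s|I01. x * indicator {x..} s * D2 u s) = x * (LINT s|I01. indicator {x..1} s * D2 u s)"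
      by (subst integral_mult_right_zero[symmetric], rule Bochner_Integration.integral_cong)
        (auto simp: indicator_def)
    then show ?thesis using K2a0_D2(4)[OF u, of x] that by (simp add: right_diff_distrib)
  qed
  have m: "(\<lambda>x. x * D01 u x) \<in> borel_measurable I01"
    using K2a0_D2(1)[OF u]
    by (intro borel_measurable_times measurable_id_I01) (auto simp: is_weak_deriv_def L1_loc_measurable)
  have "(x * D01 u x)\<^sup>2 \<le> 2 * (D01 u 1)\<^sup>2 + 2 / (a 1 * (2 - K)) * (LINT s|I01. a s * (D2 u s)\<^sup>2)"
    if "0 < x" "x < 1" for x
  proof -
    have "x \<in> space I01" using that by simp
    show ?thesis
      unfolding e[OF \<open>x \<in> space I01\<close>]
      by (intro kernel_value_bound K2a0_D2(2)[OF u] tail_measurable) (use that in \<open>auto simp: indicator_def\<close>)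
  qed
  from bounded_AE_square_integral[OF m this]
  show "L2 (\<lambda>x. x * D01 u x)"
    "(LINT x|I01. (x * D01 u x)\<^sup>2) \<le> 2 * (D01 u 1)\<^sup>2 + 2 / (a 1 * (2 - K)) * (LINT s|I01. a s * (D2 u s)\<^sup>2)"
    by auto
qed

text \<open>Obtained like \<open>Green\<close>, with the kernel x on x \<le> s in place of min(x,
  s). The term with s h u'' is left to \<open>virial_bound\<close>.\<close>

lemma Pohozaev:
  assumes fd: "flux_data g h b" and u: "u \<in> K2a0 a"
  shows "(LINT x|I01. b x * (x * D01 u x))
    = D01 u 1 * (h 1 - g 1) - (LINT s|I01. s * h s * D2 u s) + (LINT s|I01. g s * D2 u s)"
    and "integrable I01 (\<lambda>s. s * h s * D2 u s)"
proof -
  note b = flux_dataD(2)[OF fd] and w = K2a0_D2(2)[OF u] and f = K2a0_repr[OF u]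
  define k where "k x s = x * indicat_real {x..} s" for x s :: real
  have k: "(\<lambda>(x, s). k x s) \<in> borel_measurable (borel \<Otimes>\<^sub>M (borel :: real measure))"
  proof -
    have "(\<lambda>(x, s). k x s) = (\<lambda>z. fst z * indicator {z. fst z \<le> snd z} z)"
      by (auto simp: k_def indicator_def)
    also have "\<dots> \<in> borel_measurable (borel \<Otimes>\<^sub>M borel)" by measurable
    finally show ?thesis .
  qed
  have kb: "\<bar>k x s\<bar> \<le> s" if "0 < x" "x < 1" "0 < s" "s < 1" for x s :: real
    using that by (auto simp: k_def indicator_def)
  have F: "(LINT x|I01. b x * (LINT s|I01. k x s * D2 u s)) = (LINT s|I01. D2 u s * (LINT x|I01. k x s * b x))"
    "integrable I01 (\<lambda>x. b x * (LINT s|I01. k x s * D2 u s))"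
    by (rule fubini_kernel[OF b w k]; rule kb; assumption)+
  have ib: "integrable I01 (\<lambda>x. x * b x)"
    by (rule I01_integrable_cong[OF L2_mult_integrable[OF L2_continuous[of "\<lambda>x. x"] flux_dataD(1)[OF fd]]]) auto
  obtain C where C: "C > 0" "\<And>x. 0 \<le> x \<Longrightarrow> x \<le> 1 \<Longrightarrow> \<bar>h x\<bar> \<le> C"
    using flux_bounds[OF fd] by metis
  show ih: "integrable I01 (\<lambda>s. s * h s * D2 u s)"
    by (rule kernel_integrable_scaled[OF w _ _ C(1)])
      (use C continuous_measurable_I01[OF flux_dataD(3)[OF fd]] measurable_id_I01 in
        \<open>auto simp: abs_mult mult.commute intro!: borel_measurable_times mult_right_mono\<close>)
  have "(LINT x|I01. b x * (x * D01 u x)) = (LINT x|I01. D01 u 1 * (x * b x) - b x * (LINT s|I01. k x s * D2 u s))"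
    by (rule Bochner_Integration.integral_cong[OF refl])
      (simp add: K2a0_multiplier(1)[OF u] k_def algebra_simps)
  also have "\<dots> = D01 u 1 * (LINT x|I01. x * b x) - (LINT x|I01. b x * (LINT s|I01. k x s * D2 u s))"
    using ib F(2) by simp
  also have "(LINT x|I01. b x * (LINT s|I01. k x s * D2 u s)) = (LINT s|I01. s * h s * D2 u s - (g s - g 0) * D2 u s)"
    unfolding F(1)
  proof (rule Bochner_Integration.integral_cong[OF refl])
    fix s assume "s \<in> space I01"
    then have s: "0 \<le> s" "s \<le> 1" by auto
    \<comment> \<open>\<open>k\<close> includes the point x = s, which \<open>flux_head\<close>
      omits.\<close>
    have "(LINT x|I01. k x s * b x) = (LINT x|I01. x * indicator {..<s} x * b x)"
    proof (rule integral_cong_AE)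
      have "AE x in lebesgue. x \<notin> {s}"
        by (rule AE_not_in) (simp add: negligible_iff_null_sets[symmetric])
      then show "AE x in I01. k x s * b x = x * indicator {..<s} x * b x"
        unfolding AE_I01_iff by eventually_elim (auto simp: k_def indicator_def)
      have "(\<lambda>x. k x s) = (\<lambda>x. x * indicator {..s} x)" by (auto simp: k_def indicator_def)
      also have "\<dots> \<in> borel_measurable borel" by measurable
      finally show "(\<lambda>x. k x s * b x) \<in> borel_measurable I01"
        by (intro borel_measurable_times borel_measurable_integrable[OF b]) (rule borel_measurable_I01)
      show "(\<lambda>x. x * indicator {..<s} x * b x) \<in> borel_measurable I01"
        by (intro borel_measurable_times[OF _ borel_measurable_integrable[OF b]] borel_measurable_I01) measurable
    qed
    also have "\<dots> = s * h s - g s + g 0" by (rule flux_head[OF fd s])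
    finally have e: "(LINT x|I01. k x s * b x) = s * h s - g s + g 0" .
    show "D2 u s * (LINT x|I01. k x s * b x) = s * h s * D2 u s - (g s - g 0) * D2 u s"
      unfolding e by (simp add: algebra_simps)
  qed
  also have "\<dots> = (LINT s|I01. s * h s * D2 u s) - (LINT s|I01. (g s - g 0) * D2 u s)"
    using ih flux_pairing(1)[OF fd f] by simp
  finally show "(LINT x|I01. b x * (x * D01 u x))
    = D01 u 1 * (h 1 - g 1) - (LINT s|I01. s * h s * D2 u s) + (LINT s|I01. g s * D2 u s)"
    unfolding flux_pairing(3)[OF fd f] flux_moment[OF fd] by (simp add: algebra_simps)
qed

end

text \<open>Classical calculus is applied on [c, 1] with c > 0; this recovers the integrals over (0,
  1).\<close>

lemma tail_integral_limit:
  assumes f: "integrable I01 f"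
  shows "(\<lambda>n. LINT s|I01. indicator {1 / (real n + 2)..1} s * f s) \<longlonglongrightarrow> (LINT s|I01. f s :: real)"
proof (rule integral_dominated_convergence[where w = "\<lambda>s. norm (f s)"])
  show "AE s in I01. (\<lambda>n. indicator {1 / (real n + 2)..1} s * f s) \<longlonglongrightarrow> f s"
  proof (rule AE_I2)
    fix s assume "s \<in> space I01"
    then have s: "0 < s" "s < 1" by auto
    have "(\<lambda>n. 1 / (real n + 2)) \<longlonglongrightarrow> 0" by real_asymp
    then have "\<forall>\<^sub>F n in sequentially. 1 / (real n + 2) < s" by (rule order_tendstoD) (rule s)
    then have "\<forall>\<^sub>F n in sequentially. indicator {1 / (real n + 2)..1} s * f s = f s"
      by eventually_elim (use s in auto)
    then show "(\<lambda>n. indicator {1 / (real n + 2)..1} s * f s) \<longlonglongrightarrow> f s" by (rule tendsto_eventually)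
  qed
  show "(\<lambda>s. indicator {1 / (real n + 2)..1} s * f s) \<in> borel_measurable I01" for n
    by (intro borel_measurable_times borel_measurable_integrable[OF f] borel_measurable_I01) measurable
  show "AE s in I01. norm (indicator {1 / (real n + 2)..1} s * f s) \<le> norm (f s)" for n
    by (intro AE_I2) (auto simp: indicator_def)
qed (use f in auto)

context degenerate
begin

section \<open>Multiplier inequalities for displacement and velocity\<close>

lemma flux_AE:
  assumes fd: "flux_data g h b" and u: "u \<in> K2a0 a" and ae: "AE x in I01. a x * D2 u x = g x"
  shows "(LINT s|I01. g s * D2 u s) = (LINT s|I01. a s * (D2 u s)\<^sup>2)"
    and "repr f q w \<Longrightarrow> (LINT s|I01. g s * w s) = (LINT s|I01. a s * (D2 u s * w s))"
proof -
  have *: "(LINT s|I01. g s * w s) = (LINT s|I01. a s * (D2 u s * w s))" if f: "repr f q w" for f q w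
  proof (rule integral_cong_AE)
    show "AE s in I01. g s * w s = a s * (D2 u s * w s)" using ae by eventually_elim (simp add: mult.assoc[symmetric])
  qed (use flux_pairing(2)[OF fd f] wsq_mult(1)[OF K2a0_D2(2)[OF u] repr_wsq[OF f]] in auto)
  show "(LINT s|I01. g s * w s) = (LINT s|I01. a s * (D2 u s * w s))" if "repr f q w" by (rule *[OF that])
  show "(LINT s|I01. g s * D2 u s) = (LINT s|I01. a s * (D2 u s)\<^sup>2)"
    using *[OF K2a0_repr[OF u]] by (simp add: power2_eq_square)
qed

text \<open>With u'' = g / a the left side is the integral of s (g^2)' / a. The derivative of s g^2
  / a contains besides it g^2 / a, the energy density, and - s a' g^2 / a^2, which is at most K
  times that density in modulus; hence the factor 1 - K. The boundary term at c has a favourable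
  sign and is dropped.\<close>

lemma virial_bound:
  assumes fd: "flux_data g h b" and u: "u \<in> K2a0 a" and ae: "AE x in I01. a x * D2 u x = g x"
  shows "2 * (LINT s|I01. s * h s * D2 u s) \<le> (g 1)\<^sup>2 / a 1 - (1 - K) * (LINT s|I01. a s * (D2 u s)\<^sup>2)"
proof -
  define F where "F s = 2 * s * g s * h s / a s" for s
  define G where "G s = (g s)\<^sup>2 / a s" for s
  define A where "A s = s * (g s)\<^sup>2 * D01 a s / (a s)\<^sup>2" for s
  note cg = flux_continuous[OF fd] and ch = flux_dataD(3)[OF fd]
  have cs: "continuous_on {c..1} F" "continuous_on {c..1} G" "continuous_on {c..1} A" if c: "0 < c" for c
  proof -
    have [continuous_intros]: "continuous_on {c..1} a" "continuous_on {c..1} (D01 a)" "continuous_on {c..1} g" "continuous_on {c..1} h"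
      using c by (auto intro: continuous_on_subset[OF a_continuous] continuous_on_subset[OF a_D01_continuous]
          continuous_on_subset[OF cg] continuous_on_subset[OF ch])
    have nz: "\<forall>x\<in>{c..1}. a x \<noteq> 0"
    proof
      fix x assume "x \<in> {c..1}"
      then show "a x \<noteq> 0" using a_pos[of x] c by auto
    qed
    then have nz2: "\<forall>x\<in>{c..1}. (a x)\<^sup>2 \<noteq> 0" by simp
    show "continuous_on {c..1} F" "continuous_on {c..1} G" "continuous_on {c..1} A"
      unfolding F_def G_def A_def using nz nz2 by (auto intro!: continuous_intros)
  qed
  have local: "integral {c..1} F \<le> (g 1)\<^sup>2 / a 1 - (1 - K) * integral {c..1} G" if c: "0 < c" "c < 1" for c
  proof -
    note i = cs[OF c(1), THEN integrable_continuous_real]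
    have "((\<lambda>s. s * (g s)\<^sup>2 / a s) has_real_derivative (G s + F s - A s)) (at s within {c..1})" if s: "s \<in> {c..1}" for s
    proof -
      have s': "0 < s" "s \<le> 1" using s c by auto
      have a0: "a s \<noteq> 0" using a_pos[OF s'] by simp
      have "((\<lambda>s. s * (g s)\<^sup>2 / a s) has_real_derivative
          ((1 * (g s)\<^sup>2 + 2 * (g s) * h s * s) * a s - s * (g s)\<^sup>2 * D01 a s) / (a s * a s)) (at s within {0..1})"
        using s' a0
        by (auto intro!: derivative_eq_intros flux_dataD(6)[OF fd] a_DERIV)
      moreover have "((1 * (g s)\<^sup>2 + 2 * (g s) * h s * s) * a s - s * (g s)\<^sup>2 * D01 a s) / (a s * a s) = G s + F s - A s"
        using a0 by (simp add: F_def G_def A_def field_simps power2_eq_square)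
      ultimately have "((\<lambda>s. s * (g s)\<^sup>2 / a s) has_real_derivative (G s + F s - A s)) (at s within {0..1})" by simp
      then show ?thesis by (rule has_field_derivative_subset) (use c in auto)
    qed
    then have "((\<lambda>s. G s + F s - A s) has_integral (1 * (g 1)\<^sup>2 / a 1 - c * (g c)\<^sup>2 / a c)) {c..1}"
      using c by (intro fundamental_theorem_of_calculus) (auto simp: has_real_derivative_iff_has_vector_derivative)
    then have "integral {c..1} (\<lambda>s. G s + F s - A s) = (g 1)\<^sup>2 / a 1 - c * (g c)\<^sup>2 / a c"
      by (simp add: integral_unique)
    moreover have "integral {c..1} (\<lambda>s. G s + F s - A s) = integral {c..1} G + integral {c..1} F - integral {c..1} A"
      using i by (simp add: Henstock_Kurzweil_Integration.integral_diff Henstock_Kurzweil_Integration.integral_add integrable_add)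
    moreover have "0 \<le> c * (g c)\<^sup>2 / a c" using a_pos[of c] c by simp
    moreover have "integral {c..1} A \<le> integral {c..1} (\<lambda>s. K * G s)"
    proof (rule integral_le)
      show "(\<lambda>s. K * G s) integrable_on {c..1}" using i(2) by (rule integrable_on_mult_right)
      fix s assume s: "s \<in> {c..1}"
      then have s': "0 < s" "s \<le> 1" using c by auto
      have "s * D01 a s \<le> s * \<bar>D01 a s\<bar>" using s' by (intro mult_left_mono) auto
      then have "s * D01 a s \<le> K * a s" using a_deriv_bound[OF s'] by linarith
      then have "(s * D01 a s) * ((g s)\<^sup>2 / (a s)\<^sup>2) \<le> (K * a s) * ((g s)\<^sup>2 / (a s)\<^sup>2)" by (rule mult_right_mono) simp
      then show "A s \<le> K * G s" using a_pos[OF s'] by (simp add: A_def G_def power2_eq_square mult_ac)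
    qed (rule i(3))
    ultimately show ?thesis by (simp add: algebra_simps)
  qed
  have w: "wsq (D2 u)" by (rule K2a0_D2(2)[OF u])
  have c: "0 < 1 / (real n + 2)" "1 / (real n + 2) < 1" for n :: nat by auto
  \<comment> \<open>Since a u'' = g almost everywhere, the continuous functions F and G turn back
    into expressions in u'', whose integrals over (0, 1) exist.\<close>
  have 1: "integral {1 / (real n + 2)..1} F = (LINT s|I01. indicator {1 / (real n + 2)..1} s * (2 * (s * h s * D2 u s)))" for n
  proof -
    have ai: "F absolutely_integrable_on {1 / (real n + 2)..1}"
      by (rule absolutely_integrable_continuous_real[OF cs(1)[OF c(1)]])
    have "(LINT s|I01. indicator {1 / (real n + 2)..1} s * F s) = (LINT s|I01. indicator {1 / (real n + 2)..1} s * (2 * (s * h s * D2 u s)))"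
    proof (rule integral_cong_AE)
      show "AE s in I01. indicator {1 / (real n + 2)..1} s * F s = indicator {1 / (real n + 2)..1} s * (2 * (s * h s * D2 u s))"
        using ae AE_space
      proof eventually_elim
        case (elim s)
        then have "a s > 0" using a_pos[of s] by auto
        then have "F s = 2 * (s * h s * D2 u s)" unfolding F_def elim(1)[symmetric] by simp
        then show ?case by simp
      qed
      show "(\<lambda>s. indicator {1 / (real n + 2)..1} s * (2 * (s * h s * D2 u s))) \<in> borel_measurable I01"
        by (intro borel_measurable_times[OF borel_measurable_I01 borel_measurable_integrable]
            integrable_mult_right Pohozaev(2)[OF fd u]) measurable
    qed (rule borel_measurable_integrable[OF I01_interval_integral(1)[OF ai]], auto)
    then show ?thesis using I01_interval_integral(2)[OF ai] by simp
  qed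
  have 2: "integral {1 / (real n + 2)..1} G = (LINT s|I01. indicator {1 / (real n + 2)..1} s * (a s * (D2 u s)\<^sup>2))" for n
  proof -
    have ai: "G absolutely_integrable_on {1 / (real n + 2)..1}"
      by (rule absolutely_integrable_continuous_real[OF cs(2)[OF c(1)]])
    have "(LINT s|I01. indicator {1 / (real n + 2)..1} s * G s) = (LINT s|I01. indicator {1 / (real n + 2)..1} s * (a s * (D2 u s)\<^sup>2))"
    proof (rule integral_cong_AE)
      show "AE s in I01. indicator {1 / (real n + 2)..1} s * G s = indicator {1 / (real n + 2)..1} s * (a s * (D2 u s)\<^sup>2)"
        using ae AE_space
      proof eventually_elim
        case (elim s)
        then have "a s > 0" using a_pos[of s] by auto
        then have "G s = a s * (D2 u s)\<^sup>2" unfolding G_def elim(1)[symmetric] by (simp add: power2_eq_square)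
        then show ?case by simp
      qed
      show "(\<lambda>s. indicator {1 / (real n + 2)..1} s * (a s * (D2 u s)\<^sup>2)) \<in> borel_measurable I01"
        by (intro borel_measurable_times[OF borel_measurable_I01 borel_measurable_integrable]
            wsq_square(1)[OF w]) measurable
    qed (rule borel_measurable_integrable[OF I01_interval_integral(1)[OF ai]], auto)
    then show ?thesis using I01_interval_integral(2)[OF ai] by simp
  qed
  have "(LINT s|I01. 2 * (s * h s * D2 u s)) \<le> (g 1)\<^sup>2 / a 1 - (1 - K) * (LINT s|I01. a s * (D2 u s)\<^sup>2)"
  proof (rule LIMSEQ_le)
    show "(\<lambda>n. LINT s|I01. indicator {1 / (real n + 2)..1} s * (2 * (s * h s * D2 u s))) \<longlonglongrightarrow> (LINT s|I01. 2 * (s * h s * D2 u s))"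
      by (intro tail_integral_limit integrable_mult_right Pohozaev(2)[OF fd u])
    show "(\<lambda>n. (g 1)\<^sup>2 / a 1 - (1 - K) * (LINT s|I01. indicator {1 / (real n + 2)..1} s * (a s * (D2 u s)\<^sup>2)))
        \<longlonglongrightarrow> (g 1)\<^sup>2 / a 1 - (1 - K) * (LINT s|I01. a s * (D2 u s)\<^sup>2)"
      by (intro tendsto_intros tail_integral_limit wsq_square(1)[OF w])
    show "\<exists>N. \<forall>n\<ge>N. (LINT s|I01. indicator {1 / (real n + 2)..1} s * (2 * (s * h s * D2 u s)))
        \<le> (g 1)\<^sup>2 / a 1 - (1 - K) * (LINT s|I01. indicator {1 / (real n + 2)..1} s * (a s * (D2 u s)\<^sup>2))"
      using local[OF c] by (simp only: 1 2) blast
  qed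
  then show ?thesis by simp
qed

text \<open>Integrate (x v^2)' = v^2 + 2 x v v' over [c, 1], drop c v(c)^2 \<ge> 0 and let c tend to
  0.\<close>

lemma kinetic_bound:
  assumes v: "v \<in> K2a0 a"
  shows "2 * (LINT x|I01. v x * (x * D01 v x)) \<le> (v 1)\<^sup>2 - (LINT x|I01. (v x)\<^sup>2)"
proof -
  have L2v: "L2 v" by (rule L2_continuous[OF K2a0_continuous[OF v]])
  define F where "F x = (v x)\<^sup>2 + 2 * (v x * (x * D01 v x))" for x
  have iF: "integrable I01 F"
    unfolding F_def
    by (intro Bochner_Integration.integrable_add integrable_mult_right L2_square L2v L2_mult_integrable K2a0_multiplier(2)[OF v])
  have "(LINT s|I01. indicator {1 / (real n + 2)..1} s * F s) \<le> (v 1)\<^sup>2" for n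
  proof -
    define c where "c = 1 / (real n + 2)"
    have c: "0 < c" "c < 1" by (auto simp: c_def)
    have "((\<lambda>x. x * (v x)\<^sup>2) has_real_derivative F x) (at x within {c..1})" if x: "x \<in> {c..1}" for x
    proof -
      have "((\<lambda>x. x * (v x)\<^sup>2) has_real_derivative F x) (at x within {0..1})"
        unfolding F_def using x c
        by (auto intro!: derivative_eq_intros K2a0_DERIV[OF v])
      then show ?thesis by (rule has_field_derivative_subset) (use c in auto)
    qed
    then have hi: "(F has_integral (1 * (v 1)\<^sup>2 - c * (v c)\<^sup>2)) {c..1}"
      using c by (intro fundamental_theorem_of_calculus) (auto simp: has_real_derivative_iff_has_vector_derivative)
    have ai: "F absolutely_integrable_on {c..1}"
      by (rule integrable_I01_absolutely_integrable[OF iF]) (use c in auto)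
    have "(LINT s|I01. indicator {c..1} s * F s) = (v 1)\<^sup>2 - c * (v c)\<^sup>2"
      using I01_interval_integral(2)[OF ai] hi c by (simp add: integral_unique)
    then show ?thesis using c by (simp add: c_def)
  qed
  then have "(LINT s|I01. F s) \<le> (v 1)\<^sup>2"
    by (intro LIMSEQ_le_const2[OF tail_integral_limit[OF iF]]) auto
  moreover have "(LINT s|I01. F s) = (LINT x|I01. (v x)\<^sup>2) + 2 * (LINT x|I01. v x * (x * D01 v x))"
    unfolding F_def
    using L2_square[OF L2v] L2_mult_integrable[OF L2v K2a0_multiplier(2)[OF v]]
    by (simp add: integrable_mult_right)
  ultimately show ?thesis by simp
qed

lemma repr_lin:
  assumes f: "repr f q w" and f': "repr f' q' w'"
  shows "repr (\<lambda>x. c * f x + d * f' x) (c * q + d * q') (\<lambda>s. c * w s + d * w' s)"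
  unfolding repr_def
proof (intro conjI ballI impI)
  note w = repr_wsq[OF f] and w' = repr_wsq[OF f']
  show "wsq (\<lambda>s. c * w s + d * w' s)" by (rule wsq_lin[OF w w'])
  fix x :: real assume x: "x \<in> {0..1}"
  have i: "integrable I01 (\<lambda>s. min x s * w s)" "integrable I01 (\<lambda>s. min x s * w' s)"
    using x by (auto intro!: kernel_integrable(1) min_measurable w w')
  have "(LINT s|I01. min x s * (c * w s + d * w' s)) = (LINT s|I01. c * (min x s * w s) + d * (min x s * w' s))"
    by (simp add: algebra_simps)
  also have "\<dots> = c * (LINT s|I01. min x s * w s) + d * (LINT s|I01. min x s * w' s)"
    using i by simp
  finally have I: "(LINT s|I01. min x s * (c * w s + d * w' s))
      = c * (LINT s|I01. min x s * w s) + d * (LINT s|I01. min x s * w' s)" .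
  have e: "f x = x * q - (LINT s|I01. min x s * w s)" "f' x = x * q' - (LINT s|I01. min x s * w' s)"
    using repr_eq[OF f, of x] repr_eq[OF f', of x] x by auto
  show "c * f x + d * f' x = x * (c * q + d * q') - (LINT s|I01. min x s * (c * w s + d * w' s))"
    unfolding e I by (simp add: algebra_simps)
next
  assume WD: "weakly_degenerate a"
  show "c * q + d * q' = (LINT s|I01. c * w s + d * w' s)"
    using WD_integrable[OF WD repr_wsq[OF f]] WD_integrable[OF WD repr_wsq[OF f']] repr_WD[OF f WD] repr_WD[OF f' WD]
    by simp
qed

text \<open>Solutions of \<open>(a z'')'' = 0\<close> are those with \<open>a z'' = c + e x\<close>; in the strongly degenerate
  case the boundary condition at \<open>0\<close> forces \<open>c = 0\<close>.\<close>

definition affine_flux :: "(real \<Rightarrow> real) \<Rightarrow> real \<Rightarrow> real \<Rightarrow> real \<Rightarrow> bool" where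
  "affine_flux z d c e \<longleftrightarrow> repr z d (\<lambda>s. (c + e * s) / a s) \<and> (strongly_degenerate a \<longrightarrow> c = 0)"

lemma affine_flux_lin:
  assumes "affine_flux z d c e" "affine_flux z' d' c' e'"
  shows "affine_flux (\<lambda>x. p * z x + q * z' x) (p * d + q * d') (p * c + q * c') (p * e + q * e')"
proof -
  have "(\<lambda>s. p * ((c + e * s) / a s) + q * ((c' + e' * s) / a s)) = (\<lambda>s. (p * c + q * c' + (p * e + q * e') * s) / a s)"
    by (auto simp: add_divide_distrib[symmetric] algebra_simps)
  then show ?thesis
    using repr_lin[of z d _ z' d' _ p q] assms unfolding affine_flux_def by fastforce
qed

text \<open>The weight cancels and only moments of \<open>w\<close> remain: \<integral> s w = q -
  f(1), and either \<integral> w = q or c = 0.\<close>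

lemma affine_flux_pairing:
  assumes z: "affine_flux z d c e" and f: "repr f q w"
  shows "(LINT s|I01. (c + e * s) * w s) = c * q + e * (q - f 1)"
    and "(LINT s|I01. a s * (((c + e * s) / a s) * w s)) = c * q + e * (q - f 1)"
proof -
  note w = repr_wsq[OF f]
  show *: "(LINT s|I01. (c + e * s) * w s) = c * q + e * (q - f 1)"
    using deg
  proof
    assume WD: "weakly_degenerate a"
    have "(LINT s|I01. (c + e * s) * w s) = (LINT s|I01. c * w s + e * (s * w s))" by (simp add: algebra_simps)
    also have "\<dots> = c * (LINT s|I01. w s) + e * (LINT s|I01. s * w s)"
      using WD_integrable[OF WD w] wsq_integrable_id[OF w] by simp
    finally show ?thesis using repr_WD[OF f WD] repr_1[OF f] by simp
  next
    assume "strongly_degenerate a"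
    then have "c = 0" using z by (simp add: affine_flux_def)
    then show ?thesis using repr_1[OF f] by (simp add: mult.assoc)
  qed
  have "(LINT s|I01. a s * (((c + e * s) / a s) * w s)) = (LINT s|I01. (c + e * s) * w s)"
  proof (rule Bochner_Integration.integral_cong[OF refl])
    fix s assume "s \<in> space I01"
    then have "a s \<noteq> 0" using a_pos[of s] by auto
    then show "a s * ((c + e * s) / a s * w s) = (c + e * s) * w s" by simp
  qed
  then show "(LINT s|I01. a s * (((c + e * s) / a s) * w s)) = c * q + e * (q - f 1)" using * by simp
qed

text \<open>s / sqrt a is always square integrable, and 1 / sqrt a is so under weak degeneracy; in
  the other case c = 0.\<close>

lemma affine_fluxI:
  assumes c: "strongly_degenerate a \<Longrightarrow> c = 0"
    and d: "weakly_degenerate a \<Longrightarrow> d = (LINT s|I01. (c + e * s) / a s)"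
  shows "affine_flux (\<lambda>x. x * d - (LINT s|I01. min x s * ((c + e * s) / a s))) d c e"
proof -
  have s: "L2 (\<lambda>s. s / sqrt (a s))" by (rule kernel_L2(1)) (auto simp: measurable_id_I01)
  have 1: "L2 (\<lambda>s. c * (1 / sqrt (a s)) + e * (s / sqrt (a s)))"
    using deg
  proof
    assume "weakly_degenerate a"
    then show ?thesis by (intro L2_lin s WD_inverse_L2)
  next
    assume "strongly_degenerate a"
    then show ?thesis using L2_lin[OF s s, of 0 e] c by simp
  qed
  have 2: "(\<lambda>s. (c + e * s) / a s) \<in> borel_measurable I01"
    using a_measurable measurable_id_I01 by measurable
  have 3: "c * (1 / sqrt (a s)) + e * (s / sqrt (a s)) = sqrt (a s) * ((c + e * s) / a s)" if "s \<in> space I01" for s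
  proof -
    define t where "t = sqrt (a s)"
    have t: "t > 0" "a s = t * t" using sqrt_a_mult[OF that] by (simp_all add: t_def)
    have "(c + e * s) / sqrt (a s) = sqrt (a s) * ((c + e * s) / a s)"
      unfolding t_def[symmetric] t(2) using t(1) by simp
    then show ?thesis by (simp add: add_divide_distrib)
  qed
  have "L2 (\<lambda>s. sqrt (a s) * ((c + e * s) / a s))"
  proof (rule L2_cong_AE[OF 1])
    show "AE s in I01. c * (1 / sqrt (a s)) + e * (s / sqrt (a s)) = sqrt (a s) * ((c + e * s) / a s)"
      by (rule AE_I2) (rule 3)
    show "(\<lambda>s. sqrt (a s) * ((c + e * s) / a s)) \<in> borel_measurable I01"
      by (intro borel_measurable_times 2 measurable_compose[OF a_measurable borel_measurable_sqrt])
  qed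
  then have "wsq (\<lambda>s. (c + e * s) / a s)" using 2 by (simp add: wsq_def)
  then show ?thesis using c d by (auto simp: affine_flux_def repr_def)
qed

end

section \<open>The stationary problem\<close>

lemma integral_lin:
  fixes f g :: "'a \<Rightarrow> real"
  assumes "integrable M f" "integrable M g"
  shows "(LINT s|M. c * f s + e * g s) = c * (LINT s|M. f s) + e * (LINT s|M. g s)"
  using assms by simp

text \<open>Scalars of a stationary solution: z and d are its value and slope at 1, p and q its
  boundary data, I its interior energy. Testing the equation with the solution gives A = p z + q d,
  quadratic on the left and linear on the right, so Young's or the Cauchy-Schwarz inequality bounds
  A by the data.\<close>

lemma elliptic_algebra:
  fixes I A \<beta> \<gamma> C1 C2 m z d p q :: real
  assumes I: "I \<ge> 0" and pos: "\<beta> > 0" "\<gamma> > 0" and C: "C1 \<ge> 2" "C1 \<ge> m" "C2 \<ge> 1" "C2 \<ge> 1 / \<gamma>"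
    and z: "z\<^sup>2 \<le> 2 * d\<^sup>2 + m * I"
    and A: "A = I + \<beta> * z\<^sup>2 + \<gamma> * d\<^sup>2" "A = p * z + q * d"
  shows "2 * d\<^sup>2 + m * I \<le> C1 * C2 * A"
    and "A \<le> p\<^sup>2 / \<beta> + q\<^sup>2 / \<gamma>"
    and "A \<le> 3/2 * C1 * C2 * (p\<^sup>2 + q\<^sup>2)"
    and "z\<^sup>2 + d\<^sup>2 \<le> 3/2 * C1 * C2 * (1/\<beta> + 1/\<gamma>) * (p\<^sup>2 + q\<^sup>2)"
proof -
  have g: "C2 * \<gamma> \<ge> 1" using C(4) pos by (simp add: field_simps)
  have A0: "A \<ge> 0" using I pos by (simp add: A(1))
  have dA: "\<gamma> * d\<^sup>2 \<le> A" and zA: "\<beta> * z\<^sup>2 \<le> A" using I pos by (simp_all add: A(1))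
  have d2: "d\<^sup>2 \<le> C2 * (\<gamma> * d\<^sup>2)" using mult_right_mono[OF g, of "d\<^sup>2"] by (simp add: mult.assoc)
  have "2 * d\<^sup>2 + m * I \<le> C1 * d\<^sup>2 + C1 * I" using C I by (intro add_mono mult_right_mono) auto
  also have "\<dots> = C1 * (d\<^sup>2 + I)" by (simp add: algebra_simps)
  also have "\<dots> \<le> C1 * (C2 * (\<gamma> * d\<^sup>2) + C2 * I)"
  proof (intro mult_left_mono add_mono d2)
    show "I \<le> C2 * I" using mult_right_mono[OF C(3) I] by simp
  qed (use C in auto)
  also have "\<dots> = C1 * C2 * (\<gamma> * d\<^sup>2 + I)" by (simp add: algebra_simps)
  also have "\<dots> \<le> C1 * C2 * A" using C pos by (intro mult_left_mono) (auto simp: A(1))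
  finally show 1: "2 * d\<^sup>2 + m * I \<le> C1 * C2 * A" .
  have yng: "2 * (x * y) \<le> b * y\<^sup>2 + x\<^sup>2 / b" if "b > 0" for b x y :: real
  proof -
    have "0 \<le> (b * y - x)\<^sup>2 / b" using that by simp
    then show ?thesis using that by (simp add: field_simps power2_eq_square)
  qed
  show "A \<le> p\<^sup>2 / \<beta> + q\<^sup>2 / \<gamma>"
    using yng[OF pos(1), of p z] yng[OF pos(2), of q d] A I by linarith
  \<comment> \<open>z^2 contributes C1 C2 A, and d^2 at most half of that since C1 \<ge> 2; whence
    the 3/2.\<close>
  define \<tau> where "\<tau> = 3/2 * C1 * C2"
  have \<tau>: "\<tau> > 0" using C by (simp add: \<tau>_def)
  have "d\<^sup>2 \<le> C2 * A" using d2 mult_left_mono[OF dA, of C2] C by linarith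
  also have "\<dots> \<le> (C1 / 2 * C2) * A"
    using C A0 by (intro mult_right_mono) auto
  finally have zd: "z\<^sup>2 + d\<^sup>2 \<le> \<tau> * A" using z 1 by (simp add: \<tau>_def)
  have cs: "A\<^sup>2 \<le> (p\<^sup>2 + q\<^sup>2) * (z\<^sup>2 + d\<^sup>2)"
  proof -
    have "0 \<le> (p * d - q * z)\<^sup>2" by simp
    then show ?thesis unfolding A(2) by (simp add: power2_eq_square algebra_simps)
  qed
  have "A * A \<le> (\<tau> * (p\<^sup>2 + q\<^sup>2)) * A"
    using cs mult_left_mono[OF zd, of "p\<^sup>2 + q\<^sup>2"] by (simp add: power2_eq_square algebra_simps)
  then show 3: "A \<le> 3/2 * C1 * C2 * (p\<^sup>2 + q\<^sup>2)"
    using A0 \<tau> mult_right_le_imp_le[of A A "\<tau> * (p\<^sup>2 + q\<^sup>2)"]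
    by (cases "A = 0") (auto simp: \<tau>_def)
  have "z\<^sup>2 \<le> A / \<beta>" "d\<^sup>2 \<le> A / \<gamma>" using zA dA pos by (simp_all add: field_simps)
  then have "z\<^sup>2 + d\<^sup>2 \<le> (1/\<beta> + 1/\<gamma>) * A" by (simp add: algebra_simps)
  also have "\<dots> \<le> (1/\<beta> + 1/\<gamma>) * (3/2 * C1 * C2 * (p\<^sup>2 + q\<^sup>2))"
    using pos by (intro mult_left_mono 3) auto
  finally show "z\<^sup>2 + d\<^sup>2 \<le> 3/2 * C1 * C2 * (1/\<beta> + 1/\<gamma>) * (p\<^sup>2 + q\<^sup>2)" by (simp only: mult_ac)
qed

context degenerate
begin

lemma C1c_bounds: "C1c (a 1) K \<ge> 2" "C1c (a 1) K \<ge> 2 / (a 1 * (2 - K))"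
  by (auto simp: C1c_def)

lemma C2c_bounds: "C2c \<gamma> \<ge> 1" "C2c \<gamma> \<ge> 1 / \<gamma>"
  by (auto simp: C2c_def)

text \<open>A linear system for the parameters with positive determinant. Under strong degeneracy
  the unknowns are d and e; under weak degeneracy they are c and e, and d is determined by
  them.\<close>

lemma ex_affine_flux:
  assumes pos: "\<beta> > 0" "\<gamma> > 0"
  shows "\<exists>z d c e. affine_flux z d c e \<and> \<beta> * z 1 - e = p \<and> \<gamma> * d + c + e = q"
  using deg
proof
  assume SD: "strongly_degenerate a"
  then have nWD: "\<not> weakly_degenerate a" using WD_K SD_K by force
  define M where "M = (LINT s|I01. s * (s / a s))"
  have M: "M \<ge> 0"
    unfolding M_def
  proof (rule Bochner_Integration.integral_nonneg)
    fix s assume "s \<in> space I01"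
    then show "0 \<le> s * (s / a s)" using a_pos[of s] by auto
  qed
  \<comment> \<open>From inserting e = q - \<gamma> d and z(1) = d - e M into the first boundary
    condition.\<close>
  define d where "d = (p + (\<beta> * M + 1) * q) / (\<beta> + \<gamma> * (\<beta> * M + 1))"
  define e where "e = q - \<gamma> * d"
  define z where "z x = x * d - (LINT s|I01. min x s * ((0 + e * s) / a s))" for x
  have z: "affine_flux z d 0 e" unfolding z_def by (rule affine_fluxI) (use nWD in auto)
  have "repr z d (\<lambda>s. (0 + e * s) / a s)" using z unfolding affine_flux_def by blast
  then have "(LINT s|I01. s * ((0 + e * s) / a s)) = d - z 1" by (rule repr_1)
  moreover have "(LINT s|I01. s * ((0 + e * s) / a s)) = e * M"
    unfolding M_def by (subst integral_mult_right_zero[symmetric]) (simp add: mult_ac)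
  ultimately have z1: "z 1 = d - e * M" by simp
  have "\<beta> + \<gamma> * (\<beta> * M + 1) > 0" using pos M by (simp add: add_pos_nonneg)
  then have "d * (\<beta> + \<gamma> * (\<beta> * M + 1)) = p + (\<beta> * M + 1) * q" by (simp add: d_def)
  then have "\<beta> * z 1 - e = p" unfolding z1 e_def by (simp add: algebra_simps)
  then show ?thesis using z by (intro exI[of _ z] exI[of _ d] exI[of _ 0] exI[of _ e]) (simp add: e_def)
next
  assume WD: "weakly_degenerate a"
  then have nSD: "\<not> strongly_degenerate a" using WD_K SD_K by force
  have L0: "L2 (\<lambda>s. 1 / sqrt (a s))" by (rule WD_inverse_L2[OF WD])
  have L1: "L2 (\<lambda>s. s / sqrt (a s))" by (rule kernel_L2(1)) (auto simp: measurable_id_I01)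
  have sq: "1 / sqrt (a s) * (1 / sqrt (a s)) = 1 / a s" "1 / sqrt (a s) * (s / sqrt (a s)) = s / a s"
    "s / sqrt (a s) * (s / sqrt (a s)) = s\<^sup>2 / a s" if "s \<in> space I01" for s
    using sqrt_a_mult[OF that] by (simp_all add: power2_eq_square)
  define M0 M1 M2 where "M0 = (LINT s|I01. 1 / a s)" "M1 = (LINT s|I01. s / a s)" "M2 = (LINT s|I01. s\<^sup>2 / a s)"
  note M_def = this
  have i: "integrable I01 (\<lambda>s. 1 / a s)" "integrable I01 (\<lambda>s. s / a s)" "integrable I01 (\<lambda>s. s\<^sup>2 / a s)"
    using I01_integrable_cong[OF L2_mult_integrable[OF L0 L0] sq(1)]
      I01_integrable_cong[OF L2_mult_integrable[OF L0 L1] sq(2)]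
      I01_integrable_cong[OF L2_mult_integrable[OF L1 L1] sq(3)] by auto
  have M0: "(LINT s|I01. (1 / sqrt (a s))\<^sup>2) = M0"
    unfolding M_def power2_eq_square by (rule Bochner_Integration.integral_cong[OF refl sq(1)])
  have M1: "(LINT s|I01. 1 / sqrt (a s) * (s / sqrt (a s))) = M1"
    unfolding M_def by (rule Bochner_Integration.integral_cong[OF refl sq(2)])
  have M2: "(LINT s|I01. (s / sqrt (a s))\<^sup>2) = M2"
    unfolding M_def
  proof (rule Bochner_Integration.integral_cong[OF refl])
    fix s assume "s \<in> space I01"
    from sq(3)[OF this] show "(s / sqrt (a s))\<^sup>2 = s\<^sup>2 / a s" by (simp only: power2_eq_square)
  qed
  have "M1\<^sup>2 \<le> M0 * M2" using L2_Cauchy_Schwarz[OF L0 L1] unfolding M0 M1 M2 .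
  then have MM: "0 \<le> \<beta> * \<gamma> * (M0 * M2 - M1 * M1)" using pos by (simp add: power2_eq_square)
  have "(LINT s|I01. (1 - s)\<^sup>2 / a s) = (LINT s|I01. 1 / a s - 2 * (s / a s) + s\<^sup>2 / a s)"
    by (simp add: power2_diff diff_divide_distrib add_divide_distrib algebra_simps)
  also have "\<dots> = M0 - 2 * M1 + M2"
    unfolding M_def
    by (subst Bochner_Integration.integral_add[OF Bochner_Integration.integrable_diff[OF i(1) integrable_mult_right[OF i(2)]] i(3)],
        subst Bochner_Integration.integral_diff[OF i(1) integrable_mult_right[OF i(2)]], subst integral_mult_right_zero, rule refl)
  finally have "M0 - 2 * M1 + M2 = (LINT s|I01. (1 - s)\<^sup>2 / a s)" by simp
  moreover have "(LINT s|I01. (1 - s)\<^sup>2 / a s) \<ge> 0"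
  proof (rule Bochner_Integration.integral_nonneg)
    fix s assume "s \<in> space I01"
    then show "0 \<le> (1 - s)\<^sup>2 / a s" using a_pos[of s] by auto
  qed
  ultimately have "0 \<le> \<beta> * (M0 - 2 * M1 + M2)" using pos by simp
  moreover have "M0 \<ge> 0"
    unfolding M_def
  proof (rule Bochner_Integration.integral_nonneg)
    fix s assume "s \<in> space I01"
    then show "0 \<le> 1 / a s" using a_pos[of s] by auto
  qed
  then have "0 \<le> \<gamma> * M0" using pos by simp
  \<comment> \<open>Positive by Cauchy-Schwarz for 1 / sqrt a and s / sqrt a, and because M0 - 2 M1
    + M2 is the integral of (1 - s)^2 / a.\<close>
  ultimately have D: "\<beta> * \<gamma> * (M0 * M2 - M1 * M1) + \<beta> * (M0 - 2 * M1 + M2) + \<gamma> * M0 + 1 > 0" (is "?D > 0")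
    using MM by linarith
  \<comment> \<open>Cramer's rule for \<beta> (M0 - M1) c + (\<beta> (M1 - M2) - 1) e = p and
    (\<gamma> M0 + 1) c + (\<gamma> M1 + 1) e = q.\<close>
  define c where "c = (p * (\<gamma> * M1 + 1) - q * (\<beta> * (M1 - M2) - 1)) / ?D"
  define e where "e = (\<beta> * (M0 - M1) * q - (\<gamma> * M0 + 1) * p) / ?D"
  define d where "d = c * M0 + e * M1"
  have cD: "c * ?D = p * (\<gamma> * M1 + 1) - q * (\<beta> * (M1 - M2) - 1)"
    and eD: "e * ?D = \<beta> * (M0 - M1) * q - (\<gamma> * M0 + 1) * p" using D by (simp_all add: c_def e_def)
  have "d = (LINT s|I01. c * (1 / a s) + e * (s / a s))" unfolding integral_lin[OF i(1,2)] d_def M_def ..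
  then have dw: "d = (LINT s|I01. (c + e * s) / a s)" by (simp add: add_divide_distrib)
  define z where "z x = x * d - (LINT s|I01. min x s * ((c + e * s) / a s))" for x
  have z: "affine_flux z d c e" unfolding z_def by (rule affine_fluxI) (use nSD dw in auto)
  have "repr z d (\<lambda>s. (c + e * s) / a s)" using z unfolding affine_flux_def by blast
  then have "(LINT s|I01. s * ((c + e * s) / a s)) = d - z 1" by (rule repr_1)
  moreover have "(LINT s|I01. s * ((c + e * s) / a s)) = (LINT s|I01. c * (s / a s) + e * (s\<^sup>2 / a s))"
    by (simp add: add_divide_distrib algebra_simps power2_eq_square)
  moreover have "(LINT s|I01. c * (s / a s) + e * (s\<^sup>2 / a s)) = c * M1 + e * M2"
    unfolding integral_lin[OF i(2,3)] M_def ..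
  ultimately have z1: "z 1 = d - (c * M1 + e * M2)" by simp
  have "(\<beta> * z 1 - e - p) * ?D = (\<beta> * (M0 - M1)) * (c * ?D) + (\<beta> * (M1 - M2) - 1) * (e * ?D) - p * ?D"
    unfolding z1 d_def by (simp add: algebra_simps)
  also have "\<dots> = 0" unfolding cD eD by (simp add: algebra_simps)
  finally have "\<beta> * z 1 - e = p" using D by simp
  moreover have "(\<gamma> * d + c + e - q) * ?D = (\<gamma> * M0 + 1) * (c * ?D) + (\<gamma> * M1 + 1) * (e * ?D) - q * ?D"
    unfolding d_def by (simp add: algebra_simps)
  then have "(\<gamma> * d + c + e - q) * ?D = 0" unfolding cD eD by (simp add: algebra_simps)
  then have "\<gamma> * d + c + e = q" using D by simp
  ultimately show ?thesis using z by blast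
qed

text \<open>Pairing the solution with itself supplies A = p z + q d for
  \<open>elliptic_algebra\<close>. The bound by p^2 / \<beta> + q^2 / \<gamma> serves the size of
  the Lyapunov functional, those by p^2 + q^2 its derivative.\<close>

lemma affine_flux_bounds:
  assumes pos: "\<beta> > 0" "\<gamma> > 0" and z: "affine_flux z d c e"
    and bc: "\<beta> * z 1 - e = p" "\<gamma> * d + c + e = q"
  shows "L2 z" "(LINT x|I01. (z x)\<^sup>2) \<le> C1c (a 1) K * C2c \<gamma> * (p\<^sup>2 / \<beta> + q\<^sup>2 / \<gamma>)"
    "(LINT x|I01. (z x)\<^sup>2) \<le> 3/2 * (C1c (a 1) K)\<^sup>2 * (C2c \<gamma>)\<^sup>2 * (p\<^sup>2 + q\<^sup>2)"
    "(z 1)\<^sup>2 + d\<^sup>2 \<le> 3/2 * C1c (a 1) K * C2c \<gamma> * (1/\<beta> + 1/\<gamma>) * (p\<^sup>2 + q\<^sup>2)"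
proof -
  have r: "repr z d (\<lambda>s. (c + e * s) / a s)" using z by (simp add: affine_flux_def)
  define I where "I = (LINT s|I01. a s * ((c + e * s) / a s)\<^sup>2)"
  have I: "I = c * d + e * (d - z 1)"
    using affine_flux_pairing(2)[OF z r] by (simp add: I_def power2_eq_square)
  have I0: "I \<ge> 0" unfolding I_def by (rule wsq_square(3)[OF repr_wsq[OF r]])
  define A where "A = I + \<beta> * (z 1)\<^sup>2 + \<gamma> * d\<^sup>2"
  have A: "A = p * z 1 + q * d" unfolding A_def I bc[symmetric] by (simp add: power2_eq_square algebra_simps)
  have z1: "(z 1)\<^sup>2 \<le> 2 * d\<^sup>2 + 2 / (a 1 * (2 - K)) * I" using repr_bound[OF r, of 1] by (simp add: I_def)
  have zi: "(LINT x|I01. (z x)\<^sup>2) \<le> 2 * d\<^sup>2 + 2 / (a 1 * (2 - K)) * I" using repr_integrable(3)[OF r] by (simp add: I_def)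
  note E = elliptic_algebra[OF I0 pos C1c_bounds(1,2) C2c_bounds(1,2) z1 A_def A]
  have CC: "0 \<le> C1c (a 1) K * C2c \<gamma>" using C1c_bounds(1) C2c_bounds(1)[of \<gamma>] by simp
  show "L2 z" by (rule repr_integrable(2)[OF r])
  show "(LINT x|I01. (z x)\<^sup>2) \<le> C1c (a 1) K * C2c \<gamma> * (p\<^sup>2 / \<beta> + q\<^sup>2 / \<gamma>)"
    using zi E(1) mult_left_mono[OF E(2) CC] by linarith
  have "C1c (a 1) K * C2c \<gamma> * A \<le> C1c (a 1) K * C2c \<gamma> * (3/2 * C1c (a 1) K * C2c \<gamma> * (p\<^sup>2 + q\<^sup>2))"
    by (rule mult_left_mono[OF E(3) CC])
  then show "(LINT x|I01. (z x)\<^sup>2) \<le> 3/2 * (C1c (a 1) K)\<^sup>2 * (C2c \<gamma>)\<^sup>2 * (p\<^sup>2 + q\<^sup>2)"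
    using zi E(1) by (simp add: power2_eq_square mult_ac)
  show "(z 1)\<^sup>2 + d\<^sup>2 \<le> 3/2 * C1c (a 1) K * C2c \<gamma> * (1/\<beta> + 1/\<gamma>) * (p\<^sup>2 + q\<^sup>2)" by (rule E(4))
qed

end

section \<open>The Lyapunov functional\<close>

text \<open>The scalars belong to a domain element (u, v): p, q and r, s are value and slope at 1 of
  u and of v; g, h those of a u''; J1, J2, J4 are integrals produced by the multiplier; z, d are the
  traces of the stationary solution with data p, q. The left side is the derivative of the Lyapunov
  functional. \<open>\<Lambda>\<close> has to beat the p^2 and q^2 left by J1, and
  \<open>\<kappa>\<close> all r^2 and s^2.\<close>

lemma dissipation_algebra:
  fixes \<beta> \<gamma> \<epsilon> \<delta> \<Lambda> \<kappa> \<kappa>0 K a1 Ia Iv J1 J2 J4 S g h p q r s z d R \<tau> :: real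
  assumes pos: "\<beta> > 0" "\<gamma> > 0" "\<epsilon> > 0" "\<delta> > 0" "a1 > 0" and K: "K < 2" "0 < K" "\<epsilon> \<le> 2 - K"
    and I0: "Ia \<ge> 0" "Iv \<ge> 0"
    and J1: "J1 = q * (h - g) - S + Ia" and S: "2 * S \<le> g\<^sup>2 / a1 - (1 - K) * Ia"
    and J2: "2 * J2 \<le> r\<^sup>2 - Iv"
    and J4: "2 * J4 \<le> \<delta> * Iv + R * (r\<^sup>2 + s\<^sup>2) / \<delta>"
    and zd: "z\<^sup>2 + d\<^sup>2 \<le> \<tau> * (p\<^sup>2 + q\<^sup>2)" and \<tau>: "\<tau> > 0"
    and h: "h = \<beta> * p + r" and g: "g = - (\<gamma> * q + s)"
    and \<Lambda>: "\<Lambda> \<ge> \<beta> + \<epsilon> * (\<beta>/2)" "\<Lambda> \<ge> \<beta> + 1 + 2 * \<gamma>\<^sup>2 / a1 + \<epsilon> * (\<gamma>/2)"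
    and \<kappa>0: "\<kappa>0 \<ge> 2" "\<kappa>0 \<ge> 2 / a1 + 1 / (2 * \<gamma>)"
    and \<kappa>: "\<kappa> \<ge> \<kappa>0 + \<Lambda> * (\<tau> + R / \<delta>)"
  shows "- \<kappa> * (r\<^sup>2 + s\<^sup>2) - 2 * J1 - 2 * \<Lambda> * (p\<^sup>2 + q\<^sup>2 + r * z + s * d) + 2 * J2 + 2 * \<Lambda> * J4
      \<le> - (\<epsilon> - 2 * \<Lambda> * \<delta>) * (1/2 * (Ia + Iv + \<beta> * p\<^sup>2 + \<gamma> * q\<^sup>2))"
proof -
  have \<Lambda>0: "\<Lambda> > 0"
  proof -
    have "0 < \<beta> + \<epsilon> * (\<beta>/2)" using pos by (simp add: add_pos_pos)
    then show ?thesis using \<Lambda>(1) by linarith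
  qed
  have a1: "- 2 * q * h \<le> \<beta> * (p\<^sup>2 + q\<^sup>2) + q\<^sup>2 + r\<^sup>2"
  proof -
    have "0 \<le> \<beta> * (p + q)\<^sup>2 + (q + r)\<^sup>2" using pos by simp
    then show ?thesis by (simp add: h power2_eq_square algebra_simps)
  qed
  have a2: "2 * q * g \<le> s\<^sup>2 / (2 * \<gamma>)"
  proof -
    have "0 \<le> (2 * \<gamma> * q + s)\<^sup>2 / (2 * \<gamma>)" using pos by simp
    then show ?thesis using pos by (simp add: g power2_eq_square field_simps)
  qed
  have a3: "g\<^sup>2 / a1 \<le> 2 * \<gamma>\<^sup>2 / a1 * q\<^sup>2 + 2 / a1 * s\<^sup>2"
  proof -
    have "0 \<le> (\<gamma> * q - s)\<^sup>2" by simp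
    then have "g\<^sup>2 \<le> 2 * \<gamma>\<^sup>2 * q\<^sup>2 + 2 * s\<^sup>2" by (simp add: g power2_eq_square algebra_simps)
    then have "g\<^sup>2 / a1 \<le> (2 * \<gamma>\<^sup>2 * q\<^sup>2 + 2 * s\<^sup>2) / a1" using pos by (intro divide_right_mono) auto
    then show ?thesis by (simp add: add_divide_distrib)
  qed
  have X1: "- 2 * J1 + 2 * J2 \<le> - Iv - (3 - K) * Ia + \<beta> * p\<^sup>2 + (\<beta> + 1 + 2 * \<gamma>\<^sup>2 / a1) * q\<^sup>2
      + 2 * r\<^sup>2 + (2 / a1 + 1 / (2 * \<gamma>)) * s\<^sup>2"
  proof -
    have "- 2 * J1 + 2 * J2 \<le> - 2 * q * h + 2 * q * g + g\<^sup>2 / a1 - (3 - K) * Ia + r\<^sup>2 - Iv"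
      using S J2 unfolding J1 by (simp add: algebra_simps)
    then show ?thesis using a1 a2 a3 by (simp add: algebra_simps)
  qed
  \<comment> \<open>From 0 < K and \<epsilon> \<le> 2 - K follow \<epsilon>/2 \<le> 1 and
    \<epsilon>/2 \<le> 3 - K.\<close>
  have X2: "- Iv - (3 - K) * Ia \<le> - (\<epsilon> / 2) * (Iv + Ia)"
  proof -
    have "(\<epsilon> / 2) * Iv \<le> 1 * Iv" by (rule mult_right_mono) (use K I0 in linarith)+
    moreover have "(\<epsilon> / 2) * Ia \<le> (3 - K) * Ia" by (rule mult_right_mono) (use K I0 in linarith)+
    ultimately show ?thesis unfolding distrib_left left_diff_distrib by linarith
  qed
  have X3: "2 * r\<^sup>2 + (2 / a1 + 1 / (2 * \<gamma>)) * s\<^sup>2 \<le> \<kappa>0 * (r\<^sup>2 + s\<^sup>2)"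
    using mult_right_mono[OF \<kappa>0(1), of "r\<^sup>2"] mult_right_mono[OF \<kappa>0(2), of "s\<^sup>2"] by (simp add: algebra_simps)
  \<comment> \<open>Young's inequality with weight \<open>\<tau>\<close>, so that \<open>zd\<close>
    turns z^2 + d^2 into exactly one p^2 + q^2. The factor 2 in front of \<open>\<Lambda>\<close>
    pays for it and leaves one \<open>\<Lambda>\<close>.\<close>
  have X4: "- 2 * (r * z + s * d) \<le> (p\<^sup>2 + q\<^sup>2) + \<tau> * (r\<^sup>2 + s\<^sup>2)"
  proof -
    have "0 \<le> (\<tau> * r + z)\<^sup>2 / \<tau> + (\<tau> * s + d)\<^sup>2 / \<tau>" using \<tau> by simp
    also have "\<dots> = \<tau> * (r\<^sup>2 + s\<^sup>2) + 2 * (r * z + s * d) + (z\<^sup>2 + d\<^sup>2) / \<tau>"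
      using \<tau> by (simp add: power2_eq_square field_simps)
    finally have "- 2 * (r * z + s * d) \<le> \<tau> * (r\<^sup>2 + s\<^sup>2) + (z\<^sup>2 + d\<^sup>2) / \<tau>" by linarith
    moreover have "(z\<^sup>2 + d\<^sup>2) / \<tau> \<le> p\<^sup>2 + q\<^sup>2" using zd \<tau> by (simp add: field_simps)
    ultimately show ?thesis by linarith
  qed
  have X5: "- 2 * \<Lambda> * (p\<^sup>2 + q\<^sup>2 + r * z + s * d) + 2 * \<Lambda> * J4
      \<le> - \<Lambda> * (p\<^sup>2 + q\<^sup>2) + \<Lambda> * \<delta> * Iv + \<Lambda> * (\<tau> + R / \<delta>) * (r\<^sup>2 + s\<^sup>2)"
    using mult_left_mono[OF X4, of \<Lambda>] mult_left_mono[OF J4, of \<Lambda>] \<Lambda>0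
    by (simp add: algebra_simps add_divide_distrib)
  have X6: "(\<kappa>0 + \<Lambda> * (\<tau> + R / \<delta>)) * (r\<^sup>2 + s\<^sup>2) \<le> \<kappa> * (r\<^sup>2 + s\<^sup>2)" by (rule mult_right_mono[OF \<kappa>]) simp
  have X7: "\<beta> * p\<^sup>2 - \<Lambda> * p\<^sup>2 \<le> - (\<epsilon> * (\<beta>/2)) * p\<^sup>2"
    using mult_right_mono[OF \<Lambda>(1), of "p\<^sup>2"] by (simp add: algebra_simps)
  have X8: "(\<beta> + 1 + 2 * \<gamma>\<^sup>2 / a1) * q\<^sup>2 - \<Lambda> * q\<^sup>2 \<le> - (\<epsilon> * (\<gamma>/2)) * q\<^sup>2"
    using mult_right_mono[OF \<Lambda>(2), of "q\<^sup>2"] by (simp add: algebra_simps)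
  have X9: "\<Lambda> * \<delta> * Iv \<le> \<Lambda> * \<delta> * (Ia + Iv + \<beta> * p\<^sup>2 + \<gamma> * q\<^sup>2)"
    using \<Lambda>0 pos I0 by (intro mult_left_mono) (auto simp: add_nonneg_nonneg)
  have "- \<kappa> * (r\<^sup>2 + s\<^sup>2) - 2 * J1 - 2 * \<Lambda> * (p\<^sup>2 + q\<^sup>2 + r * z + s * d) + 2 * J2 + 2 * \<Lambda> * J4
    \<le> - \<kappa> * (r\<^sup>2 + s\<^sup>2) + (- (\<epsilon> / 2) * (Iv + Ia) + \<beta> * p\<^sup>2 + (\<beta> + 1 + 2 * \<gamma>\<^sup>2 / a1) * q\<^sup>2 + \<kappa>0 * (r\<^sup>2 + s\<^sup>2))
      + (- \<Lambda> * (p\<^sup>2 + q\<^sup>2) + \<Lambda> * \<delta> * Iv + \<Lambda> * (\<tau> + R / \<delta>) * (r\<^sup>2 + s\<^sup>2))"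
    using X1 X2 X3 X5 by linarith
  also have "\<dots> \<le> - (\<epsilon> / 2) * (Iv + Ia) - (\<epsilon> * (\<beta>/2)) * p\<^sup>2 - (\<epsilon> * (\<gamma>/2)) * q\<^sup>2 + \<Lambda> * \<delta> * (Ia + Iv + \<beta> * p\<^sup>2 + \<gamma> * q\<^sup>2)"
    using X6 X7 X8 X9 by (simp add: distrib_right distrib_left)
  also have "\<dots> = - (\<epsilon> - 2 * \<Lambda> * \<delta>) * (1/2 * (Ia + Iv + \<beta> * p\<^sup>2 + \<gamma> * q\<^sup>2))" by (simp add: field_simps)
  finally show ?thesis .
qed

text \<open>The multiplier \<open>2 x y' + 2 \<Lambda> z\<close>, where \<open>z = y(1) \<phi>\<^sub>1 + y'(1) \<phi>\<^sub>2\<close> solves the stationary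
  problem with the boundary data of \<open>y\<close>.\<close>

definition multiplier :: "real \<Rightarrow> (real \<Rightarrow> real) \<Rightarrow> (real \<Rightarrow> real) \<Rightarrow> (real \<Rightarrow> real) \<Rightarrow> real \<Rightarrow> real" where
  "multiplier \<Lambda> \<phi>1 \<phi>2 u x = 2 * (x * D01 u x) + 2 * \<Lambda> * (u 1 * \<phi>1 x + D01 u 1 * \<phi>2 x)"

text \<open>The square of \<open>norm_K0\<close>, that is, twice the energy.\<close>

definition sq_energy :: "(real \<Rightarrow> real) \<Rightarrow> real \<Rightarrow> real \<Rightarrow> state \<Rightarrow> real" where
  "sq_energy a \<beta> \<gamma> x = (LINT s|I01. a s * (D2 (fst x) s)\<^sup>2) + (LINT s|I01. (snd x s)\<^sup>2)
     + \<beta> * (fst x 1)\<^sup>2 + \<gamma> * (D01 (fst x) 1)\<^sup>2"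

locale damped_beam = degenerate +
  fixes \<beta> \<gamma> \<epsilon> \<delta> :: real
  assumes \<beta>: "\<beta> > 0" and \<gamma>: "\<gamma> > 0" and \<epsilon>: "0 < \<epsilon>" "\<epsilon> \<le> 2 - K"
    and \<delta>: "0 < \<delta>" "\<delta> < nu (a 1) K \<beta> \<gamma>"
begin

abbreviation "C1 \<equiv> C1c (a 1) K"
abbreviation "C2 \<equiv> C2c \<gamma>"

text \<open>The last factor of \<open>C5c\<close>; \<open>C3c\<close> is 2 \<Lambda> divided by
  \<open>Cdelta\<close>.\<close>

definition \<Lambda> :: real where
  "\<Lambda> = K/4 + K * \<beta> / 2 + 2 * \<beta> + \<epsilon> * (\<beta>/2) + 1 + 2 * \<gamma>\<^sup>2 / a 1 + \<epsilon> * (\<gamma>/2)"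

text \<open>The first two terms absorb the squared velocities at 1 produced by the multiplier 2 x
  y', the last one those produced by 2 \<Lambda> z.\<close>

definition \<kappa> :: real where
  "\<kappa> = varsigma (a 1) K + (2 - K/2) * (1/\<gamma>) + 2 * C1\<^sup>2 * C2\<^sup>2 * \<Lambda> / \<delta>"

text \<open>Twice the factor in the bound of \<integral> z^2 by \<gamma> y'(1)^2 plus the interior
  energy; \<open>C5c\<close> contains 2 \<zeta>.\<close>

definition \<zeta> :: real where "\<zeta> = 2 * C1\<^sup>2 * C2\<^sup>2 / \<beta> + 2 * C1 * C2\<^sup>2 / \<gamma>"

text \<open>The size of the cross term relative to the energy: the first summand stems from 2 x y',
  the second from 2 \<Lambda> z.\<close>

definition \<rho> :: real where "\<rho> = varrho (a 1) K \<gamma> / 2 + \<Lambda> * (1 + \<zeta>)"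

definition \<mu> :: real where "\<mu> = \<epsilon> - 2 * \<Lambda> * \<delta>"

lemma \<Lambda>_pos: "\<Lambda> > 0"
proof -
  have "0 \<le> 2 * \<gamma>\<^sup>2 / a 1" "0 < \<epsilon> * (\<beta>/2)" "0 < \<epsilon> * (\<gamma>/2)" "0 < K * \<beta> / 2"
    using a1_pos \<beta> \<gamma> \<epsilon> K_bounds by auto
  then show ?thesis using \<beta> K_bounds unfolding \<Lambda>_def by linarith
qed

lemma C_bounds: "C1 \<ge> 2" "C2 \<ge> 1" using C1c_bounds C2c_bounds by auto

text \<open>The range \<delta> < \<nu> is exactly the positivity of \<open>Cdelta\<close>.\<close>

lemma \<delta>_bound: "2 * C1 * C2 * (1/\<beta> + 1/\<gamma>) * \<delta> < 1"
proof -
  have "max 1 C1 = C1" using C_bounds by simp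
  then have "\<delta> < \<beta> * \<gamma> / (2 * C2 * C1 * (\<beta> + \<gamma>))" using \<delta>(2) by (simp add: nu_def)
  moreover have "2 * C2 * C1 * (\<beta> + \<gamma>) > 0" using C_bounds \<beta> \<gamma> by (intro mult_pos_pos) auto
  ultimately have "\<delta> * (2 * C2 * C1 * (\<beta> + \<gamma>)) < \<beta> * \<gamma>" by (simp add: pos_less_divide_eq)
  then have "\<delta> * (2 * C2 * C1 * (\<beta> + \<gamma>)) / (\<beta> * \<gamma>) < 1" using \<beta> \<gamma> by (simp add: divide_less_eq)
  moreover have "1/\<beta> + 1/\<gamma> = (\<beta> + \<gamma>) / (\<beta> * \<gamma>)" using \<beta> \<gamma> by (simp add: field_simps)
  ultimately show ?thesis by (simp add: mult_ac)
qed

text \<open>The expression is the derivative of the Lyapunov functional at (u, v) in the direction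
  (v, - B u). By the boundary conditions the energy part equals - \<kappa> (v(1)^2 + v'(1)^2); the
  multiplier parts reduce to J1, ..., J4, and the rest is
  \<open>dissipation_algebra\<close>.\<close>

theorem dissipation:
  assumes \<phi>1: "affine_flux \<phi>1 d1 c1 e1" "\<beta> * \<phi>1 1 - e1 = 1" "\<gamma> * d1 + c1 + e1 = 0"
    and \<phi>2: "affine_flux \<phi>2 d2 c2 e2" "\<beta> * \<phi>2 1 - e2 = 0" "\<gamma> * d2 + c2 + e2 = 1"
    and uv: "(u, v) \<in> dom_calB a \<beta> \<gamma>"
  shows "\<kappa> * ((LINT s|I01. a s * (D2 u s * D2 v s)) + (LINT s|I01. v s * - op_B a u s) + \<beta> * (u 1 * v 1) + \<gamma> * (D01 u 1 * D01 v 1))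
      + (LINT s|I01. - op_B a u s * multiplier \<Lambda> \<phi>1 \<phi>2 u s) + (LINT s|I01. v s * multiplier \<Lambda> \<phi>1 \<phi>2 v s)
      \<le> - \<mu> * (1/2 * sq_energy a \<beta> \<gamma> (u, v))"
proof -
  have uB: "u \<in> dom_B a" and v: "v \<in> K2a0 a" and bc1: "D01 (aD2 a u) 1 = \<beta> * u 1 + v 1"
    and bc2: "aD2 a u 1 = - (\<gamma> * D01 u 1 + D01 v 1)" using uv by (auto simp: dom_calB_def)
  have u: "u \<in> K2a0 a" using uB by (simp add: dom_B_def)
  define g where "g = aD2 a u"
  define b where "b = op_B a u"
  obtain h where fd: "flux_data g h b" and ae: "AE x in I01. a x * D2 u x = g x" and h1: "h 1 = D01 g 1"
    unfolding g_def b_def by (rule dom_B_flux_data[OF uB])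
  note ru = K2a0_repr[OF u] and rv = K2a0_repr[OF v]
  define p q r s where "p = u 1" "q = D01 u 1" "r = v 1" "s = D01 v 1"
  note pd = this
  have h: "h 1 = \<beta> * p + r" using bc1 h1 by (simp add: g_def pd)
  have g1: "g 1 = - (\<gamma> * q + s)" using bc2 by (simp add: g_def pd)
  define Ia where "Ia = (LINT s|I01. a s * (D2 u s)\<^sup>2)"
  define Iv where "Iv = (LINT s|I01. (v s)\<^sup>2)"
  have I0: "Ia \<ge> 0" "Iv \<ge> 0" unfolding Ia_def Iv_def using wsq_square(3)[OF K2a0_D2(2)[OF u]] by auto
  have L2b: "L2 b" by (rule flux_dataD(1)[OF fd])
  have L2v: "L2 v" by (rule L2_continuous[OF K2a0_continuous[OF v]])
  define z where "z x = p * \<phi>1 x + q * \<phi>2 x" for x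
  define zt where "zt x = r * \<phi>1 x + s * \<phi>2 x" for x
  define d c e where "d = p * d1 + q * d2" "c = p * c1 + q * c2" "e = p * e1 + q * e2"
  note dd = this
  have z: "affine_flux z d c e" unfolding z_def dd by (rule affine_flux_lin[OF \<phi>1(1) \<phi>2(1)])
  have bz1: "\<beta> * z 1 - e = p"
  proof -
    have "\<beta> * z 1 - e = p * (\<beta> * \<phi>1 1 - e1) + q * (\<beta> * \<phi>2 1 - e2)" by (simp add: z_def dd algebra_simps)
    then show ?thesis using \<phi>1 \<phi>2 by simp
  qed
  have bz2: "\<gamma> * d + c + e = q"
  proof -
    have "\<gamma> * d + c + e = p * (\<gamma> * d1 + c1 + e1) + q * (\<gamma> * d2 + c2 + e2)" by (simp add: dd algebra_simps)
    then show ?thesis using \<phi>1 \<phi>2 by simp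
  qed
  have zt: "affine_flux zt (r * d1 + s * d2) (r * c1 + s * c2) (r * e1 + s * e2)"
    unfolding zt_def by (rule affine_flux_lin[OF \<phi>1(1) \<phi>2(1)])
  have bt1: "\<beta> * zt 1 - (r * e1 + s * e2) = r"
  proof -
    have "\<beta> * zt 1 - (r * e1 + s * e2) = r * (\<beta> * \<phi>1 1 - e1) + s * (\<beta> * \<phi>2 1 - e2)" by (simp add: zt_def algebra_simps)
    then show ?thesis using \<phi>1 \<phi>2 by simp
  qed
  have bt2: "\<gamma> * (r * d1 + s * d2) + (r * c1 + s * c2) + (r * e1 + s * e2) = s"
  proof -
    have "\<gamma> * (r * d1 + s * d2) + (r * c1 + s * c2) + (r * e1 + s * e2) = r * (\<gamma> * d1 + c1 + e1) + s * (\<gamma> * d2 + c2 + e2)" by (simp add: algebra_simps)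
    then show ?thesis using \<phi>1 \<phi>2 by simp
  qed
  note Z = affine_flux_bounds[OF \<beta> \<gamma> z bz1 bz2] and Zt = affine_flux_bounds[OF \<beta> \<gamma> zt bt1 bt2]
  have rz: "repr z d (\<lambda>s. (c + e * s) / a s)" using z by (simp add: affine_flux_def)
  define J1 where "J1 = (LINT x|I01. b x * (x * D01 u x))"
  define J2 where "J2 = (LINT x|I01. v x * (x * D01 v x))"
  define J3 where "J3 = (LINT x|I01. b x * z x)"
  define J4 where "J4 = (LINT x|I01. v x * zt x)"
  define S where "S = (LINT s|I01. s * h s * D2 u s)"
  have J1: "J1 = q * (h 1 - g 1) - S + Ia"
    using Pohozaev(1)[OF fd u] flux_AE(1)[OF fd u ae] by (simp add: J1_def S_def Ia_def pd)
  have S: "2 * S \<le> (g 1)\<^sup>2 / a 1 - (1 - K) * Ia"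
    using virial_bound[OF fd u ae] by (simp add: S_def Ia_def)
  have J2: "2 * J2 \<le> r\<^sup>2 - Iv" using kinetic_bound[OF v] by (simp add: J2_def Iv_def pd)
  have "(LINT s|I01. g s * ((c + e * s) / a s)) = c * q + e * (q - p)"
  proof -
    have "(LINT s|I01. g s * ((c + e * s) / a s)) = (LINT s|I01. a s * (D2 u s * ((c + e * s) / a s)))"
      by (rule flux_AE(2)[OF fd u ae rz])
    also have "\<dots> = (LINT s|I01. a s * (((c + e * s) / a s) * D2 u s))" by (simp add: mult.commute)
    also have "\<dots> = c * q + e * (q - p)" using affine_flux_pairing(2)[OF z ru] by (simp add: pd)
    finally show ?thesis .
  qed
  \<comment> \<open>As a z'' is affine, the interior pairing depends on p and q only; the boundary
    conditions of u and z then combine everything to p^2 + q^2 plus terms with the velocities r and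
    s.\<close>
  then have "J3 = h 1 * z 1 - g 1 * d + (c * q + e * (q - p))"
    using Green[OF fd rz] by (simp add: J3_def)
  also have "\<dots> = p * (\<beta> * z 1 - e) + q * (\<gamma> * d + c + e) + r * z 1 + s * d"
    unfolding h g1 by (simp add: algebra_simps)
  finally have J3: "J3 = p\<^sup>2 + q\<^sup>2 + r * z 1 + s * d" unfolding bz1 bz2 by (simp add: power2_eq_square)
  define R where "R = 3/2 * C1\<^sup>2 * C2\<^sup>2"
  have J4: "2 * J4 \<le> \<delta> * Iv + R * (r\<^sup>2 + s\<^sup>2) / \<delta>"
  proof -
    have "2 * \<bar>J4\<bar> \<le> \<delta> * Iv + (LINT x|I01. (zt x)\<^sup>2) / \<delta>"
      unfolding J4_def Iv_def by (rule L2_AM_GM[OF L2v Zt(1) \<delta>(1)])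
    also have "\<dots> \<le> \<delta> * Iv + R * (r\<^sup>2 + s\<^sup>2) / \<delta>"
      using Zt(3) \<delta> by (intro add_left_mono divide_right_mono) (auto simp: R_def)
    finally show ?thesis by linarith
  qed
  define \<tau> where "\<tau> = 3/2 * C1 * C2 * (1/\<beta> + 1/\<gamma>)"
  have zd: "(z 1)\<^sup>2 + d\<^sup>2 \<le> \<tau> * (p\<^sup>2 + q\<^sup>2)" using Z(4) by (simp add: \<tau>_def)
  have \<tau>: "\<tau> > 0" using C_bounds \<beta> \<gamma> unfolding \<tau>_def by (intro mult_pos_pos add_pos_pos) auto
  have CC: "C1\<^sup>2 * C2\<^sup>2 \<ge> 4"
  proof -
    have "2\<^sup>2 \<le> C1\<^sup>2" "1\<^sup>2 \<le> C2\<^sup>2" by (rule power_mono; use C_bounds in simp)+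
    then have "4 * 1 \<le> C1\<^sup>2 * C2\<^sup>2" by (intro mult_mono) auto
    then show ?thesis by simp
  qed
  \<comment> \<open>The bound on \<delta> turns \<open>\<tau>\<close> into a multiple of 1 /
    \<delta>. Its share 1/2 and the 3/2 of \<open>R\<close> add up to the 2 in
    \<open>\<kappa>\<close>.\<close>
  have \<tau>\<delta>: "\<tau> \<le> (1/2 * C1\<^sup>2 * C2\<^sup>2) / \<delta>"
  proof -
    have "\<tau> * \<delta> = 3/4 * (2 * C1 * C2 * (1/\<beta> + 1/\<gamma>) * \<delta>)" unfolding \<tau>_def by simp
    also have "\<dots> < 3/4 * 1" by (intro mult_strict_left_mono \<delta>_bound) simp
    finally have "\<tau> * \<delta> < 3/4" by simp
    then have "\<tau> * \<delta> \<le> 1/2 * C1\<^sup>2 * C2\<^sup>2" using CC by linarith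
    then show ?thesis using \<delta> by (simp add: pos_le_divide_eq)
  qed
  define \<kappa>0 where "\<kappa>0 = varsigma (a 1) K + (2 - K/2) * (1/\<gamma>)"
  have \<kappa>0: "\<kappa>0 \<ge> 2" "\<kappa>0 \<ge> 2 / a 1 + 1 / (2 * \<gamma>)"
  proof -
    have "varsigma (a 1) K \<ge> 2" "varsigma (a 1) K \<ge> 2 / a 1" using K_bounds by (auto simp: varsigma_def)
    moreover have "1 / (2 * \<gamma>) \<le> (2 - K/2) * (1/\<gamma>)" using K_bounds \<gamma> by (simp add: field_simps)
    moreover have "0 \<le> 1 / (2 * \<gamma>)" using \<gamma> by simp
    ultimately show "\<kappa>0 \<ge> 2" "\<kappa>0 \<ge> 2 / a 1 + 1 / (2 * \<gamma>)" unfolding \<kappa>0_def by linarith+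
  qed
  have "\<Lambda> * (\<tau> + R / \<delta>) \<le> \<Lambda> * ((1/2 * C1\<^sup>2 * C2\<^sup>2) / \<delta> + R / \<delta>)"
    using \<tau>\<delta> \<Lambda>_pos by (intro mult_left_mono) auto
  also have "\<dots> = 2 * C1\<^sup>2 * C2\<^sup>2 * \<Lambda> / \<delta>" by (simp add: R_def field_simps)
  finally have \<kappa>: "\<kappa> \<ge> \<kappa>0 + \<Lambda> * (\<tau> + R / \<delta>)" by (simp add: \<kappa>_def \<kappa>0_def)
  have ge: "0 \<le> 2 * \<gamma>\<^sup>2 / a 1" "0 < \<epsilon> * \<beta>" "0 < \<epsilon> * \<gamma>" "0 < K * \<beta>" using a1_pos \<beta> \<gamma> \<epsilon> K_bounds by auto
  have \<Lambda>: "\<Lambda> \<ge> \<beta> + \<epsilon> * (\<beta>/2)" "\<Lambda> \<ge> \<beta> + 1 + 2 * \<gamma>\<^sup>2 / a 1 + \<epsilon> * (\<gamma>/2)"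
    using ge \<beta> \<gamma> \<epsilon> K_bounds unfolding \<Lambda>_def by simp_all
  note alg = dissipation_algebra[OF \<beta> \<gamma> \<epsilon>(1) \<delta>(1) a1_pos K_bounds(2,1) \<epsilon>(2) I0 J1 S J2 J4 zd \<tau> h g1 \<Lambda> \<kappa>0 \<kappa>]
  have m1: "(LINT x|I01. - b x * multiplier \<Lambda> \<phi>1 \<phi>2 u x) = - 2 * J1 - 2 * \<Lambda> * J3"
  proof -
    have "(LINT x|I01. - b x * multiplier \<Lambda> \<phi>1 \<phi>2 u x) = (LINT x|I01. - 2 * (b x * (x * D01 u x)) - 2 * \<Lambda> * (b x * z x))"
      by (simp add: multiplier_def z_def pd algebra_simps)
    also have "\<dots> = - 2 * J1 - 2 * \<Lambda> * J3"
      using L2_mult_integrable[OF L2b K2a0_multiplier(2)[OF u]] L2_mult_integrable[OF L2b Z(1)]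
      by (simp add: J1_def J3_def)
    finally show ?thesis .
  qed
  have m2: "(LINT x|I01. v x * multiplier \<Lambda> \<phi>1 \<phi>2 v x) = 2 * J2 + 2 * \<Lambda> * J4"
  proof -
    have "(LINT x|I01. v x * multiplier \<Lambda> \<phi>1 \<phi>2 v x) = (LINT x|I01. 2 * (v x * (x * D01 v x)) + 2 * \<Lambda> * (v x * zt x))"
      by (simp add: multiplier_def zt_def pd algebra_simps)
    also have "\<dots> = 2 * J2 + 2 * \<Lambda> * J4"
      using L2_mult_integrable[OF L2v K2a0_multiplier(2)[OF v]] L2_mult_integrable[OF L2v Zt(1)]
      by (simp add: J2_def J4_def)
    finally show ?thesis .
  qed
  have "(LINT s|I01. v s * - b s) = - (LINT s|I01. b s * v s)" by (simp add: mult.commute)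
  also have "\<dots> = - (h 1 * r - g 1 * s + (LINT s|I01. a s * (D2 u s * D2 v s)))"
    using Green[OF fd rv] flux_AE(2)[OF fd u ae rv] by (simp add: pd)
  finally have m3: "(LINT s|I01. a s * (D2 u s * D2 v s)) + (LINT s|I01. v s * - b s) + \<beta> * (p * r) + \<gamma> * (q * s) = - (r\<^sup>2 + s\<^sup>2)"
    unfolding h g1 by (simp add: power2_eq_square algebra_simps)
  have E: "sq_energy a \<beta> \<gamma> (u, v) = Ia + Iv + \<beta> * p\<^sup>2 + \<gamma> * q\<^sup>2"
    by (simp add: sq_energy_def Ia_def Iv_def pd)
  have neg: "\<kappa> * - (r\<^sup>2 + s\<^sup>2) = - \<kappa> * (r\<^sup>2 + s\<^sup>2)" by (simp only: mult_minus_left mult_minus_right)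
  show ?thesis
    unfolding b_def[symmetric] m1 m2 E \<mu>_def pd[symmetric] m3 neg using alg unfolding J3[symmetric] by linarith
qed

text \<open>Valid on the whole energy space, where it yields both the comparison of the Lyapunov
  functional with the energy and its continuity.\<close>

lemma multiplier_pairing_bound:
  assumes \<phi>1: "affine_flux \<phi>1 d1 c1 e1" "\<beta> * \<phi>1 1 - e1 = 1" "\<gamma> * d1 + c1 + e1 = 0"
    and \<phi>2: "affine_flux \<phi>2 d2 c2 e2" "\<beta> * \<phi>2 1 - e2 = 0" "\<gamma> * d2 + c2 + e2 = 1"
    and u: "u \<in> K2a0 a" and v: "L2 v"
  shows "\<bar>LINT s|I01. v s * multiplier \<Lambda> \<phi>1 \<phi>2 u s\<bar> \<le> \<rho> * (1/2 * sq_energy a \<beta> \<gamma> (u, v))"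
    and "L2 (multiplier \<Lambda> \<phi>1 \<phi>2 u)"
proof -
  define p q where "p = u 1" "q = D01 u 1"
  note pd = this
  note ru = K2a0_repr[OF u]
  define Ia where "Ia = (LINT s|I01. a s * (D2 u s)\<^sup>2)"
  define Iv where "Iv = (LINT s|I01. (v s)\<^sup>2)"
  have I0: "Ia \<ge> 0" "Iv \<ge> 0" unfolding Ia_def Iv_def using wsq_square(3)[OF K2a0_D2(2)[OF u]] by auto
  define z where "z x = p * \<phi>1 x + q * \<phi>2 x" for x
  have z: "affine_flux z (p * d1 + q * d2) (p * c1 + q * c2) (p * e1 + q * e2)"
    unfolding z_def by (rule affine_flux_lin[OF \<phi>1(1) \<phi>2(1)])
  have bz1: "\<beta> * z 1 - (p * e1 + q * e2) = p"
  proof -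
    have "\<beta> * z 1 - (p * e1 + q * e2) = p * (\<beta> * \<phi>1 1 - e1) + q * (\<beta> * \<phi>2 1 - e2)" by (simp add: z_def algebra_simps)
    then show ?thesis using \<phi>1 \<phi>2 by simp
  qed
  have bz2: "\<gamma> * (p * d1 + q * d2) + (p * c1 + q * c2) + (p * e1 + q * e2) = q"
  proof -
    have "\<gamma> * (p * d1 + q * d2) + (p * c1 + q * c2) + (p * e1 + q * e2) = p * (\<gamma> * d1 + c1 + e1) + q * (\<gamma> * d2 + c2 + e2)" by (simp add: algebra_simps)
    then show ?thesis using \<phi>1 \<phi>2 by simp
  qed
  note Z = affine_flux_bounds[OF \<beta> \<gamma> z bz1 bz2]
  note M = K2a0_multiplier(2,3)[OF u]
  have mz: "multiplier \<Lambda> \<phi>1 \<phi>2 u = (\<lambda>x. 2 * (x * D01 u x) + 2 * \<Lambda> * z x)"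
    by (auto simp: multiplier_def z_def pd)
  show "L2 (multiplier \<Lambda> \<phi>1 \<phi>2 u)" unfolding mz by (rule L2_lin[OF M(1) Z(1)])
  define E where "E = 1/2 * (Ia + Iv + \<beta> * p\<^sup>2 + \<gamma> * q\<^sup>2)"
  have E: "1/2 * sq_energy a \<beta> \<gamma> (u, v) = E" by (simp add: E_def sq_energy_def Ia_def Iv_def pd)
  define J1 where "J1 = (LINT x|I01. v x * (x * D01 u x))"
  define J2 where "J2 = (LINT x|I01. v x * z x)"
  have bp: "0 \<le> \<beta> * p\<^sup>2" "0 \<le> \<gamma> * q\<^sup>2" using \<beta> \<gamma> by auto
  have b1: "2 * \<bar>J1\<bar> \<le> varrho (a 1) K \<gamma> / 2 * E"
  proof -
    define m where "m = Max {2 / \<gamma>, 2 / (a 1 * (2 - K)), 1}"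
    have m: "2 / \<gamma> \<le> m" "2 / (a 1 * (2 - K)) \<le> m" "1 \<le> m" by (simp_all add: m_def)
    have "2 * \<bar>J1\<bar> \<le> 1 * Iv + (LINT x|I01. (x * D01 u x)\<^sup>2) / 1"
      unfolding J1_def Iv_def by (rule L2_AM_GM[OF v M(1)]) simp
    also have "\<dots> \<le> 1 * Iv + 2 / (a 1 * (2 - K)) * Ia + 2 / \<gamma> * (\<gamma> * q\<^sup>2)"
      using M(2) \<gamma> by (simp add: Ia_def pd)
    also have "\<dots> \<le> m * Iv + m * Ia + m * (\<gamma> * q\<^sup>2)"
      using m I0 bp by (intro add_mono mult_right_mono) auto
    also have "\<dots> \<le> varrho (a 1) K \<gamma> / 2 * E"
    proof -
      have v: "varrho (a 1) K \<gamma> = 4 * m" by (simp only: varrho_def m_def)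
      have "0 \<le> m * (\<beta> * p\<^sup>2)" by (rule mult_nonneg_nonneg[OF _ bp(1)]) (use m(3) in linarith)
      then show ?thesis unfolding v E_def by (simp add: algebra_simps)
    qed
    finally show ?thesis .
  qed
  have b2: "2 * \<bar>J2\<bar> \<le> (1 + \<zeta>) * E"
  proof -
    have C0: "C1 * C2 > 0" "C2 > 0" "C1 > 0" using C_bounds by auto
    have \<zeta>: "\<zeta> \<ge> 0" using C0 \<beta> \<gamma> by (simp add: \<zeta>_def)
    define W where "W = \<gamma> * q\<^sup>2 + Ia"
    have W: "W \<ge> 0" using I0 bp by (simp add: W_def)
    have g: "C2 * \<gamma> \<ge> 1" using C2c_bounds(2)[of \<gamma>] \<gamma> by (simp add: field_simps)
    have q2: "q\<^sup>2 \<le> C2 * W"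
    proof -
      have "1 * q\<^sup>2 \<le> (C2 * \<gamma>) * q\<^sup>2" by (intro mult_right_mono g) auto
      also have "\<dots> \<le> C2 * W" using C0 I0 by (simp add: W_def algebra_simps)
      finally show ?thesis by simp
    qed
    have p2: "p\<^sup>2 \<le> C1 * C2 * W"
    proof -
      have "p\<^sup>2 \<le> 2 * q\<^sup>2 + 2 / (a 1 * (2 - K)) * Ia" using repr_bound[OF ru, of 1] by (simp add: pd Ia_def)
      also have "\<dots> \<le> C1 * q\<^sup>2 + C1 * Ia" using C1c_bounds I0 by (intro add_mono mult_right_mono) auto
      also have "\<dots> = C1 * (q\<^sup>2 + Ia)" by (simp add: algebra_simps)
      also have "\<dots> \<le> C1 * (C2 * W)"
      proof (rule mult_left_mono)
        have "1 * q\<^sup>2 \<le> (C2 * \<gamma>) * q\<^sup>2" by (intro mult_right_mono g) auto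
        moreover have "1 * Ia \<le> C2 * Ia" using C_bounds I0 by (intro mult_right_mono) auto
        ultimately show "q\<^sup>2 + Ia \<le> C2 * W" by (simp add: W_def algebra_simps)
      qed (use C0 in auto)
      finally show ?thesis by (simp add: mult.assoc)
    qed
    have "(LINT x|I01. (z x)\<^sup>2) \<le> C1 * C2 * (p\<^sup>2 / \<beta> + q\<^sup>2 / \<gamma>)" by (rule Z(2))
    also have "\<dots> \<le> C1 * C2 * (C1 * C2 * W / \<beta> + C2 * W / \<gamma>)"
      using p2 q2 \<beta> \<gamma> C0 by (intro mult_left_mono add_mono divide_right_mono) auto
    also have "\<dots> = \<zeta> / 2 * W" by (simp add: \<zeta>_def power2_eq_square algebra_simps)
    finally have zW: "(LINT x|I01. (z x)\<^sup>2) \<le> \<zeta> / 2 * W" .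
    \<comment> \<open>With this weight \<zeta> / 2 \<le> \<theta>^2, so both terms get the same
      factor \<theta>.\<close>
    define \<theta> where "\<theta> = (1 + \<zeta>) / 2"
    have \<theta>: "\<theta> > 0" using \<zeta> by (simp add: \<theta>_def)
    have "2 * \<bar>J2\<bar> \<le> \<theta> * Iv + (LINT x|I01. (z x)\<^sup>2) / \<theta>"
      unfolding J2_def Iv_def by (rule L2_AM_GM[OF v Z(1) \<theta>])
    also have "\<dots> \<le> \<theta> * Iv + (\<zeta> / 2 * W) / \<theta>" using zW \<theta> by (intro add_left_mono divide_right_mono) auto
    also have "(\<zeta> / 2 * W) / \<theta> \<le> \<theta> * W"
    proof -
      have "\<zeta> / 2 \<le> \<theta> * \<theta>" using \<zeta> by (simp add: \<theta>_def field_simps)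
      then have "\<zeta> / 2 * W \<le> \<theta> * \<theta> * W" using W by (rule mult_right_mono)
      then show ?thesis using \<theta> by (simp add: pos_divide_le_eq mult_ac)
    qed
    also have "\<theta> * Iv + \<theta> * W = \<theta> * (Iv + W)" by (simp add: algebra_simps)
    also have "\<dots> \<le> \<theta> * (2 * E)" using \<theta> bp by (intro mult_left_mono) (auto simp: E_def W_def)
    finally show ?thesis by (simp add: \<theta>_def)
  qed
  have "(LINT s|I01. v s * multiplier \<Lambda> \<phi>1 \<phi>2 u s) = (LINT x|I01. 2 * (v x * (x * D01 u x)) + 2 * \<Lambda> * (v x * z x))"
    by (simp add: mz algebra_simps)
  also have "\<dots> = 2 * J1 + \<Lambda> * (2 * J2)"
    using L2_mult_integrable[OF v M(1)] L2_mult_integrable[OF v Z(1)] by (simp add: J1_def J2_def)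
  finally have "\<bar>LINT s|I01. v s * multiplier \<Lambda> \<phi>1 \<phi>2 u s\<bar> \<le> 2 * \<bar>J1\<bar> + \<Lambda> * (2 * \<bar>J2\<bar>)"
    using abs_triangle_ineq[of "2 * J1" "\<Lambda> * (2 * J2)"] \<Lambda>_pos by (simp add: abs_mult)
  also have "\<dots> \<le> varrho (a 1) K \<gamma> / 2 * E + \<Lambda> * ((1 + \<zeta>) * E)"
    using b1 b2 \<Lambda>_pos by (intro add_mono mult_left_mono) auto
  also have "\<dots> = \<rho> * E" by (simp add: \<rho>_def algebra_simps)
  finally show "\<bar>LINT s|I01. v s * multiplier \<Lambda> \<phi>1 \<phi>2 u s\<bar> \<le> \<rho> * (1/2 * sq_energy a \<beta> \<gamma> (u, v))"
    unfolding E .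
qed

text \<open>The constants of the theorem are met here. As \<open>Cdelta\<close> lies in (0, 1),
  \<mu> is at least the denominator of M, and \<kappa> + 2 \<rho> is at most its numerator, the
  terms with factor \<Lambda> being collected in \<open>C5c\<close>.\<close>

lemma constants:
  assumes "\<delta> * C3c (a 1) K \<beta> \<gamma> \<epsilon> \<delta> < \<epsilon>"
  shows "0 < \<mu>" "\<kappa> > 0" "\<rho> > 0" "(\<kappa> + 2 * \<rho>) / \<mu> \<le> Mc (a 1) K \<beta> \<gamma> \<epsilon> \<delta>"
proof -
  define D where "D = Cdelta (a 1) K \<beta> \<gamma> \<delta>"
  have m1: "max 1 C1 = C1" using C_bounds by simp
  have "0 < 2 * C2 * C1 * \<delta> * (1/\<beta> + 1/\<gamma>)" using C_bounds \<delta> \<beta> \<gamma> by (intro mult_pos_pos add_pos_pos) auto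
  moreover have "2 * C2 * C1 * \<delta> * (1/\<beta> + 1/\<gamma>) < 1" using \<delta>_bound by (simp add: mult_ac)
  ultimately have D: "0 < D" "D < 1" by (simp_all add: D_def Cdelta_def m1)
  have "K/4 + K * \<beta> / 2 + \<beta> + \<epsilon> * (\<beta>/2) + (\<beta> + 1 + 2 * \<gamma>\<^sup>2 / a 1 + \<epsilon> * (\<gamma>/2)) = \<Lambda>"
    by (simp add: \<Lambda>_def)
  then have C3: "C3c (a 1) K \<beta> \<gamma> \<epsilon> \<delta> = \<Lambda> * (2 / D)"
    unfolding C3c_def D_def[symmetric] distrib_right[symmetric] by (simp only:)
  have iD: "1 \<le> 1 / D" using D by simp
  have "2 * \<Lambda> * 1 \<le> 2 * \<Lambda> * (1 / D)" using iD \<Lambda>_pos by (intro mult_left_mono) auto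
  then have "2 * \<Lambda> \<le> \<Lambda> * (2 / D)" by (simp add: mult.commute)
  then have "\<delta> * (2 * \<Lambda>) \<le> \<delta> * C3c (a 1) K \<beta> \<gamma> \<epsilon> \<delta>" unfolding C3 using \<delta> by (intro mult_left_mono) auto
  then have \<mu>: "\<epsilon> - \<delta> * C3c (a 1) K \<beta> \<gamma> \<epsilon> \<delta> \<le> \<mu>" by (simp add: \<mu>_def mult_ac)
  then show \<mu>0: "0 < \<mu>" using assms by linarith
  have C0: "C1 > 0" "C2 > 0" using C_bounds by auto
  have \<zeta>: "\<zeta> \<ge> 0" using C0 \<beta> \<gamma> by (simp add: \<zeta>_def)
  have vs: "varsigma (a 1) K > 0" using K_bounds by (auto simp: varsigma_def less_max_iff_disj)
  have k2: "0 < (2 - K/2) * (1/\<gamma>)" using K_bounds \<gamma> by simp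
  show \<kappa>0: "\<kappa> > 0"
    unfolding \<kappa>_def using vs k2 C0 \<Lambda>_pos \<delta> K_bounds \<gamma> by (intro add_pos_pos divide_pos_pos mult_pos_pos) auto
  have vr: "varrho (a 1) K \<gamma> > 0" by (auto simp: varrho_def less_max_iff_disj)
  show \<rho>0: "\<rho> > 0" unfolding \<rho>_def using vr \<Lambda>_pos \<zeta> by (intro add_pos_nonneg) auto
  have th: "0 \<le> vartheta (a 1) K \<gamma>" using K_bounds by (auto simp: vartheta_def le_max_iff_disj)
  define X where "X = 2 + 4 * (C1\<^sup>2 * C2\<^sup>2 / \<beta>) + 4 * (C1 * C2\<^sup>2 / \<gamma>) + 1 / \<delta> + 2 * C1 * C2\<^sup>2 * C1 / \<delta>"
  have "2 * C1\<^sup>2 * C2\<^sup>2 * \<Lambda> / \<delta> + 2 * \<Lambda> * (1 + \<zeta>) \<le> X * \<Lambda>"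
  proof -
    have "X * \<Lambda> = 2 * C1\<^sup>2 * C2\<^sup>2 * \<Lambda> / \<delta> + 2 * \<Lambda> * (1 + \<zeta>) + \<Lambda> / \<delta>"
      by (simp add: X_def \<zeta>_def power2_eq_square algebra_simps)
    then show ?thesis using \<Lambda>_pos \<delta> by simp
  qed
  moreover have "X * \<Lambda> \<le> 1 / D * X * \<Lambda>"
  proof -
    have "0 \<le> X" using C0 \<beta> \<gamma> \<delta> by (simp add: X_def)
    then have "1 * (X * \<Lambda>) \<le> 1 / D * (X * \<Lambda>)" using iD \<Lambda>_pos by (intro mult_right_mono) auto
    then show ?thesis by (simp add: mult_ac)
  qed
  moreover have "C5c (a 1) K \<beta> \<gamma> \<epsilon> \<delta> = 1 / D * X * \<Lambda>"
    by (simp add: C5c_def D_def X_def \<Lambda>_def m1)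
  ultimately have C4: "\<kappa> + 2 * \<rho> \<le> C4c (a 1) K \<beta> \<gamma> \<epsilon> \<delta>"
    using th by (simp add: \<kappa>_def \<rho>_def C4c_def algebra_simps)
  have "(\<kappa> + 2 * \<rho>) / \<mu> \<le> C4c (a 1) K \<beta> \<gamma> \<epsilon> \<delta> / (\<epsilon> - \<delta> * C3c (a 1) K \<beta> \<gamma> \<epsilon> \<delta>)"
    by (rule frac_le) (use C4 \<mu> \<mu>0 \<kappa>0 \<rho>0 assms in auto)
  then show "(\<kappa> + 2 * \<rho>) / \<mu> \<le> Mc (a 1) K \<beta> \<gamma> \<epsilon> \<delta>" by (simp add: Mc_def)
qed

end

section \<open>Exponential decay of contraction semigroups\<close>

text \<open>For semigroup orbits only right derivatives are at hand. With a tolerance slope e > 0,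
  the set of t with f(t) \<le> f(a) + e (t - a) is closed, and its supremum cannot lie before
  b.\<close>

lemma nonincreasing_if_right_derivative_nonpos:
  fixes f :: "real \<Rightarrow> real"
  assumes ab: "a \<le> b" and cont: "continuous_on {a..b} f"
    and D: "\<And>s. a \<le> s \<Longrightarrow> s < b \<Longrightarrow> \<exists>D\<le>0. ((\<lambda>h. (f (s + h) - f s) / h) \<longlongrightarrow> D) (at_right 0)"
  shows "f b \<le> f a"
proof (rule field_le_epsilon)
  fix e0 :: real assume e0: "e0 > 0"
  define e where "e = e0 / (b - a + 1)"
  have e: "e > 0" using e0 ab by (simp add: e_def)
  define S where "S = {t \<in> {a..b}. f t - e * (t - a) \<le> f a}"
  have "closed ({a..b} \<inter> (\<lambda>t. f t - e * (t - a)) -` {..f a})"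
    by (intro continuous_closed_preimage continuous_intros cont)
  also have "{a..b} \<inter> (\<lambda>t. f t - e * (t - a)) -` {..f a} = S" by (auto simp: S_def)
  finally have "closed S" .
  moreover have "a \<in> S" using ab by (simp add: S_def)
  moreover have bdd: "bdd_above S" by (auto simp: S_def intro!: bdd_aboveI[of _ b])
  ultimately have c: "Sup S \<in> S" by (intro closed_contains_Sup) auto
  define c where "c = Sup S"
  have cS: "a \<le> c" "c \<le> b" "f c - e * (c - a) \<le> f a" using c by (auto simp: S_def c_def)
  have "c = b"
  proof (rule ccontr)
    assume "c \<noteq> b"
    then have cb: "c < b" using cS by simp
    obtain D where D: "D \<le> 0" "((\<lambda>h. (f (c + h) - f c) / h) \<longlongrightarrow> D) (at_right 0)" using D[OF cS(1) cb] by blast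
    have "\<forall>\<^sub>F h in at_right 0. (f (c + h) - f c) / h < e"
      by (rule order_tendstoD(2)[OF D(2)]) (use D(1) e in linarith)
    then obtain r where r: "r > 0" "\<And>h. 0 < h \<Longrightarrow> h < r \<Longrightarrow> (f (c + h) - f c) / h < e"
      by (auto simp: eventually_at_right_field)
    define h where "h = min (r / 2) (b - c)"
    have h: "0 < h" "h < r" "c + h \<le> b" using r cb by (auto simp: h_def)
    have "f (c + h) - f c < e * h" using r(2)[OF h(1,2)] h by (simp add: field_simps)
    then have "c + h \<in> S" using cS h by (auto simp: S_def algebra_simps)
    then have "c + h \<le> c" unfolding c_def by (rule cSup_upper[OF _ bdd])
    then show False using h by simp
  qed
  then have "f b \<le> f a + e * (b - a)" using cS by simp
  also have "e * (b - a) \<le> e0" using e0 ab by (simp add: e_def field_simps)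
  finally show "f b \<le> f a + e0" by simp
qed

text \<open>A version on a finite horizon: f(S) = \<integral> E over [S, t] satisfies f \<le> - M
  f', so f(S) exp(S / M) does not increase up to S = t - M. There monotonicity of E gives f \<ge> M
  E(t), which produces the 1 in the exponent. For t \<le> M the exponent is nonnegative and
  monotonicity suffices.\<close>

lemma Komornik:
  fixes E :: "real \<Rightarrow> real"
  assumes cont: "continuous_on {0..t} E" and mono: "\<And>r s. 0 \<le> r \<Longrightarrow> r \<le> s \<Longrightarrow> s \<le> t \<Longrightarrow> E s \<le> E r"
    and nonneg: "\<And>s. 0 \<le> s \<Longrightarrow> E s \<ge> 0" and M: "M > 0" and t: "t \<ge> 0"
    and int: "\<And>S. 0 \<le> S \<Longrightarrow> S \<le> t \<Longrightarrow> integral {S..t} E \<le> M * E S"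
  shows "E t \<le> E 0 * exp (1 - t / M)"
proof (cases "t \<le> M")
  case True
  have "E t \<le> E 0 * 1" using mono[of 0 t] t by simp
  also have "\<dots> \<le> E 0 * exp (1 - t / M)"
    using nonneg[of 0] True M by (intro mult_left_mono) (auto simp: field_simps)
  finally show ?thesis .
next
  case False
  define f where "f S = integral {0..t} E - integral {0..S} E" for S
  have iE: "E integrable_on {0..t}" by (rule integrable_continuous_real[OF cont])
  have fS: "f S = integral {S..t} E" if "0 \<le> S" "S \<le> t" for S
    using Henstock_Kurzweil_Integration.integral_combine[OF that iE] by (simp add: f_def)
  define g where "g S = f S * exp (S / M)" for S
  have cg: "continuous_on {0..t} g"
    unfolding g_def f_def using M by (intro continuous_intros indefinite_integral_continuous_1 iE) auto
  have "g (t - M) \<le> g 0"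
  proof (rule DERIV_nonpos_imp_decreasing_open[where f = g and a = 0 and b = "t - M"])
    show "0 \<le> t - M" using False by simp
    show "continuous_on {0..t - M} g" by (rule continuous_on_subset[OF cg]) (use M in auto)
    fix S assume S: "0 < S" "S < t - M"
    have "((\<lambda>S. integral {0..S} E) has_real_derivative E S) (at S within {0..t})"
      by (rule integral_has_real_derivative[OF cont]) (use S M in auto)
    moreover have "at S within {0..t} = at S" by (rule at_within_interior) (use S M in auto)
    ultimately have "(g has_real_derivative ((0 - E S) * exp (S / M) + exp (S / M) * (1 / M) * f S)) (at S)"
      unfolding g_def f_def using M by (auto intro!: derivative_eq_intros)
    moreover have "(0 - E S) * exp (S / M) + exp (S / M) * (1 / M) * f S = exp (S / M) * (f S / M - E S)"
      by (simp add: algebra_simps)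
    moreover have "f S / M - E S \<le> 0" using int[of S] fS[of S] S M by (simp add: field_simps)
    then have "exp (S / M) * (f S / M - E S) \<le> 0" by (intro mult_nonneg_nonpos) auto
    ultimately show "\<exists>y. (g has_real_derivative y) (at S) \<and> y \<le> 0" by metis
  qed
  also have "g 0 = integral {0..t} E" by (simp add: g_def f_def)
  also have "\<dots> \<le> M * E 0" using int[of 0] t by simp
  finally have 1: "f (t - M) * exp ((t - M) / M) \<le> M * E 0" by (simp add: g_def)
  have "M * E t = integral {t - M..t} (\<lambda>_. E t)" using M by simp
  also have "\<dots> \<le> integral {t - M..t} E"
  proof (rule integral_le)
    show "E integrable_on {t - M..t}" by (rule integrable_on_subinterval[OF iE]) (use False in auto)
    show "E t \<le> E s" if "s \<in> {t - M..t}" for s using mono[of s t] that False by auto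
  qed auto
  also have "\<dots> = f (t - M)" using fS[of "t - M"] False M by simp
  finally have "M * E t * exp ((t - M) / M) \<le> M * E 0" using 1 by (meson exp_ge_zero mult_right_mono order_trans)
  then have "E t * exp ((t - M) / M) \<le> E 0" using M by simp
  then have "E t \<le> E 0 * exp (- ((t - M) / M))" by (simp add: exp_minus field_simps)
  also have "- ((t - M) / M) = 1 - t / M" using M by (simp add: field_simps)
  finally show ?thesis .
qed

text \<open>Representatives with a positive semidefinite form; no quotient is taken, and elements at
  distance 0 are merely indistinguishable to bounded forms. The semigroup argument is thereby
  separated from the beam.\<close>

locale form_space =
  fixes X :: "state set" and B :: "state \<Rightarrow> state \<Rightarrow> real" and N :: "state \<Rightarrow> real"
  assumes lin_X: "x \<in> X \<Longrightarrow> y \<in> X \<Longrightarrow> lin c x d y \<in> X"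
    and B_lin: "x \<in> X \<Longrightarrow> y \<in> X \<Longrightarrow> z \<in> X \<Longrightarrow> B (lin c x d y) z = c * B x z + d * B y z"
    and B_sym: "x \<in> X \<Longrightarrow> y \<in> X \<Longrightarrow> B x y = B y x"
    and B_nonneg: "x \<in> X \<Longrightarrow> 0 \<le> B x x"
    and N_B: "x \<in> X \<Longrightarrow> N x = sqrt (B x x)"
begin

lemma N_nonneg: "x \<in> X \<Longrightarrow> 0 \<le> N x" and N_sq: "x \<in> X \<Longrightarrow> (N x)\<^sup>2 = B x x"
  by (simp_all add: N_B B_nonneg)

lemma B_lin2: "x \<in> X \<Longrightarrow> y \<in> X \<Longrightarrow> z \<in> X \<Longrightarrow> B z (lin c x d y) = c * B z x + d * B z y"
  using B_lin[of x y z c d] B_sym lin_X by metis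

lemma N_lin_sq:
  assumes "x \<in> X" "y \<in> X"
  shows "(N (lin c x d y))\<^sup>2 = c\<^sup>2 * (N x)\<^sup>2 + 2 * c * d * B x y + d\<^sup>2 * (N y)\<^sup>2"
  using assms by (simp add: N_sq lin_X B_lin B_lin2 B_sym[of y x]) (simp add: power2_eq_square algebra_simps)

text \<open>The form is only semidefinite, hence the separate case N y = 0, in which B x y \<noteq>
  0 would make the quadratic polynomial negative somewhere.\<close>

lemma Cauchy_Schwarz: assumes x: "x \<in> X" and y: "y \<in> X" shows "\<bar>B x y\<bar> \<le> N x * N y"
proof -
  have q: "0 \<le> c\<^sup>2 * (N x)\<^sup>2 + 2 * c * d * B x y + d\<^sup>2 * (N y)\<^sup>2" for c d
    using N_lin_sq[OF x y, of c d] zero_le_power2[of "N (lin c x d y)"] by simp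
  have n: "N x \<ge> 0" "N y \<ge> 0" using x y by (auto intro: N_nonneg)
  have "(B x y)\<^sup>2 \<le> (N x)\<^sup>2 * (N y)\<^sup>2"
  proof (cases "N y = 0")
    case True
    have "B x y = 0"
    proof (rule ccontr)
      assume "B x y \<noteq> 0"
      then show False using q[of 1 "- ((N x)\<^sup>2 + 1) / (2 * B x y)"] True by (simp add: field_simps)
    qed
    then show ?thesis by simp
  next
    case False
    have "0 \<le> (N y)\<^sup>2 * ((N y)\<^sup>2 * (N x)\<^sup>2 - (B x y)\<^sup>2)"
      using q[of "(N y)\<^sup>2" "- B x y"] by (simp add: power2_eq_square algebra_simps)
    then have "0 \<le> (N y)\<^sup>2 * (N x)\<^sup>2 - (B x y)\<^sup>2" using False by (simp add: zero_le_mult_iff)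
    then show ?thesis by (simp add: mult.commute)
  qed
  then have "\<bar>B x y\<bar>\<^sup>2 \<le> (N x * N y)\<^sup>2" by (simp add: power_mult_distrib)
  then show ?thesis by (rule power2_le_imp_le) (use n in simp)
qed

lemma N_lin_le: assumes x: "x \<in> X" and y: "y \<in> X" shows "N (lin c x d y) \<le> \<bar>c\<bar> * N x + \<bar>d\<bar> * N y"
proof (rule power2_le_imp_le)
  have "c * d * B x y \<le> \<bar>c * d\<bar> * \<bar>B x y\<bar>" by (metis abs_ge_self abs_mult)
  also have "\<dots> \<le> \<bar>c * d\<bar> * (N x * N y)" by (intro mult_left_mono Cauchy_Schwarz x y) auto
  finally have "2 * (c * d * B x y) \<le> 2 * (\<bar>c\<bar> * N x * (\<bar>d\<bar> * N y))" by (simp add: abs_mult mult_ac)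
  then show "(N (lin c x d y))\<^sup>2 \<le> (\<bar>c\<bar> * N x + \<bar>d\<bar> * N y)\<^sup>2"
    unfolding N_lin_sq[OF x y] by (simp add: power2_sum power_mult_distrib)
qed (use N_nonneg x y in auto)

lemma dist_nonneg: "x \<in> X \<Longrightarrow> y \<in> X \<Longrightarrow> 0 \<le> dist_of N x y"
  by (simp add: dist_of_def N_nonneg lin_X)

lemma dist_triangle:
  assumes "x \<in> X" "y \<in> X" "z \<in> X" shows "dist_of N x z \<le> dist_of N x y + dist_of N y z"
proof -
  have "lin 1 x (- 1) z = lin 1 (lin 1 x (- 1) y) 1 (lin 1 y (- 1) z)" by (auto simp: lin_def)
  then show ?thesis
    using N_lin_le[of "lin 1 x (- 1) y" "lin 1 y (- 1) z" 1 1] assms by (simp add: dist_of_def lin_X)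
qed

lemma dist_sym: assumes "x \<in> X" "y \<in> X" shows "dist_of N x y = dist_of N y x"
proof -
  have "N (lin 1 x (- 1) y) \<le> N (lin 1 y (- 1) x)" if "x \<in> X" "y \<in> X" for x y
  proof -
    have "lin 1 x (- 1) y = lin (- 1) (lin 1 y (- 1) x) 0 x" by (auto simp: lin_def)
    then show ?thesis using N_lin_le[of "lin 1 y (- 1) x" x "-1" 0] that by (simp add: lin_X)
  qed
  then show ?thesis using assms by (metis dist_of_def order_antisym)
qed

lemma dist_lin:
  assumes "x \<in> X" "y \<in> X" "x' \<in> X" "y' \<in> X"
  shows "dist_of N (lin c x d y) (lin c x' d y') \<le> \<bar>c\<bar> * dist_of N x x' + \<bar>d\<bar> * dist_of N y y'"
proof -
  have "lin 1 (lin c x d y) (- 1) (lin c x' d y') = lin c (lin 1 x (- 1) x') d (lin 1 y (- 1) y')"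
    by (auto simp: lin_def algebra_simps)
  then show ?thesis
    using N_lin_le[of "lin 1 x (- 1) x'" "lin 1 y (- 1) y'" c d] assms by (simp add: dist_of_def lin_X)
qed

lemma dist_self: assumes "x \<in> X" shows "dist_of N x x = 0"
proof -
  have "lin 1 x (- 1) x = lin 0 x 0 x" by (auto simp: lin_def)
  then show ?thesis
    using N_lin_le[OF assms assms, of 0 0] N_nonneg[OF lin_X[OF assms assms], of 0 0] by (simp add: dist_of_def)
qed

lemma N_le_dist: assumes "x \<in> X" "y \<in> X" shows "N x \<le> N y + dist_of N x y"
proof -
  have "x = lin 1 y 1 (lin 1 x (- 1) y)" by (auto simp: lin_def)
  then have "N x = N (lin 1 y 1 (lin 1 x (- 1) y))" by simp
  then show ?thesis using N_lin_le[of y "lin 1 x (- 1) y" 1 1] assms by (simp add: dist_of_def lin_X)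
qed

text \<open>The two slots are treated separately because the cross term of the Lyapunov functional,
  which pairs the velocity of one argument with the displacement of the other, is not
  symmetric.\<close>

definition bounded_form :: "(state \<Rightarrow> state \<Rightarrow> real) \<Rightarrow> real \<Rightarrow> bool" where
  "bounded_form G C \<longleftrightarrow> C \<ge> 0 \<and>
     (\<forall>x\<in>X. \<forall>y\<in>X. \<forall>z\<in>X. \<forall>c d. G (lin c x d y) z = c * G x z + d * G y z \<and> G z (lin c x d y) = c * G z x + d * G z y) \<and>
     (\<forall>x\<in>X. \<forall>y\<in>X. \<bar>G x y\<bar> \<le> C * (N x * N y))"

lemma bounded_formD:
  assumes "bounded_form G C"
  shows "C \<ge> 0" "x \<in> X \<Longrightarrow> y \<in> X \<Longrightarrow> z \<in> X \<Longrightarrow> G (lin c x d y) z = c * G x z + d * G y z"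
    "x \<in> X \<Longrightarrow> y \<in> X \<Longrightarrow> z \<in> X \<Longrightarrow> G z (lin c x d y) = c * G z x + d * G z y"
    "x \<in> X \<Longrightarrow> y \<in> X \<Longrightarrow> \<bar>G x y\<bar> \<le> C * (N x * N y)"
  using assms unfolding bounded_form_def by blast+

text \<open>Gives continuity in the norm and, at distance 0, independence of the
  representative.\<close>

lemma bounded_form_diff:
  assumes G: "bounded_form G C" and "x \<in> X" "y \<in> X" "x' \<in> X" "y' \<in> X"
  shows "\<bar>G x y - G x' y'\<bar> \<le> C * (dist_of N x x' * N y + N x' * dist_of N y y')"
proof -
  have "G x y - G x' y' = G (lin 1 x (- 1) x') y + G x' (lin 1 y (- 1) y')"
    using assms by (simp add: bounded_formD(2,3)[OF G])
  also have "\<bar>\<dots>\<bar> \<le> \<bar>G (lin 1 x (- 1) x') y\<bar> + \<bar>G x' (lin 1 y (- 1) y')\<bar>" by (rule abs_triangle_ineq)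
  also have "\<dots> \<le> C * (N (lin 1 x (- 1) x') * N y) + C * (N x' * N (lin 1 y (- 1) y'))"
    using assms by (intro add_mono bounded_formD(4)[OF G] lin_X)
  finally show ?thesis by (simp add: dist_of_def algebra_simps)
qed

section \<open>Orbits of a contraction semigroup\<close>

context
  fixes R D A
  assumes gen: "generates X N D A R" and DX: "D \<subseteq> X" and AX: "\<And>x. x \<in> D \<Longrightarrow> A x \<in> X"
begin

lemma semigroup:
  "t \<ge> 0 \<Longrightarrow> x \<in> X \<Longrightarrow> R t x \<in> X" "t \<ge> 0 \<Longrightarrow> x \<in> X \<Longrightarrow> N (R t x) \<le> N x"
  "t \<ge> 0 \<Longrightarrow> x \<in> X \<Longrightarrow> y \<in> X \<Longrightarrow> dist_of N (R t (lin c x d y)) (lin c (R t x) d (R t y)) = 0"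
  "x \<in> X \<Longrightarrow> dist_of N (R 0 x) x = 0"
  "s \<ge> 0 \<Longrightarrow> t \<ge> 0 \<Longrightarrow> x \<in> X \<Longrightarrow> dist_of N (R (s + t) x) (R s (R t x)) = 0"
  "x \<in> X \<Longrightarrow> ((\<lambda>t. dist_of N (R t x) x) \<longlongrightarrow> 0) (at_right 0)"
  using gen unfolding generates_def contraction_semigroup_def by blast+

lemma generator:
  "x \<in> X \<Longrightarrow> z \<in> X \<Longrightarrow> has_generator_value N R x z \<longleftrightarrow> (\<exists>x'\<in>D. dist_of N x x' = 0 \<and> dist_of N z (A x') = 0)"
  using gen unfolding generates_def by blast

text \<open>R t is linear only up to distance 0, hence the detour through
  \<open>N_le_dist\<close>.\<close>

lemma semigroup_contraction:
  assumes t: "t \<ge> 0" and x: "x \<in> X" and y: "y \<in> X" shows "dist_of N (R t x) (R t y) \<le> dist_of N x y"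
proof -
  let ?u = "lin 1 (R t x) (- 1) (R t y)" and ?v = "R t (lin 1 x (- 1) y)"
  have X: "?u \<in> X" "?v \<in> X" using assms by (auto intro!: lin_X semigroup)
  have "N ?u \<le> N ?v + dist_of N ?u ?v" by (rule N_le_dist[OF X])
  also have "dist_of N ?u ?v = 0" using semigroup(3)[OF t x y] dist_sym[OF X] by simp
  also have "N ?v \<le> dist_of N x y" unfolding dist_of_def by (intro semigroup(2) t lin_X x y)
  finally show ?thesis by (simp add: dist_of_def)
qed

lemma orbit_difference:
  assumes "0 \<le> s" "0 \<le> h" "x \<in> X"
  shows "dist_of N (R (s + h) x) (R s x) \<le> dist_of N (R h x) x"
proof -
  have "dist_of N (R (s + h) x) (R s x) \<le> dist_of N (R (s + h) x) (R s (R h x)) + dist_of N (R s (R h x)) (R s x)"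
    using assms by (intro dist_triangle semigroup) auto
  also have "\<dots> \<le> 0 + dist_of N (R h x) x"
    using assms by (intro add_mono semigroup_contraction semigroup) (auto simp: semigroup)
  finally show ?thesis by simp
qed

text \<open>Strong continuity is given at 0 from the right; \<open>orbit_difference\<close>
  transports it to all times with the same modulus, which yields continuity from both sides.\<close>

lemma orbit_continuous:
  assumes G: "bounded_form G C" and x: "x \<in> X"
  shows "continuous_on {0..} (\<lambda>t. G (R t x) (R t x))"
  unfolding continuous_on_iff
proof (intro ballI allI impI)
  fix t e :: real assume t: "t \<in> {0..}" and e: "e > 0"
  define k where "k = 2 * C * N x + 1"
  have k: "k > 0" using bounded_formD(1)[OF G] N_nonneg[OF x] by (simp add: k_def add_nonneg_pos)
  have "\<forall>\<^sub>F h in at_right 0. dist_of N (R h x) x < e / k"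
    by (rule order_tendstoD(2)[OF semigroup(6)[OF x]]) (use e k in simp)
  then obtain d where d: "d > 0" "\<And>h. 0 < h \<Longrightarrow> h < d \<Longrightarrow> dist_of N (R h x) x < e / k"
    by (auto simp: eventually_at_right_field)
  have main: "\<bar>G (R s x) (R s x) - G (R r x) (R r x)\<bar> < e" if "0 \<le> r" "r < s" "s - r < d" for r s
  proof -
    have X: "R s x \<in> X" "R r x \<in> X" using that x by (auto intro: semigroup)
    have dd: "dist_of N (R s x) (R r x) < e / k"
      using orbit_difference[of r "s - r" x] d(2)[of "s - r"] that x by simp
    have "\<bar>G (R s x) (R s x) - G (R r x) (R r x)\<bar>
        \<le> C * (dist_of N (R s x) (R r x) * N (R s x) + N (R r x) * dist_of N (R s x) (R r x))"
      by (rule bounded_form_diff[OF G X(1) X(1) X(2) X(2)])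
    also have "\<dots> \<le> C * (dist_of N (R s x) (R r x) * N x + N x * dist_of N (R s x) (R r x))"
      using that x X bounded_formD(1)[OF G]
      by (intro mult_left_mono add_mono mult_right_mono semigroup(2) dist_nonneg) auto
    also have "\<dots> = (2 * C * N x) * dist_of N (R s x) (R r x)" by (simp add: algebra_simps)
    also have "\<dots> \<le> k * dist_of N (R s x) (R r x)"
      using dist_nonneg[OF X] by (intro mult_right_mono) (auto simp: k_def)
    also have "\<dots> < e" using dd k by (simp add: field_simps)
    finally show ?thesis .
  qed
  show "\<exists>d>0. \<forall>s\<in>{0..}. dist s t < d \<longrightarrow> dist (G (R s x) (R s x)) (G (R t x) (R t x)) < e"
  proof (intro exI[of _ d] conjI ballI impI d(1))
    fix s assume "s \<in> {0..}" "dist s t < d"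
    then show "dist (G (R s x) (R s x)) (G (R t x) (R t x)) < e"
      using main[of s t] main[of t s] t e
      by (cases s t rule: linorder_cases) (auto simp: dist_real_def abs_minus_commute)
  qed
qed

text \<open>R s commutes with difference quotients up to distance 0, so orbits starting in the
  domain stay in it up to distance 0, and the generator commutes with the semigroup.\<close>

lemma orbit_generator_value:
  assumes s: "s \<ge> 0" and x: "x \<in> D"
  shows "((\<lambda>h. dist_of N (lin (1 / h) (R (s + h) x) (- 1 / h) (R s x)) (R s (A x))) \<longlongrightarrow> 0) (at_right 0)"
    and "has_generator_value N R (R s x) (R s (A x))"
proof -
  have xX: "x \<in> X" and AxX: "A x \<in> X" using x DX AX by auto
  have gx: "((\<lambda>h. dist_of N (lin (1 / h) (R h x) (- 1 / h) x) (A x)) \<longlongrightarrow> 0) (at_right 0)"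
    using generator[OF xX AxX] x dist_self[OF xX] dist_self[OF AxX] unfolding has_generator_value_def by blast
  \<comment> \<open>The point y stands for \<open>R (s + h) x\<close> in the first claim and for
    \<open>R h (R s x)\<close> in the second.\<close>
  have le: "dist_of N (lin (1 / h) y (- 1 / h) (R s x)) (R s (A x)) \<le> dist_of N (lin (1 / h) (R h x) (- 1 / h) x) (A x)"
    if h: "h > 0" and y: "y \<in> X" "dist_of N y (R s (R h x)) = 0" for h y
  proof -
    define q where "q = lin (1 / h) (R h x) (- 1 / h) x"
    have q: "q \<in> X" unfolding q_def using h xX by (intro lin_X semigroup) auto
    have X: "R s (R h x) \<in> X" "R s x \<in> X" "R s q \<in> X" "R s (A x) \<in> X"
      using s h xX AxX q semigroup(1)[of h x] by (auto intro: semigroup(1))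
    let ?k = "lin (1 / h) y (- 1 / h) (R s x)" and ?k' = "lin (1 / h) (R s (R h x)) (- 1 / h) (R s x)"
    have kX: "?k \<in> X" "?k' \<in> X" using y X by (auto intro: lin_X)
    have "dist_of N ?k (R s (A x)) \<le> dist_of N ?k ?k' + dist_of N ?k' (R s (A x))"
      by (rule dist_triangle[OF kX X(4)])
    also have "dist_of N ?k' (R s (A x)) \<le> dist_of N ?k' (R s q) + dist_of N (R s q) (R s (A x))"
      by (rule dist_triangle[OF kX(2) X(3,4)])
    also have "dist_of N ?k' (R s q) = 0"
    proof -
      have "R h x \<in> X" using h xX by (intro semigroup) auto
      then have "dist_of N (R s q) ?k' = 0" unfolding q_def by (rule semigroup(3)[OF s _ xX])
      then show ?thesis using dist_sym[OF kX(2) X(3)] by simp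
    qed
    also have "dist_of N (R s q) (R s (A x)) \<le> dist_of N q (A x)" by (rule semigroup_contraction[OF s q AxX])
    also have "dist_of N ?k ?k' \<le> \<bar>1 / h\<bar> * dist_of N y (R s (R h x)) + \<bar>- 1 / h\<bar> * dist_of N (R s x) (R s x)"
      by (rule dist_lin[OF y(1) X(2) X(1) X(2)])
    finally show ?thesis using y(2) dist_self[OF X(2)] by (simp add: q_def)
  qed
  have ev: "\<forall>\<^sub>F h in at_right 0. 0 < (h::real)" by (rule eventually_at_right_less)
  show "((\<lambda>h. dist_of N (lin (1 / h) (R (s + h) x) (- 1 / h) (R s x)) (R s (A x))) \<longlongrightarrow> 0) (at_right 0)"
  proof (rule tendsto_sandwich[OF _ _ tendsto_const gx])
    show "\<forall>\<^sub>F h in at_right 0. 0 \<le> dist_of N (lin (1 / h) (R (s + h) x) (- 1 / h) (R s x)) (R s (A x))"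
      using ev by eventually_elim (use s xX AxX in \<open>auto intro!: dist_nonneg lin_X semigroup\<close>)
    show "\<forall>\<^sub>F h in at_right 0. dist_of N (lin (1 / h) (R (s + h) x) (- 1 / h) (R s x)) (R s (A x))
        \<le> dist_of N (lin (1 / h) (R h x) (- 1 / h) x) (A x)"
      using ev
    proof eventually_elim
      case (elim h)
      then show ?case using s xX by (intro le semigroup) auto
    qed
  qed
  show "has_generator_value N R (R s x) (R s (A x))"
    unfolding has_generator_value_def
  proof (rule tendsto_sandwich[OF _ _ tendsto_const gx])
    show "\<forall>\<^sub>F h in at_right 0. 0 \<le> dist_of N (lin (1 / h) (R h (R s x)) (- 1 / h) (R s x)) (R s (A x))"
      using ev by eventually_elim (use s xX AxX in \<open>auto intro!: dist_nonneg lin_X semigroup\<close>)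
    show "\<forall>\<^sub>F h in at_right 0. dist_of N (lin (1 / h) (R h (R s x)) (- 1 / h) (R s x)) (R s (A x))
        \<le> dist_of N (lin (1 / h) (R h x) (- 1 / h) x) (A x)"
      using ev
    proof eventually_elim
      case (elim h)
      have X: "R h (R s x) \<in> X" "R s (R h x) \<in> X" "R (s + h) x \<in> X" using elim s xX by (auto intro!: semigroup)
      have "dist_of N (R h (R s x)) (R s (R h x)) \<le> dist_of N (R h (R s x)) (R (s + h) x) + dist_of N (R (s + h) x) (R s (R h x))"
        by (rule dist_triangle[OF X(1,3,2)])
      also have "\<dots> = 0"
        using semigroup(5)[of h s x] semigroup(5)[of s h x] dist_sym[OF X(1,3)] elim s xX by (simp add: add.commute)
      finally have "dist_of N (R h (R s x)) (R s (R h x)) = 0" using dist_nonneg[OF X(1,2)] by simp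
      then show ?case by (rule le[OF elim X(1)])
    qed
  qed
qed

text \<open>\<open>R s x\<close> itself need not lie in D, only some x' at distance 0 from it. As
  bounded forms do not see the difference, the derivative is expressed by x', to which dissipativity
  applies.\<close>

lemma orbit_right_derivative:
  assumes G: "bounded_form G C" and s: "s \<ge> 0" and x: "x \<in> D"
  obtains x' where "x' \<in> D" "dist_of N (R s x) x' = 0"
    "((\<lambda>h. (G (R (s + h) x) (R (s + h) x) - G (R s x) (R s x)) / h) \<longlongrightarrow> G x' (A x') + G (A x') x') (at_right 0)"
proof -
  have xX: "x \<in> X" and AxX: "A x \<in> X" using x DX AX by auto
  define z k where "z = R s x" "k = R s (A x)"
  have zX: "z \<in> X" and kX: "k \<in> X" unfolding z_k_def using s xX AxX by (auto intro: semigroup)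
  obtain x' where x': "x' \<in> D" "dist_of N z x' = 0" "dist_of N k (A x') = 0"
    using orbit_generator_value(2)[OF s x] generator[OF zX kX] unfolding z_k_def by blast
  have x'X: "x' \<in> X" and Ax'X: "A x' \<in> X" using x'(1) DX AX by auto
  \<comment> \<open>With this quotient R (s + h) x = z + h kh, and expanding G leaves the quadratic
    remainder h G(kh, kh), which tends to 0.\<close>
  define kh where "kh h = lin (1 / h) (R (s + h) x) (- 1 / h) z" for h
  have khX: "kh h \<in> X" if "h > 0" for h unfolding kh_def using that s xX zX by (intro lin_X semigroup) auto
  have lim: "((\<lambda>h. dist_of N (kh h) k) \<longlongrightarrow> 0) (at_right 0)"
    using orbit_generator_value(1)[OF s x] by (simp add: kh_def z_k_def)
  have ev: "\<forall>\<^sub>F h in at_right 0. 0 < (h::real)" by (rule eventually_at_right_less)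
  have toG: "((\<lambda>h. F (kh h)) \<longlongrightarrow> F k) (at_right 0)"
    if F: "\<And>y. y \<in> X \<Longrightarrow> \<bar>F y - F k\<bar> \<le> c * dist_of N y k" for F c
  proof (rule Lim_null_comparison[THEN LIM_zero_cancel])
    show "\<forall>\<^sub>F h in at_right 0. norm (F (kh h) - F k) \<le> c * dist_of N (kh h) k"
      using ev by eventually_elim (use F khX in auto)
    show "((\<lambda>h. c * dist_of N (kh h) k) \<longlongrightarrow> 0) (at_right 0)" using tendsto_mult_left[OF lim, of c] by simp
  qed
  have 1: "((\<lambda>h. G z (kh h)) \<longlongrightarrow> G z k) (at_right 0)"
    by (rule toG[of _ "C * N z"]) (use bounded_form_diff[OF G zX _ zX kX] dist_self[OF zX] in \<open>auto simp: mult.assoc\<close>)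
  have 2: "((\<lambda>h. G (kh h) z) \<longlongrightarrow> G k z) (at_right 0)"
    by (rule toG[of "\<lambda>y. G y z" "C * N z"]) (use bounded_form_diff[OF G _ zX kX zX] dist_self[OF zX] in \<open>auto simp: mult_ac\<close>)
  have 3: "((\<lambda>h. h * G (kh h) (kh h)) \<longlongrightarrow> 0) (at_right 0)"
  proof (rule Lim_null_comparison)
    show "\<forall>\<^sub>F h in at_right 0. norm (h * G (kh h) (kh h)) \<le> h * (C * ((N k + dist_of N (kh h) k) * (N k + dist_of N (kh h) k)))"
      using ev
    proof eventually_elim
      case (elim h)
      have n: "N (kh h) \<le> N k + dist_of N (kh h) k" by (rule N_le_dist[OF khX[OF elim] kX])
      have "\<bar>G (kh h) (kh h)\<bar> \<le> C * (N (kh h) * N (kh h))" by (rule bounded_formD(4)[OF G khX[OF elim] khX[OF elim]])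
      also have "\<dots> \<le> C * ((N k + dist_of N (kh h) k) * (N k + dist_of N (kh h) k))"
        using n N_nonneg[OF khX[OF elim]] bounded_formD(1)[OF G] by (intro mult_left_mono mult_mono) auto
      finally show ?case using elim by (simp add: abs_mult)
    qed
    have "((\<lambda>h. h * (C * ((N k + dist_of N (kh h) k) * (N k + dist_of N (kh h) k)))) \<longlongrightarrow> 0 * (C * ((N k + 0) * (N k + 0)))) (at_right 0)"
      by (intro tendsto_intros lim)
    then show "((\<lambda>h. h * (C * ((N k + dist_of N (kh h) k) * (N k + dist_of N (kh h) k)))) \<longlongrightarrow> 0) (at_right 0)" by simp
  qed
  have "((\<lambda>h. G z (kh h) + G (kh h) z + h * G (kh h) (kh h)) \<longlongrightarrow> G z k + G k z + 0) (at_right 0)"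
    by (intro tendsto_add 1 2 3)
  moreover have "\<forall>\<^sub>F h in at_right 0. G z (kh h) + G (kh h) z + h * G (kh h) (kh h) = (G (R (s + h) x) (R (s + h) x) - G z z) / h"
    using ev
  proof eventually_elim
    case (elim h)
    have e: "R (s + h) x = lin 1 z h (kh h)" using elim by (auto simp: kh_def lin_def field_simps)
    show ?case unfolding e
      using elim khX[OF elim] zX by (simp add: bounded_formD(2,3)[OF G] lin_X field_simps)
  qed
  ultimately have "((\<lambda>h. (G (R (s + h) x) (R (s + h) x) - G z z) / h) \<longlongrightarrow> G z k + G k z) (at_right 0)"
    by (simp add: Lim_transform_eventually)
  moreover have "G z k = G x' (A x')"
    using bounded_form_diff[OF G zX kX x'X Ax'X] x' by simp
  moreover have "G k z = G (A x') x'"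
    using bounded_form_diff[OF G kX zX Ax'X x'X] x' by simp
  ultimately show ?thesis using x' by (intro that[of x']) (auto simp: z_k_def)
qed

text \<open>L' \<le> - \<mu> E leads to \<mu> \<integral> E over [S, t] \<le> L(S) - L(t) \<le> (M1
  + M2) E(S), the hypothesis of \<open>Komornik\<close>.\<close>

theorem Lyapunov_decay_domain:
  assumes G: "bounded_form G C" and \<mu>: "\<mu> > 0" and M: "M1 > 0" "M2 \<ge> 0"
    and diss: "\<And>x. x \<in> D \<Longrightarrow> G x (A x) + G (A x) x \<le> - \<mu> * (1/2 * B x x)"
    and upper: "\<And>x. x \<in> X \<Longrightarrow> G x x \<le> M1 * (1/2 * B x x)"
    and lower: "\<And>x. x \<in> X \<Longrightarrow> - M2 * (1/2 * B x x) \<le> G x x"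
    and x: "x \<in> D" and t: "t \<ge> 0"
  shows "B (R t x) (R t x) \<le> B x x * exp (1 - t / ((M1 + M2) / \<mu>))"
proof -
  have xX: "x \<in> X" using x DX by auto
  have RX: "R s x \<in> X" if "s \<ge> 0" for s using that xX by (rule semigroup)
  define E where "E s = 1/2 * B (R s x) (R s x)" for s
  define L where "L s = G (R s x) (R s x)" for s
  have BB: "bounded_form B 1"
    unfolding bounded_form_def using B_lin B_lin2 Cauchy_Schwarz by auto
  have cE: "continuous_on S E" if "S \<subseteq> {0..}" for S
    unfolding E_def using continuous_on_subset[OF orbit_continuous[OF BB xX] that] by (intro continuous_intros)
  have cL: "continuous_on S L" if "S \<subseteq> {0..}" for S
    unfolding L_def using continuous_on_subset[OF orbit_continuous[OF G xX] that] .
  have E0: "E s \<ge> 0" if "s \<ge> 0" for s using B_nonneg[OF RX[OF that]] by (simp add: E_def)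
  have mono: "E s \<le> E r" if "0 \<le> r" "r \<le> s" for r s
  proof -
    have X: "R s x \<in> X" "R r x \<in> X" "R (s - r) (R r x) \<in> X" using that xX by (auto intro!: semigroup)
    have "N (R s x) \<le> N (R (s - r) (R r x)) + dist_of N (R s x) (R (s - r) (R r x))" by (rule N_le_dist[OF X(1,3)])
    also have "dist_of N (R s x) (R (s - r) (R r x)) = 0" using semigroup(5)[of "s - r" r x] that xX by simp
    also have "N (R (s - r) (R r x)) \<le> N (R r x)" using that X semigroup(2)[of "s - r" "R r x"] by simp
    finally have "N (R s x) \<le> N (R r x)" by simp
    then have "(N (R s x))\<^sup>2 \<le> (N (R r x))\<^sup>2" using N_nonneg[OF X(1)] by (intro power_mono)
    then show ?thesis using X by (simp add: E_def N_sq)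
  qed
  have int: "integral {S..t} E \<le> (M1 + M2) / \<mu> * E S" if S: "0 \<le> S" "S \<le> t" for S
  proof -
    \<comment> \<open>Adding the integral of E yields a continuous function with nonpositive right
      derivative, so the derivative of L never has to be integrated.\<close>
    define H where "H r = L r + \<mu> * integral {S..r} E" for r
    have cES: "continuous_on {S..t} E" using S by (intro cE) auto
    have "H t \<le> H S"
    proof (rule nonincreasing_if_right_derivative_nonpos[OF S(2)])
      show "continuous_on {S..t} H"
        unfolding H_def using S
        by (intro continuous_on_add continuous_on_mult continuous_on_const cL
            indefinite_integral_continuous_1 integrable_continuous_real cES) auto
      fix s assume s: "S \<le> s" "s < t"
      then have s0: "s \<ge> 0" using S by simp
      obtain x' where x': "x' \<in> D" "dist_of N (R s x) x' = 0"
        "((\<lambda>h. (L (s + h) - L s) / h) \<longlongrightarrow> G x' (A x') + G (A x') x') (at_right 0)"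
        unfolding L_def using orbit_right_derivative[OF G s0 x] by blast
      have x'X: "x' \<in> X" using x' DX by auto
      have "B (R s x) (R s x) = B x' x'"
        using bounded_form_diff[OF BB RX[OF s0] RX[OF s0] x'X x'X] x' by simp
      then have d: "G x' (A x') + G (A x') x' \<le> - \<mu> * E s" using diss[OF x'(1)] by (simp add: E_def)
      have "((\<lambda>r. integral {S..r} E) has_real_derivative E s) (at s within {S..t})"
        by (rule integral_has_real_derivative[OF cES]) (use s in auto)
      then have "((\<lambda>r. integral {S..r} E) has_real_derivative E s) (at s within {s..t})"
        by (rule has_field_derivative_subset) (use s in auto)
      then have "((\<lambda>r. integral {S..r} E) has_real_derivative E s) (at_right s)"
        using s by (simp add: at_within_Icc_at_right)
      then have "((\<lambda>r. (integral {S..r} E - integral {S..s} E) / (r - s)) \<longlongrightarrow> E s) (at_right s)"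
        by (simp add: has_field_derivative_iff)
      then have "((\<lambda>h. (integral {S..s + h} E - integral {S..s} E) / h) \<longlongrightarrow> E s) (at_right 0)"
        by (subst (asm) filterlim_at_right_to_0) (simp add: add.commute)
      then have "((\<lambda>h. (L (s + h) - L s) / h + \<mu> * ((integral {S..s + h} E - integral {S..s} E) / h))
          \<longlongrightarrow> (G x' (A x') + G (A x') x') + \<mu> * E s) (at_right 0)"
        by (intro tendsto_add x'(3) tendsto_mult_left)
      moreover have "(\<lambda>h. (L (s + h) - L s) / h + \<mu> * ((integral {S..s + h} E - integral {S..s} E) / h)) = (\<lambda>h. (H (s + h) - H s) / h)"
        by (auto simp: H_def diff_divide_distrib add_divide_distrib algebra_simps)
      ultimately have "((\<lambda>h. (H (s + h) - H s) / h) \<longlongrightarrow> (G x' (A x') + G (A x') x') + \<mu> * E s) (at_right 0)" by simp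
      moreover have "(G x' (A x') + G (A x') x') + \<mu> * E s \<le> 0" using d by simp
      ultimately show "\<exists>D\<le>0. ((\<lambda>h. (H (s + h) - H s) / h) \<longlongrightarrow> D) (at_right 0)" by blast
    qed
    then have "\<mu> * integral {S..t} E \<le> L S - L t" by (simp add: H_def)
    moreover have "L S \<le> M1 * E S" using upper[OF RX[OF S(1)]] by (simp add: L_def E_def)
    moreover have "- (M2 * E t) \<le> L t" using lower[OF RX[OF t]] by (simp add: L_def E_def)
    moreover have "M2 * E t \<le> M2 * E S" by (rule mult_left_mono[OF mono[OF S] M(2)])
    ultimately have "\<mu> * integral {S..t} E \<le> (M1 + M2) * E S" unfolding distrib_right by linarith
    then show ?thesis using \<mu> by (simp add: field_simps)
  qed
  have "E t \<le> E 0 * exp (1 - t / ((M1 + M2) / \<mu>))"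
    by (rule Komornik[OF _ mono E0 _ t int]) (use cE M \<mu> in auto)
  moreover have "B (R 0 x) (R 0 x) = B x x"
    using bounded_form_diff[OF BB RX[OF order_refl] RX[OF order_refl] xX xX] semigroup(4)[OF xX] by simp
  ultimately show ?thesis by (simp add: E_def)
qed

text \<open>Contractivity of R t carries the bound from D to its closure. The approximation takes
  place in the norm, hence the square root \<open>c\<close>.\<close>

theorem Lyapunov_decay:
  assumes G: "bounded_form G C" and \<mu>: "\<mu> > 0" and M: "M1 > 0" "M2 \<ge> 0"
    and diss: "\<And>x. x \<in> D \<Longrightarrow> G x (A x) + G (A x) x \<le> - \<mu> * (1/2 * B x x)"
    and upper: "\<And>x. x \<in> X \<Longrightarrow> G x x \<le> M1 * (1/2 * B x x)"
    and lower: "\<And>x. x \<in> X \<Longrightarrow> - M2 * (1/2 * B x x) \<le> G x x"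
    and dense: "\<And>x e. x \<in> X \<Longrightarrow> e > 0 \<Longrightarrow> \<exists>x'\<in>D. dist_of N x x' < e"
    and x: "x \<in> X" and t: "t \<ge> 0"
  shows "B (R t x) (R t x) \<le> B x x * exp (1 - t / ((M1 + M2) / \<mu>))"
proof -
  define c where "c = sqrt (exp (1 - t / ((M1 + M2) / \<mu>)))"
  have c: "c \<ge> 0" "c\<^sup>2 = exp (1 - t / ((M1 + M2) / \<mu>))" by (simp_all add: c_def)
  have RX: "R t x \<in> X" using x t by (intro semigroup)
  have "N (R t x) \<le> c * N x"
  proof (rule field_le_epsilon)
    fix e :: real assume "e > 0"
    then have "e / (c + 1) > 0" using c by simp
    then obtain x' where x': "x' \<in> D" "dist_of N x x' < e / (c + 1)" using dense[OF x] by blast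
    have x'X: "x' \<in> X" using x' DX by auto
    have R': "R t x' \<in> X" using x'X t by (intro semigroup)
    have "B (R t x') (R t x') \<le> B x' x' * c\<^sup>2"
      unfolding c(2) by (rule Lyapunov_decay_domain[OF G \<mu> M diss upper lower x'(1) t])
    then have "(N (R t x'))\<^sup>2 \<le> (N x' * c)\<^sup>2" using R' x'X by (simp add: N_sq power_mult_distrib)
    then have a: "N (R t x') \<le> N x' * c" by (rule power2_le_imp_le) (use c N_nonneg[OF x'X] in auto)
    have "N (R t x) \<le> N (R t x') + dist_of N (R t x) (R t x')" by (rule N_le_dist[OF RX R'])
    also have "\<dots> \<le> N x' * c + dist_of N x x'" by (intro add_mono a semigroup_contraction t x x'X)
    also have "N x' \<le> N x + dist_of N x x'" using N_le_dist[OF x'X x] dist_sym[OF x x'X] by simp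
    then have "N x' * c \<le> (N x + dist_of N x x') * c" using c by (intro mult_right_mono) auto
    then have "N x' * c + dist_of N x x' \<le> c * N x + (c + 1) * dist_of N x x'" by (simp add: algebra_simps)
    also have "(c + 1) * dist_of N x x' \<le> e" using x'(2) c by (simp add: field_simps)
    finally show "N (R t x) \<le> c * N x + e" by simp
  qed
  then have "(N (R t x))\<^sup>2 \<le> (c * N x)\<^sup>2" using N_nonneg[OF RX] by (intro power_mono)
  then show ?thesis using N_sq[OF RX] N_sq[OF x] c by (simp add: power_mult_distrib mult.commute)
qed

end

end

section \<open>The energy space of the beam\<close>

lemma H1_lin: assumes "H1 f" "H1 g" shows "H1 (\<lambda>x. c * f x + d * g x)"
proof -
  obtain f' g' where "is_weak_deriv f f'" "L2 f'" "is_weak_deriv g g'" "L2 g'"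
    using assms by (auto simp: H1_def)
  then show ?thesis using assms is_weak_deriv_lin L2_lin unfolding H1_def by meson
qed

context degenerate
begin

lemma D01_lin:
  assumes u: "u \<in> K2a0 a" and v: "v \<in> K2a0 a" and x: "0 < x" "x \<le> 1"
  shows "D01 (\<lambda>s. c * u s + d * v s) x = c * D01 u x + d * D01 v x"
    and "((\<lambda>s. c * u s + d * v s) has_real_derivative c * D01 u x + d * D01 v x) (at x within {0..1})"
proof -
  show D: "((\<lambda>s. c * u s + d * v s) has_real_derivative c * D01 u x + d * D01 v x) (at x within {0..1})"
    by (intro DERIV_add DERIV_cmult K2a0_DERIV u v x)
  show "D01 (\<lambda>s. c * u s + d * v s) x = c * D01 u x + d * D01 v x"
    by (rule D01_eqI[OF D]) (use x in auto)
qed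

text \<open>\<open>wderiv\<close> picks arbitrary representatives, so linearity survives only almost
  everywhere.\<close>

lemma D2_lin:
  assumes u: "u \<in> K2a0 a" and v: "v \<in> K2a0 a"
  shows "AE x in I01. D2 (\<lambda>s. c * u s + d * v s) x = c * D2 u x + d * D2 v x"
    and "D2 (\<lambda>s. c * u s + d * v s) \<in> borel_measurable I01"
proof -
  have "is_weak_deriv (\<lambda>x. c * D01 u x + d * D01 v x) (\<lambda>x. c * D2 u x + d * D2 v x)"
    by (intro is_weak_deriv_lin K2a0_D2(1) u v)
  then have "is_weak_deriv (D01 (\<lambda>s. c * u s + d * v s)) (\<lambda>x. c * D2 u x + d * D2 v x)"
  proof (rule is_weak_deriv_cong_AE)
    show "AE x in I01. c * D01 u x + d * D01 v x = D01 (\<lambda>s. c * u s + d * v s) x"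
      by (intro AE_I2 D01_lin(1)[OF u v, symmetric]) auto
  qed simp
  from weak_deriv_wderiv[OF this]
  show "AE x in I01. D2 (\<lambda>s. c * u s + d * v s) x = c * D2 u x + d * D2 v x"
    and "D2 (\<lambda>s. c * u s + d * v s) \<in> borel_measurable I01"
    by (auto simp: D2_def is_weak_deriv_def intro: L1_loc_measurable)
qed

lemma K2a0_lin:
  assumes u: "u \<in> K2a0 a" and v: "v \<in> K2a0 a" shows "(\<lambda>s. c * u s + d * v s) \<in> K2a0 a"
proof -
  let ?f = "\<lambda>s. c * u s + d * v s"
  have H: "H1 ?f" using u v by (intro H1_lin) (auto simp: K2a0_def)
  have C: "continuous_on {0..1} ?f" using u v by (intro continuous_intros K2a0_continuous)
  have f0: "?f 0 = 0" using K2a0_0[OF u] K2a0_0[OF v] by simp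
  have dif: "?f differentiable (at x within {0..1})" if "0 < x" "x \<le> 1" for x
    using D01_lin(2)[OF u v that] by (auto simp: real_differentiable_def)
  have L: "L2 (\<lambda>x. sqrt (a x) * D2 ?f x)"
  proof (rule L2_cong_AE)
    show "L2 (\<lambda>s. sqrt (a s) * (c * D2 u s + d * D2 v s))"
      by (intro wsqD wsq_lin K2a0_D2 u v)
    show "AE x in I01. sqrt (a x) * (c * D2 u x + d * D2 v x) = sqrt (a x) * D2 ?f x"
      using D2_lin(1)[OF u v, of c d] by eventually_elim simp
    show "(\<lambda>x. sqrt (a x) * D2 ?f x) \<in> borel_measurable I01"
      by (intro borel_measurable_times D2_lin(2) u v measurable_compose[OF a_measurable borel_measurable_sqrt])
  qed
  have ac: "abs_cont_on e 1 (D01 ?f)" if "0 < e" "e < 1" for e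
  proof (rule abs_cont_on_cong)
    show "abs_cont_on e 1 (\<lambda>x. c * D01 u x + d * D01 v x)" by (intro abs_cont_on_lin K2a0_abs_cont u v that)
    show "c * D01 u x + d * D01 v x = D01 ?f x" if "x \<in> {e..1}" for x
      using D01_lin(1)[OF u v, of x] that \<open>0 < e\<close> by simp
  qed
  have WD: "(\<forall>x\<in>{0..1}. ?f differentiable (at x within {0..1})) \<and> abs_cont_on 0 1 (D01 ?f) \<and> D01 ?f 0 = 0"
    if WD: "weakly_degenerate a"
  proof -
    have d0: "u differentiable (at 0 within {0..1})" "v differentiable (at 0 within {0..1})" "D01 u 0 = 0" "D01 v 0 = 0"
      using u v WD by (auto simp: K2a0_def)
    have D: "(?f has_real_derivative c * D01 u 0 + d * D01 v 0) (at 0 within {0..1})"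
      by (intro DERIV_add DERIV_cmult D01_DERIV d0) auto
    have D0: "D01 ?f 0 = c * D01 u 0 + d * D01 v 0" by (rule D01_eqI[OF D]) auto
    have "abs_cont_on 0 1 (D01 ?f)"
    proof (rule abs_cont_on_cong)
      show "abs_cont_on 0 1 (\<lambda>x. c * D01 u x + d * D01 v x)"
        using u v WD by (intro abs_cont_on_lin) (auto simp: K2a0_def)
      show "c * D01 u x + d * D01 v x = D01 ?f x" if "x \<in> {0..1}" for x
        using D01_lin(1)[OF u v, of x] that D0 by (cases "x = 0") auto
    qed
    moreover have "?f differentiable (at x within {0..1})" if "x \<in> {0..1}" for x
      using dif[of x] D that by (cases "x = 0") (auto simp: real_differentiable_def)
    ultimately show ?thesis using D0 d0 by simp
  qed
  show ?thesis
    unfolding K2a0_def using H C f0 dif L ac WD by simp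
qed

lemma wsq_cong_AE_mult:
  assumes w: "wsq w" and ae: "AE x in I01. w' x = w x" and m: "w' \<in> borel_measurable I01" and k: "wsq k"
  shows "(LINT s|I01. a s * (w' s * k s)) = (LINT s|I01. a s * (w s * k s))"
proof (rule integral_cong_AE)
  show "AE x in I01. a x * (w' x * k x) = a x * (w x * k x)" using ae by eventually_elim simp
qed (use m wsqD(1)[OF w] wsqD(1)[OF k] a_measurable in measurable)

lemma dom_calB_subset: "dom_calB a \<beta> \<gamma> \<subseteq> space_K0 a"
  by (auto simp: dom_calB_def space_K0_def dom_B_def intro: L2_continuous K2a0_continuous)

lemma calB_space: assumes "x \<in> dom_calB a \<beta> \<gamma>" shows "calB a x \<in> space_K0 a"
proof -
  obtain u v where x: "x = (u, v)" by (cases x)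
  have uB: "u \<in> dom_B a" and v: "v \<in> K2a0 a" using assms x by (auto simp: dom_calB_def)
  obtain h where "flux_data (aD2 a u) h (op_B a u)" using dom_B_flux_data[OF uB] by blast
  then have b: "L2 (op_B a u)" by (rule flux_dataD(1))
  then have "L2 (\<lambda>s. - op_B a u s)" using L2_lin[OF b b, of "-1" 0] by simp
  then show ?thesis using v by (simp add: x calB_def space_K0_def)
qed

end

context damped_beam
begin

text \<open>The polarisation of \<open>sq_energy\<close>.\<close>

definition energy_form :: "state \<Rightarrow> state \<Rightarrow> real" where
  "energy_form x y = (LINT s|I01. a s * (D2 (fst x) s * D2 (fst y) s)) + (LINT s|I01. snd x s * snd y s)
     + \<beta> * (fst x 1 * fst y 1) + \<gamma> * (D01 (fst x) 1 * D01 (fst y) 1)"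

lemma space_K0D: "x \<in> space_K0 a \<Longrightarrow> fst x \<in> K2a0 a" "x \<in> space_K0 a \<Longrightarrow> L2 (snd x)"
  by (auto simp: space_K0_def)

lemma energy_form_diag: "energy_form x x = sq_energy a \<beta> \<gamma> x"
  by (simp add: energy_form_def sq_energy_def power2_eq_square)

lemma sq_energy_terms:
  assumes x: "x \<in> space_K0 a"
  shows "0 \<le> (LINT s|I01. a s * (D2 (fst x) s)\<^sup>2)" "0 \<le> \<beta> * (fst x 1)\<^sup>2" "0 \<le> \<gamma> * (D01 (fst x) 1)\<^sup>2"
    "0 \<le> (LINT s|I01. (snd x s)\<^sup>2)"
  using wsq_square(3)[OF K2a0_D2(2)[OF space_K0D(1)[OF x]]] \<beta> \<gamma> by auto

text \<open>Linearity in the first slot is the point that needs care, since \<open>D2\<close> is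
  linear only almost everywhere.\<close>

sublocale form_space "space_K0 a" energy_form "norm_K0 a \<beta> \<gamma>"
proof
  fix x y c d assume x: "x \<in> space_K0 a" and y: "y \<in> space_K0 a"
  note x' = space_K0D[OF x] and y' = space_K0D[OF y]
  show "lin c x d y \<in> space_K0 a"
    using K2a0_lin[OF x'(1) y'(1)] L2_lin[OF x'(2) y'(2)] by (simp add: lin_def space_K0_def)
  show "energy_form x y = energy_form y x" by (simp add: energy_form_def mult.commute)
  show "energy_form (lin c x d y) z = c * energy_form x z + d * energy_form y z" if z: "z \<in> space_K0 a" for z
  proof -
    note z' = space_K0D[OF z]
    note wx = K2a0_D2(2)[OF x'(1)] and wy = K2a0_D2(2)[OF y'(1)] and wz = K2a0_D2(2)[OF z'(1)]
    have "(LINT s|I01. a s * (D2 (fst (lin c x d y)) s * D2 (fst z) s))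
        = (LINT s|I01. a s * ((c * D2 (fst x) s + d * D2 (fst y) s) * D2 (fst z) s))"
      by (rule wsq_cong_AE_mult[OF wsq_lin[OF wx wy] _ _ wz])
        (use D2_lin[OF x'(1) y'(1)] in \<open>auto simp: lin_def\<close>)
    also have "\<dots> = (LINT s|I01. c * (a s * (D2 (fst x) s * D2 (fst z) s)) + d * (a s * (D2 (fst y) s * D2 (fst z) s)))"
      by (simp add: algebra_simps)
    also have "\<dots> = c * (LINT s|I01. a s * (D2 (fst x) s * D2 (fst z) s)) + d * (LINT s|I01. a s * (D2 (fst y) s * D2 (fst z) s))"
      by (rule integral_lin) (intro wsq_mult wx wy wz)+
    finally have 1: "(LINT s|I01. a s * (D2 (fst (lin c x d y)) s * D2 (fst z) s)) = \<dots>" .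
    have "(LINT s|I01. snd (lin c x d y) s * snd z s) = (LINT s|I01. c * (snd x s * snd z s) + d * (snd y s * snd z s))"
      by (simp add: lin_def algebra_simps)
    also have "\<dots> = c * (LINT s|I01. snd x s * snd z s) + d * (LINT s|I01. snd y s * snd z s)"
      by (rule integral_lin) (intro L2_mult_integrable x' y' z')+
    finally have 2: "(LINT s|I01. snd (lin c x d y) s * snd z s) = \<dots>" .
    have 3: "D01 (fst (lin c x d y)) 1 = c * D01 (fst x) 1 + d * D01 (fst y) 1"
      using D01_lin(1)[OF x'(1) y'(1), of 1] by (simp add: lin_def)
    have 4: "fst (lin c x d y) 1 = c * fst x 1 + d * fst y 1" by (simp add: lin_def)
    show ?thesis unfolding energy_form_def 1 2 3 4 by (simp add: algebra_simps)
  qed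
next
  fix x assume x: "x \<in> space_K0 a"
  show "0 \<le> energy_form x x" unfolding energy_form_diag using sq_energy_terms[OF x] by (simp add: sq_energy_def)
  show "norm_K0 a \<beta> \<gamma> x = sqrt (energy_form x x)"
    unfolding energy_form_diag by (cases x) (simp add: norm_K0_def sq_energy_def)
qed

context
  fixes \<phi>1 d1 c1 e1 \<phi>2 d2 c2 e2
  assumes \<phi>1: "affine_flux \<phi>1 d1 c1 e1" "\<beta> * \<phi>1 1 - e1 = 1" "\<gamma> * d1 + c1 + e1 = 0"
    and \<phi>2: "affine_flux \<phi>2 d2 c2 e2" "\<beta> * \<phi>2 1 - e2 = 0" "\<gamma> * d2 + c2 + e2 = 1"
begin

abbreviation "T \<equiv> multiplier \<Lambda> \<phi>1 \<phi>2"

lemma \<rho>_pos: "\<rho> > 0"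
proof -
  have C0: "C1 > 0" "C2 > 0" using C_bounds by auto
  have \<zeta>: "\<zeta> \<ge> 0" using C0 \<beta> \<gamma> by (simp add: \<zeta>_def)
  have vr: "varrho (a 1) K \<gamma> > 0" by (auto simp: varrho_def less_max_iff_disj)
  show ?thesis unfolding \<rho>_def using vr \<Lambda>_pos \<zeta> by (intro add_pos_nonneg) auto
qed

text \<open>The bound \<open>|\<integral> v T u| \<le> \<rho>/2 (\<integral> v\<^sup>2 + W(u))\<close>, applied to \<open>v = T u / \<rho>\<close>, bounds \<open>T u\<close> itself.\<close>

lemma multiplier_L2_bound:
  assumes x: "x \<in> space_K0 a"
  shows "(LINT s|I01. (T (fst x) s)\<^sup>2) \<le> \<rho>\<^sup>2 * (norm_K0 a \<beta> \<gamma> x)\<^sup>2"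
proof -
  note u = space_K0D(1)[OF x]
  define W where "W = (LINT s|I01. a s * (D2 (fst x) s)\<^sup>2) + \<beta> * (fst x 1)\<^sup>2 + \<gamma> * (D01 (fst x) 1)\<^sup>2"
  define J where "J = (LINT s|I01. (T (fst x) s)\<^sup>2)"
  have L: "L2 (T (fst x))" using multiplier_pairing_bound(2)[OF \<phi>1 \<phi>2 u L2_continuous[OF continuous_on_const]] .
  have L': "L2 (\<lambda>s. 1 / \<rho> * T (fst x) s)" using L2_lin[OF L L, of "1 / \<rho>" 0] by simp
  have A: "\<bar>LINT s|I01. 1 / \<rho> * T (fst x) s * T (fst x) s\<bar> \<le> \<rho> * (1/2 * sq_energy a \<beta> \<gamma> (fst x, \<lambda>s. 1 / \<rho> * T (fst x) s))"
    by (rule multiplier_pairing_bound(1)[OF \<phi>1 \<phi>2 u L'])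
  have B: "(LINT s|I01. 1 / \<rho> * T (fst x) s * T (fst x) s) = 1 / \<rho> * J"
    unfolding J_def by (subst integral_mult_right_zero[symmetric]) (simp add: power2_eq_square)
  have C: "sq_energy a \<beta> \<gamma> (fst x, \<lambda>s. 1 / \<rho> * T (fst x) s) = W + 1 / \<rho>\<^sup>2 * J"
    unfolding sq_energy_def W_def J_def fst_conv snd_conv power_mult_distrib
    by (subst integral_mult_right_zero) (simp add: power_divide)
  have "1 / \<rho> * J \<le> \<rho> * (1/2 * (W + 1 / \<rho>\<^sup>2 * J))"
    by (rule order_trans[OF abs_ge_self A[unfolded B C]])
  then have "\<rho> * (1 / \<rho> * J) \<le> \<rho> * (\<rho> * (1/2 * (W + 1 / \<rho>\<^sup>2 * J)))" using \<rho>_pos by (intro mult_left_mono) auto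
  then have "J \<le> \<rho>\<^sup>2 * W" using \<rho>_pos by (simp add: power2_eq_square field_simps)
  also have "\<dots> \<le> \<rho>\<^sup>2 * (norm_K0 a \<beta> \<gamma> x)\<^sup>2"
    unfolding N_sq[OF x] energy_form_diag
    by (intro mult_left_mono) (auto simp: W_def sq_energy_def)
  finally show ?thesis by (simp add: J_def)
qed

definition cross_form :: "state \<Rightarrow> state \<Rightarrow> real" where
  "cross_form x y = (LINT s|I01. snd x s * T (fst y) s)"

lemma multiplier_lin:
  assumes x: "x \<in> space_K0 a" and y: "y \<in> space_K0 a" and s: "s \<in> space I01"
  shows "T (fst (lin c x d y)) s = c * T (fst x) s + d * T (fst y) s"
proof -
  note x' = space_K0D(1)[OF x] and y' = space_K0D(1)[OF y]
  have "D01 (fst (lin c x d y)) s = c * D01 (fst x) s + d * D01 (fst y) s"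
    "D01 (fst (lin c x d y)) 1 = c * D01 (fst x) 1 + d * D01 (fst y) 1"
    using D01_lin(1)[OF x' y', of s] D01_lin(1)[OF x' y', of 1] s by (auto simp: lin_def)
  moreover have "fst (lin c x d y) 1 = c * fst x 1 + d * fst y 1" by (simp add: lin_def)
  ultimately show ?thesis by (simp add: multiplier_def algebra_simps)
qed

lemma multiplier_L2: "x \<in> space_K0 a \<Longrightarrow> L2 (T (fst x))"
  by (rule multiplier_pairing_bound(2)[OF \<phi>1 \<phi>2 space_K0D(1) L2_continuous[OF continuous_on_const]])

lemma cross_form_bounded: "bounded_form cross_form \<rho>"
  unfolding bounded_form_def
proof (intro conjI ballI allI)
  show "\<rho> \<ge> 0" using \<rho>_pos by simp
  fix x y assume x: "x \<in> space_K0 a" and y: "y \<in> space_K0 a"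
  note x' = space_K0D[OF x] and y' = space_K0D[OF y]
  {
    fix z c d assume z: "z \<in> space_K0 a"
    note z' = space_K0D[OF z]
    have "cross_form (lin c x d y) z = (LINT s|I01. c * (snd x s * T (fst z) s) + d * (snd y s * T (fst z) s))"
      by (simp add: cross_form_def lin_def algebra_simps)
    also have "\<dots> = c * cross_form x z + d * cross_form y z"
      unfolding cross_form_def by (rule integral_lin) (intro L2_mult_integrable x' y' multiplier_L2 z)+
    finally show "cross_form (lin c x d y) z = c * cross_form x z + d * cross_form y z" .
    have "cross_form z (lin c x d y) = (LINT s|I01. c * (snd z s * T (fst x) s) + d * (snd z s * T (fst y) s))"
      unfolding cross_form_def
      by (rule Bochner_Integration.integral_cong[OF refl]) (simp only: multiplier_lin[OF x y] algebra_simps)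
    also have "\<dots> = c * cross_form z x + d * cross_form z y"
      unfolding cross_form_def by (rule integral_lin) (intro L2_mult_integrable z' multiplier_L2 x y)+
    finally show "cross_form z (lin c x d y) = c * cross_form z x + d * cross_form z y" .
  }
  have "(cross_form x y)\<^sup>2 \<le> (LINT s|I01. (snd x s)\<^sup>2) * (LINT s|I01. (T (fst y) s)\<^sup>2)"
    unfolding cross_form_def by (rule L2_Cauchy_Schwarz[OF x'(2) multiplier_L2[OF y]])
  also have "\<dots> \<le> (norm_K0 a \<beta> \<gamma> x)\<^sup>2 * (\<rho>\<^sup>2 * (norm_K0 a \<beta> \<gamma> y)\<^sup>2)"
  proof (intro mult_mono multiplier_L2_bound y)
    show "(LINT s|I01. (snd x s)\<^sup>2) \<le> (norm_K0 a \<beta> \<gamma> x)\<^sup>2"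
      unfolding N_sq[OF x] energy_form_diag using sq_energy_terms[OF x] by (simp add: sq_energy_def)
  qed auto
  also have "\<dots> = (\<rho> * (norm_K0 a \<beta> \<gamma> x * norm_K0 a \<beta> \<gamma> y))\<^sup>2" by (simp add: power_mult_distrib)
  finally have "\<bar>cross_form x y\<bar>\<^sup>2 \<le> (\<rho> * (norm_K0 a \<beta> \<gamma> x * norm_K0 a \<beta> \<gamma> y))\<^sup>2" by simp
  then show "\<bar>cross_form x y\<bar> \<le> \<rho> * (norm_K0 a \<beta> \<gamma> x * norm_K0 a \<beta> \<gamma> y)"
    by (rule power2_le_imp_le) (use \<rho>_pos N_nonneg x y in auto)
qed

text \<open>Its diagonal is the functional L; \<open>energy_form\<close> is twice the energy there,
  hence the factor \<kappa> / 2.\<close>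

definition lyapunov_form :: "state \<Rightarrow> state \<Rightarrow> real" where
  "lyapunov_form x y = \<kappa> / 2 * energy_form x y + cross_form x y"

lemma lyapunov_form_bounded: assumes "\<kappa> > 0" shows "bounded_form lyapunov_form (\<kappa> / 2 + \<rho>)"
  unfolding bounded_form_def
proof (intro conjI ballI allI)
  show "0 \<le> \<kappa> / 2 + \<rho>" using assms \<rho>_pos by simp
  fix x y assume x: "x \<in> space_K0 a" and y: "y \<in> space_K0 a"
  show "lyapunov_form (lin c x d y) z = c * lyapunov_form x z + d * lyapunov_form y z"
    "lyapunov_form z (lin c x d y) = c * lyapunov_form z x + d * lyapunov_form z y" if "z \<in> space_K0 a" for z c d
    using x y that
    by (simp_all add: lyapunov_form_def B_lin B_lin2 bounded_formD(2,3)[OF cross_form_bounded] algebra_simps)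
  have "\<bar>lyapunov_form x y\<bar> \<le> \<bar>\<kappa> / 2 * energy_form x y\<bar> + \<bar>cross_form x y\<bar>"
    unfolding lyapunov_form_def by (rule abs_triangle_ineq)
  also have "\<bar>\<kappa> / 2 * energy_form x y\<bar> = \<kappa> / 2 * \<bar>energy_form x y\<bar>" using assms by (simp add: abs_mult)
  also have "\<dots> \<le> \<kappa> / 2 * (norm_K0 a \<beta> \<gamma> x * norm_K0 a \<beta> \<gamma> y)"
    using assms by (intro mult_left_mono Cauchy_Schwarz x y) auto
  also have "\<bar>cross_form x y\<bar> \<le> \<rho> * (norm_K0 a \<beta> \<gamma> x * norm_K0 a \<beta> \<gamma> y)"
    by (rule bounded_formD(4)[OF cross_form_bounded x y])
  finally show "\<bar>lyapunov_form x y\<bar> \<le> (\<kappa> / 2 + \<rho>) * (norm_K0 a \<beta> \<gamma> x * norm_K0 a \<beta> \<gamma> y)"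
    by (simp add: algebra_simps)
qed

lemma lyapunov_form_diag:
  assumes x: "x \<in> space_K0 a" and \<kappa>: "\<kappa> > 0"
  shows "lyapunov_form x x \<le> (\<kappa> + \<rho>) * (1/2 * energy_form x x)" "- \<rho> * (1/2 * energy_form x x) \<le> lyapunov_form x x"
proof -
  have c: "\<bar>cross_form x x\<bar> \<le> \<rho> * (1/2 * energy_form x x)"
    using multiplier_pairing_bound(1)[OF \<phi>1 \<phi>2 space_K0D[OF x]] by (simp add: cross_form_def energy_form_diag)
  then show "lyapunov_form x x \<le> (\<kappa> + \<rho>) * (1/2 * energy_form x x)"
    by (simp add: lyapunov_form_def algebra_simps)
  have "0 \<le> \<kappa> / 2 * energy_form x x" using B_nonneg[OF x] \<kappa> by simp
  then show "- \<rho> * (1/2 * energy_form x x) \<le> lyapunov_form x x"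
    using c by (simp add: lyapunov_form_def)
qed

lemma lyapunov_form_dissipation:
  assumes "x \<in> dom_calB a \<beta> \<gamma>"
  shows "lyapunov_form x (calB a x) + lyapunov_form (calB a x) x \<le> - \<mu> * (1/2 * energy_form x x)"
proof -
  obtain u v where x: "x = (u, v)" by (cases x)
  have X: "x \<in> space_K0 a" "calB a x \<in> space_K0 a" using assms dom_calB_subset calB_space by auto
  have "lyapunov_form x (calB a x) + lyapunov_form (calB a x) x
      = \<kappa> * energy_form x (calB a x) + cross_form (calB a x) x + cross_form x (calB a x)"
    using B_sym[OF X] by (simp add: lyapunov_form_def)
  also have "\<dots> \<le> - \<mu> * (1/2 * energy_form x x)"
    using dissipation[OF \<phi>1 \<phi>2, of u v] assms
    by (simp add: x energy_form_diag energy_form_def cross_form_def calB_def)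
  finally show ?thesis .
qed

end

end

section \<open>Density of the domain\<close>

lemma L2_add_square_le:
  assumes f: "L2 f" and g: "L2 g"
  shows "(LINT x|I01. (f x + g x)\<^sup>2) \<le> 2 * (LINT x|I01. (f x)\<^sup>2) + 2 * (LINT x|I01. (g x)\<^sup>2)"
proof -
  have fg: "L2 (\<lambda>x. f x + g x)" using L2_lin[OF f g, of 1 1] by simp
  have "(LINT x|I01. (f x + g x)\<^sup>2) \<le> (LINT x|I01. 2 * (f x)\<^sup>2 + 2 * (g x)\<^sup>2)"
  proof (rule integral_mono[OF L2_square[OF fg]])
    show "integrable I01 (\<lambda>x. 2 * (f x)\<^sup>2 + 2 * (g x)\<^sup>2)"
      by (intro Bochner_Integration.integrable_add integrable_mult_right L2_square f g)
    show "(f x + g x)\<^sup>2 \<le> 2 * (f x)\<^sup>2 + 2 * (g x)\<^sup>2" for x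
      using zero_le_power2[of "f x - g x"] by (simp add: power2_eq_square algebra_simps)
  qed
  also have "\<dots> = 2 * (LINT x|I01. (f x)\<^sup>2) + 2 * (LINT x|I01. (g x)\<^sup>2)"
    by (rule integral_lin[OF L2_square[OF f] L2_square[OF g]])
  finally show ?thesis .
qed

lemma L2_diff: "L2 f \<Longrightarrow> L2 g \<Longrightarrow> L2 (\<lambda>x. f x - g x)"
  using L2_lin[of f g 1 "-1"] by simp

lemma L2_approx_trans:
  assumes f: "L2 f" and g: "L2 g" and h: "L2 h"
    and "(LINT x|I01. (f x - g x)\<^sup>2) < e / 4" "(LINT x|I01. (g x - h x)\<^sup>2) < e / 4"
  shows "(LINT x|I01. (f x - h x)\<^sup>2) < e"
  using L2_add_square_le[OF L2_diff[OF f g] L2_diff[OF g h]] assms(4,5) by simp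

lemma L2_poly: "L2 (poly P)"
  by (intro L2_continuous continuous_intros)

lemma continuous_approx_poly:
  assumes f: "continuous_on {0..1} f" and e: "e > 0"
  shows "\<exists>P. (LINT x|I01. (f x - poly P x)\<^sup>2) < e"
proof -
  have "sqrt (e / 2) > 0" using e by simp
  then obtain g where g: "real_polynomial_function g" "\<And>x. x \<in> {0..1} \<Longrightarrow> \<bar>f x - g x\<bar> < sqrt (e / 2)"
    using Stone_Weierstrass_real_polynomial_function[of "{0..1::real}" f "sqrt (e / 2)"] f by auto
  obtain a n where a: "g = (\<lambda>x. \<Sum>i\<le>n. a i * x ^ i)"
    using real_polynomial_function_imp_sum[OF g(1)] by blast
  define P where "P = (\<Sum>i\<le>n. monom (a i) i)"
  have gP: "g x = poly P x" for x by (simp add: a P_def poly_sum poly_monom)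
  have L: "L2 (\<lambda>x. f x - poly P x)" by (intro L2_diff L2_continuous f L2_poly)
  have "(LINT x|I01. (f x - poly P x)\<^sup>2) \<le> e / 2"
  proof (rule bounded_AE_square_integral(2)[OF L2_measurable[OF L]])
    fix x :: real assume "0 < x" "x < 1"
    then have "\<bar>f x - poly P x\<bar>\<^sup>2 \<le> (sqrt (e / 2))\<^sup>2" using g(2)[of x] gP by (intro power_mono) auto
    then show "(f x - poly P x)\<^sup>2 \<le> e / 2" using e by simp
  qed
  then show ?thesis using e by (intro exI[of _ P]) simp
qed

text \<open>A measurable function is an almost everywhere limit of continuous ones; truncating these
  at B provides the dominating constant.\<close>

lemma bounded_approx_poly:
  assumes f: "f \<in> borel_measurable I01" and bd: "\<And>x. 0 < x \<Longrightarrow> x < 1 \<Longrightarrow> \<bar>f x\<bar> \<le> B" and e: "e > 0"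
  shows "\<exists>P. (LINT x|I01. (f x - poly P x)\<^sup>2) < e"
proof -
  interpret finite_measure I01 by (rule finite_measure_I01)
  have B: "B \<ge> 0" using bd[of "1/2"] by simp
  have "(f x)\<^sup>2 \<le> B\<^sup>2" if "0 < x" "x < 1" for x
    using power_mono[OF bd[OF that], of 2] by simp
  then have Lf: "L2 f" by (rule bounded_AE_square_integral(1)[OF f])
  have "f measurable_on {0<..<1}" using f by (subst measurable_on_iff_borel_measurable) auto
  then obtain M g where M: "negligible M" and g: "\<And>n. continuous_on UNIV (g n)"
    and lim: "\<And>x. x \<notin> M \<Longrightarrow> (\<lambda>n. g n x) \<longlonglongrightarrow> (if x \<in> {0<..<1} then f x else 0)"
    unfolding measurable_on_def by blast
  define h where "h n x = max (- B) (min B (g n x))" for n x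
  have ch: "continuous_on {0..1} (h n)" for n
    unfolding h_def by (intro continuous_intros continuous_on_subset[OF g]) auto
  have hB: "\<bar>h n x\<bar> \<le> B" for n x using B by (auto simp: h_def)
  have Lh: "L2 (h n)" for n by (rule L2_continuous[OF ch])
  have "(\<lambda>n. LINT x|I01. (f x - h n x)\<^sup>2) \<longlonglongrightarrow> (LINT x|I01. 0)"
  proof (rule integral_dominated_convergence[where w = "\<lambda>x. (2 * B)\<^sup>2"])
    have "AE x in lebesgue. x \<notin> M" using AE_not_in[of M lebesgue] M by (simp add: negligible_iff_null_sets)
    then show "AE x in I01. (\<lambda>n. (f x - h n x)\<^sup>2) \<longlonglongrightarrow> 0"
      unfolding AE_I01_iff
    proof eventually_elim
      case (elim x)
      show ?case
      proof
        assume x: "0 < x \<and> x < 1"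
        then have "(\<lambda>n. h n x) \<longlonglongrightarrow> max (- B) (min B (f x))"
          unfolding h_def using lim[OF elim] by (intro tendsto_intros) auto
        also have "max (- B) (min B (f x)) = f x" using bd[of x] x by auto
        finally have "(\<lambda>n. (f x - h n x)\<^sup>2) \<longlonglongrightarrow> (f x - f x)\<^sup>2" by (intro tendsto_intros)
        then show "(\<lambda>n. (f x - h n x)\<^sup>2) \<longlonglongrightarrow> 0" by simp
      qed
    qed
    show "AE x in I01. norm ((f x - h n x)\<^sup>2) \<le> (2 * B)\<^sup>2" for n
    proof (rule AE_I2)
      fix x assume "x \<in> space I01"
      then have "\<bar>f x - h n x\<bar> \<le> 2 * B" using bd[of x] hB[of n x] by auto
      then show "norm ((f x - h n x)\<^sup>2) \<le> (2 * B)\<^sup>2" using power_mono[of "\<bar>f x - h n x\<bar>" "2 * B" 2] by simp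
    qed
    show "(\<lambda>x. (f x - h n x)\<^sup>2) \<in> borel_measurable I01" for n
      using f L2_measurable[OF Lh[of n]] by measurable
  qed auto
  then have "\<forall>\<^sub>F n in sequentially. (LINT x|I01. (f x - h n x)\<^sup>2) < e / 4"
    by (intro order_tendstoD(2)) (use e in auto)
  then obtain n where n: "(LINT x|I01. (f x - h n x)\<^sup>2) < e / 4" by (auto simp: eventually_sequentially)
  obtain P where P: "(LINT x|I01. (h n x - poly P x)\<^sup>2) < e / 4"
    using continuous_approx_poly[OF ch, of "e/4" n] e by auto
  show ?thesis using L2_approx_trans[OF Lf Lh L2_poly n P] by blast
qed

text \<open>Truncation at level n reduces this to the bounded case, with f^2 as dominating
  function.\<close>

lemma L2_approx_poly:
  assumes f: "L2 f" and e: "e > 0"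
  shows "\<exists>P. (LINT x|I01. (f x - poly P x)\<^sup>2) < e"
proof -
  define h where "h n x = max (- real n) (min (real n) (f x))" for n x
  have hm: "h n \<in> borel_measurable I01" for n
    unfolding h_def using L2_measurable[OF f] by measurable
  have Lh: "L2 (h n)" for n
  proof (rule bounded_AE_square_integral(1)[OF hm])
    show "(h n x)\<^sup>2 \<le> (real n)\<^sup>2" for x
      using power_mono[of "\<bar>h n x\<bar>" "real n" 2] by (auto simp: h_def)
  qed
  have "(\<lambda>n. LINT x|I01. (f x - h n x)\<^sup>2) \<longlonglongrightarrow> (LINT x|I01. 0)"
  proof (rule integral_dominated_convergence[where w = "\<lambda>x. (f x)\<^sup>2"])
    show "AE x in I01. (\<lambda>n. (f x - h n x)\<^sup>2) \<longlonglongrightarrow> 0"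
    proof (rule AE_I2)
      fix x
      obtain m where m: "\<bar>f x\<bar> < real m" using reals_Archimedean2 by blast
      have "\<forall>\<^sub>F n in sequentially. (f x - h n x)\<^sup>2 = 0"
        using eventually_ge_at_top[of m]
      proof eventually_elim
        case (elim n)
        then have "\<bar>f x\<bar> \<le> real n" using m by linarith
        then have "h n x = f x" by (auto simp: h_def)
        then show ?case by simp
      qed
      then show "(\<lambda>n. (f x - h n x)\<^sup>2) \<longlonglongrightarrow> 0" by (rule tendsto_eventually)
    qed
    show "AE x in I01. norm ((f x - h n x)\<^sup>2) \<le> (f x)\<^sup>2" for n
    proof (rule AE_I2)
      fix x
      have "\<bar>f x - h n x\<bar> \<le> \<bar>f x\<bar>" by (auto simp: h_def)
      then show "norm ((f x - h n x)\<^sup>2) \<le> (f x)\<^sup>2" using power_mono[of "\<bar>f x - h n x\<bar>" "\<bar>f x\<bar>" 2] by simp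
    qed
    show "(\<lambda>x. (f x - h n x)\<^sup>2) \<in> borel_measurable I01" for n
      using L2_measurable[OF f] hm by measurable
  qed (use L2_square[OF f] in auto)
  then have "\<forall>\<^sub>F n in sequentially. (LINT x|I01. (f x - h n x)\<^sup>2) < e / 4"
    by (intro order_tendstoD(2)) (use e in auto)
  then obtain n where n: "(LINT x|I01. (f x - h n x)\<^sup>2) < e / 4" by (auto simp: eventually_sequentially)
  have hb: "\<bar>h n x\<bar> \<le> real n" for x by (auto simp: h_def)
  obtain P where P: "(LINT x|I01. (h n x - poly P x)\<^sup>2) < e / 4"
    using bounded_approx_poly[OF hm[of n] hb, of "e / 4"] e by auto
  show ?thesis using L2_approx_trans[OF f Lh L2_poly n P] by blast
qed

text \<open>Multiples of \<open>k\<close> remain dense because \<open>k\<close> is bounded below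
  away from 0: cut \<open>f\<close> off where it has little mass, near 0, and approximate the
  quotient of the cut function by \<open>k\<close>.\<close>

lemma L2_approx_weighted_poly:
  assumes f: "L2 f" and e: "e > 0" and k: "k \<in> borel_measurable I01"
    and kB: "\<And>x. 0 < x \<Longrightarrow> x < 1 \<Longrightarrow> \<bar>k x\<bar> \<le> B"
    and k0: "\<And>c. 0 < c \<Longrightarrow> c < 1 \<Longrightarrow> \<exists>m>0. \<forall>x\<in>{c..1}. m \<le> k x"
  shows "\<exists>P. (LINT x|I01. (f x - k x * poly P x)\<^sup>2) < e"
proof -
  have B: "B \<ge> 0" using kB[of "1/2"] by simp
  define S where "S n = {1 / (real n + 2)..1}" for n :: nat
  have Sm: "(\<lambda>x. indicat_real (S n) x) \<in> borel_measurable I01" for n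
    unfolding S_def by (intro borel_measurable_I01) measurable
  have "(\<lambda>n. LINT x|I01. indicator (S n) x * (f x)\<^sup>2) \<longlonglongrightarrow> (LINT x|I01. (f x)\<^sup>2)"
    unfolding S_def by (rule tail_integral_limit[OF L2_square[OF f]])
  then have "\<forall>\<^sub>F n in sequentially. (LINT x|I01. (f x)\<^sup>2) - e / 4 < (LINT x|I01. indicator (S n) x * (f x)\<^sup>2)"
    by (intro order_tendstoD(1)) (use e in auto)
  then obtain n where n: "(LINT x|I01. (f x)\<^sup>2) - e / 4 < (LINT x|I01. indicator (S n) x * (f x)\<^sup>2)"
    by (auto simp: eventually_sequentially)
  define g where "g x = indicator (S n) x * f x" for x
  have Lg: "L2 g" unfolding g_def by (rule L2_bounded_mult(1)[OF f Sm, where B = 1]) (auto simp: indicator_def)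
  have ig: "integrable I01 (\<lambda>x. indicator (S n) x * (f x)\<^sup>2)"
    by (rule I01_integrable_cong[OF L2_square[OF Lg]]) (auto simp: g_def indicator_def)
  have "(LINT x|I01. (f x - g x)\<^sup>2) = (LINT x|I01. (f x)\<^sup>2 - indicator (S n) x * (f x)\<^sup>2)"
    by (rule Bochner_Integration.integral_cong) (auto simp: g_def indicator_def)
  also have "\<dots> = (LINT x|I01. (f x)\<^sup>2) - (LINT x|I01. indicator (S n) x * (f x)\<^sup>2)"
    by (rule Bochner_Integration.integral_diff[OF L2_square[OF f] ig])
  finally have fg: "(LINT x|I01. (f x - g x)\<^sup>2) < e / 4" using n by simp
  obtain m where m: "m > 0" "\<And>x. x \<in> S n \<Longrightarrow> m \<le> k x"
    using k0[of "1 / (real n + 2)"] by (auto simp: S_def)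
  have Lgk: "L2 (\<lambda>x. (indicator (S n) x / k x) * f x)"
  proof (rule L2_bounded_mult(1)[OF f])
    show "(\<lambda>x. indicator (S n) x / k x) \<in> borel_measurable I01" using Sm[of n] k by (rule borel_measurable_divide)
    show "\<bar>indicator (S n) x / k x\<bar> \<le> 1 / m" for x
      using m(1) m(2)[of x] by (cases "x \<in> S n") (auto intro!: divide_left_mono mult_pos_pos)
  qed
  \<comment> \<open>The denominator pays for the multiplication by \<open>k\<close> and is positive
    even for B = 0.\<close>
  define e1 where "e1 = (e / 4) / (B\<^sup>2 + 1)"
  have "e1 > 0" using e by (simp add: e1_def add_nonneg_pos)
  then obtain P where P: "(LINT x|I01. (indicator (S n) x / k x * f x - poly P x)\<^sup>2) < e1"
    using L2_approx_poly[OF Lgk] by blast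
  have Ld: "L2 (\<lambda>x. indicator (S n) x / k x * f x - poly P x)" by (rule L2_diff[OF Lgk L2_poly])
  have "(LINT x|I01. (g x - k x * poly P x)\<^sup>2) = (LINT x|I01. (k x * (indicator (S n) x / k x * f x - poly P x))\<^sup>2)"
  proof (rule Bochner_Integration.integral_cong[OF refl])
    fix x
    have "k x * (indicator (S n) x / k x * f x) = g x"
      using m(1) m(2)[of x] by (cases "x \<in> S n") (auto simp: g_def)
    then show "(g x - k x * poly P x)\<^sup>2 = (k x * (indicator (S n) x / k x * f x - poly P x))\<^sup>2"
      by (simp only: right_diff_distrib)
  qed
  also have "\<dots> \<le> B\<^sup>2 * (LINT x|I01. (indicator (S n) x / k x * f x - poly P x)\<^sup>2)"
    by (rule L2_bounded_mult(2)[OF Ld k kB])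
  also have "\<dots> \<le> B\<^sup>2 * e1" using P by (intro mult_left_mono) auto
  also have "\<dots> < e / 4"
  proof -
    have "B\<^sup>2 * e1 < (B\<^sup>2 + 1) * e1" using \<open>e1 > 0\<close> by simp
    also have "(B\<^sup>2 + 1) * e1 = e / 4"
    proof -
      have "B\<^sup>2 + 1 > 0" by (simp add: add_nonneg_pos)
      moreover have "k * ((e / 4) / k) = e / 4" if "k > 0" for k using that by simp
      ultimately show ?thesis unfolding e1_def by blast
    qed
    finally show ?thesis .
  qed
  finally have gP: "(LINT x|I01. (g x - k x * poly P x)\<^sup>2) < e / 4" .
  have LP: "L2 (\<lambda>x. k x * poly P x)" by (rule L2_bounded_mult(1)[OF L2_poly k kB])
  show ?thesis using L2_approx_trans[OF f Lg LP fg gP] by blast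
qed

section \<open>Regular elements of the energy space and of the domain\<close>

lemma poly_primitive:
  fixes Q :: "real poly"
  assumes "0 \<le> x" shows "poly Q x = poly Q 0 + integral {0..x} (poly (pderiv Q))"
proof -
  have "(poly (pderiv Q) has_integral (poly Q x - poly Q 0)) {0..x}"
    by (rule fundamental_theorem_of_calculus[OF assms])
      (auto simp: has_real_derivative_iff_has_vector_derivative[symmetric] intro: poly_DERIV has_field_derivative_at_within)
  then show ?thesis by (simp add: integral_unique)
qed

lemma poly_weak_deriv: "is_weak_deriv (poly Q) (poly (pderiv Q))"
  by (rule primitive_weak_deriv[OF L2_integrable[OF L2_poly]]) (auto intro: poly_primitive)

context degenerate
begin

text \<open>A continuous second derivative makes the slope Lipschitz, hence absolutely continuous on
  all of [0, 1], so both variants of the space are covered at once.\<close>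

lemma C2_K2a0:
  assumes w: "continuous_on {0..1} w" and f1: "\<And>x. x \<in> {0..1} \<Longrightarrow> f1 x = f1 0 + integral {0..x} w"
    and f: "\<And>x. x \<in> {0..1} \<Longrightarrow> f x = integral {0..x} f1" and WD0: "weakly_degenerate a \<Longrightarrow> f1 0 = 0"
  shows "f \<in> K2a0 a" "\<And>x. x \<in> {0..1} \<Longrightarrow> D01 f x = f1 x" "AE x in I01. D2 f x = w x"
proof -
  have iw: "integrable I01 w" by (rule L2_integrable[OF L2_continuous[OF w]])
  have "continuous_on {0..1} (\<lambda>x. f1 0 + integral {0..x} w)" by (rule continuous_primitive[OF iw])
  then have cf1: "continuous_on {0..1} f1" by (rule continuous_on_eq) (rule f1[symmetric])
  have if1: "integrable I01 f1" by (rule L2_integrable[OF L2_continuous[OF cf1]])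
  have f': "f x = 0 + integral {0..x} f1" if "x \<in> {0..1}" for x using f[OF that] by simp
  have "continuous_on {0..1} (\<lambda>x. 0 + integral {0..x} f1)" by (rule continuous_primitive[OF if1])
  then have cf: "continuous_on {0..1} f" by (rule continuous_on_eq) (rule f'[symmetric])
  have D: "(f has_real_derivative f1 x) (at x within {0..1})" if "x \<in> {0..1}" for x
    by (rule primitive_DERIV[OF cf1 f' that])
  show Df: "D01 f x = f1 x" if "x \<in> {0..1}" for x by (rule D01_eqI[OF D that]) (rule that)
  have wf: "is_weak_deriv f f1" by (rule primitive_weak_deriv[OF if1]) (rule f', simp)
  have "is_weak_deriv f1 w" by (rule primitive_weak_deriv[OF iw]) (rule f1, simp)
  then have "is_weak_deriv (D01 f) w"
    by (rule is_weak_deriv_cong_AE) (use Df in \<open>auto intro!: AE_I2\<close>)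
  from weak_deriv_wderiv[OF this] have wd: "is_weak_deriv (D01 f) (D2 f)" and ae: "AE x in I01. D2 f x = w x"
    by (auto simp: D2_def)
  show "AE x in I01. D2 f x = w x" by (rule ae)
  obtain C where C: "C > 0" "\<And>x. x \<in> {0..1} \<Longrightarrow> \<bar>w x\<bar> \<le> C" using continuous_bounded_I01[OF w] by metis
  have ac: "abs_cont_on 0 1 (D01 f)"
  proof (rule Lipschitz_imp_abs_cont_on)
    have *: "\<bar>f1 y - f1 x\<bar> \<le> C * (y - x)" if xy: "0 \<le> x" "x \<le> y" "y \<le> 1" for x y
    proof -
      have "w integrable_on {0..y}"
        by (intro integrable_continuous_real continuous_on_subset[OF w]) (use xy in auto)
      then have "integral {0..x} w + integral {x..y} w = integral {0..y} w"
        using xy by (intro Henstock_Kurzweil_Integration.integral_combine) auto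
      then have "f1 y - f1 x = integral {x..y} w" using f1[of x] f1[of y] xy by simp
      moreover have "norm (integral {x..y} w) \<le> C * (y - x)"
        by (rule integral_bound) (use xy C continuous_on_subset[OF w] in auto)
      ultimately show ?thesis by simp
    qed
    fix x y :: real assume "x \<in> {0..1}" "y \<in> {0..1}"
    then show "\<bar>D01 f x - D01 f y\<bar> \<le> C * \<bar>x - y\<bar>"
      using *[of x y] *[of y x] Df by (cases "x \<le> y") (auto simp: abs_minus_commute)
  qed
  have H: "H1 f" unfolding H1_def using L2_continuous[OF cf] wf L2_continuous[OF cf1] by blast
  have L: "L2 (\<lambda>x. sqrt (a x) * D2 f x)"
  proof (rule L2_cong_AE)
    have "\<exists>B. \<forall>x\<in>{0..1}. \<bar>sqrt (a x)\<bar> \<le> B"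
    proof -
      have "continuous_on {0..1} a"
        using deg by (auto simp: weakly_degenerate_def strongly_degenerate_def C1_on_def continuous_on_eq_continuous_within
            intro: differentiable_imp_continuous_within)
      then have "continuous_on {0..1} (\<lambda>x. sqrt (a x))" by (intro continuous_intros)
      from continuous_bounded_I01[OF this] show ?thesis by metis
    qed
    then obtain B where "\<And>x. x \<in> {0..1} \<Longrightarrow> \<bar>sqrt (a x)\<bar> \<le> B" by blast
    then show "L2 (\<lambda>x. sqrt (a x) * w x)"
      by (intro L2_bounded_mult(1)[OF L2_continuous[OF w], where B = B] measurable_compose[OF a_measurable borel_measurable_sqrt]) auto
    show "AE x in I01. sqrt (a x) * w x = sqrt (a x) * D2 f x" using ae by eventually_elim simp
    show "(\<lambda>x. sqrt (a x) * D2 f x) \<in> borel_measurable I01"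
      using wd by (intro borel_measurable_times measurable_compose[OF a_measurable borel_measurable_sqrt])
        (auto simp: is_weak_deriv_def intro: L1_loc_measurable)
  qed
  have "f differentiable (at x within {0..1})" if "x \<in> {0..1}" for x
    using D[OF that] by (auto simp: real_differentiable_def)
  moreover have "f 0 = 0" using f[of 0] by simp
  moreover have "D01 f 0 = 0" if "weakly_degenerate a" using Df[of 0] WD0[OF that] by simp
  moreover have "abs_cont_on c 1 (D01 f)" if "0 < c" for c
    by (rule abs_cont_on_subinterval[OF ac]) (use that in auto)
  ultimately show "f \<in> K2a0 a" unfolding K2a0_def using H cf ac L by simp
qed

text \<open>In the domain the traces of the velocity at 1 are dictated by the displacement. They are
  not continuous in the mean, so they can be prescribed freely: x^2 P approximates \<open>v\<close>
  with the right behaviour at 0, and a correction of small mean square adjusts the traces.\<close>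

lemma velocity_dense:
  assumes v: "L2 v" and e: "e > 0"
  shows "\<exists>v'\<in>K2a0 a. v' 1 = r \<and> D01 v' 1 = s \<and> (LINT x|I01. (v x - v' x)\<^sup>2) < e"
proof -
  have "\<exists>P. (LINT x|I01. (v x - x\<^sup>2 * poly P x)\<^sup>2) < e / 4"
  proof (rule L2_approx_weighted_poly[OF v])
    show "(\<lambda>x. x\<^sup>2) \<in> borel_measurable I01" by (intro borel_measurable_I01) measurable
    show "\<bar>x\<^sup>2\<bar> \<le> 1" if "0 < x" "x < 1" for x :: real using that by (simp add: power_le_one)
    show "\<exists>m>0. \<forall>x\<in>{c..1}. m \<le> x\<^sup>2" if "0 < c" "c < 1" for c :: real
      using that by (intro exI[of _ "c\<^sup>2"]) (auto intro!: power_mono)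
  qed (use e in simp)
  then obtain P where P: "(LINT x|I01. (v x - x\<^sup>2 * poly P x)\<^sup>2) < e / 4" by blast
  define Q where "Q = [:0, 0, 1:] * P"
  have Q: "poly Q x = x\<^sup>2 * poly P x" for x by (simp add: Q_def power2_eq_square)
  define A S where "A = r - poly Q 1" "S = s - poly (pderiv Q) 1"
  note AS = this
  text \<open>\<open>2 x\<^sup>m - x\<^sup>2\<^sup>m\<close> and \<open>x\<^sup>m (x - 1)\<close> are small in the mean, with value and slope
    \<open>(1, 0)\<close> and \<open>(0, 1)\<close> at \<open>1\<close>.\<close>
  define Z where "Z m = smult A (monom 2 m - monom 1 (2 * m)) + smult S (monom 1 (m + 1) - monom 1 m)" for m
  have Zv: "poly (Z m) x = A * (2 * x ^ m - x ^ (2 * m)) + S * (x ^ (m + 1) - x ^ m)" for m x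
    by (simp add: Z_def poly_monom)
  have Zd: "poly (pderiv (Z m)) x = A * (2 * (real m * x ^ (m - 1)) - real (2 * m) * x ^ (2 * m - 1))
      + S * (real (m + 1) * x ^ m - real m * x ^ (m - 1))" for m x
    by (simp add: Z_def pderiv_add pderiv_smult pderiv_diff pderiv_monom poly_monom algebra_simps)
  define c where "c = 2 * \<bar>A\<bar> + \<bar>S\<bar>"
  have "(\<lambda>m. c\<^sup>2 / real (2 * m + 1)) \<longlonglongrightarrow> 0" by real_asymp
  then have "\<forall>\<^sub>F m in sequentially. c\<^sup>2 / real (2 * m + 1) < e / 4 \<and> m \<ge> 2"
    using e by (intro eventually_conj order_tendstoD(2) eventually_ge_at_top) auto
  \<comment> \<open>The condition m \<ge> 2 keeps value and slope of the correction at the origin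
    equal to 0.\<close>
  then obtain m where m: "c\<^sup>2 / real (2 * m + 1) < e / 4" "m \<ge> 2" by (auto simp: eventually_sequentially)
  define v' where "v' = poly (Q + Z m)"
  have i: "integrable I01 (\<lambda>x. c\<^sup>2 * x ^ (2 * m))"
    by (intro integrable_mult_right L2_integrable L2_continuous continuous_intros)
  have "(LINT x|I01. (poly (Z m) x)\<^sup>2) \<le> (LINT x|I01. c\<^sup>2 * x ^ (2 * m))"
  proof (rule integral_mono[OF L2_square[OF L2_poly] i])
    fix x assume "x \<in> space I01"
    then have x: "0 < x" "x < 1" by auto
    have a1: "\<bar>2 * x ^ m - x ^ (2 * m)\<bar> \<le> 2 * x ^ m"
    proof -
      have "x ^ (2 * m) \<le> x ^ m" using x by (intro power_decreasing) auto
      moreover have "0 \<le> x ^ (2 * m)" "0 \<le> x ^ m" using x by auto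
      ultimately show ?thesis by linarith
    qed
    have a2: "\<bar>x ^ (m + 1) - x ^ m\<bar> \<le> x ^ m"
    proof -
      have "x ^ (m + 1) \<le> x ^ m" using x by (intro power_decreasing) auto
      moreover have "0 \<le> x ^ (m + 1)" using x by auto
      ultimately show ?thesis by linarith
    qed
    have "\<bar>poly (Z m) x\<bar> \<le> \<bar>A\<bar> * \<bar>2 * x ^ m - x ^ (2 * m)\<bar> + \<bar>S\<bar> * \<bar>x ^ (m + 1) - x ^ m\<bar>"
      unfolding Zv using abs_triangle_ineq[of "A * (2 * x ^ m - x ^ (2 * m))" "S * (x ^ (m + 1) - x ^ m)"] by (simp only: abs_mult)
    also have "\<dots> \<le> \<bar>A\<bar> * (2 * x ^ m) + \<bar>S\<bar> * x ^ m" by (intro add_mono mult_left_mono a1 a2) auto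
    also have "\<dots> = c * x ^ m" by (simp add: c_def algebra_simps)
    finally have "\<bar>poly (Z m) x\<bar>\<^sup>2 \<le> (c * x ^ m)\<^sup>2" by (intro power_mono) auto
    then show "(poly (Z m) x)\<^sup>2 \<le> c\<^sup>2 * x ^ (2 * m)" by (simp add: power_mult_distrib power_even_eq)
  qed
  also have "\<dots> = (LINT x|I01. c\<^sup>2 * x powr real (2 * m))"
  proof (rule Bochner_Integration.integral_cong[OF refl])
    fix x assume "x \<in> space I01"
    then have "0 < x" by simp
    from powr_realpow[OF this, of "2 * m"] show "c\<^sup>2 * x ^ (2 * m) = c\<^sup>2 * x powr real (2 * m)" by (simp only:)
  qed
  also have "\<dots> = c\<^sup>2 * (LINT x|I01. x powr real (2 * m))" by (rule integral_mult_right_zero)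
  also have "\<dots> = c\<^sup>2 / real (2 * m + 1)" by (subst powr_I01(2)) auto
  finally have Zs: "(LINT x|I01. (poly (Z m) x)\<^sup>2) < e / 4" using m(1) by (rule le_less_trans)
  have z: "(0::real) ^ m = 0" "(0::real) ^ (2 * m) = 0" "(0::real) ^ (m - Suc 0) = 0" "(0::real) ^ (2 * m - Suc 0) = 0"
    using m(2) by (auto simp: power_0_left)
  have "(LINT x|I01. (v x - v' x)\<^sup>2) < e"
  proof (rule L2_approx_trans[OF v L2_poly[of Q]])
    show "L2 v'" unfolding v'_def by (rule L2_poly)
    show "(LINT x|I01. (v x - poly Q x)\<^sup>2) < e / 4" using P by (simp add: Q)
    show "(LINT x|I01. (poly Q x - v' x)\<^sup>2) < e / 4" using Zs by (simp add: v'_def)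
  qed
  moreover have v0: "v' 0 = 0" "poly (pderiv (Q + Z m)) 0 = 0"
    by (auto simp: v'_def Q Zv Zd z pderiv_add Q_def pderiv_mult pderiv_pCons)
  moreover have K: "v' \<in> K2a0 a" "\<And>x. x \<in> {0..1} \<Longrightarrow> D01 v' x = poly (pderiv (Q + Z m)) x"
  proof -
    have "v' x = integral {0..x} (poly (pderiv (Q + Z m)))" if "x \<in> {0..1}" for x
      using poly_primitive[of x "Q + Z m"] that v0(1) by (simp add: v'_def)
    note C = C2_K2a0[of "poly (pderiv (pderiv (Q + Z m)))" "poly (pderiv (Q + Z m))", OF _ _ this v0(2)]
    show "v' \<in> K2a0 a" by (rule C(1)) (auto intro!: continuous_intros poly_primitive)
    show "\<And>x. x \<in> {0..1} \<Longrightarrow> D01 v' x = poly (pderiv (Q + Z m)) x"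
      by (rule C(2)) (auto intro!: continuous_intros poly_primitive)
  qed
  moreover have "v' 1 = r" by (simp add: v'_def Zv AS)
  moreover have "D01 v' 1 = s" using K(2)[of 1] by (simp add: pderiv_add Zd AS)
  ultimately show ?thesis by blast
qed

text \<open>Prescribing the flux as the polynomial x^2 P makes the regularity of a u'' evident. The
  factor x^2 compensates the degeneracy, since x^2 / a tends to 0 at 0. \<open>d\<close> is the
  slope at 0, which is free only under strong degeneracy.\<close>

lemma smooth_flux_dom_B:
  assumes d: "weakly_degenerate a \<Longrightarrow> d = 0" and w: "w = (\<lambda>x. x\<^sup>2 * poly P x / a x)"
  obtains u where "u \<in> dom_B a" "D01 u 1 = d + integral {0..1} w" "AE x in I01. D2 u x = w x"
proof -
  define Q where "Q = [:0, 0, 1:] * P"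
  have Q: "poly Q x = x\<^sup>2 * poly P x" for x by (simp add: Q_def power2_eq_square)
  have a0: "a 0 = 0" using deg by (auto simp: weakly_degenerate_def strongly_degenerate_def)
  have cw: "continuous_on {0..1} w"
    unfolding continuous_on_eq_continuous_within
  proof
    fix x :: real assume x: "x \<in> {0..1}"
    show "continuous (at x within {0..1}) w"
    proof (cases "x = 0")
      case True
      obtain C where C: "C > 0" "\<And>x. x \<in> {0..1} \<Longrightarrow> \<bar>poly P x\<bar> \<le> C"
        using continuous_bounded_I01[of "poly P", OF continuous_on_poly[OF continuous_on_id]] by metis
      have ev: "\<forall>\<^sub>F x in at 0 within {0..1}. 0 \<le> (x::real)"
        unfolding eventually_at by (intro exI[of _ 1]) auto
      have "((\<lambda>x. x powr (2 - K) / a 1 * C) \<longlongrightarrow> 0 powr (2 - K) / a 1 * C) (at 0 within {0..1})"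
      proof (intro tendsto_intros tendsto_powr')
        show "(0::real) \<noteq> 0 \<or> 0 < 2 - K \<and> (\<forall>\<^sub>F x in at 0 within {0..1}. 0 \<le> (x::real))"
          using K_bounds ev by simp
      qed (use a1_pos in auto)
      then have lim: "((\<lambda>x. x powr (2 - K) / a 1 * C) \<longlongrightarrow> 0) (at 0 within {0..1})" by simp
      have "(w \<longlongrightarrow> 0) (at 0 within {0..1})"
      proof (rule Lim_null_comparison[OF _ lim])
        have "norm (w x) \<le> x powr (2 - K) / a 1 * C" if x: "0 < x" "x \<le> 1" for x
        proof -
          have "norm (w x) = x\<^sup>2 / a x * \<bar>poly P x\<bar>" using a_pos[OF x] by (simp add: w abs_mult)
          also have "\<dots> \<le> x powr (2 - K) / a 1 * C"
            using square_over_a_bound[OF x] C(2)[of x] x a1_pos by (intro mult_mono) auto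
          finally show ?thesis .
        qed
        then show "\<forall>\<^sub>F x in at 0 within {0..1}. norm (w x) \<le> x powr (2 - K) / a 1 * C"
          by (auto simp: eventually_at intro!: exI[of _ 1])
      qed
      \<comment> \<open>w(0) = 0 because division by a(0) = 0 yields 0.\<close>
      then show ?thesis using True a0 by (simp add: continuous_within w)
    next
      case False
      then have x: "x \<in> {0<..1}" using x by auto
      have "continuous_on {0<..1} w"
        unfolding w by (intro continuous_intros a_continuous) (use a_pos in force)
      then have "continuous (at x within {0<..1}) w" using x by (simp add: continuous_on_eq_continuous_within)
      moreover have "at x within {0<..1} = at x within {0..1}"
      proof (rule at_within_nhd[of x "{0<..}"])
        show "{0<..1} \<inter> {0<..} - {x} = {0..1} \<inter> {0<..} - {x}" by auto
      qed (use x in auto)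
      ultimately show ?thesis by simp
    qed
  qed
  define f1 where "f1 x = d + integral {0..x} w" for x
  define u where "u x = integral {0..x} f1" for x
  note C = C2_K2a0[OF cw, of f1 u]
  have f10: "f1 x = f1 0 + integral {0..x} w" for x by (simp add: f1_def)
  have WD: "f1 0 = 0" if "weakly_degenerate a" using d[OF that] by (simp add: f1_def)
  have u: "u \<in> K2a0 a" and Du: "D01 u 1 = f1 1" and ae: "AE x in I01. D2 u x = w x"
    using C[OF f10 u_def WD] by auto
  have aeQ: "AE x in I01. poly Q x = a x * D2 u x"
    using ae AE_space
  proof eventually_elim
    case (elim x)
    then have "a x \<noteq> 0" using a_pos[of x] by auto
    then show ?case using elim by (simp add: w Q)
  qed
  have m: "(\<lambda>x. a x * D2 u x) \<in> borel_measurable I01"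
    using wsqD(1)[OF K2a0_D2(2)[OF u]] a_measurable by measurable
  have "is_weak_deriv (\<lambda>x. a x * D2 u x) (poly (pderiv Q))"
    by (rule is_weak_deriv_cong_AE[OF poly_weak_deriv aeQ]) simp
  moreover have "H1 (poly (pderiv Q))" unfolding H1_def using L2_poly poly_weak_deriv by blast
  ultimately have H: "H2 (\<lambda>x. a x * D2 u x)"
    unfolding H2_def using L2_cong_AE[OF L2_poly aeQ m] by blast
  have "aD2 a u 0 = poly Q 0"
    unfolding aD2_def by (rule cont_rep(3)) (use aeQ in \<open>auto intro: continuous_intros elim: eventually_mono\<close>)
  then have "aD2 a u 0 = 0" by (simp add: Q)
  then have "u \<in> dom_B a" using u H by (simp add: dom_B_def)
  then show ?thesis using Du ae by (intro that[of u]) (auto simp: f1_def)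
qed

end

context degenerate
begin

text \<open>The weight x^2 / sqrt a arises from sqrt a u'' = (x^2 / sqrt a) P for the elements built
  in \<open>smooth_flux_dom_B\<close>.\<close>

lemma weight_measurable: "(\<lambda>x. x\<^sup>2 / sqrt (a x)) \<in> borel_measurable I01"
proof -
  have "(\<lambda>x::real. x\<^sup>2) \<in> borel_measurable I01" by (intro borel_measurable_I01) measurable
  then show ?thesis using a_measurable by measurable
qed

lemma weight_bounded:
  assumes "0 < x" "x < 1" shows "\<bar>x\<^sup>2 / sqrt (a x)\<bar> \<le> sqrt (1 / a 1)"
proof -
  have ax: "a x > 0" using a_pos[of x] assms by simp
  have "x\<^sup>2 * (x\<^sup>2 / a x) \<le> 1 * (1 / a 1)"
    using square_over_a_bound1[of x] assms ax by (intro mult_mono) (auto simp: power_le_one)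
  then have "(x\<^sup>2 / sqrt (a x))\<^sup>2 \<le> 1 / a 1" using ax by (simp add: power_divide power2_eq_square)
  then show ?thesis by (rule real_le_rsqrt[where x = "\<bar>_\<bar>", simplified power2_abs])
qed

lemma weight_bounded_below:
  assumes c: "0 < c" "c < 1" shows "\<exists>m>0. \<forall>x\<in>{c..1}. m \<le> x\<^sup>2 / sqrt (a x)"
proof -
  have "continuous_on {c..1} a" by (rule continuous_on_subset[OF a_continuous]) (use c in auto)
  then have "compact (a ` {c..1})" by (intro compact_continuous_image) auto
  then obtain M where M: "M > 0" "\<And>x. x \<in> {c..1} \<Longrightarrow> norm (a x) \<le> M"
    using compact_imp_bounded bounded_pos by (metis imageI)
  show ?thesis
  proof (intro exI[of _ "c\<^sup>2 / sqrt M"] conjI ballI)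
    show "0 < c\<^sup>2 / sqrt M" using M c by simp
    fix x assume x: "x \<in> {c..1}"
    then have "a x > 0" using a_pos[of x] c by auto
    moreover have "a x \<le> M" using M(2)[OF x] by simp
    ultimately show "c\<^sup>2 / sqrt M \<le> x\<^sup>2 / sqrt (a x)"
      using x c by (intro frac_le power_mono) auto
  qed
qed

end

context damped_beam
begin

text \<open>The displacement is chosen first, the velocity afterwards with the traces that the
  boundary conditions then demand; this works since the velocity is measured in the mean
  only.\<close>

lemma domain_dense:
  assumes x: "x \<in> space_K0 a" and e: "e > 0"
  shows "\<exists>x'\<in>dom_calB a \<beta> \<gamma>. dist_of (norm_K0 a \<beta> \<gamma>) x x' < e"
proof -
  note u0 = space_K0D(1)[OF x] and v0 = space_K0D(2)[OF x]
  \<comment> \<open>\<open>M\<close> bounds the squared error of the slope at 1 by the interior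
    error I: under weak degeneracy that slope is the integral of the second derivative; otherwise
    \<open>d\<close> below is chosen so that the slopes at 1 match. \<open>c\<close> collects the
    interior and all boundary errors in units of I.\<close>
  define M where "M = (if weakly_degenerate a then LINT s|I01. (1 / sqrt (a s))\<^sup>2 else 0)"
  define m where "m = 2 / (a 1 * (2 - K))"
  define c where "c = 1 + (2 * \<beta> + \<gamma>) * M + \<beta> * m"
  have M: "M \<ge> 0" by (simp add: M_def)
  have m: "m \<ge> 0" using a1_pos K_bounds by (simp add: m_def)
  have c: "c > 0" unfolding c_def using M m \<beta> \<gamma> by (intro add_pos_nonneg mult_nonneg_nonneg) auto
  obtain P where P: "(LINT s|I01. (sqrt (a s) * D2 (fst x) s - s\<^sup>2 / sqrt (a s) * poly P s)\<^sup>2) < e\<^sup>2 / (2 * c)"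
    using L2_approx_weighted_poly[OF wsqD(2)[OF K2a0_D2(2)[OF u0]] _ weight_measurable weight_bounded weight_bounded_below,
        of "e\<^sup>2 / (2 * c)"] e c by auto
  define w where "w = (\<lambda>s. s\<^sup>2 * poly P s / a s)"
  define d where "d = (if weakly_degenerate a then 0 else D01 (fst x) 1 - integral {0..1} w)"
  obtain u where u: "u \<in> dom_B a" "D01 u 1 = d + integral {0..1} w" "AE s in I01. D2 u s = w s"
    by (rule smooth_flux_dom_B[OF _ w_def, of d]) (auto simp: d_def)
  have uK: "u \<in> K2a0 a" using u(1) by (simp add: dom_B_def)
  obtain v where v: "v \<in> K2a0 a" "v 1 = D01 (aD2 a u) 1 - \<beta> * u 1" "D01 v 1 = - (\<gamma> * D01 u 1 + aD2 a u 1)"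
      "(LINT s|I01. (snd x s - v s)\<^sup>2) < e\<^sup>2 / 2"
    using velocity_dense[OF v0, of "e\<^sup>2 / 2"] e by auto
  define y :: state where "y = (u, v)"
  have y: "y \<in> dom_calB a \<beta> \<gamma>" using u v by (simp add: y_def dom_calB_def)
  have yX: "y \<in> space_K0 a" using y dom_calB_subset by auto
  define z where "z = lin 1 x (-1) y"
  have zX: "z \<in> space_K0 a" unfolding z_def by (rule lin_X[OF x yX])
  note zK = space_K0D(1)[OF zX]
  have fz: "fst z = (\<lambda>s. 1 * fst x s + (-1) * u s)" by (simp add: z_def y_def lin_def)
  have D2z: "AE s in I01. D2 (fst z) s = D2 (fst x) s - w s"
    using D2_lin(1)[OF u0 uK, of 1 "-1"] u(3) unfolding fz by eventually_elim simp
  define I where "I = (LINT s|I01. a s * (D2 (fst z) s)\<^sup>2)"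
  define J where "J = (LINT s|I01. (snd z s)\<^sup>2)"
  have "I = (LINT s|I01. (sqrt (a s) * D2 (fst z) s)\<^sup>2)"
    unfolding I_def by (rule wsq_square(2)[OF K2a0_D2(2)[OF zK]])
  also have "\<dots> = (LINT s|I01. (sqrt (a s) * D2 (fst x) s - s\<^sup>2 / sqrt (a s) * poly P s)\<^sup>2)"
  proof (rule integral_cong_AE)
    show "(\<lambda>s. (sqrt (a s) * D2 (fst z) s)\<^sup>2) \<in> borel_measurable I01"
      using wsqD(2)[OF K2a0_D2(2)[OF zK]] L2_measurable by measurable
    show "(\<lambda>s. (sqrt (a s) * D2 (fst x) s - s\<^sup>2 / sqrt (a s) * poly P s)\<^sup>2) \<in> borel_measurable I01"
      using L2_measurable[OF wsqD(2)[OF K2a0_D2(2)[OF u0]]] weight_measurable L2_measurable[OF L2_poly[of P]]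
      by measurable
    show "AE s in I01. (sqrt (a s) * D2 (fst z) s)\<^sup>2 = (sqrt (a s) * D2 (fst x) s - s\<^sup>2 / sqrt (a s) * poly P s)\<^sup>2"
      using D2z AE_space
    proof eventually_elim
      case (elim s)
      then have "a s > 0" using a_pos[of s] by auto
      then have "sqrt (a s) * w s = s\<^sup>2 / sqrt (a s) * poly P s"
        using real_sqrt_mult_self[of "a s"] by (simp add: w_def field_simps)
      then show ?case using elim by (simp only: right_diff_distrib)
    qed
  qed
  finally have I: "I < e\<^sup>2 / (2 * c)" using P by simp
  have I0: "I \<ge> 0" unfolding I_def by (rule wsq_square(3)[OF K2a0_D2(2)[OF zK]])
  have J: "J < e\<^sup>2 / 2" using v(4) by (simp add: J_def z_def y_def lin_def)
  have q: "(D01 (fst z) 1)\<^sup>2 \<le> M * I"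
  proof (cases "weakly_degenerate a")
    case True
    note w2 = K2a0_D2(2)[OF zK]
    have "D01 (fst z) 1 = (LINT s|I01. D2 (fst z) s)"
      using K2a0_repr[OF zK] True by (simp add: repr_def)
    also have "\<dots> = (LINT s|I01. 1 / sqrt (a s) * (sqrt (a s) * D2 (fst z) s))"
      by (rule Bochner_Integration.integral_cong[OF refl]) (use sqrt_a_mult(2) in force)
    also have "\<dots>\<^sup>2 \<le> (LINT s|I01. (1 / sqrt (a s))\<^sup>2) * (LINT s|I01. (sqrt (a s) * D2 (fst z) s)\<^sup>2)"
      by (rule L2_Cauchy_Schwarz[OF WD_inverse_L2[OF True] wsqD(2)[OF w2]])
    finally show ?thesis using True wsq_square(2)[OF w2] by (simp add: M_def I_def)
  next
    case False
    then have "D01 u 1 = D01 (fst x) 1" using u(2) by (simp add: d_def)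
    then have "D01 (fst z) 1 = 0" unfolding fz using D01_lin(1)[OF u0 uK, of 1 1 "-1"] by simp
    then show ?thesis using M I0 by simp
  qed
  have p: "(fst z 1)\<^sup>2 \<le> 2 * (M * I) + m * I"
    using repr_bound[OF K2a0_repr[OF zK], of 1] q by (simp add: m_def I_def)
  have "sq_energy a \<beta> \<gamma> z = I + J + \<beta> * (fst z 1)\<^sup>2 + \<gamma> * (D01 (fst z) 1)\<^sup>2"
    by (simp add: sq_energy_def I_def J_def)
  also have "\<dots> \<le> I + J + \<beta> * (2 * (M * I) + m * I) + \<gamma> * (M * I)"
    using \<beta> \<gamma> p q by (intro add_mono mult_left_mono) auto
  also have "\<dots> = c * I + J" by (simp add: c_def algebra_simps)
  also have "\<dots> < e\<^sup>2 / 2 + e\<^sup>2 / 2"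
  proof (rule add_strict_mono[OF _ J])
    have "c * I < c * (e\<^sup>2 / (2 * c))" using I c by (rule mult_strict_left_mono)
    then show "c * I < e\<^sup>2 / 2" using c by simp
  qed
  finally have "(norm_K0 a \<beta> \<gamma> z)\<^sup>2 < e\<^sup>2" by (simp add: N_sq[OF zX] energy_form_diag)
  then have "norm_K0 a \<beta> \<gamma> z < e" by (rule power_less_imp_less_base) (use e in simp)
  then show ?thesis using y by (auto simp: dist_of_def z_def)
qed

text \<open>The multiplier is composed of the stationary solutions with boundary data (1, 0) and (0,
  1). In the end (\<kappa> + 2 \<rho>) / \<mu> is replaced by the larger M.\<close>

lemma energy_decay:
  assumes gen: "generates (space_K0 a) (norm_K0 a \<beta> \<gamma>) (dom_calB a \<beta> \<gamma>) (calB a) R"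
    and x: "x \<in> space_K0 a" and t: "t \<ge> 0" and C3: "\<delta> * C3c (a 1) K \<beta> \<gamma> \<epsilon> \<delta> < \<epsilon>"
  shows "energy_form (R t x) (R t x) \<le> energy_form x x * exp (1 - t / Mc (a 1) K \<beta> \<gamma> \<epsilon> \<delta>)"
proof -
  note k = constants[OF C3]
  obtain \<phi>1 d1 c1 e1 where 1: "affine_flux \<phi>1 d1 c1 e1" "\<beta> * \<phi>1 1 - e1 = 1" "\<gamma> * d1 + c1 + e1 = 0"
    using ex_affine_flux[OF \<beta> \<gamma>, of 1 0] by blast
  obtain \<phi>2 d2 c2 e2 where 2: "affine_flux \<phi>2 d2 c2 e2" "\<beta> * \<phi>2 1 - e2 = 0" "\<gamma> * d2 + c2 + e2 = 1"
    using ex_affine_flux[OF \<beta> \<gamma>, of 0 1] by blast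
  have "energy_form (R t x) (R t x) \<le> energy_form x x * exp (1 - t / ((\<kappa> + \<rho> + \<rho>) / \<mu>))"
  proof (rule Lyapunov_decay[OF gen dom_calB_subset calB_space lyapunov_form_bounded[OF 1 2 k(2)] k(1) _ _ _ _ _ domain_dense x t])
    show "0 < \<kappa> + \<rho>" "0 \<le> \<rho>" using k by auto
    show "lyapunov_form \<phi>1 \<phi>2 x (calB a x) + lyapunov_form \<phi>1 \<phi>2 (calB a x) x \<le> - \<mu> * (1/2 * energy_form x x)"
      if "x \<in> dom_calB a \<beta> \<gamma>" for x by (rule lyapunov_form_dissipation[OF 1 2 that])
    show "lyapunov_form \<phi>1 \<phi>2 x x \<le> (\<kappa> + \<rho>) * (1/2 * energy_form x x)"
      "- \<rho> * (1/2 * energy_form x x) \<le> lyapunov_form \<phi>1 \<phi>2 x x"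
      if "x \<in> space_K0 a" for x by (rule lyapunov_form_diag[OF 1 2 that k(2)])+
  qed
  also have "\<dots> \<le> energy_form x x * exp (1 - t / Mc (a 1) K \<beta> \<gamma> \<epsilon> \<delta>)"
  proof (intro mult_left_mono B_nonneg[OF x])
    have "0 < (\<kappa> + 2 * \<rho>) / \<mu>" using k by (intro divide_pos_pos add_pos_pos) auto
    then have "t / Mc (a 1) K \<beta> \<gamma> \<epsilon> \<delta> \<le> t / ((\<kappa> + 2 * \<rho>) / \<mu>)"
      using k(4) t by (intro divide_left_mono mult_pos_pos) auto
    moreover have "\<kappa> + \<rho> + \<rho> = \<kappa> + 2 * \<rho>" by simp
    ultimately show "exp (1 - t / ((\<kappa> + \<rho> + \<rho>) / \<mu>)) \<le> exp (1 - t / Mc (a 1) K \<beta> \<gamma> \<epsilon> \<delta>)"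
      by (simp only: exp_le_cancel_iff diff_left_mono)
  qed
  finally show ?thesis .
qed

lemma energy_eq_form:
  assumes "(y t, y' t) \<in> space_K0 a"
  shows "energy a \<beta> \<gamma> y y' t = 1/2 * energy_form (y t, y' t) (y t, y' t)"
proof -
  have y: "y t \<in> K2a0 a" "L2 (y' t)" using assms by (auto simp: space_K0_def)
  have "(LINT x|I01. (y' t x)\<^sup>2 + a x * (D2 (y t) x)\<^sup>2) = (LINT x|I01. (y' t x)\<^sup>2) + (LINT x|I01. a x * (D2 (y t) x)\<^sup>2)"
    by (rule Bochner_Integration.integral_add[OF L2_square[OF y(2)] wsq_square(1)[OF K2a0_D2(2)[OF y(1)]]])
  then show ?thesis unfolding energy_form_diag by (simp add: energy_def sq_energy_def algebra_simps)
qed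

text \<open>R 0 x and x represent the same element but may be different functions; the energy does
  not distinguish them.\<close>

lemma semigroup_state:
  assumes gen: "generates (space_K0 a) (norm_K0 a \<beta> \<gamma>) (dom_calB a \<beta> \<gamma>) (calB a) R" and x: "x \<in> space_K0 a"
  shows "t \<ge> 0 \<Longrightarrow> R t x \<in> space_K0 a" "energy_form (R 0 x) (R 0 x) = energy_form x x"
proof -
  have R: "t \<ge> 0 \<Longrightarrow> R t x \<in> space_K0 a" for t
    using gen x by (auto simp: generates_def contraction_semigroup_def)
  then show "t \<ge> 0 \<Longrightarrow> R t x \<in> space_K0 a" .
  have R0: "R 0 x \<in> space_K0 a" by (rule R) simp
  have "dist_of (norm_K0 a \<beta> \<gamma>) (R 0 x) x = 0"
    using gen x by (auto simp: generates_def contraction_semigroup_def)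
  then have "norm_K0 a \<beta> \<gamma> (R 0 x) = norm_K0 a \<beta> \<gamma> x"
    using N_le_dist[OF R0 x] N_le_dist[OF x R0] dist_sym[OF R0 x] by simp
  then show "energy_form (R 0 x) (R 0 x) = energy_form x x"
    using N_sq[OF R0] N_sq[OF x] by simp
qed

end

theorem theorem4p4:
  fixes a :: "real \<Rightarrow> real" and K \<beta> \<gamma> \<epsilon>\<^sub>0 :: real
    and y\<^sub>0 y\<^sub>1 :: "real \<Rightarrow> real" and y y\<^sub>t :: "real \<Rightarrow> real \<Rightarrow> real"
  assumes "weakly_degenerate a \<or> strongly_degenerate a"
    and "K = degen_const a"
    and "\<beta> > 0" and "\<gamma> > 0"
    and "0 < \<epsilon>\<^sub>0" and "\<epsilon>\<^sub>0 \<le> 2 - K"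
    and "mild_solution a \<beta> \<gamma> y\<^sub>0 y\<^sub>1 y y\<^sub>t"
  shows "\<forall>t>0. \<forall>\<delta>. 0 < \<delta> \<and> \<delta> < nu (a 1) K \<beta> \<gamma> \<and> \<delta> * C3c (a 1) K \<beta> \<gamma> \<epsilon>\<^sub>0 \<delta> < \<epsilon>\<^sub>0 \<longrightarrow>
           energy a \<beta> \<gamma> y y\<^sub>t t
             \<le> energy a \<beta> \<gamma> y y\<^sub>t 0 * exp (1 - t / Mc (a 1) K \<beta> \<gamma> \<epsilon>\<^sub>0 \<delta>)"
proof (intro allI impI)
  fix t \<delta> :: real
  assume t: "t > 0"
    and \<delta>_range: "0 < \<delta> \<and> \<delta> < nu (a 1) K \<beta> \<gamma> \<and> \<delta> * C3c (a 1) K \<beta> \<gamma> \<epsilon>\<^sub>0 \<delta> < \<epsilon>\<^sub>0"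
  interpret damped_beam a K \<beta> \<gamma> \<epsilon>\<^sub>0 \<delta>
    using assms(1-6) \<delta>_range by unfold_locales auto
  obtain R where x: "(y\<^sub>0, y\<^sub>1) \<in> space_K0 a"
    and gen: "generates (space_K0 a) (norm_K0 a \<beta> \<gamma>) (dom_calB a \<beta> \<gamma>) (calB a) R"
    and y: "\<And>s. s \<ge> 0 \<Longrightarrow> (y s, y\<^sub>t s) = R s (y\<^sub>0, y\<^sub>1)"
    using assms(7) unfolding mild_solution_def by blast
  have E: "energy a \<beta> \<gamma> y y\<^sub>t s = 1/2 * energy_form (R s (y\<^sub>0, y\<^sub>1)) (R s (y\<^sub>0, y\<^sub>1))" if "s \<ge> 0" for s
    using energy_eq_form[of y s y\<^sub>t] semigroup_state(1)[OF gen x that] by (simp only: y[OF that])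
  have "energy_form (R t (y\<^sub>0, y\<^sub>1)) (R t (y\<^sub>0, y\<^sub>1))
      \<le> energy_form (y\<^sub>0, y\<^sub>1) (y\<^sub>0, y\<^sub>1) * exp (1 - t / Mc (a 1) K \<beta> \<gamma> \<epsilon>\<^sub>0 \<delta>)"
    using energy_decay[OF gen x less_imp_le[OF t]] \<delta>_range by blast
  then show "energy a \<beta> \<gamma> y y\<^sub>t t \<le> energy a \<beta> \<gamma> y y\<^sub>t 0 * exp (1 - t / Mc (a 1) K \<beta> \<gamma> \<epsilon>\<^sub>0 \<delta>)"
    unfolding E[OF less_imp_le[OF t]] E[OF order_refl] semigroup_state(2)[OF gen x] by simp
qed

end
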